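(* Let $p,q$ be positive integers, let $d=\gcd(p,q)$, and let $K(p,q)$ be the torus link that is the closure of the $p$-braid $B(p,q)=(\sigma_1\sigma_2\cdots\sigma_{p-1})^q$. Then there exists a minimal unknotting crossing data for $K(p,q)$ among the crossings of $B(p,q)$; that is, there is a set of crossings of the braid word $B(p,q)$, whose number of elements equals the unknotting number of $K(p,q)$, such that changing these crossings gives a braid whose closure is a trivial knot or link.
   Context: $\sigma_1,\dots,\sigma_{p-1}$ are the elementary generators of the $p$-string braid group $\mathbb{B}_p$. Each letter of the braid word $B(p,q)$ is one crossing; changing a crossing means replacing the corresponding letter by its inverse. The unknotting number of a knot or link is the minimum number of crossing changes needed to turn it into a trivial knot or link (unlink), taken over all of its diagrams. *)

theory Defs
  imports Main
begin

section \<open>Link diagrams\<close>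

text \<open>
  A link diagram in the plane is put in Morse position with respect to the height function, so that
  its cups (minima), caps (maxima) and crossings lie at different heights, and is read from
  bottom to top.  An event \<open>(e, i)\<close> is an elementary piece \<open>e\<close> with \<open>i\<close> strands to its left, so
  that it takes place at the strands \<open>i\<close> and \<open>i + 1\<close>, counted from 0.
  Every link diagram has this form up to an isotopy of the plane, and such an isotopy neither
  creates nor removes crossings.

  In \<open>Crossing s\<close> the two strands are exchanged; the strand running from the lower left to the
  upper right is the overstrand iff \<open>s\<close>.
\<close>

datatype piece = Cup | Cap | Crossing bool

type_synonym event = "piece \<times> nat"

type_synonym diagram = "event list"

fun ins :: "piece \<Rightarrow> nat" where
  "ins Cup = 0"
| "ins Cap = 2"
| "ins (Crossing s) = 2"

fun outs :: "piece \<Rightarrow> nat" where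
  "outs Cup = 2"
| "outs Cap = 0"
| "outs (Crossing s) = 2"

text \<open>\<open>tangle n D m\<close>: \<open>D\<close> is a diagram of a tangle with \<open>n\<close> lower and \<open>m\<close> upper end points.\<close>

fun tangle :: "nat \<Rightarrow> diagram \<Rightarrow> nat \<Rightarrow> bool" where
  "tangle n [] m \<longleftrightarrow> n = m"
| "tangle n ((e, i) # D) m \<longleftrightarrow> i + ins e \<le> n \<and> tangle (n - ins e + outs e) D m"

definition link_diagram :: "diagram \<Rightarrow> bool" where
  "link_diagram D \<longleftrightarrow> tangle 0 D 0"


section \<open>Equivalence of diagrams\<close>

text \<open>
  Two diagrams in Morse position represent isotopic links iff they are related by a finite sequence
  of the following local moves (Reidemeister's theorem in the form for sliced diagrams, see
  Freyd and Yetter, Turaev).  The moves \<open>exchange\<close>, \<open>zigzag_left\<close>, \<open>zigzag_right\<close>, \<open>swing_cap\<close>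
  and \<open>swing_cup\<close> realise the isotopies of the plane; the others are the Reidemeister moves.

  In \<open>reidemeister3\<close>, let \<open>a\<close>, \<open>b\<close>, \<open>c\<close> be the three strands, from left to right at the bottom.  Then
  \<open>s\<close>, \<open>t\<close>, \<open>u\<close> say that \<open>a\<close> passes over \<open>b\<close>, \<open>a\<close> over \<open>c\<close>, \<open>b\<close> over \<open>c\<close>, respectively; the side
  condition excludes the two cyclic patterns.
\<close>

inductive local_move :: "diagram \<Rightarrow> diagram \<Rightarrow> bool" where
  exchange: "i \<le> j \<Longrightarrow> local_move [(e, i), (f, j + outs e)] [(f, j + ins e), (e, i)]"
| zigzag_left: "local_move [(Cup, Suc i), (Cap, i)] []"
| zigzag_right: "local_move [(Cup, i), (Cap, Suc i)] []"
| swing_cap: "local_move [(Crossing s, i), (Cap, Suc i)] [(Crossing (\<not> s), Suc i), (Cap, i)]"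
| swing_cup: "local_move [(Cup, Suc i), (Crossing s, i)] [(Cup, i), (Crossing (\<not> s), Suc i)]"
| reidemeister1_cap: "local_move [(Crossing s, i), (Cap, i)] [(Cap, i)]"
| reidemeister1_cup: "local_move [(Cup, i), (Crossing s, i)] [(Cup, i)]"
| reidemeister2: "local_move [(Crossing s, i), (Crossing (\<not> s), i)] []"
| reidemeister3: "s = t \<or> t = u \<Longrightarrow>
    local_move [(Crossing s, i), (Crossing t, Suc i), (Crossing u, i)]
               [(Crossing u, Suc i), (Crossing t, i), (Crossing s, Suc i)]"

definition diagram_move :: "diagram \<Rightarrow> diagram \<Rightarrow> bool" where
  "diagram_move D D' \<longleftrightarrow> link_diagram D \<and> link_diagram D' \<and>
     (\<exists>A L R B. local_move L R \<and> D = A @ L @ B \<and> D' = A @ R @ B)"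

definition same_link :: "diagram \<Rightarrow> diagram \<Rightarrow> bool" where
  "same_link = equivclp diagram_move"

text \<open>The crossingless diagram of \<open>k\<close> circles, none inside another.\<close>

definition unlink :: "nat \<Rightarrow> diagram" where
  "unlink k = concat (replicate k [(Cup, 0), (Cap, 0)])"

definition trivial_link :: "diagram \<Rightarrow> bool" where
  "trivial_link D \<longleftrightarrow> (\<exists>k. same_link D (unlink k))"


section \<open>Crossing changes and the unknotting number\<close>

definition map_at :: "nat set \<Rightarrow> ('a \<Rightarrow> 'a) \<Rightarrow> 'a list \<Rightarrow> 'a list" where
  "map_at S f xs = map (\<lambda>k. if k \<in> S then f (xs ! k) else xs ! k) [0..<length xs]"

definition crossings :: "diagram \<Rightarrow> nat set" where
  "crossings D = {k. k < length D \<and> (\<exists>s i. D ! k = (Crossing s, i))}"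

fun flip_crossing :: "event \<Rightarrow> event" where
  "flip_crossing (Crossing s, i) = (Crossing (\<not> s), i)"
| "flip_crossing (e, i) = (e, i)"

definition change_crossings :: "nat set \<Rightarrow> diagram \<Rightarrow> diagram" where
  "change_crossings S D = map_at S flip_crossing D"

definition unknotting_number :: "diagram \<Rightarrow> nat" where
  "unknotting_number D = (LEAST n. \<exists>D' S. same_link D D' \<and> S \<subseteq> crossings D' \<and> card S = n \<and>
     trivial_link (change_crossings S D'))"


section \<open>Braid words and their closures\<close>

text \<open>\<open>Gen i\<close> and \<open>Inv i\<close> are \<open>\<sigma>\<^sub>i\<close> and its inverse; here strands and generators are numbered from 1.\<close>

datatype letter = Gen nat | Inv nat

type_synonym braid_word = "letter list"

fun inverse_letter :: "letter \<Rightarrow> letter" where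
  "inverse_letter (Gen i) = Inv i"
| "inverse_letter (Inv i) = Gen i"

fun letter_index :: "letter \<Rightarrow> nat" where
  "letter_index (Gen i) = i"
| "letter_index (Inv i) = i"

definition is_braid_word :: "nat \<Rightarrow> braid_word \<Rightarrow> bool" where
  "is_braid_word p w \<longleftrightarrow> (\<forall>l \<in> set w. 1 \<le> letter_index l \<and> letter_index l < p)"

fun letter_event :: "letter \<Rightarrow> event" where
  "letter_event (Gen i) = (Crossing True, i - 1)"
| "letter_event (Inv i) = (Crossing False, i - 1)"

text \<open>
  The braid occupies the \<open>p\<close> left strands; the \<open>p\<close> right strands are the nested closing arcs.
\<close>

definition closure :: "nat \<Rightarrow> braid_word \<Rightarrow> diagram" where
  "closure p w = map (\<lambda>i. (Cup, i)) [0..<p] @ map letter_event w @ map (\<lambda>i. (Cap, i)) (rev [0..<p])"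

definition torus_braid :: "nat \<Rightarrow> nat \<Rightarrow> braid_word" where
  "torus_braid p q = concat (replicate q (map Gen [1..<p]))"

definition torus_link :: "nat \<Rightarrow> nat \<Rightarrow> diagram" where
  "torus_link p q = closure p (torus_braid p q)"

definition change_letters :: "nat set \<Rightarrow> braid_word \<Rightarrow> braid_word" where
  "change_letters S w = map_at S inverse_letter w"


section \<open>Well-formedness\<close>

lemma tangle_append: "tangle n D k \<Longrightarrow> tangle k E m \<Longrightarrow> tangle n (D @ E) m"
  by (induction n D k rule: tangle.induct) auto

lemma tangle_cups: "tangle 0 (map (\<lambda>i. (Cup, i)) [0..<p]) (2 * p)"
  by (induction p) (auto intro!: tangle_append)

lemma tangle_caps: "tangle (2 * p) (map (\<lambda>i. (Cap, i)) (rev [0..<p])) 0"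
  by (induction p) auto

lemma tangle_braid: "is_braid_word p w \<Longrightarrow> tangle (2 * p) (map letter_event w) (2 * p)"
proof (induction w)
  case (Cons l w)
  then have "p > 0"
    by (auto simp: is_braid_word_def)
  then have "Suc (Suc (2 * p - 2)) = 2 * p"
    by arith
  with Cons show ?case by (cases l) (auto simp: is_braid_word_def)
qed simp

lemma link_diagram_closure: "is_braid_word p w \<Longrightarrow> link_diagram (closure p w)"
  unfolding link_diagram_def closure_def
  by (intro tangle_append[OF tangle_cups] tangle_append[OF tangle_braid] tangle_caps)

lemma is_braid_word_torus_braid: "is_braid_word p (torus_braid p q)"
  by (auto simp: is_braid_word_def torus_braid_def)

lemma link_diagram_torus_link: "link_diagram (torus_link p q)"
  unfolding torus_link_def by (rule link_diagram_closure[OF is_braid_word_torus_braid])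

end

theory Submission
  imports Defs "HOL-Library.Discrete_Functions"
begin

text \<open>
  Lower bound: the smoothings of a diagram form a cube, and with coefficients in the field of two
  elements they span the complex of Bar-Natan's deformation of Khovanov homology.  In the basis of
  idempotents of \<open>F[x]/(x\<^sup>2 + x)\<close>, the space of a smoothing consists of the
  functions on the set of colourings of its circles by two colours, so that merging two circles is
  restriction, splitting is extension by zero, and the filtration is given by the degree of polynomials.  The
  homology is spanned by classes indexed by the orientations of the link.  As for
  Rasmussen's invariant, the filtration level of such a class is preserved by Reidemeister moves and drops
  by at most two under a crossing change; for this one only has to transform cocycles.  For a
  positive braid on \<open>p\<close> strands with \<open>n\<close> letters some class has level \<open>n - p\<close>, while all classes of the unlink of
  \<open>k\<close> circles have level at most \<open>- k\<close>, because the indicator function of a point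
  of a cube of dimension \<open>k\<close> has degree \<open>k\<close>.

  Upper bound: run through the components of the torus link one after another, starting at the strands
  \<open>0, \<dots>, d - 1\<close>, and let the strand that is met first be the overstrand at each
  crossing.  The top generator of such a layered braid can be made to occur at most once, since
  words in the elementary transpositions with equal permutations are related by the Coxeter moves, which all
  are realised by Reidemeister moves; then one destabilises.  The number of crossings that change is
  half of \<open>q (p - 1) - p + d\<close>, which is the lower bound.
\<close>

section \<open>Polynomial functions on colourings\<close>

text \<open>No homology group is ever computed. Coboundaries vanish at the canonical colourings, so
  an invariance statement only has to turn a given cocycle into one with the same values there and
  with controlled degrees. Planarity enters in a single form: in each row of a resolved diagram an
  even number of strands is coloured; this makes every saddle either a merging or a splitting. The
  number \<open>k\<close> of circles of the unlink that is reached is not prescribed. As canonical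
  colourings are matched bijectively, \<open>2 ^ k\<close> is an invariant, so \<open>k\<close> is
  the same for every unlinking, namely \<open>d\<close>. A positive braid with
  \<open>q * (p - 1)\<close> letters then gives \<open>q * (p - 1) - p + d \<le> 2 * card S\<close>.
  For the upper bound the labels of the strands must be consecutive along each component:
  destabilisation joins two strands with neighbouring labels, and only for this reason does the
  joined strand fit into the same order.\<close>

definition xr :: "bool \<Rightarrow> bool \<Rightarrow> bool" (infixl "\<oplus>" 55) where
  "x \<oplus> y \<longleftrightarrow> x \<noteq> y"

lemma xr_simps [simp]: "x \<oplus> False = x" "False \<oplus> x = x" "x \<oplus> x = False"
  "x \<oplus> True = (\<not> x)" "True \<oplus> x = (\<not> x)" "(\<not> x) \<oplus> y = (\<not> x \<oplus> y)" "x \<oplus> (\<not> y) = (\<not> x \<oplus> y)"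
  unfolding xr_def by auto

text \<open>Polynomials over the field with two elements, taken as functions, so that coordinates
  are idempotent. The degree bound is an integer: a negative bound admits only the zero function,
  and derivatives may lower any bound by one.\<close>

inductive deg_le :: "int \<Rightarrow> (('e \<Rightarrow> bool) \<Rightarrow> bool) \<Rightarrow> bool" where
  deg_False: "deg_le r (\<lambda>_. False)"
| deg_True: "0 \<le> r \<Longrightarrow> deg_le r (\<lambda>_. True)"
| deg_xor: "deg_le r f \<Longrightarrow> deg_le r g \<Longrightarrow> deg_le r (\<lambda>c. f c \<oplus> g c)"
| deg_var: "deg_le (r - 1) f \<Longrightarrow> deg_le r (\<lambda>c. c e \<and> f c)"

lemma deg_mono: "deg_le r f \<Longrightarrow> r \<le> s \<Longrightarrow> deg_le s f"
proof (induction arbitrary: s rule: deg_le.induct)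
  case (deg_var r f e)
  then show ?case by (intro deg_le.deg_var) auto
qed (auto intro: deg_le.intros)

lemma deg_const: "0 \<le> r \<Longrightarrow> deg_le r (\<lambda>_. b)"
  by (cases b) (auto intro: deg_le.intros)

lemma deg_coord: "1 \<le> r \<Longrightarrow> deg_le r (\<lambda>c. c e)"
  using deg_var[of r "\<lambda>_. True" e] by (simp add: deg_True)

lemma deg_Not:
  assumes "deg_le r f" "0 \<le> r"
  shows "deg_le r (\<lambda>c. \<not> f c)"
  using deg_xor[OF assms(1) deg_True[OF assms(2)]] by simp

lemma deg_eq:
  assumes "deg_le r f" "deg_le r g" "0 \<le> r"
  shows "deg_le r (\<lambda>c. f c = g c)"
  using deg_Not[OF deg_xor[OF assms(1,2)] assms(3)] by (simp add: xr_def)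

lemma deg_conj:
  assumes "deg_le r f" "deg_le s g"
  shows "deg_le (r + s) (\<lambda>c. f c \<and> g c)"
  using assms(1)
proof induction
  case (deg_False r)
  then show ?case by (simp add: deg_le.deg_False)
next
  case (deg_True r)
  then show ?case using deg_mono[OF assms(2)] by simp
next
  case (deg_xor r f g')
  have "(\<lambda>c. (f c \<oplus> g' c) \<and> g c) = (\<lambda>c. (f c \<and> g c) \<oplus> (g' c \<and> g c))"
    by (auto simp: xr_def)
  then show ?case using deg_le.deg_xor[OF deg_xor.IH] by simp
next
  case (deg_var r f e)
  have "r - 1 + s = r + s - 1" by simp
  then have "deg_le (r + s) (\<lambda>c. c e \<and> (f c \<and> g c))"
    using deg_le.deg_var[of "r + s" "\<lambda>c. f c \<and> g c" e] deg_var.IH by metis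
  then show ?case by (simp add: conj_assoc)
qed

lemma deg_subst:
  assumes "deg_le r f" and s: "\<And>e. deg_le 1 (\<lambda>c. s c e)"
  shows "deg_le r (\<lambda>c. f (s c))"
  using assms(1)
proof induction
  case (deg_var r f e)
  then show ?case using deg_conj[OF s[of e] deg_var.IH] by simp
qed (auto intro: deg_le.intros)

text \<open>Leibniz rule for differences. The substitutions \<open>s\<close> and \<open>t\<close>
  differ only by negating coordinates; if the leading coordinate \<open>e\<close> is negated, the
  product leaves the extra summand \<open>f (t c)\<close>, whose degree is already one
  lower.\<close>

lemma deg_derivative:
  assumes "deg_le r f" and s: "\<And>e. deg_le 1 (\<lambda>c. s c e)"
    and t: "\<And>e. (\<forall>c. t c e = s c e) \<or> (\<forall>c. t c e = (\<not> s c e))"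
  shows "deg_le (r - 1) (\<lambda>c. f (s c) \<oplus> f (t c))"
  using assms(1)
proof induction
  case (deg_xor r f g)
  have "(\<lambda>c. (f (s c) \<oplus> g (s c)) \<oplus> (f (t c) \<oplus> g (t c)))
      = (\<lambda>c. (f (s c) \<oplus> f (t c)) \<oplus> (g (s c) \<oplus> g (t c)))"
    by (auto simp: xr_def)
  then show ?case using deg_le.deg_xor[OF deg_xor.IH] by simp
next
  case (deg_var r f e)
  have 1: "deg_le (r - 1) (\<lambda>c. s c e \<and> (f (s c) \<oplus> f (t c)))"
    using deg_conj[OF s[of e] deg_var.IH] by simp
  have t1: "deg_le 1 (\<lambda>c. t c e')" for e'
  proof (cases "\<forall>c. t c e' = s c e'")
    case True
    then show ?thesis using s[of e'] by simp
  next
    case False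
    then have "\<forall>c. t c e' = (\<not> s c e')" using t by blast
    then show ?thesis using deg_Not[OF s[of e']] by simp
  qed
  have ft: "deg_le (r - 1) (\<lambda>c. f (t c))"
    by (rule deg_subst[OF deg_var.hyps(1) t1])
  show ?case
  proof (cases "\<forall>c. t c e = s c e")
    case True
    then have "(\<lambda>c. (s c e \<and> f (s c)) \<oplus> (t c e \<and> f (t c)))
        = (\<lambda>c. s c e \<and> (f (s c) \<oplus> f (t c)))"
      by (auto simp: xr_def)
    then show ?thesis using 1 by simp
  next
    case False
    then have "\<forall>c. t c e = (\<not> s c e)" using t by blast
    then have "(\<lambda>c. (s c e \<and> f (s c)) \<oplus> (t c e \<and> f (t c)))
        = (\<lambda>c. (s c e \<and> (f (s c) \<oplus> f (t c))) \<oplus> f (t c))"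
      by (auto simp: xr_def)
    then show ?thesis using deg_le.deg_xor[OF 1 ft] by simp
  qed
qed (auto intro: deg_le.intros)

text \<open>
  If \<open>V\<close> is the set of colourings of \<open>k\<close> circles, then \<open>floor_log (card V) = k\<close>, and the quantum
  degree of a function of degree \<open>r\<close> is \<open>k - 2 * r\<close>.
\<close>

definition fil :: "('e \<Rightarrow> bool) set \<Rightarrow> int \<Rightarrow> (('e \<Rightarrow> bool) \<Rightarrow> bool) \<Rightarrow> bool" where
  "fil V a f \<longleftrightarrow>
     (\<exists>r g. deg_le r g \<and> (\<forall>c\<in>V. f c = g c) \<and> 2 * r \<le> int (floor_log (card V)) + a)"

lemma fil_cong: "fil V a f \<Longrightarrow> (\<And>c. c \<in> V \<Longrightarrow> f' c = f c) \<Longrightarrow> fil V a f'"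
  unfolding fil_def by metis

lemma fil_False: "fil V a (\<lambda>_. False)"
proof -
  \<comment> \<open>The zero function satisfies every degree bound, and \<open>- abs a\<close> is
    small enough whatever \<open>V\<close> is.\<close>
  have "2 * (- abs a) \<le> int (floor_log (card V)) + a" by simp
  then show ?thesis unfolding fil_def using deg_False by blast
qed

lemma fil_xor:
  assumes "fil V a f" "fil V a g"
  shows "fil V a (\<lambda>c. f c \<oplus> g c)"
proof -
  obtain r f' where f: "deg_le r f'" "\<forall>c\<in>V. f c = f' c" "2 * r \<le> int (floor_log (card V)) + a"
    using assms(1) unfolding fil_def by blast
  obtain s g' where g: "deg_le s g'" "\<forall>c\<in>V. g c = g' c" "2 * s \<le> int (floor_log (card V)) + a"
    using assms(2) unfolding fil_def by blast
  have "deg_le (max r s) (\<lambda>c. f' c \<oplus> g' c)"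
    by (rule deg_xor[OF deg_mono[OF f(1)] deg_mono[OF g(1)]]) auto
  moreover have "2 * max r s \<le> int (floor_log (card V)) + a" using f(3) g(3) by (simp add: max_def)
  moreover have "\<forall>c\<in>V. (f c \<oplus> g c) = (f' c \<oplus> g' c)" using f(2) g(2) by simp
  ultimately show ?thesis unfolding fil_def by blast
qed

lemma fil_mult:
  assumes "fil V a f" "deg_le 1 g" "a + 2 \<le> b"
  shows "fil V b (\<lambda>c. g c \<and> f c)"
proof -
  obtain r f' where f: "deg_le r f'" "\<forall>c\<in>V. f c = f' c" "2 * r \<le> int (floor_log (card V)) + a"
    using assms(1) unfolding fil_def by blast
  have "deg_le (1 + r) (\<lambda>c. g c \<and> f' c)" by (rule deg_conj[OF assms(2) f(1)])
  moreover have "2 * (1 + r) \<le> int (floor_log (card V)) + b" using f(3) assms(3) by simp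
  ultimately show ?thesis unfolding fil_def using f(2) by blast
qed

lemma floor_log_pow_mult: "n > 0 \<Longrightarrow> floor_log (2 ^ s * n) = s + floor_log n"
proof (induction s)
  case (Suc s)
  have "2 ^ Suc s * n = 2 * (2 ^ s * n)" by simp
  then have "floor_log (2 ^ Suc s * n) = Suc (floor_log (2 ^ s * n))"
    using Suc.prems by (simp only: floor_log_twice) simp
  then show ?case using Suc by simp
qed simp

text \<open>Coordinates only matter on \<open>V\<close>; substitutions need to be affine there.\<close>

definition affine_on :: "('e \<Rightarrow> bool) set \<Rightarrow> (('e \<Rightarrow> bool) \<Rightarrow> 'f \<Rightarrow> bool) \<Rightarrow> bool" where
  "affine_on V s \<longleftrightarrow> (\<forall>e. \<exists>g. deg_le 1 g \<and> (\<forall>c\<in>V. s c e = g c))"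

lemma affine_onI: "(\<And>e. \<exists>g. deg_le 1 g \<and> (\<forall>c\<in>V. s c e = g c)) \<Longrightarrow> affine_on V s"
  unfolding affine_on_def by blast

lemma affine_on_id: "affine_on V (\<lambda>c. c)"
proof (rule affine_onI)
  show "\<exists>g. deg_le 1 g \<and> (\<forall>c\<in>V. c e = g c)" for e
    by (rule exI[of _ "\<lambda>c. c e"]) (simp add: deg_coord)
qed

lemma affine_on_upd:
  assumes "affine_on V s" "deg_le 1 g"
  shows "affine_on V (\<lambda>c. (s c)(x := g c))"
proof (rule affine_onI)
  fix e
  show "\<exists>g'. deg_le 1 g' \<and> (\<forall>c\<in>V. ((s c)(x := g c)) e = g' c)"
  proof (cases "e = x")
    case True
    then show ?thesis using assms(2) by (intro exI[of _ g]) simp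
  next
    case False
    obtain g' where "deg_le 1 g'" "\<forall>c\<in>V. s c e = g' c"
      using assms(1) unfolding affine_on_def by blast
    then show ?thesis using False by (intro exI[of _ g']) simp
  qed
qed

lemma fil_subst:
  assumes f: "fil V a f" and V: "\<And>c. c \<in> V' \<Longrightarrow> s c \<in> V" and s: "affine_on V' s"
    and k: "int (floor_log (card V)) + a \<le> int (floor_log (card V')) + b"
  shows "fil V' b (\<lambda>c. f (s c))"
proof -
  obtain r f' where f: "deg_le r f'" "\<forall>c\<in>V. f c = f' c" "2 * r \<le> int (floor_log (card V)) + a"
    using f unfolding fil_def by blast
  obtain g where g: "\<And>e. deg_le 1 (g e)" "\<And>e c. c \<in> V' \<Longrightarrow> s c e = g e c"
    using s unfolding affine_on_def by metis
  have eq: "s c = (\<lambda>e. g e c)" if "c \<in> V'" for c using g(2)[OF that] by auto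
  have "deg_le r (\<lambda>c. f' (\<lambda>e. g e c))"
    by (rule deg_subst[OF f(1) g(1)])
  moreover have "\<forall>c\<in>V'. f (s c) = f' (\<lambda>e. g e c)"
  proof
    fix c assume c: "c \<in> V'"
    have "f (s c) = f' (s c)" using f(2) V[OF c] by blast
    then show "f (s c) = f' (\<lambda>e. g e c)" by (simp only: eq[OF c])
  qed
  moreover have "2 * r \<le> int (floor_log (card V')) + b" using f(3) k by linarith
  ultimately show ?thesis unfolding fil_def by blast
qed

text \<open>Reading a function on a space with \<open>n\<close> more circles: the degree stays,
  while the logarithm of the number of colourings grows by at least \<open>n\<close>.\<close>

lemma fil_pull:
  assumes "fil V a f" "\<And>c. c \<in> V' \<Longrightarrow> s c \<in> V" "affine_on V' s"
    and k: "2 ^ n * card V \<le> card V'" "card V > 0" and b: "a - int n \<le> b"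
  shows "fil V' b (\<lambda>c. f (s c))"
proof (rule fil_subst[OF assms(1-3)])
  have "n + floor_log (card V) \<le> floor_log (card V')"
    using floor_log_le_iff[OF k(1)] floor_log_pow_mult[OF k(2)] by simp
  then show "int (floor_log (card V)) + a \<le> int (floor_log (card V')) + b" using b by linarith
qed

lemma floor_log_le_double: "m \<le> 2 * n \<Longrightarrow> n > 0 \<Longrightarrow> int (floor_log m) \<le> 1 + int (floor_log n)"
  using floor_log_le_iff[of m "2 * n"] by simp

text \<open>Removing a circle by summing over its two colours is a difference of two substitutions.
  The degree drops by one, and as it counts twice this outweighs the loss of one circle.\<close>

lemma fil_death:
  assumes f: "fil V a f" and V: "\<And>c. c \<in> V' \<Longrightarrow> s c \<in> V" "\<And>c. c \<in> V' \<Longrightarrow> t c \<in> V"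
    and s: "affine_on V' s"
    and t: "\<And>e. (\<forall>c\<in>V'. t c e = s c e) \<or> (\<forall>c\<in>V'. t c e = (\<not> s c e))"
    and k: "card V \<le> 2 * card V'" "card V' > 0" and b: "a - 1 \<le> b"
  shows "fil V' b (\<lambda>c. f (s c) \<oplus> f (t c))"
proof -
  obtain r f' where f: "deg_le r f'" "\<forall>c\<in>V. f c = f' c" "2 * r \<le> int (floor_log (card V)) + a"
    using f unfolding fil_def by blast
  obtain g where g: "\<And>e. deg_le 1 (g e)" "\<And>e c. c \<in> V' \<Longrightarrow> s c e = g e c"
    using s unfolding affine_on_def by metis
  define h where "h c e \<longleftrightarrow> (if \<forall>c\<in>V'. t c e = s c e then g e c else \<not> g e c)" for c e
  have eq: "s c = (\<lambda>e. g e c)" if "c \<in> V'" for c using g(2)[OF that] by auto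
  have eq': "t c = h c" if "c \<in> V'" for c
  proof
    fix e
    show "t c e = h c e"
    proof (cases "\<forall>c\<in>V'. t c e = s c e")
      case True
      then show ?thesis using g(2)[OF that, of e] that by (simp add: h_def)
    next
      case False
      then have "t c e = (\<not> s c e)" using t[of e] that by blast
      then show ?thesis using False g(2)[OF that, of e] by (simp add: h_def)
    qed
  qed
  have "deg_le (r - 1) (\<lambda>c. f' (\<lambda>e. g e c) \<oplus> f' (h c))"
    by (rule deg_derivative[OF f(1) g(1)]) (auto simp: h_def)
  moreover have "\<forall>c\<in>V'. (f (s c) \<oplus> f (t c)) = (f' (\<lambda>e. g e c) \<oplus> f' (h c))"
  proof
    fix c assume c: "c \<in> V'"
    have "f (s c) = f' (s c)" "f (t c) = f' (t c)" using f(2) V[OF c] by blast+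
    then show "(f (s c) \<oplus> f (t c)) = (f' (\<lambda>e. g e c) \<oplus> f' (h c))"
      by (simp only: eq[OF c] eq'[OF c])
  qed
  moreover have "2 * (r - 1) \<le> int (floor_log (card V')) + b"
    using floor_log_le_double[OF k] f(3) b unfolding right_diff_distrib by linarith
  ultimately show ?thesis unfolding fil_def by blast
qed

text \<open>The colourings that are constant on circles form a Boolean ring. Closure under
  conjunction, beyond linearity, reflects that they are functions on a set of circles;
  \<open>fil_saddle\<close> depends on it.\<close>

definition alg :: "('e \<Rightarrow> bool) set \<Rightarrow> bool" where
  "alg V \<longleftrightarrow> finite V \<and> (\<lambda>_. False) \<in> V \<and>
     (\<forall>c\<in>V. \<forall>c'\<in>V. (\<lambda>e. c e \<oplus> c' e) \<in> V \<and> (\<lambda>e. c e \<and> c' e) \<in> V)"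

lemma alg_card_pos: "alg V \<Longrightarrow> card V > 0"
  unfolding alg_def card_gt_0_iff by blast

lemma alg_finite: "alg V \<Longrightarrow> finite V"
  and alg_zero: "alg V \<Longrightarrow> (\<lambda>_. False) \<in> V"
  and alg_xor: "alg V \<Longrightarrow> c \<in> V \<Longrightarrow> c' \<in> V \<Longrightarrow> (\<lambda>e. c e \<oplus> c' e) \<in> V"
  and alg_conj: "alg V \<Longrightarrow> c \<in> V \<Longrightarrow> c' \<in> V \<Longrightarrow> (\<lambda>e. c e \<and> c' e) \<in> V"
  unfolding alg_def by blast+

lemma algI:
  assumes "finite V" "(\<lambda>_. False) \<in> V"
    "\<And>c c'. c \<in> V \<Longrightarrow> c' \<in> V \<Longrightarrow> (\<lambda>e. c e \<oplus> c' e) \<in> V"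
    "\<And>c c'. c \<in> V \<Longrightarrow> c' \<in> V \<Longrightarrow> (\<lambda>e. c e \<and> c' e) \<in> V"
  shows "alg V"
  using assms unfolding alg_def by blast

lemma alg_eq: "alg V \<Longrightarrow> alg {c\<in>V. c p = c q}"
  by (rule algI) (auto simp: alg_finite intro: alg_zero alg_xor alg_conj)

text \<open>Adding a fixed \<open>u\<close> with \<open>u p \<noteq> u q\<close> exchanges the
  solutions of \<open>c p = c q\<close> with the other colourings, so the two sets are equally
  large; without such a \<open>u\<close> the equation holds throughout.\<close>

lemma alg_halve:
  fixes V :: "('e \<Rightarrow> bool) set"
  assumes "alg V"
  shows "card V \<le> 2 * card {c\<in>V. c p = c q}"
    and "u \<in> V \<Longrightarrow> u p \<noteq> u q \<Longrightarrow> 2 * card {c\<in>V. c p = c q} \<le> card V"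
proof -
  let ?W = "{c\<in>V. c p = c q}" and ?U = "{c\<in>V. c p \<noteq> c q}"
  have fin: "finite ?W" "finite ?U" using alg_finite[OF assms] by auto
  have "?W \<union> ?U = V" "?W \<inter> ?U = {}" by auto
  then have c: "card V = card ?W + card ?U" using card_Un_disjoint[OF fin] by simp
  have inj: "inj_on (\<lambda>c e. c e \<oplus> u e) A" for u :: "'e \<Rightarrow> bool" and A
  proof (rule inj_onI, rule ext)
    fix c c' :: "'e \<Rightarrow> bool" and e
    assume "(\<lambda>e. c e \<oplus> u e) = (\<lambda>e. c' e \<oplus> u e)"
    from fun_cong[OF this, of e] show "c e = c' e" by (auto simp: xr_def)
  qed
  have 1: "card ?U \<le> card ?W" "card ?W \<le> card ?U" if u: "u \<in> V" "u p \<noteq> u q" for u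
  proof -
    have V: "(\<lambda>e. c e \<oplus> u e) \<in> V" if "c \<in> V" for c by (rule alg_xor[OF assms that u(1)])
    have UW: "(\<lambda>e. c e \<oplus> u e) \<in> ?W" if c: "c \<in> ?U" for c
    proof -
      have "(c p \<oplus> u p) = (c q \<oplus> u q)" using c u(2) by (auto simp: xr_def)
      then show ?thesis using V c by blast
    qed
    have WU: "(\<lambda>e. c e \<oplus> u e) \<in> ?U" if c: "c \<in> ?W" for c
    proof -
      have "(c p \<oplus> u p) \<noteq> (c q \<oplus> u q)" using c u(2) by (auto simp: xr_def)
      then show ?thesis using V c by blast
    qed
    show "card ?U \<le> card ?W"
      by (rule card_inj_on_le[OF inj[of u] image_subsetI[OF UW] fin(1)])
    show "card ?W \<le> card ?U"
      by (rule card_inj_on_le[OF inj[of u] image_subsetI[OF WU] fin(2)])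
  qed
  show "card V \<le> 2 * card ?W"
  proof (cases "\<exists>u\<in>V. u p \<noteq> u q")
    case True
    then obtain u where "u \<in> V" "u p \<noteq> u q" ..
    from 1(1)[OF this] c show ?thesis by linarith
  next
    case False
    then have "?U = {}" by blast
    then have "card ?U = 0" by (simp only: card.empty)
    then show ?thesis using c by linarith
  qed
  show "2 * card ?W \<le> card V" if "u \<in> V" "u p \<noteq> u q"
    using 1(2)[OF that] c by simp
qed

text \<open>One edge of the cube. The parity condition forces the two smoothings to be nested: if
  the second is contained in the first, circles merge and the map is a restriction; otherwise a
  circle splits and the map is extension by zero, written as multiplication by the affine function
  \<open>c p = c p'\<close>. Either way the quantum degree drops by at most one.\<close>

lemma fil_saddle:
  assumes V: "alg V" and par: "\<And>c. c \<in> V \<Longrightarrow> (c p \<noteq> c q) = (c p' \<noteq> c q')"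
    and f: "fil {c\<in>V. c p = c p' \<and> c q = c q'} a f" and ab: "a + 1 \<le> b"
  shows "fil {c\<in>V. c p = c q \<and> c p' = c q'} b (\<lambda>c. c p = c p' \<and> f c)"
proof -
  let ?A = "{c\<in>V. c p = c p' \<and> c q = c q'}" and ?B = "{c\<in>V. c p = c q \<and> c p' = c q'}"
  have "?A = {c \<in> {c\<in>V. c p = c p'}. c q = c q'}" "?B = {c \<in> {c\<in>V. c p = c q}. c p' = c q'}"
    by auto
  then have alg: "alg ?A" "alg ?B" using alg_eq[OF alg_eq[OF V]] by simp_all
  obtain r g where g: "deg_le r g" "\<forall>c\<in>?A. f c = g c" "2 * r \<le> int (floor_log (card ?A)) + a"
    using f unfolding fil_def by blast
  have nest: "?A \<subseteq> ?B \<or> ?B \<subseteq> ?A"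
  proof (rule ccontr)
    assume "\<not> ?thesis"
    then obtain u u' where u: "u \<in> V" "u p = u p'" "u q = u q'" "u p \<noteq> u q"
      and u': "u' \<in> V" "u' p = u' q" "u' p' = u' q'" "u' p \<noteq> u' p'"
      by blast
    \<comment> \<open>The conjunction colours exactly one of the four points \<open>p\<close>,
      \<open>q\<close>, \<open>p'\<close>, \<open>q'\<close>, against the parity.\<close>
    have "(\<lambda>e. u e \<and> u' e) \<in> V" by (rule alg_conj[OF V u(1) u'(1)])
    then show False using par[of "\<lambda>e. u e \<and> u' e"] u u' by auto
  qed
  show ?thesis
  proof (cases "?B \<subseteq> ?A")
    case True
    then have B: "?B = {c\<in>?A. c p = c q}" by auto
    have "card ?A \<le> 2 * card ?B" unfolding B by (rule alg_halve(1)[OF alg(1)])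
    from floor_log_le_double[OF this alg_card_pos[OF alg(2)]]
    have "2 * r \<le> int (floor_log (card ?B)) + b" using g(3) ab by linarith
    moreover have "\<forall>c\<in>?B. (c p = c p' \<and> f c) = g c" using True g(2) by blast
    ultimately show ?thesis unfolding fil_def using g(1) by blast
  next
    case False
    then have A: "?A \<subseteq> ?B" using nest by blast
    obtain u where u: "u \<in> ?B" "u p \<noteq> u p'" using False by blast
    have AB: "?A = {c\<in>?B. c p = c p'}" using A by blast
    have "2 * card ?A \<le> card ?B" unfolding AB by (rule alg_halve(2)[OF alg(2) u])
    then have "floor_log (2 * card ?A) \<le> floor_log (card ?B)" by (rule floor_log_le_iff)
    then have "Suc (floor_log (card ?A)) \<le> floor_log (card ?B)"
      using alg_card_pos[OF alg(1)] by simp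
    then have "2 * (1 + r) \<le> int (floor_log (card ?B)) + b" using g(3) ab unfolding distrib_left by linarith
    moreover have "deg_le (1 + r) (\<lambda>c. c p = c p' \<and> g c)"
      by (intro deg_conj deg_eq deg_coord g(1)) auto
    moreover have "\<forall>c\<in>?B. (c p = c p' \<and> f c) = (c p = c p' \<and> g c)"
      using g(2) by auto
    ultimately show ?thesis unfolding fil_def by blast
  qed
qed


section \<open>Cubes of smoothings\<close>

definition parity :: "'x set \<Rightarrow> ('x \<Rightarrow> bool) \<Rightarrow> bool" where
  "parity v Q \<longleftrightarrow> odd (card {x\<in>v. Q x})"

lemma parity_empty [simp]: "parity {} Q = False"
  by (simp add: parity_def)

lemma parity_insert:
  assumes "finite v" "x \<notin> v"
  shows "parity (insert x v) Q = (Q x \<oplus> parity v Q)"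
proof -
  have "{y \<in> insert x v. Q y} = (if Q x then insert x {y\<in>v. Q y} else {y\<in>v. Q y})" by auto
  then show ?thesis using assms by (simp add: parity_def)
qed

lemma parity_cong: "(\<And>x. x \<in> v \<Longrightarrow> Q x = R x) \<Longrightarrow> parity v Q = parity v R"
  unfolding parity_def by (metis (mono_tags, lifting) Collect_cong)

lemma parity_False [simp]: "parity v (\<lambda>_. False) = False"
  by (simp add: parity_def)

lemma parity_xr: "finite v \<Longrightarrow> parity v (\<lambda>x. Q x \<oplus> R x) = (parity v Q \<oplus> parity v R)"
  by (induction v rule: finite_induct) (auto simp: parity_insert xr_def)

lemma parity_image: "inj_on h v \<Longrightarrow> parity (h ` v) Q = parity v (\<lambda>x. Q (h x))"
proof -
  assume h: "inj_on h v"
  have "{y \<in> h ` v. Q y} = h ` {x\<in>v. Q (h x)}" by auto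
  moreover have "inj_on h {x\<in>v. Q (h x)}" using h by (rule inj_on_subset) auto
  ultimately show ?thesis unfolding parity_def by (simp add: card_image)
qed

type_synonym 'e colouring = "'e \<Rightarrow> bool"
type_synonym ('x, 'e) smoothings = "bool \<Rightarrow> 'x \<Rightarrow> 'e colouring \<Rightarrow> bool"
type_synonym ('x, 'e) chain = "'x set \<Rightarrow> 'e colouring \<Rightarrow> bool"

text \<open>
  \<open>P b x c\<close> says that the colouring \<open>c\<close> of the edges of the diagram is constant along the arcs of the
  smoothing \<open>b\<close> of the crossing \<open>x\<close>, hence a colouring of the circles if it holds at each crossing.
  The colourings in \<open>canon\<close> extend to just one
  smoothing of each crossing; they correspond to the orientations, and \<open>res\<close> gives that smoothing.
  A cohomology class is determined by the values of a cocycle at the canonical colourings, so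
  \<open>lev c0 j\<close> says that the class of \<open>c0\<close> has filtration level at least \<open>j\<close>; the grading
  \<open>wt\<close> is normalised by the signs of the crossings for the orientation \<open>c0\<close>.
\<close>

definition states :: "'e colouring set \<Rightarrow> 'x set \<Rightarrow> ('x, 'e) smoothings \<Rightarrow> 'x set \<Rightarrow> 'e colouring set" where
  "states Om X P v = {c\<in>Om. \<forall>x\<in>X. P (x \<in> v) x c}"

text \<open>The coboundary evaluated at a colouring \<open>c\<close> of the smoothing
  \<open>v\<close>. The edge from \<open>v - {x}\<close> contributes the value there if
  \<open>c\<close> also satisfies the smoothing \<open>False\<close> at \<open>x\<close>, and zero
  otherwise; this is at once the restriction for a merging and the extension by zero for a
  splitting.\<close>

definition bd :: "('x, 'e) smoothings \<Rightarrow> ('x, 'e) chain \<Rightarrow> ('x, 'e) chain" where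
  "bd P z v c = parity v (\<lambda>x. P False x c \<and> z (v - {x}) c)"

definition cyc :: "'e colouring set \<Rightarrow> 'x set \<Rightarrow> ('x, 'e) smoothings \<Rightarrow> ('x, 'e) chain \<Rightarrow> bool" where
  "cyc Om X P z \<longleftrightarrow> (\<forall>v\<subseteq>X. \<forall>c\<in>states Om X P v. \<not> bd P z v c)"

definition canon :: "'e colouring set \<Rightarrow> 'x set \<Rightarrow> ('x, 'e) smoothings \<Rightarrow> 'e colouring set" where
  "canon Om X P = {c\<in>Om. \<forall>x\<in>X. P False x c \<noteq> P True x c}"

definition res :: "'x set \<Rightarrow> ('x, 'e) smoothings \<Rightarrow> 'e colouring \<Rightarrow> 'x set" where
  "res X P c = {x\<in>X. P True x c}"

text \<open>The usual shift: cube degree plus the number of positive crossings minus twice the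
  number of negative ones. For the orientation of a canonical \<open>c\<close>, the smoothing to
  which \<open>c\<close> extends is the oriented one, which is \<open>False\<close> just at the
  positive crossings.\<close>

definition wt :: "'x set \<Rightarrow> ('x, 'e) smoothings \<Rightarrow> 'e colouring \<Rightarrow> 'x set \<Rightarrow> int" where
  "wt X P c v = int (card v) + int (card {x\<in>X. P False x c}) - 2 * int (card {x\<in>X. P True x c})"

definition lev :: "'e colouring set \<Rightarrow> 'x set \<Rightarrow> ('x, 'e) smoothings \<Rightarrow> 'e colouring \<Rightarrow> int \<Rightarrow> bool" where
  "lev Om X P c0 j \<longleftrightarrow> (\<exists>z. cyc Om X P z \<and> (\<forall>c\<in>canon Om X P. z (res X P c) c \<longleftrightarrow> c = c0) \<and>
     (\<forall>v\<subseteq>X. fil (states Om X P v) (wt X P c0 v - j) (z v)))"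

text \<open>Filtration levels drop by at most \<open>a\<close>. The bijection \<open>h\<close>
  carries the orientations of one link to those of the other.\<close>

definition sub :: "int \<Rightarrow> 'e colouring set \<Rightarrow> 'x set \<Rightarrow> ('x, 'e) smoothings \<Rightarrow>
    'f colouring set \<Rightarrow> 'y set \<Rightarrow> ('y, 'f) smoothings \<Rightarrow> bool" where
  "sub a Om X P Om' X' P' \<longleftrightarrow> (\<exists>h. bij_betw h (canon Om X P) (canon Om' X' P') \<and>
     (\<forall>c\<in>canon Om X P. \<forall>j. lev Om X P c j \<longrightarrow> lev Om' X' P' (h c) (j - a)))"

definition cube :: "'e colouring set \<Rightarrow> 'x set \<Rightarrow> ('x, 'e) smoothings \<Rightarrow> bool" where
  "cube Om X P \<longleftrightarrow> finite X \<and> (\<forall>v\<subseteq>X. alg (states Om X P v))"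

lemma sub_refl: "sub 0 Om X P Om X P"
  unfolding sub_def by (rule exI[of _ id]) auto

lemma sub_trans:
  assumes "sub a Om X P Om' X' P'" "sub b Om' X' P' Om'' X'' P''"
  shows "sub (a + b) Om X P Om'' X'' P''"
proof -
  obtain g where g: "bij_betw g (canon Om X P) (canon Om' X' P')"
    "\<And>c j. c \<in> canon Om X P \<Longrightarrow> lev Om X P c j \<Longrightarrow> lev Om' X' P' (g c) (j - a)"
    using assms(1) unfolding sub_def by blast
  obtain h where h: "bij_betw h (canon Om' X' P') (canon Om'' X'' P'')"
    "\<And>c j. c \<in> canon Om' X' P' \<Longrightarrow> lev Om' X' P' c j \<Longrightarrow> lev Om'' X'' P'' (h c) (j - b)"
    using assms(2) unfolding sub_def by blast
  show ?thesis
    unfolding sub_def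
  proof (intro exI[of _ "h \<circ> g"] conjI ballI allI impI)
    show "bij_betw (h \<circ> g) (canon Om X P) (canon Om'' X'' P'')"
      by (rule bij_betw_trans[OF g(1) h(1)])
    fix c j assume c: "c \<in> canon Om X P" "lev Om X P c j"
    have "g c \<in> canon Om' X' P'" using bij_betwE[OF g(1)] c(1) by blast
    from h(2)[OF this g(2)[OF c]]
    show "lev Om'' X'' P'' ((h \<circ> g) c) (j - (a + b))" by (simp add: algebra_simps)
  qed
qed

lemma sub_card_canon: "sub a Om X P Om' X' P' \<Longrightarrow> card (canon Om X P) = card (canon Om' X' P')"
  unfolding sub_def using bij_betw_same_card by blast

text \<open>The new cocycle may depend on \<open>c0\<close>; \<open>sub_crossing_change\<close>
  exploits this, as its formula depends on the sign of the crossing for that orientation. Since all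
  canonical values are kept, \<open>z'\<close> again singles out one canonical colouring,
  \<open>h c0\<close>.\<close>

lemma subI:
  assumes h: "bij_betw h (canon Om X P) (canon Om' X' P')"
    and f: "\<And>c0 z. c0 \<in> canon Om X P \<Longrightarrow> cyc Om X P z \<Longrightarrow>
        (\<And>c. c \<in> canon Om X P \<Longrightarrow> z (res X P c) c = (c = c0)) \<Longrightarrow>
        \<exists>z'. cyc Om' X' P' z' \<and> (\<forall>c\<in>canon Om X P. z' (res X' P' (h c)) (h c) = z (res X P c) c) \<and>
         (\<forall>j. (\<forall>v\<subseteq>X. fil (states Om X P v) (wt X P c0 v - j) (z v)) \<longrightarrow>
            (\<forall>v\<subseteq>X'. fil (states Om' X' P' v) (wt X' P' (h c0) v - (j - a)) (z' v)))"
  shows "sub a Om X P Om' X' P'"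
  unfolding sub_def
proof (intro exI[of _ h] conjI ballI allI impI h)
  fix c0 j assume c0: "c0 \<in> canon Om X P" and "lev Om X P c0 j"
  then obtain z where z: "cyc Om X P z" "\<And>c. c \<in> canon Om X P \<Longrightarrow> z (res X P c) c = (c = c0)"
    "\<forall>v\<subseteq>X. fil (states Om X P v) (wt X P c0 v - j) (z v)"
    unfolding lev_def by blast
  obtain z' where z': "cyc Om' X' P' z'"
    "\<forall>c\<in>canon Om X P. z' (res X' P' (h c)) (h c) = z (res X P c) c"
    "\<forall>v\<subseteq>X'. fil (states Om' X' P' v) (wt X' P' (h c0) v - (j - a)) (z' v)"
    by (rule exE[OF f[OF c0 z(1)]], erule z(2), elim conjE, intro that, assumption, assumption)
      (drule spec[of _ j], drule mp, rule z(3), assumption)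
  have eq: "z' (res X' P' c') c' = (c' = h c0)" if c': "c' \<in> canon Om' X' P'" for c'
  proof -
    obtain c where c: "c \<in> canon Om X P" "c' = h c"
      using c' unfolding bij_betw_imp_surj_on[OF h, symmetric] by (elim imageE)
    have "(h c = h c0) = (c = c0)" using bij_betw_imp_inj_on[OF h] c(1) c0 by (simp add: inj_on_eq_iff)
    then show ?thesis using z'(2) z(2) c by simp
  qed
  show "lev Om' X' P' (h c0) (j - a)"
    unfolding lev_def by (rule exI[of _ z'], intro conjI ballI z'(1,3)) (rule eq)
qed

section \<open>Splitting a cube along one crossing\<close>

definition vin :: "'x \<Rightarrow> bool \<Rightarrow> 'x set \<Rightarrow> 'x set" where
  "vin x b v = (if b then insert x v else v)"

definition join :: "'x \<Rightarrow> (bool \<Rightarrow> ('x, 'e) chain) \<Rightarrow> ('x, 'e) chain" where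
  "join x Z v = Z (x \<in> v) (v - {x})"

lemma vin_in [simp]: "y \<in> vin x b v \<longleftrightarrow> y \<in> v \<or> (b \<and> y = x)"
  by (auto simp: vin_def)

lemma vin_False [simp]: "vin x False v = v"
  by (simp add: vin_def)

lemma join_vin: "x \<notin> v \<Longrightarrow> join x Z (vin x b v) = Z b v"
  by (auto simp: join_def vin_def)

lemma finite_vin [simp]: "finite (vin x b v) = finite v"
  by (simp add: vin_def)

lemma all_subset_insert:
  assumes "x \<notin> X"
  shows "(\<forall>w\<subseteq>insert x X. Q w) \<longleftrightarrow> (\<forall>v\<subseteq>X. \<forall>b. Q (vin x b v))"
proof (intro iffI allI impI)
  fix v b assume "\<forall>w\<subseteq>insert x X. Q w" "v \<subseteq> X"
  moreover from this have "vin x b v \<subseteq> insert x X" by (auto simp: vin_def)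
  ultimately show "Q (vin x b v)" by blast
next
  fix w assume a: "\<forall>v\<subseteq>X. \<forall>b. Q (vin x b v)" "w \<subseteq> insert x X"
  then have "Q (vin x (x \<in> w) (w - {x}))" by blast
  moreover have "vin x (x \<in> w) (w - {x}) = w" by (auto simp: vin_def)
  ultimately show "Q w" by simp
qed

lemma states_vin:
  assumes "x \<notin> X"
  shows "states Om (insert x X) P (vin x b v) = {c \<in> states Om X P v. P (x \<in> v \<or> b) x c}"
proof -
  have "(y \<in> vin x b v) = (y \<in> v)" if "y \<in> X" for y using assms that by auto
  then show ?thesis unfolding states_def by auto
qed

lemma bd_cong:
  assumes "\<And>u. u \<subseteq> v \<Longrightarrow> z u c = z' u c"
  shows "bd P z v c = bd P z' v c"
  unfolding bd_def using assms by (intro parity_cong) auto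

lemma bd_vin:
  assumes "finite v" "x \<notin> v"
  shows "bd P z (vin x b v) c = (bd P (\<lambda>u. z (vin x b u)) v c \<oplus> (b \<and> P False x c \<and> z v c))"
proof (cases b)
  case True
  have "parity v (\<lambda>y. P False y c \<and> z (insert x v - {y}) c)
      = parity v (\<lambda>y. P False y c \<and> z (insert x (v - {y})) c)"
    by (rule parity_cong) (use assms in \<open>metis insert_Diff_if singletonD\<close>)
  moreover have "insert x v - {x} = v" using assms by auto
  ultimately show ?thesis using True assms
    by (simp add: bd_def vin_def parity_insert xr_def) blast
next
  case False
  then show ?thesis by simp
qed

lemma bd_xr: "finite v \<Longrightarrow> bd P (\<lambda>u c. z u c \<oplus> z' u c) v c = (bd P z v c \<oplus> bd P z' v c)"
proof -
  assume v: "finite v"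
  have "(P False x c \<and> (z (v - {x}) c \<oplus> z' (v - {x}) c)) =
      ((P False x c \<and> z (v - {x}) c) \<oplus> (P False x c \<and> z' (v - {x}) c))" for x
    by (auto simp: xr_def)
  then show ?thesis unfolding bd_def using parity_xr[OF v] by simp
qed

lemma bd_conj: "bd P (\<lambda>u c. g c \<and> z u c) v c = (g c \<and> bd P z v c)"
  unfolding bd_def by (cases "g c") simp_all

lemma bd_False [simp]: "bd P (\<lambda>u c. False) v c = False"
  unfolding bd_def by simp

lemma bd_subst:
  assumes "\<And>x. x \<in> v \<Longrightarrow> P False x (s c) = P False x c"
  shows "bd P (\<lambda>u c. z u (s c)) v c = bd P z v (s c)"
  unfolding bd_def using assms by (intro parity_cong) auto

lemma res_insert: "res (insert x X) P c = vin x (P True x c) (res X P c)"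
  unfolding res_def vin_def by auto

lemma wt_insert:
  assumes "finite X" "x \<notin> X" "v \<subseteq> X"
  shows "wt (insert x X) P c (vin x b v) =
    wt X P c v + (if b then 1 else 0) + (if P False x c then 1 else 0) - (if P True x c then 2 else 0)"
proof -
  have "{y \<in> insert x X. P b y c} = (if P b x c then insert x {y\<in>X. P b y c} else {y\<in>X. P b y c})" for b
    by auto
  then have "card {y \<in> insert x X. P b y c} = card {y\<in>X. P b y c} + (if P b x c then 1 else 0)" for b
    using assms by simp
  moreover have "card (vin x b v) = card v + (if b then 1 else 0)"
  proof -
    have "finite v" "x \<notin> v" using assms finite_subset by auto
    then show ?thesis by (simp add: vin_def)
  qed
  ultimately show ?thesis by (simp add: wt_def)
qed

lemma wt_cong: "(\<And>x b. x \<in> X \<Longrightarrow> P b x c = P' b x c') \<Longrightarrow> wt X P c v = wt X P' c' v"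
proof -
  assume "\<And>x b. x \<in> X \<Longrightarrow> P b x c = P' b x c'"
  then have "{x\<in>X. P b x c} = {x\<in>X. P' b x c'}" for b by auto
  then show ?thesis by (simp add: wt_def)
qed

text \<open>The cube with one more crossing is the cone of the edge maps at \<open>x\<close>: the
  half \<open>False\<close> has to be a cocycle by itself, and on the half \<open>True\<close> the
  coboundary is compensated by the image of the half \<open>False\<close>.\<close>

lemma cyc_insert:
  assumes "finite X" "x \<notin> X"
  shows "cyc Om (insert x X) P z \<longleftrightarrow> (\<forall>v\<subseteq>X. \<forall>b. \<forall>c\<in>states Om X P v. P b x c \<longrightarrow>
     bd P (\<lambda>u. z (vin x b u)) v c = (b \<and> P False x c \<and> z v c))"
  unfolding cyc_def all_subset_insert[OF assms(2)]
proof (intro all_cong1 imp_cong refl)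
  fix v b assume "v \<subseteq> X"
  then have "finite v" "x \<notin> v" using assms finite_subset by auto
  then show "(\<forall>c\<in>states Om (insert x X) P (vin x b v). \<not> bd P z (vin x b v) c) \<longleftrightarrow>
    (\<forall>c\<in>states Om X P v. P b x c \<longrightarrow> bd P (\<lambda>u. z (vin x b u)) v c = (b \<and> P False x c \<and> z v c))"
    by (auto simp: states_vin[OF assms(2)] bd_vin xr_def)
qed

section \<open>Crossing changes\<close>

lemma affine_on_subset: "affine_on V s \<Longrightarrow> V' \<subseteq> V \<Longrightarrow> affine_on V' s"
  unfolding affine_on_def by (meson subsetD)

lemma states_cong:
  "(\<And>x c. x \<in> X \<Longrightarrow> c \<in> Om \<Longrightarrow> P (x \<in> v) x c = P' (x \<in> v) x c) \<Longrightarrow> states Om X P v = states Om X P' v"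
  unfolding states_def by blast

text \<open>The change exchanges the two smoothings, hence the two halves of the cube. Only the half
  that contains the oriented smoothing for \<open>c0\<close> is kept; the other is replaced by
  zero.\<close>

lemma sub_crossing_change:
  assumes X: "finite X" "x \<notin> X"
    and P': "\<And>y b c. y \<in> X \<Longrightarrow> c \<in> Om \<Longrightarrow> P' b y c = P b y c" "\<And>b c. c \<in> Om \<Longrightarrow> P' b x c = P (\<not> b) x c"
    and mono: "\<And>c. c \<in> Om \<Longrightarrow> P True x c \<Longrightarrow> P False x c \<longleftrightarrow> c e = c e'"
  shows "sub 2 Om (insert x X) P Om (insert x X) P'"
proof (rule subI[where h = id])
  have canon: "canon Om (insert x X) P' = canon Om (insert x X) P"
    unfolding canon_def using P' by auto
  then show "bij_betw id (canon Om (insert x X) P) (canon Om (insert x X) P')" by simp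
  have st: "states Om X P' v = states Om X P v" for v
    by (rule states_cong) (use P' in auto)
  have bd: "bd P' z v c = bd P z v c" if "v \<subseteq> X" "c \<in> Om" for z v c
    unfolding bd_def by (rule parity_cong) (use that P' in auto)
  have res: "res X P' c = res X P c" if "c \<in> Om" for c
    unfolding res_def using P' that by auto
  have wt: "wt X P' c v = wt X P c v" if "c \<in> Om" for c v
    by (rule wt_cong) (use that P' in auto)
  fix c0 z
  assume c0: "c0 \<in> canon Om (insert x X) P" and cz: "cyc Om (insert x X) P z"
    and z: "\<And>c. c \<in> canon Om (insert x X) P \<Longrightarrow> z (res (insert x X) P c) c = (c = c0)"
  have c0Om: "c0 \<in> Om" and c0x: "P False x c0 \<noteq> P True x c0" using c0 by (auto simp: canon_def)
  have Om: "c \<in> Om" if "c \<in> states Om X P v" for c v using that by (auto simp: states_def)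
  let ?goal = "\<lambda>z'. cyc Om (insert x X) P' z' \<and>
    (\<forall>c\<in>canon Om (insert x X) P. z' (res (insert x X) P' (id c)) (id c) = z (res (insert x X) P c) c) \<and>
         (\<forall>j. (\<forall>v\<subseteq>insert x X. fil (states Om (insert x X) P v) (wt (insert x X) P c0 v - j) (z v)) \<longrightarrow>
            (\<forall>v\<subseteq>insert x X. fil (states Om (insert x X) P' v) (wt (insert x X) P' (id c0) v - (j - 2)) (z' v)))"
  have cz': "bd P (\<lambda>u. z (vin x b u)) v c = (b \<and> P False x c \<and> z v c)"
    if "v \<subseteq> X" "c \<in> states Om X P v" "P b x c" for v c b
    using cz that unfolding cyc_insert[OF X] by blast
  show "\<exists>z'. ?goal z'"
  proof (cases "P False x c0")
    case True
    \<comment> \<open>Positive crossing: the half \<open>False\<close> is a cocycle by itself and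
      becomes the terminal half \<open>True\<close>. The contribution of \<open>x\<close> to the
      weight turns from \<open>0 + 1\<close> into \<open>1 - 2\<close>, a loss of two.\<close>
    define z' where "z' = join x (\<lambda>b v c. b \<and> z v c)"
    have j: "z' (vin x b v) = (\<lambda>c. b \<and> z v c)" if "x \<notin> v" for b v
      using that by (simp add: z'_def join_vin)
    have "?goal z'"
    proof (intro conjI ballI allI impI)
      show "cyc Om (insert x X) P' z'"
        unfolding cyc_insert[OF X]
      proof (intro allI impI ballI)
        fix v b c assume v: "v \<subseteq> X" and c: "c \<in> states Om X P' v" and Pb: "P' b x c"
        have cO: "c \<in> Om" and c': "c \<in> states Om X P v" using c st Om by auto
        have "x \<notin> v" using v X by auto
        then have z'v: "\<not> z' v c" using j[of v False] by simp
        have "bd P' (\<lambda>u. z' (vin x b u)) v c = bd P (\<lambda>u c. b \<and> z u c) v c"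
          unfolding bd[OF v cO]
        proof (rule bd_cong)
          fix u assume "u \<subseteq> v"
          then have "x \<notin> u" using v X by blast
          then show "z' (vin x b u) c = (b \<and> z u c)" by (simp add: j)
        qed
        also have "\<dots> = (b \<and> bd P z v c)" by (rule bd_conj)
        also have "\<dots> = False" using cz'[OF v c', of False] Pb P'(2)[OF cO] by (cases b) auto
        finally show "bd P' (\<lambda>u. z' (vin x b u)) v c = (b \<and> P' False x c \<and> z' v c)"
          using z'v by simp
      qed
    next
      fix c assume c: "c \<in> canon Om (insert x X) P"
      then have cO: "c \<in> Om" "P False x c \<noteq> P True x c" by (auto simp: canon_def)
      have "x \<notin> res X P c" using X by (auto simp: res_def)
      moreover have "c \<noteq> c0" if "P True x c" using that True c0x by auto
      ultimately show "z' (res (insert x X) P' (id c)) (id c) = z (res (insert x X) P c) c"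
        using z[OF c] cO j[of "res X P c" False] by (cases "P True x c") (auto simp: res_insert P' res j)
    next
      fix k :: int and w
      assume f: "\<forall>v\<subseteq>insert x X. fil (states Om (insert x X) P v) (wt (insert x X) P c0 v - k) (z v)"
      have f': "fil (states Om (insert x X) P (vin x b v)) (wt (insert x X) P c0 (vin x b v) - k) (z (vin x b v))"
        if "v \<subseteq> X" for v b
        using f that unfolding all_subset_insert[OF X(2)] by blast
      have "\<forall>v\<subseteq>insert x X. fil (states Om (insert x X) P' v) (wt (insert x X) P' (id c0) v - (k - 2)) (z' v)"
        unfolding all_subset_insert[OF X(2)]
      proof (intro allI impI)
        fix v b assume v: "v \<subseteq> X"
        then have xv: "x \<notin> v" using X by auto
        show "fil (states Om (insert x X) P' (vin x b v)) (wt (insert x X) P' (id c0) (vin x b v) - (k - 2)) (z' (vin x b v))"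
        proof (cases b)
          case b: True
          have "states Om (insert x X) P' (vin x b v) = states Om (insert x X) P (vin x False v)"
            using xv b Om P'(2) unfolding states_vin[OF X(2)] st by auto
          moreover have "wt (insert x X) P' c0 (vin x b v) - (k - 2) = wt (insert x X) P c0 (vin x False v) - k"
            using wt_insert[OF X v, of P c0 False] wt_insert[OF X v, of P' c0 b] True c0x wt P' c0Om b
            by simp
          ultimately show ?thesis using f'[OF v, of False] j[OF xv, of b] b
            by (simp only: vin_False id_apply simp_thms)
        next
          case False
          then show ?thesis using j[OF xv, of b] fil_False by simp
        qed
      qed
      then show "w \<subseteq> insert x X \<Longrightarrow> fil (states Om (insert x X) P' w) (wt (insert x X) P' (id c0) w - (k - 2)) (z' w)"
        by blast
    qed
    then show ?thesis by blast
  next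
    case False
    \<comment> \<open>Negative crossing: the half \<open>True\<close> becomes the initial one. The
      factor vanishes where both smoothings hold, which removes both the contribution of the old
      half \<open>False\<close> and the coboundary into the new half \<open>True\<close>. Its cost
      of two is absorbed, as the contribution of \<open>x\<close> to the weight rises from
      \<open>1 - 2\<close> to \<open>0 + 1\<close>.\<close>
    define z' where "z' = join x (\<lambda>b v c. \<not> b \<and> (c e \<oplus> c e') \<and> z (insert x v) c)"
    have j: "z' (vin x b v) = (\<lambda>c. \<not> b \<and> (c e \<oplus> c e') \<and> z (insert x v) c)" if "x \<notin> v" for b v
      using that by (simp add: z'_def join_vin)
    have "?goal z'"
    proof (intro conjI ballI allI impI)
      show "cyc Om (insert x X) P' z'"
        unfolding cyc_insert[OF X]
      proof (intro allI impI ballI)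
        fix v b c assume v: "v \<subseteq> X" and c: "c \<in> states Om X P' v" and Pb: "P' b x c"
        have cO: "c \<in> Om" and c': "c \<in> states Om X P v" using c st Om by auto
        have z'v: "z' v c = ((c e \<oplus> c e') \<and> z (insert x v) c)"
          using j[of v False] v X by (metis subsetD vin_False)
        have "bd P' (\<lambda>u. z' (vin x b u)) v c =
            bd P (\<lambda>u c. (\<not> b \<and> (c e \<oplus> c e')) \<and> z (vin x True u) c) v c"
          unfolding bd[OF v cO]
        proof (rule bd_cong)
          fix u assume "u \<subseteq> v"
          then have "x \<notin> u" using v X by blast
          then show "z' (vin x b u) c = ((\<not> b \<and> (c e \<oplus> c e')) \<and> z (vin x True u) c)"
            unfolding j[OF \<open>x \<notin> u\<close>] by (simp add: vin_def)
        qed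
        also have "\<dots> = ((\<not> b \<and> (c e \<oplus> c e')) \<and> bd P (\<lambda>u. z (vin x True u)) v c)" by (rule bd_conj)
        also have "\<dots> = False" using cz'[OF v c', of True] Pb P'(2)[OF cO] mono[OF cO]
          by (cases b) auto
        finally show "bd P' (\<lambda>u. z' (vin x b u)) v c = (b \<and> P' False x c \<and> z' v c)"
          using z'v Pb P'(2)[OF cO] mono[OF cO] by (cases b) (auto simp: xr_def)
      qed
    next
      fix c assume c: "c \<in> canon Om (insert x X) P"
      then have cO: "c \<in> Om" "P False x c \<noteq> P True x c" by (auto simp: canon_def)
      have "x \<notin> res X P c" using X by (auto simp: res_def)
      moreover have "c \<noteq> c0" if "P False x c" using that False by auto
      moreover have "c e \<oplus> c e'" if "P True x c" using mono[OF cO(1) that] cO(2) that by (auto simp: xr_def)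
      ultimately show "z' (res (insert x X) P' (id c)) (id c) = z (res (insert x X) P c) c"
        using z[OF c] cO j[of "res X P c" "P False x c"]
        by (cases "P True x c") (auto simp: res_insert P' res vin_def)
    next
      fix k :: int and w
      assume f: "\<forall>v\<subseteq>insert x X. fil (states Om (insert x X) P v) (wt (insert x X) P c0 v - k) (z v)"
      have f': "fil (states Om (insert x X) P (vin x b v)) (wt (insert x X) P c0 (vin x b v) - k) (z (vin x b v))"
        if "v \<subseteq> X" for v b
        using f that unfolding all_subset_insert[OF X(2)] by blast
      have "\<forall>v\<subseteq>insert x X. fil (states Om (insert x X) P' v) (wt (insert x X) P' (id c0) v - (k - 2)) (z' v)"
        unfolding all_subset_insert[OF X(2)]
      proof (intro allI impI)
        fix v b assume v: "v \<subseteq> X"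
        then have xv: "x \<notin> v" using X by auto
        show "fil (states Om (insert x X) P' (vin x b v)) (wt (insert x X) P' (id c0) (vin x b v) - (k - 2)) (z' (vin x b v))"
        proof (cases b)
          case b: False
          have s: "states Om (insert x X) P' (vin x b v) = states Om (insert x X) P (vin x True v)"
            using xv b Om P'(2) unfolding states_vin[OF X(2)] st by auto
          have w: "wt (insert x X) P c0 (vin x True v) - k + 2 \<le> wt (insert x X) P' (id c0) (vin x b v) - (k - 2)"
            using wt_insert[OF X v, of P c0 True] wt_insert[OF X v, of P' c0 b] False c0x wt P' c0Om b
            by simp
          have "deg_le 1 (\<lambda>c. c e \<oplus> c e')" by (intro deg_xor deg_coord) auto
          from fil_mult[OF f'[OF v, of True] this w] show ?thesis
            using j[OF xv, of b] b s by (simp add: vin_def)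
        next
          case True
          then show ?thesis using j[OF xv, of b] fil_False by simp
        qed
      qed
      then show "w \<subseteq> insert x X \<Longrightarrow> fil (states Om (insert x X) P' w) (wt (insert x X) P' (id c0) w - (k - 2)) (z' w)"
        by blast
    qed
    then show ?thesis by blast
  qed
qed

section \<open>Isomorphisms\<close>

text \<open>Cocycles are transported by reading them through \<open>s\<close>, so it is this
  direction that must be affine to keep degrees.\<close>

lemma sub_iso:
  assumes X: "inj_on h X" "X' = h ` X"
    and t: "\<And>c. c \<in> Om \<Longrightarrow> t c \<in> Om'" "\<And>c. c \<in> Om' \<Longrightarrow> s c \<in> Om"
      "\<And>c. c \<in> Om \<Longrightarrow> s (t c) = c" "\<And>c. c \<in> Om' \<Longrightarrow> t (s c) = c"
    and P: "\<And>b x c. x \<in> X \<Longrightarrow> c \<in> Om \<Longrightarrow> P' b (h x) (t c) = P b x c"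
    and aff: "affine_on Om' s" and cube: "cube Om X P"
  shows "sub 0 Om X P Om' X' P'"
proof (rule subI[where h = t])
  have canon: "canon Om' X' P' = t ` canon Om X P"
  proof
    show "t ` canon Om X P \<subseteq> canon Om' X' P'"
      unfolding canon_def X(2) using t P by auto
    show "canon Om' X' P' \<subseteq> t ` canon Om X P"
    proof
      fix c assume c: "c \<in> canon Om' X' P'"
      then have "c \<in> Om'" by (simp add: canon_def)
      then have "s c \<in> Om" "t (s c) = c" using t by auto
      moreover have "s c \<in> canon Om X P"
        using c P[OF _ \<open>s c \<in> Om\<close>] \<open>s c \<in> Om\<close> \<open>t (s c) = c\<close> unfolding canon_def X(2) by auto
      ultimately show "c \<in> t ` canon Om X P" by (metis imageI)
    qed
  qed
  have "inj_on t Om" by (rule inj_on_inverseI[of _ s]) (rule t(3))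
  then show "bij_betw t (canon Om X P) (canon Om' X' P')"
    unfolding canon by (intro inj_on_imp_bij_betw) (auto simp: canon_def inj_on_def)
  have stt: "t c \<in> states Om' X' P' (h ` v) \<longleftrightarrow> c \<in> states Om X P v" if "v \<subseteq> X" "c \<in> Om" for c v
  proof -
    have "h x \<in> h ` v \<longleftrightarrow> x \<in> v" if "x \<in> X" for x
      using X(1) that \<open>v \<subseteq> X\<close> by (auto dest: inj_onD)
    then show ?thesis unfolding states_def X(2) using t P that by auto
  qed
  have states: "states Om' X' P' (h ` v) = t ` states Om X P v" if v: "v \<subseteq> X" for v
  proof
    show "t ` states Om X P v \<subseteq> states Om' X' P' (h ` v)"
      using stt[OF v] by (auto simp: states_def)
    show "states Om' X' P' (h ` v) \<subseteq> t ` states Om X P v"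
    proof
      fix c assume c: "c \<in> states Om' X' P' (h ` v)"
      then have "c \<in> Om'" by (auto simp: states_def)
      then show "c \<in> t ` states Om X P v" using stt[OF v t(2)[of c]] c t(4)[of c] by (metis imageI)
    qed
  qed
  fix c0 z
  assume c0: "c0 \<in> canon Om X P" and cz: "cyc Om X P z"
  define z' where "z' w c = z {x\<in>X. h x \<in> w} (s c)" for w c
  have pre: "{x\<in>X. h x \<in> h ` v} = v" if "v \<subseteq> X" for v
    using that X(1) by (auto dest: inj_onD)
  have subs: "\<exists>v\<subseteq>X. w = h ` v" if "w \<subseteq> X'" for w
    using that unfolding X(2) by (simp add: subset_image_iff) 
  have z': "z' (h ` v) c = z v (s c)" if "v \<subseteq> X" for v c
    by (simp add: z'_def pre[OF that])
  have c0O: "c0 \<in> Om" using c0 by (simp add: canon_def)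
  show "\<exists>z'. cyc Om' X' P' z' \<and> (\<forall>c\<in>canon Om X P. z' (res X' P' (t c)) (t c) = z (res X P c) c) \<and>
      (\<forall>j. (\<forall>v\<subseteq>X. fil (states Om X P v) (wt X P c0 v - j) (z v)) \<longrightarrow>
         (\<forall>v\<subseteq>X'. fil (states Om' X' P' v) (wt X' P' (t c0) v - (j - 0)) (z' v)))"
  proof (intro exI[of _ z'] conjI ballI allI impI)
    show "cyc Om' X' P' z'"
      unfolding cyc_def
    proof (intro allI impI ballI)
      fix w c' assume "w \<subseteq> X'" "c' \<in> states Om' X' P' w"
      then obtain v c where v: "v \<subseteq> X" "w = h ` v" and c: "c \<in> states Om X P v" "c' = t c"
        using subs states by (metis imageE)
      then have cO: "c \<in> Om" by (auto simp: states_def)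
      have "inj_on h v" using X(1) v(1) by (rule inj_on_subset)
      have "bd P' z' w c' = parity v (\<lambda>x. P' False (h x) (t c) \<and> z' (h ` v - {h x}) (t c))"
        unfolding bd_def v(2) c(2) by (rule parity_image) fact
      also have "\<dots> = bd P z v c"
        unfolding bd_def
      proof (rule parity_cong)
        fix x assume x: "x \<in> v"
        have "h ` v - {h x} = h ` (v - {x})"
          using \<open>inj_on h v\<close> x by (auto dest: inj_onD)
        then have "z' (h ` v - {h x}) (t c) = z (v - {x}) c"
          using z'[OF subset_trans[OF Diff_subset v(1)], of "{x}"] t(3)[OF cO] by simp
        then show "(P' False (h x) (t c) \<and> z' (h ` v - {h x}) (t c)) = (P False x c \<and> z (v - {x}) c)"
          using P[OF _ cO] x v(1) by auto
      qed
      finally show "\<not> bd P' z' w c'" using cz c(1) v(1) unfolding cyc_def by auto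
    qed
  next
    fix c assume "c \<in> canon Om X P"
    then have cO: "c \<in> Om" by (simp add: canon_def)
    have "res X' P' (t c) = h ` res X P c"
      unfolding res_def X(2) using P[OF _ cO] by auto
    then show "z' (res X' P' (t c)) (t c) = z (res X P c) c"
      using z'[of "res X P c"] t(3)[OF cO] by (simp add: res_def)
  next
    fix j w assume f: "\<forall>v\<subseteq>X. fil (states Om X P v) (wt X P c0 v - j) (z v)" and w: "w \<subseteq> X'"
    obtain v where v: "v \<subseteq> X" "w = h ` v" using subs[OF w] by (elim exE conjE)
    have alg: "alg (states Om X P v)" using cube v(1) unfolding cube_def by blast
    have inj: "inj_on t (states Om X P v)"
      using \<open>inj_on t Om\<close> by (rule inj_on_subset) (auto simp: states_def)
    have card: "card (states Om' X' P' w) = card (states Om X P v)"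
      unfolding v(2) states[OF v(1)] by (rule card_image[OF inj])
    have "{y\<in>X'. P' b y (t c0)} = h ` {x\<in>X. P b x c0}" for b
      unfolding X(2) using P[OF _ c0O] by auto
    moreover have "inj_on h {x\<in>X. P b x c0}" for b
      using X(1) by (rule inj_on_subset) auto
    ultimately have "card {y\<in>X'. P' b y (t c0)} = card {x\<in>X. P b x c0}" for b
      by (simp add: card_image)
    moreover have "card w = card v" unfolding v(2) by (rule card_image[OF inj_on_subset[OF X(1) v(1)]])
    ultimately have wt: "wt X' P' (t c0) w = wt X P c0 v" by (simp add: wt_def)
    have sv: "s c \<in> states Om X P v" if "c \<in> states Om' X' P' w" for c
      using that t(3) unfolding v(2) states[OF v(1)] by (auto simp: states_def)
    have aff': "affine_on (states Om' X' P' w) s"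
      by (rule affine_on_subset[OF aff]) (auto simp: states_def)
    have "fil (states Om' X' P' w) (wt X P c0 v - j) (\<lambda>c. z v (s c))"
      by (rule fil_pull[where n = 0, OF f[rule_format, OF v(1)] sv aff'])
        (use card alg_card_pos[OF alg] in auto)
    moreover have "z' w = (\<lambda>c. z v (s c))" unfolding v(2) using z'[OF v(1)] by auto
    ultimately show "fil (states Om' X' P' w) (wt X' P' (t c0) w - (j - 0)) (z' w)"
      by (simp only: wt diff_zero)
  qed
qed


lemma canon_Om: "c \<in> canon Om X P \<Longrightarrow> c \<in> Om"
  by (simp add: canon_def)

lemma states_Om: "c \<in> states Om X P v \<Longrightarrow> c \<in> Om"
  by (simp add: states_def)

lemma states_sub: "states {c\<in>Om. Q c} X P v = {c\<in>states Om X P v. Q c}"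
  by (auto simp: states_def)

lemma bij_betw_inverses:
  assumes "\<And>c. c \<in> A \<Longrightarrow> f c \<in> B" "\<And>c. c \<in> B \<Longrightarrow> g c \<in> A"
    "\<And>c. c \<in> A \<Longrightarrow> g (f c) = c" "\<And>c. c \<in> B \<Longrightarrow> f (g c) = c"
  shows "bij_betw f A B"
  by (rule bij_betw_byWitness[where f' = g]) (use assms in auto)

lemma states_vin':
  assumes "x \<notin> X" "v \<subseteq> X"
  shows "states Om (insert x X) P (vin x b v) = {c \<in> states Om X P v. P b x c}"
proof -
  have "x \<notin> v" using assms by blast
  then show ?thesis by (simp add: states_vin[OF assms(1)])
qed

section \<open>The first Reidemeister move\<close>

text \<open>
  One smoothing of the crossing splits off a circle.  If it is the initial one, a cocycle is multiplied by the linear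
  function that tells the circle from its neighbour, and back one sums over the colours of
  the circle; otherwise one extends constantly, and back gives the circle the opposite colour.
\<close>

locale R1 =
  fixes Om :: "'e colouring set" and X :: "'x set" and P :: "('x, 'e) smoothings"
    and x :: 'x and h :: bool and p q y1 y2 :: 'e
  assumes X: "finite X" "x \<notin> X"
    and cube: "cube Om (insert x X) P"
    and yy: "\<And>c. c \<in> Om \<Longrightarrow> c y1 = c y2"
    and hor: "\<And>c. c \<in> Om \<Longrightarrow> P h x c \<longleftrightarrow> c p = c q"
    and vert: "\<And>c. c \<in> Om \<Longrightarrow> P (\<not> h) x c \<longleftrightarrow> c p = c y1 \<and> c q = c y2"
    and upd: "\<And>c b. c \<in> Om \<Longrightarrow> c(y1 := b, y2 := b) \<in> Om"
    and outer: "\<And>y c b u. y \<in> X \<Longrightarrow> P b y (c(y1 := u, y2 := u)) = P b y c"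
    and ne: "p \<noteq> y1" "p \<noteq> y2" "q \<noteq> y1" "q \<noteq> y2"
begin

abbreviation "Om1 \<equiv> {c\<in>Om. P (\<not> h) x c}"
abbreviation "A \<equiv> states Om1 X P"
abbreviation "B v \<equiv> {c \<in> states Om X P v. c p = c q}"
abbreviation "u b c \<equiv> c(y1 := b, y2 := b)"

lemma A_eq: "A v = {c \<in> B v. c p = c y1}"
  unfolding states_sub using vert yy by (auto dest: states_Om)

lemma states_h: "v \<subseteq> X \<Longrightarrow> states Om (insert x X) P (vin x h v) = B v"
  using hor by (auto simp: states_vin'[OF X(2)] dest: states_Om)

lemma u_states: "c \<in> states Om X P v \<Longrightarrow> u b c \<in> states Om X P v"
  using upd outer by (simp add: states_def)

lemma alg_B: "v \<subseteq> X \<Longrightarrow> alg (B v)"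
proof -
  assume v: "v \<subseteq> X"
  then have "vin x h v \<subseteq> insert x X" by (auto simp: vin_def)
  then show ?thesis using cube states_h[OF v] unfolding cube_def by metis
qed

lemma alg_A: "v \<subseteq> X \<Longrightarrow> alg (A v)"
  unfolding A_eq by (rule alg_eq[OF alg_B])

text \<open>In \<open>B v\<close> the circle can be coloured freely, whereas in \<open>A v\<close>
  it copies \<open>c p\<close>: exactly one circle less.\<close>

lemma card_AB: "v \<subseteq> X \<Longrightarrow> card (B v) \<le> 2 * card (A v)" "v \<subseteq> X \<Longrightarrow> 2 * card (A v) \<le> card (B v)"
proof -
  assume v: "v \<subseteq> X"
  show "card (B v) \<le> 2 * card (A v)"
    unfolding A_eq by (rule alg_halve(1)[OF alg_B[OF v]])
  have "(\<lambda>_. False) \<in> B v" by (rule alg_zero[OF alg_B[OF v]])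
  then have "u True (\<lambda>_. False) \<in> B v" using u_states ne by simp
  then show "2 * card (A v) \<le> card (B v)"
    unfolding A_eq by (rule alg_halve(2)[OF alg_B[OF v]]) (use ne in simp)
qed

lemma u_A: "c \<in> B v \<Longrightarrow> u (c p) c \<in> A v"
  unfolding A_eq using u_states ne by simp

lemma u_B: "c \<in> B v \<Longrightarrow> u b c \<in> B v"
  using u_states ne by simp

lemma A_B: "c \<in> A v \<Longrightarrow> c \<in> B v"
  unfolding A_eq by simp

lemma Px: "c \<in> Om \<Longrightarrow> P b x c \<longleftrightarrow> c p = c q \<and> (b \<noteq> h \<longrightarrow> c y1 = c p)"
proof (cases "b = h")
  case False
  then have "b = (\<not> h)" by simp
  then show "c \<in> Om \<Longrightarrow> ?thesis" using vert[of c] yy[of c] by auto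
qed (simp add: hor)

lemma canon_K: "canon Om (insert x X) P = {c\<in>canon Om X P. c p = c q \<and> c y1 \<noteq> c p}"
  unfolding canon_def using Px by (cases h) auto

lemma canon_K': "canon Om1 X P = {c\<in>canon Om X P. c p = c q \<and> c y1 = c p}"
  unfolding canon_def using Px by auto

lemma u_canon: "c \<in> canon Om X P \<Longrightarrow> u b c \<in> canon Om X P"
  using upd outer by (simp add: canon_def)

lemma u_id: "c \<in> Om \<Longrightarrow> u (c y1) c = c"
  using yy[of c] by (intro ext) auto

text \<open>Here the vertical smoothing implies the horizontal one, so a canonical colouring at
  \<open>x\<close> satisfies only the latter: the circle has the colour opposite to
  \<open>c p\<close>. With the crossing straightened it has the colour \<open>c p\<close>.\<close>

lemma bij1: "bij_betw (\<lambda>c. u (\<not> c p) c) (canon Om1 X P) (canon Om (insert x X) P)"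
proof (rule bij_betw_inverses[where g = "\<lambda>c. u (c p) c"])
  show "c \<in> canon Om1 X P \<Longrightarrow> u ((u (\<not> c p) c) p) (u (\<not> c p) c) = c" for c
    unfolding canon_K' using u_id[of c] ne by (auto dest: canon_Om)
  show "c \<in> canon Om (insert x X) P \<Longrightarrow> u (\<not> (u (c p) c) p) (u (c p) c) = c" for c
    unfolding canon_K using u_id[of c] ne by (auto dest: canon_Om)
qed (use u_canon ne in \<open>simp_all add: canon_K canon_K'\<close>)

lemma bij2: "bij_betw (\<lambda>c. u (c p) c) (canon Om (insert x X) P) (canon Om1 X P)"
proof (rule bij_betw_inverses[where g = "\<lambda>c. u (\<not> c p) c"])
  show "c \<in> canon Om1 X P \<Longrightarrow> u ((u (\<not> c p) c) p) (u (\<not> c p) c) = c" for c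
    unfolding canon_K' using u_id[of c] ne by (auto dest: canon_Om)
  show "c \<in> canon Om (insert x X) P \<Longrightarrow> u (\<not> (u (c p) c) p) (u (c p) c) = c" for c
    unfolding canon_K using u_id[of c] ne by (auto dest: canon_Om)
qed (use u_canon ne in \<open>simp_all add: canon_K canon_K'\<close>)

lemma res_u: "res X P (u b c) = res X P c"
  unfolding res_def using outer by auto

lemma wt_u: "wt X P (u b c) v = wt X P c v"
  by (rule wt_cong) (use outer in simp)

lemma Px_canon: "c \<in> canon Om (insert x X) P \<Longrightarrow> P b x c \<longleftrightarrow> b = h"
  using Px[OF canon_Om] unfolding canon_K by auto

lemma wt_K:
  assumes "c \<in> canon Om (insert x X) P" "v \<subseteq> X"
  shows "wt (insert x X) P c (vin x b v) = wt X P c v + (if b then 1 else 0) + (if h then - 2 else 1)"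
proof -
  show ?thesis using wt_insert[OF X assms(2), of P c b] by (simp add: Px_canon[OF assms(1)])
qed

lemma aff_u: "deg_le 1 g \<Longrightarrow> affine_on V (\<lambda>c. u (g c) c)"
  by (intro affine_on_upd affine_on_id)

lemma bd_u: "v \<subseteq> X \<Longrightarrow> bd P (\<lambda>w c. z w (u (g c) c)) v c = bd P z v (u (g c) c)"
  by (rule bd_subst, rule outer) blast

lemma notin: "v \<subseteq> X \<Longrightarrow> x \<notin> v"
  using X by blast

lemma sub_from: "sub 0 Om1 X P Om (insert x X) P"
proof (rule subI[OF bij1])
  fix c0 z'
  assume c0: "c0 \<in> canon Om1 X P" and cz': "cyc Om1 X P z'"
  \<comment> \<open>If the circle is in the initial half, the factor
    \<open>c y1 \<oplus> c p\<close> vanishes on all colourings that survive into the other half. In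
    the terminal half nothing follows, and the constant extension is closed.\<close>
  let ?f = "\<lambda>b v c. b = h \<and> (h \<or> (c y1 \<oplus> c p)) \<and> z' v (u (c p) c)"
  define z where "z = join x ?f"
  have z: "z (vin x b v) = ?f b v" if "v \<subseteq> X" for b v
    unfolding z_def by (rule join_vin) (use that X in blast)
  have z0: "z v = ?f False v" if "v \<subseteq> X" for v using z[OF that, of False] by simp
  have psi: "u (\<not> c0 p) c0 \<in> canon Om (insert x X) P" using bij_betwE[OF bij1] c0 by blast
  have "cyc Om (insert x X) P z"
    unfolding cyc_insert[OF X]
  proof (intro allI impI ballI)
    fix v b c assume v: "v \<subseteq> X" and c: "c \<in> states Om X P v" "P b x c"
    have B: "c \<in> B v" using c Px[OF states_Om[OF c(1)], of b] by simp
    have "bd P (\<lambda>w. z (vin x b w)) v c = bd P (\<lambda>w c. (b = h \<and> (h \<or> (c y1 \<oplus> c p))) \<and> z' w (u (c p) c)) v c"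
      by (rule bd_cong) (use v z in auto)
    also have "\<dots> = ((b = h \<and> (h \<or> (c y1 \<oplus> c p))) \<and> bd P z' v (u (c p) c))"
      unfolding bd_conj by (simp only: bd_u[OF v, of z' "\<lambda>c. c p"])
    also have "\<dots> = False" using cz' u_A[OF B] v unfolding cyc_def by simp
    finally show "bd P (\<lambda>w. z (vin x b w)) v c = (b \<and> P False x c \<and> z v c)"
      using Px[OF states_Om[OF c(1)], of b] c(2) Px[OF states_Om[OF c(1)], of False] z0[OF v] by auto
  qed
  moreover have "z (res (insert x X) P (u (\<not> c p) c)) (u (\<not> c p) c) = z' (res X P c) c"
    if c: "c \<in> canon Om1 X P" for c
  proof -
    have "u (\<not> c p) c \<in> canon Om (insert x X) P" using bij_betwE[OF bij1] c by blast
    then have "P True x (u (\<not> c p) c) = h" using Px_canon by simp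
    moreover have "res X P c \<subseteq> X" by (auto simp: res_def)
    moreover have "c y1 = c p" using c unfolding canon_K' by blast
    moreover have "u (c p) c = c" using u_id[of c] canon_Om[OF c] \<open>c y1 = c p\<close> by simp
    ultimately show ?thesis using ne by (auto simp: res_insert res_u z)
  qed
  moreover have "fil (states Om (insert x X) P w) (wt (insert x X) P (u (\<not> c0 p) c0) w - (j - 0)) (z w)"
    if f: "\<forall>v\<subseteq>X. fil (A v) (wt X P c0 v - j) (z' v)" and w: "w \<subseteq> insert x X" for j w
  proof -
    have "\<forall>w\<subseteq>insert x X. fil (states Om (insert x X) P w) (wt (insert x X) P (u (\<not> c0 p) c0) w - j) (z w)"
      unfolding all_subset_insert[OF X(2)]
    proof (intro allI impI)
      fix v b assume v: "v \<subseteq> X"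
      show "fil (states Om (insert x X) P (vin x b v)) (wt (insert x X) P (u (\<not> c0 p) c0) (vin x b v) - j) (z (vin x b v))"
        unfolding wt_K[OF psi v] z[OF v] wt_u
      proof (cases "b = h")
        case True
        have "fil (B v) (wt X P c0 v - j - 1) (\<lambda>c. z' v (u (c p) c))"
          by (rule fil_pull[where n = 1, OF f[rule_format, OF v] u_A])
            (use card_AB[OF v] alg_card_pos[OF alg_A[OF v]] in \<open>auto intro!: aff_u deg_coord\<close>)
        moreover have "fil (B v) (wt X P c0 v - j + 1) (\<lambda>c. (c y1 \<oplus> c p) \<and> z' v (u (c p) c))"
          by (rule fil_mult[OF calculation]) (auto intro!: deg_xor deg_coord)
        ultimately show "fil (states Om (insert x X) P (vin x b v))
          (wt X P c0 v + (if b then 1 else 0) + (if h then - 2 else 1) - j) (?f b v)"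
          unfolding True states_h[OF v] by (cases h) (simp_all add: algebra_simps)
      next
        case False
        then show "fil (states Om (insert x X) P (vin x b v))
          (wt X P c0 v + (if b then 1 else 0) + (if h then - 2 else 1) - j) (?f b v)"
          by (simp add: fil_False)
      qed
    qed
    then show ?thesis using w by simp
  qed
  ultimately show "\<exists>z. cyc Om (insert x X) P z \<and>
      (\<forall>c\<in>canon Om1 X P. z (res (insert x X) P (u (\<not> c p) c)) (u (\<not> c p) c) = z' (res X P c) c) \<and>
      (\<forall>j. (\<forall>v\<subseteq>X. fil (A v) (wt X P c0 v - j) (z' v)) \<longrightarrow>
        (\<forall>w\<subseteq>insert x X. fil (states Om (insert x X) P w) (wt (insert x X) P (u (\<not> c0 p) c0) w - (j - 0)) (z w)))"
    by (intro exI[of _ z] conjI ballI allI impI) simp_all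
qed

lemma sub_to: "sub 0 Om (insert x X) P Om1 X P"
proof (rule subI[OF bij2])
  fix c0 z
  assume c0: "c0 \<in> canon Om (insert x X) P" and cz: "cyc Om (insert x X) P z"
  have cz': "bd P (\<lambda>w. z (vin x b w)) v c = (b \<and> P False x c \<and> z v c)"
    if "v \<subseteq> X" "c \<in> states Om X P v" "P b x c" for v c b
    using cz that unfolding cyc_insert[OF X] by blast
  \<comment> \<open>Terminal circle: the colour opposite to \<open>c p\<close> avoids the image of
    the initial half. Initial circle: each summand is closed, and taking both makes the degree drop
    as in \<open>fil_death\<close>.\<close>
  define z' where "z' v c = ((if h then False else z (vin x h v) (u (c p) c)) \<oplus> z (vin x h v) (u (\<not> c p) c))" for v c
  have "cyc Om1 X P z'"
    unfolding cyc_def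
  proof (intro allI impI ballI)
    fix v c assume v: "v \<subseteq> X" and c: "c \<in> A v"
    have c'1: "u b c \<in> B v" for b by (rule u_B[OF A_B[OF c]])
    have c': "u b c \<in> states Om X P v" "P h x (u b c)" for b
      using c'1[of b] hor[OF states_Om[of "u b c"]] by blast+
    have fin: "finite v" using finite_subset[OF v X(1)] .
    have eq: "bd P (\<lambda>w. z (vin x h w)) v (u b c) = (h \<and> b = c p \<and> z v (u b c))" for b
      using cz'[OF v c'[of b]] Px[OF states_Om[OF c'(1)], of False b] c'(2) A_B[OF c] ne
      by auto
    have "bd P z' v c = (bd P (\<lambda>w c. \<not> h \<and> z (vin x h w) (u (c p) c)) v c \<oplus> bd P (\<lambda>w c. z (vin x h w) (u (\<not> c p) c)) v c)"
      unfolding bd_xr[OF fin, symmetric] z'_def by (rule bd_cong) simp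
    also have "\<dots> = False" unfolding bd_conj
      by (simp add: bd_u[OF v, of "\<lambda>w. z (vin x h w)" "\<lambda>c. c p"]
          bd_u[OF v, of "\<lambda>w. z (vin x h w)" "\<lambda>c. \<not> c p"] eq)
    finally show "\<not> bd P z' v c" by simp
  qed
  moreover have "z' (res X P (u (c p) c)) (u (c p) c) = z (res (insert x X) P c) c"
    if c: "c \<in> canon Om (insert x X) P" for c
  proof -
    have cO: "c \<in> Om" using canon_Om[OF c] .
    have cp: "c p = c q" "c y1 = (\<not> c p)" "c \<in> canon Om X P" using c unfolding canon_K by auto
    have Pb: "P b x c = (b = h)" for b using Px[OF cO] cp by auto
    define v where "v = res X P c"
    have v: "v \<subseteq> X" by (auto simp: res_def v_def)
    have "c \<in> states Om X P v" using c by (auto simp: v_def states_def res_def canon_def)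
    then have u: "u (c p) c \<in> states Om X P v" by (rule u_states)
    have nocan: "\<not> P False y c" if "y \<in> v" for y
      using c that by (auto simp: v_def res_def canon_def)
    \<comment> \<open>The unwanted summand vanishes: at a canonical colouring no crossing of
      \<open>v\<close> contributes to the coboundary, so the cocycle equation on the half
      \<open>True\<close> leaves only this value.\<close>
    have "\<not> z v (u (c p) c)" if h: "\<not> h"
    proof -
      have "P True x (u (c p) c)" using Px[OF states_Om[OF u]] cp ne by simp
      from cz'[OF v u this] have "bd P (\<lambda>w. z (vin x True w)) v (u (c p) c) = (P False x (u (c p) c) \<and> z v (u (c p) c))"
        by simp
      moreover have "P False x (u (c p) c)" using Px[OF states_Om[OF u]] h cp ne by simp
      moreover have "bd P (\<lambda>w. z (vin x True w)) v (u (c p) c) = parity v (\<lambda>_. False)"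
        unfolding bd_def by (rule parity_cong) (use nocan outer v in auto)
      ultimately show ?thesis by simp
    qed
    moreover have "u (\<not> c p) c = c" using u_id[OF cO] cp by simp
    ultimately show ?thesis using ne Pb by (auto simp: z'_def res_insert res_u v_def[symmetric])
  qed
  moreover have "fil (A v) (wt X P (u (c0 p) c0) v - (j - 0)) (z' v)"
    if f: "\<forall>v\<subseteq>insert x X. fil (states Om (insert x X) P v) (wt (insert x X) P c0 v - j) (z v)" and v: "v \<subseteq> X" for j v
  proof -
    have "fil (states Om (insert x X) P (vin x h v)) (wt (insert x X) P c0 (vin x h v) - j) (z (vin x h v))"
      using f v unfolding all_subset_insert[OF X(2)] by blast
    moreover have "wt (insert x X) P c0 (vin x h v) = wt X P c0 v + (if h then - 1 else 1)"
      using wt_K[OF c0 v, of h] by simp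
    ultimately have f': "fil (B v) (wt X P c0 v + (if h then - 1 else 1) - j) (z (vin x h v))"
      by (simp only: states_h[OF v])
    show ?thesis
    proof (cases h)
      case True
      have "fil (A v) (wt X P c0 v - j) (\<lambda>c. z (vin x h v) (u (\<not> c p) c))"
      proof (rule fil_subst[OF f'])
        show "int (floor_log (card (B v))) + (wt X P c0 v + (if h then - 1 else 1) - j)
            \<le> int (floor_log (card (A v))) + (wt X P c0 v - j)"
          using floor_log_le_double[OF card_AB(1)[OF v] alg_card_pos[OF alg_A[OF v]]] True by simp
        show "affine_on (A v) (\<lambda>c. u (\<not> c p) c)" by (intro aff_u deg_Not deg_coord) simp_all
      qed (rule u_B[OF A_B])
      moreover have "z' v = (\<lambda>c. z (vin x h v) (u (\<not> c p) c))"
        by (rule ext) (simp add: z'_def True)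
      ultimately show ?thesis by (simp only: wt_u diff_zero)
    next
      case False
      have "fil (A v) (wt X P c0 v - j) (\<lambda>c. z (vin x h v) (u (c p) c) \<oplus> z (vin x h v) (u (\<not> c p) c))"
      proof (rule fil_death[OF f'])
        show "affine_on (A v) (\<lambda>c. u (c p) c)" by (auto intro!: aff_u deg_coord)
        show "(\<forall>c\<in>A v. (u (\<not> c p) c) e = (u (c p) c) e) \<or> (\<forall>c\<in>A v. (u (\<not> c p) c) e = (\<not> (u (c p) c) e))" for e
          by auto
        show "card (B v) \<le> 2 * card (A v)" "0 < card (A v)"
          by (rule card_AB(1)[OF v], rule alg_card_pos[OF alg_A[OF v]])
        show "wt X P c0 v + (if h then - 1 else 1) - j - 1 \<le> wt X P c0 v - j" using False by simp
      qed (rule u_B[OF A_B], assumption)+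
      moreover have "z' v = (\<lambda>c. z (vin x h v) (u (c p) c) \<oplus> z (vin x h v) (u (\<not> c p) c))"
        by (rule ext) (simp add: z'_def False)
      ultimately show ?thesis by (simp only: wt_u diff_zero)
    qed
  qed
  ultimately show "\<exists>z'. cyc Om1 X P z' \<and>
      (\<forall>c\<in>canon Om (insert x X) P. z' (res X P (u (c p) c)) (u (c p) c) = z (res (insert x X) P c) c) \<and>
      (\<forall>j. (\<forall>v\<subseteq>insert x X. fil (states Om (insert x X) P v) (wt (insert x X) P c0 v - j) (z v)) \<longrightarrow>
        (\<forall>v\<subseteq>X. fil (A v) (wt X P (u (c0 p) c0) v - (j - 0)) (z' v)))"
    by (intro exI[of _ z'] conjI ballI allI impI) simp_all
qed

end


declare vin_False [simp del]

section \<open>The second Reidemeister move\<close>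

text \<open>
  A cocycle goes to itself on the smoothings isotopic to the other side and to its image under the
  saddle on those with a circle between the crossings; back, one adds the saddle of the sum over the
  colours of this circle to the first component.
\<close>

lemma all_subset_insert2:
  assumes "x1 \<notin> X" "x2 \<notin> X" "x1 \<noteq> x2"
  shows "(\<forall>w\<subseteq>insert x1 (insert x2 X). Q w) \<longleftrightarrow> (\<forall>v\<subseteq>X. \<forall>b1 b2. Q (vin x1 b1 (vin x2 b2 v)))"
proof -
  have "x1 \<notin> insert x2 X" using assms by simp
  from all_subset_insert[OF this, of Q] all_subset_insert[OF assms(2), of "\<lambda>w. \<forall>b. Q (vin x1 b w)"]
  show ?thesis by (simp only:) (intro iffI allI impI; simp)
qed

lemma states_vin2:
  assumes "x1 \<notin> X" "x2 \<notin> X" "x1 \<noteq> x2" "v \<subseteq> X"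
  shows "states Om (insert x1 (insert x2 X)) P (vin x1 b1 (vin x2 b2 v)) =
    {c\<in>states Om X P v. P b1 x1 c \<and> P b2 x2 c}"
proof -
  have "x1 \<notin> insert x2 X" "vin x2 b2 v \<subseteq> insert x2 X" using assms by (auto simp: vin_def)
  from states_vin'[OF this] show ?thesis by (auto simp: states_vin'[OF assms(2,4)])
qed

text \<open>The equations over the square of smoothings of \<open>x1\<close> and \<open>x2\<close>;
  both terms on the right can occur only at the corner where both are \<open>True\<close>.\<close>

lemma cyc_insert2:
  assumes "finite X" "x1 \<notin> X" "x2 \<notin> X" "x1 \<noteq> x2"
  shows "cyc Om (insert x1 (insert x2 X)) P z \<longleftrightarrow>
    (\<forall>v\<subseteq>X. \<forall>b1 b2. \<forall>c\<in>states Om X P v. P b1 x1 c \<longrightarrow> P b2 x2 c \<longrightarrow>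
      bd P (\<lambda>u. z (vin x1 b1 (vin x2 b2 u))) v c =
      ((b1 \<and> P False x1 c \<and> z (vin x2 b2 v) c) \<oplus> (b2 \<and> P False x2 c \<and> z (vin x1 b1 v) c)))"
  unfolding cyc_def all_subset_insert2[OF assms(2-4)]
proof (intro all_cong1 imp_cong refl)
  fix v b1 b2 assume v: "v \<subseteq> X"
  then have "finite v" "x1 \<notin> v" "x2 \<notin> v" using assms finite_subset by auto
  then have "bd P z (vin x1 b1 (vin x2 b2 v)) c =
      ((bd P (\<lambda>u. z (vin x1 b1 (vin x2 b2 u))) v c \<oplus> (b2 \<and> P False x2 c \<and> z (vin x1 b1 v) c)) \<oplus>
       (b1 \<and> P False x1 c \<and> z (vin x2 b2 v) c))" for c
    using assms(4) by (simp add: bd_vin)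
  then show "(\<forall>c\<in>states Om (insert x1 (insert x2 X)) P (vin x1 b1 (vin x2 b2 v)).
      \<not> bd P z (vin x1 b1 (vin x2 b2 v)) c) \<longleftrightarrow>
    (\<forall>c\<in>states Om X P v. P b1 x1 c \<longrightarrow> P b2 x2 c \<longrightarrow>
      bd P (\<lambda>u. z (vin x1 b1 (vin x2 b2 u))) v c =
      ((b1 \<and> P False x1 c \<and> z (vin x2 b2 v) c) \<oplus> (b2 \<and> P False x2 c \<and> z (vin x1 b1 v) c)))"
    unfolding states_vin2[OF assms(2-4) v] by (simp add: xr_def) blast
qed

lemma wt_insert2:
  assumes "finite X" "x1 \<notin> X" "x2 \<notin> X" "x1 \<noteq> x2" "v \<subseteq> X"
  shows "wt (insert x1 (insert x2 X)) P c (vin x1 b1 (vin x2 b2 v)) = wt X P c v +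
    (if b1 then 1 else 0) + (if P False x1 c then 1 else 0) - (if P True x1 c then 2 else 0) +
    (if b2 then 1 else 0) + (if P False x2 c then 1 else 0) - (if P True x2 c then 2 else 0)"
proof -
  have vv: "finite (insert x2 X)" "x1 \<notin> insert x2 X" "vin x2 b2 v \<subseteq> insert x2 X"
    using assms by (auto simp: vin_def)
  show ?thesis unfolding wt_insert[OF vv] wt_insert[OF assms(1,3,5)] by linarith
qed

definition join2 :: "'x \<Rightarrow> 'x \<Rightarrow> (bool \<Rightarrow> bool \<Rightarrow> ('x, 'e) chain) \<Rightarrow> ('x, 'e) chain" where
  "join2 x1 x2 Z = join x1 (\<lambda>b1. join x2 (Z b1))"

lemma join2_vin:
  "x1 \<notin> v \<Longrightarrow> x2 \<notin> v \<Longrightarrow> x1 \<noteq> x2 \<Longrightarrow> join2 x1 x2 Z (vin x1 b1 (vin x2 b2 v)) = Z b1 b2 v"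
  unfolding join2_def by (simp add: join_vin)

lemma bd_no_mono: "(\<And>y. y \<in> v \<Longrightarrow> \<not> P False y c) \<Longrightarrow> bd P z v c = False"
proof -
  assume "\<And>y. y \<in> v \<Longrightarrow> \<not> P False y c"
  then have "bd P z v c = parity v (\<lambda>_. False)"
    unfolding bd_def by (intro parity_cong) simp
  then show ?thesis by simp
qed

lemma res_states: "c \<in> canon Om X P \<Longrightarrow> c \<in> states Om X P (res X P c)"
  by (auto simp: states_def res_def canon_def)

lemma res_not_mono: "c \<in> canon Om X P \<Longrightarrow> y \<in> res X P c \<Longrightarrow> \<not> P False y c"
  by (auto simp: res_def canon_def)

lemma res_subset: "res X P c \<subseteq> X"
  by (auto simp: res_def)

text \<open>The ends \<open>p\<close>, \<open>q\<close> are next to \<open>x1\<close>, the ends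
  \<open>p'\<close>, \<open>q'\<close> next to \<open>x2\<close>, and \<open>m\<close>,
  \<open>n\<close> are the strands between the crossings. The crossings being opposite, both are
  vertical for \<open>False\<close> at \<open>x1\<close> and \<open>True\<close> at
  \<open>x2\<close>, and both are horizontal, with the circle \<open>m = n\<close>, in the opposite
  corner.\<close>

locale R2 =
  fixes Om :: "'e colouring set" and X :: "'x set" and P :: "('x, 'e) smoothings"
    and x1 x2 :: 'x and p q p' q' m n :: 'e
  assumes X: "finite X" "x1 \<notin> X" "x2 \<notin> X" "x1 \<noteq> x2"
    and alg: "\<And>v. v \<subseteq> X \<Longrightarrow> alg (states Om X P v)"
    and par: "\<And>v c. v \<subseteq> X \<Longrightarrow> c \<in> states Om X P v \<Longrightarrow> (c p \<noteq> c q) = (c p' \<noteq> c q')"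
    and P1: "\<And>c. c \<in> Om \<Longrightarrow> P False x1 c \<longleftrightarrow> c p = c m \<and> c q = c n"
      "\<And>c. c \<in> Om \<Longrightarrow> P True x1 c \<longleftrightarrow> c p = c q \<and> c m = c n"
    and P2: "\<And>c. c \<in> Om \<Longrightarrow> P False x2 c \<longleftrightarrow> c m = c n \<and> c p' = c q'"
      "\<And>c. c \<in> Om \<Longrightarrow> P True x2 c \<longleftrightarrow> c m = c p' \<and> c n = c q'"
    and upd: "\<And>c a b. c \<in> Om \<Longrightarrow> c(m := a, n := b) \<in> Om"
    and outer: "\<And>y c b u w. y \<in> X \<Longrightarrow> P b y (c(m := u, n := w)) = P b y c"
    and ne: "m \<noteq> n" "p \<noteq> m" "p \<noteq> n" "q \<noteq> m" "q \<noteq> n" "p' \<noteq> m" "p' \<noteq> n" "q' \<noteq> m" "q' \<noteq> n"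
begin

abbreviation "Om1 \<equiv> {c\<in>Om. P False x1 c \<and> P True x2 c}"
abbreviation "K \<equiv> insert x1 (insert x2 X)"
abbreviation "S v \<equiv> states Om X P v"
abbreviation "A \<equiv> states Om1 X P"
abbreviation "V0 v \<equiv> {c\<in>S v. c p = c m \<and> c q = c n}"
abbreviation "B0 v \<equiv> {c\<in>V0 v. c p = c q \<and> c p' = c q'}"
abbreviation "H v \<equiv> {c\<in>S v. c p = c q \<and> c m = c n \<and> c p' = c q'}"
abbreviation "u a b c \<equiv> c(m := a, n := b)"

lemma A_eq: "A v = {c\<in>V0 v. c p = c p' \<and> c q = c q'}"
  unfolding states_sub using P1 P2 by (auto dest: states_Om)

lemma H_eq: "v \<subseteq> X \<Longrightarrow> states Om K P (vin x1 True (vin x2 False v)) = H v"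
  using P1 P2 by (auto simp: states_vin2[OF X(2-4)] dest: states_Om)

lemma A_eq': "v \<subseteq> X \<Longrightarrow> states Om K P (vin x1 False (vin x2 True v)) = A v"
  by (auto simp: states_vin2[OF X(2-4)] states_sub)

lemma u_S: "c \<in> S v \<Longrightarrow> u a b c \<in> S v"
  using upd outer by (simp add: states_def)

lemma alg_V0: "v \<subseteq> X \<Longrightarrow> alg (V0 v)"
  using alg_eq[OF alg_eq[OF alg], of v q n p m] by (simp add: conj_commute conj_left_commute)

lemma alg_H: "v \<subseteq> X \<Longrightarrow> alg (H v)"
  using alg_eq[OF alg_eq[OF alg_eq[OF alg]], of v p' q' m n p q] by (simp add: conj_commute conj_left_commute)

lemma B0_eq: "B0 v = {c\<in>H v. c p = c m}"
  by auto

lemma alg_B0: "v \<subseteq> X \<Longrightarrow> alg (B0 v)"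
  unfolding B0_eq by (rule alg_eq[OF alg_H])

lemma card_HB:
  assumes v: "v \<subseteq> X"
  shows "card (H v) \<le> 2 * card (B0 v)" "2 * card (B0 v) \<le> card (H v)"
proof -
  show "card (H v) \<le> 2 * card (B0 v)"
    unfolding B0_eq by (rule alg_halve(1)[OF alg_H[OF v]])
  have "(\<lambda>_. False) \<in> H v" by (rule alg_zero[OF alg_H[OF v]])
  then have "u True True (\<lambda>_. False) \<in> H v" using u_S ne by simp
  then show "2 * card (B0 v) \<le> card (H v)"
    unfolding B0_eq by (rule alg_halve(2)[OF alg_H[OF v]]) (use ne in simp)
qed

lemma res_u: "res X P (u a b c) = res X P c"
  unfolding res_def using outer by auto

lemma wt_u: "wt X P (u a b c) v = wt X P c v"
  by (rule wt_cong) (use outer in simp)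

lemma u_canon: "c \<in> canon Om X P \<Longrightarrow> u a b c \<in> canon Om X P"
  using upd outer by (simp add: canon_def)

text \<open>A canonical colouring changes colour whenever a strand is followed through a crossing.
  Hence \<open>n\<close> is opposite to \<open>p\<close>, \<open>m\<close> is opposite to
  \<open>q\<close>, and both strands recover their colour at the other end.\<close>

lemma canon_K: "canon Om K P = {c\<in>canon Om X P. c m = (\<not> c q) \<and> c n = (\<not> c p) \<and> c p' = c p \<and> c q' = c q}"
  unfolding canon_def by (auto simp: P1 P2)

lemma canon_K': "canon Om1 X P = {c\<in>canon Om X P. c m = c p \<and> c n = c q \<and> c p' = c p \<and> c q' = c q}"
  unfolding canon_def by (auto simp: P1 P2)

abbreviation "g c \<equiv> u (\<not> c q) (\<not> c p) c"
abbreviation "r c \<equiv> u (c p) (c q) c"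

lemma u_u: "u a b (u a' b' c) = u a b c"
  by (intro ext) simp

lemma r_id: "c m = c p \<Longrightarrow> c n = c q \<Longrightarrow> r c = c"
  by (intro ext) simp

lemma g_id: "c m = (\<not> c q) \<Longrightarrow> c n = (\<not> c p) \<Longrightarrow> g c = c"
  by (intro ext) auto

lemma bij: "bij_betw (\<lambda>c. g c) (canon Om1 X P) (canon Om K P)"
  "bij_betw (\<lambda>c. r c) (canon Om K P) (canon Om1 X P)"
proof -
  have 1: "g c \<in> canon Om K P" "r (g c) = c" if "c \<in> canon Om1 X P" for c
    using that ne u_canon unfolding canon_K canon_K' by (simp_all add: u_u r_id)
  have 2: "r c \<in> canon Om1 X P" "g (r c) = c" if "c \<in> canon Om K P" for c
    using that ne u_canon unfolding canon_K canon_K' by (simp_all add: u_u g_id)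
  show "bij_betw (\<lambda>c. g c) (canon Om1 X P) (canon Om K P)"
    by (rule bij_betw_inverses[where g = "\<lambda>c. r c"]) (fact 1 2)+
  show "bij_betw (\<lambda>c. r c) (canon Om K P) (canon Om1 X P)"
    by (rule bij_betw_inverses[where g = "\<lambda>c. g c"]) (fact 1 2)+
qed

lemma P_canon:
  assumes "c \<in> canon Om K P"
  shows "P b x1 c \<longleftrightarrow> b = (c p = c q)" "P b x2 c \<longleftrightarrow> b = (c p \<noteq> c q)"
  using assms P1[OF canon_Om[OF assms]] P2[OF canon_Om[OF assms]] unfolding canon_K
  by (cases b; auto)+

text \<open>One of the two crossings is positive and the other negative, which contributes
  \<open>1 - 2\<close>.\<close>

lemma wt_K:
  assumes "c \<in> canon Om K P" "v \<subseteq> X"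
  shows "wt K P c (vin x1 b1 (vin x2 b2 v)) = wt X P c v + (if b1 then 1 else 0) + (if b2 then 1 else 0) - 1"
  by (subst wt_insert2[OF X assms(2)]) (simp add: P_canon[OF assms(1)])

lemma bd_u: "v \<subseteq> X \<Longrightarrow> bd P (\<lambda>w c. z w (u (a c) (b c) c)) v c = bd P z v (u (a c) (b c) c)"
  by (rule bd_subst, rule outer) blast

lemma notin: "v \<subseteq> X \<Longrightarrow> x1 \<notin> v" "v \<subseteq> X \<Longrightarrow> x2 \<notin> v"
  using X by auto

lemma aff_u: "deg_le 1 a \<Longrightarrow> deg_le 1 b \<Longrightarrow> affine_on V (\<lambda>c. u (a c) (b c) c)"
  by (intro affine_on_upd affine_on_id)

lemma sub_from: "sub 0 Om1 X P Om K P"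
proof (rule subI[OF bij(1)])
  fix c0 z'
  assume c0: "c0 \<in> canon Om1 X P" and cz': "cyc Om1 X P z'"
  \<comment> \<open>The corner with the circle receives the image of \<open>z'\<close> under the
    saddle, extended constantly over the circle by means of \<open>r\<close>. At the corner where
    both smoothings are \<open>True\<close> the contributions of the two corners cancel.\<close>
  let ?f = "\<lambda>b1 b2 v c. if \<not> b1 \<and> b2 then z' v c else if b1 \<and> \<not> b2 then c p = c p' \<and> z' v (r c) else False"
  define z where "z = join2 x1 x2 ?f"
  have z: "z (vin x1 b1 (vin x2 b2 v)) = ?f b1 b2 v" if "v \<subseteq> X" for b1 b2 v
    unfolding z_def by (rule join2_vin) (use that X in auto)
  have psi: "g c0 \<in> canon Om K P" using bij_betwE[OF bij(1)] c0 by blast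
  have "cyc Om K P z"
    unfolding cyc_insert2[OF X]
  proof (intro allI impI ballI)
    fix v b1 b2 c assume v: "v \<subseteq> X" and c: "c \<in> S v" "P b1 x1 c" "P b2 x2 c"
    have cO: "c \<in> Om" using states_Om[OF c(1)] .
    have rA: "r c \<in> A v" if "c p = c p'" "c q = c q'"
      unfolding A_eq using u_S[OF c(1)] ne that by simp
    have Ac: "c \<in> A v" if "\<not> b1" "b2" using c that unfolding states_sub by simp
    have "bd P (\<lambda>w. z (vin x1 b1 (vin x2 b2 w))) v c = bd P (\<lambda>w. ?f b1 b2 w) v c"
      by (rule bd_cong) (use v z in auto)
    also have "\<dots> = False"
    proof -
      consider "\<not> b1" "b2" | "b1" "\<not> b2" | "b1 = b2" by blast
      then show ?thesis
      proof cases
        case 1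
        then show ?thesis using cz' Ac v unfolding cyc_def by simp
      next
        case 2
        then have "c p = c q" "c p' = c q'" using c P1 P2 cO by auto
        then have imp: "c p = c p' \<longrightarrow> \<not> bd P z' v (r c)" using cz' rA v unfolding cyc_def by simp
        have "bd P (\<lambda>w c. c p = c p' \<and> z' w (r c)) v c = (c p = c p' \<and> bd P z' v (r c))"
          unfolding bd_conj bd_u[OF v, of z' "\<lambda>c. c p" "\<lambda>c. c q" c] ..
        also have "\<dots> = False" using imp by blast
        finally show ?thesis using 2 by simp
      next
        case 3
        then show ?thesis by (cases b1) simp_all
      qed
    qed
    finally have bdF: "bd P (\<lambda>w. z (vin x1 b1 (vin x2 b2 w))) v c = False" .
    show "bd P (\<lambda>w. z (vin x1 b1 (vin x2 b2 w))) v c =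
      ((b1 \<and> P False x1 c \<and> z (vin x2 b2 v) c) \<oplus> (b2 \<and> P False x2 c \<and> z (vin x1 b1 v) c))"
    proof -
      have z1: "z (vin x2 b2 v) c = (b2 \<and> z' v c)" "z (vin x1 b1 v) c = (b1 \<and> c p = c p' \<and> z' v (r c))"
        using z[OF v, of False b2] z[OF v, of b1 False] unfolding vin_False by simp_all
      have "P False x1 c = (c p = c p')" "P False x2 c" "c p = c p' \<Longrightarrow> r c = c" if "b1" "b2"
      proof -
        have cc: "c p = c q" "c m = c n" "c m = c p'" "c n = c q'"
          using c(2,3) P1(2)[OF cO] P2(2)[OF cO] that by auto
        show "P False x1 c = (c p = c p')" "P False x2 c" "c p = c p' \<Longrightarrow> r c = c"
          using cc P1(1)[OF cO] P2(1)[OF cO] r_id[of c] by auto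
      qed
      then show ?thesis unfolding z1 bdF by (cases "b1 \<and> b2"; cases "c p = c p'") auto
    qed
  qed
  moreover have "z (res K P (g c)) (g c) = z' (res X P c) c" if c: "c \<in> canon Om1 X P" for c
  proof -
    have gc: "g c \<in> canon Om K P" using bij_betwE[OF bij(1)] c by blast
    have cc: "c m = c p" "c n = c q" "c p' = c p" "c q' = c q" using c unfolding canon_K' by auto
    have 1: "c p \<noteq> c q \<Longrightarrow> g c = c" using g_id[of c] cc by auto
    have 2: "r (g c) = c" using cc ne by (simp add: u_u r_id)
    show ?thesis
      unfolding res_insert P_canon[OF gc] z[OF res_subset] res_u
      using 1 2 ne cc by auto
  qed
  moreover have "fil (states Om K P w) (wt K P (g c0) w - (j - 0)) (z w)"
    if f: "\<forall>v\<subseteq>X. fil (A v) (wt X P c0 v - j) (z' v)" and w: "w \<subseteq> K" for j w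
  proof -
    have "\<forall>w\<subseteq>K. fil (states Om K P w) (wt K P (g c0) w - j) (z w)"
      unfolding all_subset_insert2[OF X(2-4)]
    proof (intro allI impI)
      fix v b1 b2 assume v: "v \<subseteq> X"
      have f1: "fil (A v) (wt X P c0 v - j) (z' v)" using f v by simp
      show "fil (states Om K P (vin x1 b1 (vin x2 b2 v))) (wt K P (g c0) (vin x1 b1 (vin x2 b2 v)) - j) (z (vin x1 b1 (vin x2 b2 v)))"
        unfolding wt_K[OF psi v] z[OF v] wt_u
      proof -
        \<comment> \<open>The saddle costs one, which the additional circle in \<open>H v\<close>
          gives back.\<close>
        have 1: "fil (B0 v) (wt X P c0 v - j + 1) (\<lambda>c. c p = c p' \<and> z' v c)"
        proof (rule fil_saddle[OF alg_V0[OF v] _ f1[unfolded A_eq]])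
          show "(c p \<noteq> c q) = (c p' \<noteq> c q')" if "c \<in> V0 v" for c
            using par[OF v, of c] that by blast
        qed simp
        have "fil (H v) (wt X P c0 v - j) (\<lambda>c. r c p = r c p' \<and> z' v (r c))"
        proof (rule fil_pull[where n = 1, OF 1])
          show "affine_on (H v) (\<lambda>c. r c)" by (intro aff_u deg_coord) simp_all
          show "r c \<in> B0 v" if "c \<in> H v" for c using that u_S[of c v] ne by simp
        qed (use card_HB[OF v] alg_card_pos[OF alg_B0[OF v]] in simp_all)
        then have 2: "fil (H v) (wt X P c0 v - j) (\<lambda>c. c p = c p' \<and> z' v (r c))"
          using ne by simp
        consider "\<not> b1" "b2" | "b1" "\<not> b2" | "b1 = b2" by blast
        then show "fil (states Om K P (vin x1 b1 (vin x2 b2 v)))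
          (wt X P c0 v + (if b1 then 1 else 0) + (if b2 then 1 else 0) - 1 - j) (?f b1 b2 v)"
        proof cases
          case 1
          then show ?thesis using f1 A_eq'[OF v] by simp
        next
          case b: 2
          then show ?thesis using 2 H_eq[OF v] by simp
        next
          case 3
          then have "?f b1 b2 v = (\<lambda>_. False)" by auto
          then show ?thesis by (simp only: fil_False)
        qed
      qed
    qed
    then show ?thesis using w by simp
  qed
  ultimately show "\<exists>z. cyc Om K P z \<and>
      (\<forall>c\<in>canon Om1 X P. z (res K P (g c)) (g c) = z' (res X P c) c) \<and>
      (\<forall>j. (\<forall>v\<subseteq>X. fil (A v) (wt X P c0 v - j) (z' v)) \<longrightarrow>
        (\<forall>w\<subseteq>K. fil (states Om K P w) (wt K P (g c0) w - (j - 0)) (z w)))"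
    by (intro exI[of _ z] conjI ballI allI impI) simp_all
qed

lemma sub_to: "sub 0 Om K P Om1 X P"
proof (rule subI[OF bij(2)])
  fix c0 z
  assume c0: "c0 \<in> canon Om K P" and cz: "cyc Om K P z"
  define f where "f b1 b2 v = z (vin x1 b1 (vin x2 b2 v))" for b1 b2 v
  have cz': "bd P (f b1 b2) v c = ((b1 \<and> P False x1 c \<and> f False b2 v c) \<oplus> (b2 \<and> P False x2 c \<and> f b1 False v c))"
    if "v \<subseteq> X" "c \<in> S v" "P b1 x1 c" "P b2 x2 c" for v c b1 b2
    using cz that unfolding cyc_insert2[OF X] f_def by (simp add: vin_False)
  \<comment> \<open>Both components have the same defect, which stems from the corner where both
    smoothings are \<open>False\<close>. Summing over the colours of the circle and applying the
    saddle \<open>c p = c q\<close> makes the two defects cancel.\<close>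
  define z' where "z' v c = (f False True v c \<oplus> (c p = c q \<and> (f True False v (u True True c) \<oplus> f True False v (u False False c))))" for v c
  have uc: "u (c p) (c p) c = c" if "c m = c p" "c n = c p" for c :: "'e colouring"
    using that by (intro ext) simp
  have "cyc Om1 X P z'"
    unfolding cyc_def
  proof (intro allI impI ballI)
    fix v c assume v: "v \<subseteq> X" and c: "c \<in> A v"
    have cc: "c \<in> S v" "c p = c m" "c q = c n" "c p = c p'" "c q = c q'" using c unfolding A_eq by auto
    have cO: "c \<in> Om" using states_Om[OF cc(1)] .
    have fin: "finite v" using finite_subset[OF v X(1)] .
    have e1: "bd P (f False True) v c = (c p = c q \<and> f False False v c)"
      using cz'[OF v cc(1), of False True] P1[OF cO] P2[OF cO] cc by auto
    have e2: "bd P (f True False) v (u b b c) = (b = c p \<and> f False False v c)" if eq: "c p = c q" for b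
    proof -
      have S: "u b b c \<in> S v" using u_S[OF cc(1)] .
      have "P True x1 (u b b c)" "P False x2 (u b b c)" "P False x1 (u b b c) = (b = c p)"
        using P1[OF states_Om[OF S]] P2[OF states_Om[OF S]] cc eq ne by auto
      then have "bd P (f True False) v (u b b c) = (b = c p \<and> f False False v (u b b c))"
        using cz'[OF v S, of True False] by simp
      moreover have "b = c p \<Longrightarrow> u b b c = c" using uc[of c] cc eq by auto
      ultimately show ?thesis by auto
    qed
    have "bd P z' v c = (bd P (f False True) v c \<oplus> (c p = c q \<and> (bd P (\<lambda>w c. f True False w (u True True c)) v c \<oplus> bd P (\<lambda>w c. f True False w (u False False c)) v c)))"
      unfolding z'_def by (simp add: bd_xr[OF fin] bd_conj)
    also have "\<dots> = False"
    proof (cases "c p = c q")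
      case True
      have "bd P (\<lambda>w c. f True False w (u b b c)) v c = (b = c p \<and> f False False v c)" for b
        using bd_u[OF v, of "f True False" "\<lambda>_. b" "\<lambda>_. b" c] e2[OF True, of b] by simp
      then show ?thesis using e1 True by (cases "c p") simp_all
    next
      case False
      then show ?thesis using e1 by simp
    qed
    finally show "\<not> bd P z' v c" by simp
  qed
  moreover have "z' (res X P (r c)) (r c) = z (res K P c) c" if c: "c \<in> canon Om K P" for c
  proof -
    have cO: "c \<in> Om" using canon_Om[OF c] .
    have cc: "c m = (\<not> c q)" "c n = (\<not> c p)" "c p' = c p" "c q' = c q" "c \<in> canon Om X P"
      using c unfolding canon_K by auto
    define v where "v = res X P c"
    have v: "v \<subseteq> X" unfolding v_def by (rule res_subset)
    have S: "r c \<in> S v" unfolding v_def by (rule u_S[OF res_states[OF cc(5)]])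
    \<comment> \<open>The cocycle equation at the corner with both smoothings \<open>True\<close>,
      to which \<open>X\<close> contributes nothing at a canonical colouring, identifies the two
      components at \<open>r c\<close>. So only the summand with the colours of \<open>c\<close>
      survives.\<close>
    have "f False True v (r c) = f True False v (r c)" if eq: "c p = c q"
    proof -
      have "P b x1 (r c)" "P b x2 (r c)" for b
        using P1[OF states_Om[OF S]] P2[OF states_Om[OF S]] cc eq ne by (cases b; simp)+
      moreover have "bd P (f True True) v (r c) = False"
        by (rule bd_no_mono) (use res_not_mono[OF cc(5)] outer v in \<open>auto simp: v_def\<close>)
      ultimately show ?thesis using cz'[OF v S, of True True] by (auto simp: xr_def)
    qed
    moreover have "z (res K P c) c = f (c p = c q) (c p \<noteq> c q) v c"
      unfolding f_def v_def by (simp add: res_insert P_canon[OF c])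
    moreover have "c p \<noteq> c q \<Longrightarrow> r c = c" using r_id[of c] cc by auto
    moreover have "u (\<not> c p) (\<not> c p) c = c" if "c p = c q" using that cc by (intro ext) simp
    moreover have "z' (res X P (r c)) (r c) = (f False True v (r c) \<oplus> (c p = c q \<and>
      (f True False v (u True True c) \<oplus> f True False v (u False False c))))"
      unfolding z'_def res_u v_def[symmetric] u_u using ne by simp
    ultimately show ?thesis by (cases "c p"; cases "c q") (auto simp: xr_def)
  qed
  moreover have "fil (A v) (wt X P (r c0) v - (j - 0)) (z' v)"
    if fz: "\<forall>w\<subseteq>K. fil (states Om K P w) (wt K P c0 w - j) (z w)" and v: "v \<subseteq> X" for j v
  proof -
    have fz': "fil (states Om K P (vin x1 b1 (vin x2 b2 v))) (wt K P c0 (vin x1 b1 (vin x2 b2 v)) - j) (f b1 b2 v)" for b1 b2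
      using fz v unfolding all_subset_insert2[OF X(2-4)] f_def by simp
    have f1: "fil (A v) (wt X P c0 v - j) (f False True v)"
      using fz'[of False True] unfolding wt_K[OF c0 v] A_eq'[OF v] by simp
    have f2: "fil (H v) (wt X P c0 v - j) (f True False v)"
      using fz'[of True False] unfolding wt_K[OF c0 v] H_eq[OF v] by simp
    have f3: "fil (B0 v) (wt X P c0 v - j - 1) (\<lambda>c. f True False v (u True True c) \<oplus> f True False v (u False False c))"
    proof (rule fil_death[OF f2])
      show "affine_on (B0 v) (\<lambda>c. u True True c)" by (intro aff_u deg_const) simp_all
      show "(\<forall>c\<in>B0 v. (u False False c) e = (u True True c) e) \<or> (\<forall>c\<in>B0 v. (u False False c) e = (\<not> (u True True c) e))" for e
        by auto
      show "card (H v) \<le> 2 * card (B0 v)" "0 < card (B0 v)"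
        by (rule card_HB(1)[OF v], rule alg_card_pos[OF alg_B0[OF v]])
    qed (use u_S ne in auto)
    have par': "(c p \<noteq> c p') = (c q \<noteq> c q')" if "c \<in> V0 v" for c
      using par[OF v, of c] that by auto
    have f4: "fil (A v) (wt X P c0 v - j) (\<lambda>c. c p = c q \<and> (f True False v (u True True c) \<oplus> f True False v (u False False c)))"
      using fil_saddle[OF alg_V0[OF v] par' f3, of "wt X P c0 v - j"] unfolding A_eq by simp
    have "fil (A v) (wt X P c0 v - j) (z' v)"
      using fil_xor[OF f1 f4] by (simp add: z'_def[abs_def])
    then show ?thesis by (simp only: wt_u diff_zero)
  qed
  ultimately show "\<exists>z'. cyc Om1 X P z' \<and>
      (\<forall>c\<in>canon Om K P. z' (res X P (r c)) (r c) = z (res K P c) c) \<and>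
      (\<forall>j. (\<forall>v\<subseteq>K. fil (states Om K P v) (wt K P c0 v - j) (z v)) \<longrightarrow>
        (\<forall>v\<subseteq>X. fil (A v) (wt X P (r c0) v - (j - 0)) (z' v)))"
    by (intro exI[of _ z'] conjI ballI allI impI) simp_all
qed

end


section \<open>The third Reidemeister move\<close>

lemma xr_ac: "(x \<oplus> y) \<oplus> z = x \<oplus> (y \<oplus> z)" "x \<oplus> y = y \<oplus> x" "x \<oplus> (y \<oplus> z) = y \<oplus> (x \<oplus> z)"
  "x \<oplus> (x \<oplus> y) = y"
  by (auto simp: xr_def)

lemma all_subset_insert3:
  assumes "x1 \<notin> X" "x2 \<notin> X" "x3 \<notin> X" "x1 \<noteq> x2" "x1 \<noteq> x3" "x2 \<noteq> x3"
  shows "(\<forall>w\<subseteq>insert x1 (insert x2 (insert x3 X)). Q w) \<longleftrightarrow>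
    (\<forall>v\<subseteq>X. \<forall>b1 b2 b3. Q (vin x1 b1 (vin x2 b2 (vin x3 b3 v))))"
proof -
  have "x1 \<notin> insert x3 X" "x2 \<notin> insert x3 X" using assms by simp_all
  from all_subset_insert2[OF this assms(4), of Q]
    all_subset_insert[OF assms(3), of "\<lambda>w. \<forall>b1 b2. Q (vin x1 b1 (vin x2 b2 w))"]
  show ?thesis by (simp only:) (intro iffI allI impI; simp)
qed

lemma states_vin3:
  assumes "x1 \<notin> X" "x2 \<notin> X" "x3 \<notin> X" "x1 \<noteq> x2" "x1 \<noteq> x3" "x2 \<noteq> x3" "v \<subseteq> X"
  shows "states Om (insert x1 (insert x2 (insert x3 X))) P (vin x1 b1 (vin x2 b2 (vin x3 b3 v))) =
    {c\<in>states Om X P v. P b1 x1 c \<and> P b2 x2 c \<and> P b3 x3 c}"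
proof -
  have vv: "x1 \<notin> insert x3 X" "x2 \<notin> insert x3 X" "vin x3 b3 v \<subseteq> insert x3 X"
    using assms by (auto simp: vin_def)
  show ?thesis
    unfolding states_vin2[OF vv(1,2) assms(4) vv(3)] states_vin'[OF assms(3,7)] by auto
qed

lemma cyc_insert3:
  assumes X: "finite X" "x1 \<notin> X" "x2 \<notin> X" "x3 \<notin> X" "x1 \<noteq> x2" "x1 \<noteq> x3" "x2 \<noteq> x3"
  shows "cyc Om (insert x1 (insert x2 (insert x3 X))) P z \<longleftrightarrow>
    (\<forall>v\<subseteq>X. \<forall>b1 b2 b3. \<forall>c\<in>states Om X P v. P b1 x1 c \<longrightarrow> P b2 x2 c \<longrightarrow> P b3 x3 c \<longrightarrow>
      bd P (\<lambda>u. z (vin x1 b1 (vin x2 b2 (vin x3 b3 u)))) v c =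
      ((b1 \<and> P False x1 c \<and> z (vin x1 False (vin x2 b2 (vin x3 b3 v))) c) \<oplus>
       ((b2 \<and> P False x2 c \<and> z (vin x1 b1 (vin x2 False (vin x3 b3 v))) c) \<oplus>
        (b3 \<and> P False x3 c \<and> z (vin x1 b1 (vin x2 b2 (vin x3 False v))) c))))"
  unfolding cyc_def all_subset_insert3[OF X(2-7)]
proof (intro all_cong1 imp_cong refl)
  fix v b1 b2 b3 assume v: "v \<subseteq> X"
  then have "finite v" "x1 \<notin> v" "x2 \<notin> v" "x3 \<notin> v" using X finite_subset by auto
  then have "bd P z (vin x1 b1 (vin x2 b2 (vin x3 b3 v))) c =
      (((bd P (\<lambda>u. z (vin x1 b1 (vin x2 b2 (vin x3 b3 u)))) v c \<oplus>
        (b3 \<and> P False x3 c \<and> z (vin x1 b1 (vin x2 b2 (vin x3 False v))) c)) \<oplus>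
        (b2 \<and> P False x2 c \<and> z (vin x1 b1 (vin x2 False (vin x3 b3 v))) c)) \<oplus>
       (b1 \<and> P False x1 c \<and> z (vin x1 False (vin x2 b2 (vin x3 b3 v))) c))" for c
    using X(5-7) by (simp add: bd_vin vin_False)
  then show "(\<forall>c\<in>states Om (insert x1 (insert x2 (insert x3 X))) P (vin x1 b1 (vin x2 b2 (vin x3 b3 v))).
      \<not> bd P z (vin x1 b1 (vin x2 b2 (vin x3 b3 v))) c) \<longleftrightarrow>
    (\<forall>c\<in>states Om X P v. P b1 x1 c \<longrightarrow> P b2 x2 c \<longrightarrow> P b3 x3 c \<longrightarrow>
      bd P (\<lambda>u. z (vin x1 b1 (vin x2 b2 (vin x3 b3 u)))) v c =
      ((b1 \<and> P False x1 c \<and> z (vin x1 False (vin x2 b2 (vin x3 b3 v))) c) \<oplus>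
       ((b2 \<and> P False x2 c \<and> z (vin x1 b1 (vin x2 False (vin x3 b3 v))) c) \<oplus>
        (b3 \<and> P False x3 c \<and> z (vin x1 b1 (vin x2 b2 (vin x3 False v))) c))))"
    unfolding states_vin3[OF X(2-7) v] by (simp add: xr_def) blast
qed

lemma wt_insert3:
  assumes X: "finite X" "x1 \<notin> X" "x2 \<notin> X" "x3 \<notin> X" "x1 \<noteq> x2" "x1 \<noteq> x3" "x2 \<noteq> x3" "v \<subseteq> X"
  shows "wt (insert x1 (insert x2 (insert x3 X))) P c (vin x1 b1 (vin x2 b2 (vin x3 b3 v))) = wt X P c v +
    (if b1 then 1 else 0) + (if P False x1 c then 1 else 0) - (if P True x1 c then 2 else 0) +
    (if b2 then 1 else 0) + (if P False x2 c then 1 else 0) - (if P True x2 c then 2 else 0) +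
    (if b3 then 1 else 0) + (if P False x3 c then 1 else 0) - (if P True x3 c then 2 else 0)"
proof -
  have vv: "finite (insert x3 X)" "x1 \<notin> insert x3 X" "x2 \<notin> insert x3 X" "vin x3 b3 v \<subseteq> insert x3 X"
    using X by (auto simp: vin_def)
  show ?thesis unfolding wt_insert2[OF vv(1-3) X(5) vv(4)] wt_insert[OF X(1,4,8)] by linarith
qed

definition join3 :: "'x \<Rightarrow> 'x \<Rightarrow> 'x \<Rightarrow> (bool \<Rightarrow> bool \<Rightarrow> bool \<Rightarrow> ('x, 'e) chain) \<Rightarrow> ('x, 'e) chain" where
  "join3 x1 x2 x3 Z = join x1 (\<lambda>b1. join x2 (\<lambda>b2. join x3 (Z b1 b2)))"

lemma join3_vin:
  "x1 \<notin> v \<Longrightarrow> x2 \<notin> v \<Longrightarrow> x3 \<notin> v \<Longrightarrow> x1 \<noteq> x2 \<Longrightarrow> x1 \<noteq> x3 \<Longrightarrow> x2 \<noteq> x3 \<Longrightarrow>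
    join3 x1 x2 x3 Z (vin x1 b1 (vin x2 b2 (vin x3 b3 v))) = Z b1 b2 b3 v"
  unfolding join3_def by (simp add: join_vin)

text \<open>
  The strands \<open>a\<close>, \<open>b\<close>, \<open>c\<close> enter at the bottom and the strands \<open>a'\<close>, \<open>b'\<close>, \<open>c'\<close> leave at the top, from
  left to right.  Smoothing horizontally the crossing \<open>s\<close> that is moved across the third strand, the
  second move reduces both sides to the same diagram, in which \<open>a = b\<close>, \<open>c = a'\<close> and \<open>b' = c'\<close>;
  \<open>slide_w\<close> is the projection of the left side to it.  Smoothing \<open>s\<close> vertically, both sides are
  isotopic; the terms of \<open>slide\<close> there that stem from the other smoothing are the
  homotopy that makes the maps on the two halves compatible.
\<close>

type_synonym local_chain = "bool \<Rightarrow> bool \<Rightarrow> bool \<Rightarrow> bool \<Rightarrow> bool \<Rightarrow> bool \<Rightarrow> bool"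

definition slide_loop :: "local_chain \<Rightarrow> bool" where
  "slide_loop F = (F False False True True True True \<oplus> F False False True False False False)"

definition slide_w :: "local_chain \<Rightarrow> bool \<Rightarrow> bool \<Rightarrow> bool \<Rightarrow> bool" where
  "slide_w F c b' c' = (F False True False c c c' \<oplus> (c = b' \<and> slide_loop F))"

definition slide :: "local_chain \<Rightarrow> bool \<Rightarrow> bool \<Rightarrow> bool \<Rightarrow> bool \<Rightarrow> bool \<Rightarrow> bool \<Rightarrow> bool \<Rightarrow> bool \<Rightarrow> bool" where
  "slide F a b c b' c' s y1 y2 =
    (if s then
       if y1 then F True True y2 a b c'
       else if y2 then F True False True a b b \<oplus> F False True True c c c'
       else F True False False a b b \<oplus> (a = b \<and> slide_loop F)
     else if y1 then \<not> y2 \<and> a = b \<and> slide_w F c b' c'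
     else y2 \<and> slide_w F c b' c')"

text \<open>Here \<open>D\<close> stands for the coboundary along the other crossings,
  \<open>L\<close> is the cocycle equation of the left cube at each local state with inner colours
  \<open>k\<close>, \<open>l\<close>, \<open>n\<close>, and the claim is that of the right cube. The
  smoothings on the right leave few independent colours, so in each of the eight cases at most three
  instances of \<open>L\<close> have to be added up.\<close>

lemma slide_chain_map:
  assumes L: "\<And>s x2 x3 k l n.
      (if s then a = k \<and> b = l else a = b \<and> k = l) \<and>
      (if x2 then l = c \<and> n = c' else l = n \<and> c = c') \<and>
      (if x3 then k = n \<and> a' = b' else k = a' \<and> n = b') \<longrightarrow>
      D s x2 x3 k l n = ((s \<and> (a = b \<and> k = l) \<and> F False x2 x3 k l n) \<oplus>
        ((x2 \<and> (l = n \<and> c = c') \<and> F s False x3 k l n) \<oplus> (x3 \<and> (k = a' \<and> n = b') \<and> F s x2 False k l n)))"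
    and y1: "if y1 then b = c \<and> k = l else b = k \<and> c = l"
    and y2: "if y2 then a = k \<and> a' = n else a = a' \<and> k = n"
    and s: "if s then n = b' \<and> l = c' else n = l \<and> b' = c'"
  shows "slide D a b c b' c' s y1 y2 =
    ((s \<and> (n = l \<and> b' = c') \<and> slide F a b c b' c' False y1 y2) \<oplus>
     ((y1 \<and> (b = k \<and> c = l) \<and> slide F a b c b' c' s False y2) \<oplus>
      (y2 \<and> (a = a' \<and> k = n) \<and> slide F a b c b' c' s y1 False)))"
proof (cases s; cases y1; cases y2)
  assume h: "s" "y1" "y2"
  have e: "c = b" "b' = a'" "c' = a" "k = a" "l = a" "n = a'"
    using y1 y2 s h by simp_all
  note Ls = L[where s = True and ?x2.0 = True and ?x3.0 = True and k = "a" and l = "b" and n = "c'", unfolded if_True if_False e]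
  show ?thesis
    using Ls h unfolding slide_def slide_w_def slide_loop_def e
    by - (cases a; cases b; cases a'; simp add: xr_ac)
next
  assume h: "s" "y1" "\<not> y2"
  have e: "c = b" "a' = a" "c' = b'" "k = b'" "l = b'" "n = b'"
    using y1 y2 s h by simp_all
  note Ls = L[where s = True and ?x2.0 = True and ?x3.0 = False and k = "a" and l = "b" and n = "c'", unfolded if_True if_False e]
  show ?thesis
    using Ls h unfolding slide_def slide_w_def slide_loop_def e
    by - (cases a; cases b; cases b'; simp add: xr_ac)
next
  assume h: "s" "\<not> y1" "y2"
  have e: "b = a" "b' = a'" "c' = c" "k = a" "l = c" "n = a'"
    using y1 y2 s h by simp_all
  note Ls = L[where s = True and ?x2.0 = False and ?x3.0 = True and k = "a" and l = "b" and n = "b", unfolded if_True if_False e]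
    L[where s = False and ?x2.0 = True and ?x3.0 = True and k = "c" and l = "c" and n = "c'", unfolded if_True if_False e]
  show ?thesis
    using Ls h unfolding slide_def slide_w_def slide_loop_def e
    by - (cases a; cases c; cases a'; simp add: xr_ac)
next
  assume h: "s" "\<not> y1" "\<not> y2"
  have e: "a' = a" "b' = b" "c' = c" "k = b" "l = c" "n = b"
    using y1 y2 s h by simp_all
  note Ls = L[where s = True and ?x2.0 = False and ?x3.0 = False and k = "a" and l = "b" and n = "b", unfolded if_True if_False e]
    L[where s = False and ?x2.0 = False and ?x3.0 = True and k = "True" and l = "True" and n = "True", unfolded if_True if_False e]
    L[where s = False and ?x2.0 = False and ?x3.0 = True and k = "False" and l = "False" and n = "False", unfolded if_True if_False e]
  show ?thesis
    using Ls h unfolding slide_def slide_w_def slide_loop_def e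
    by - (cases a; cases b; cases c; simp add: xr_ac)
next
  assume h: "\<not> s" "y1" "y2"
  have e: "c = b" "a' = a" "c' = b'" "k = a" "l = a" "n = a"
    using y1 y2 s h by simp_all
  show ?thesis
    using  h unfolding slide_def slide_w_def slide_loop_def e
    by - (cases a; cases b; cases b'; simp add: xr_ac)
next
  assume h: "\<not> s" "y1" "\<not> y2"
  have e: "c = b" "a' = a" "c' = b'" "l = k" "n = k"
    using y1 y2 s h by simp_all
  note Ls = L[where s = False and ?x2.0 = True and ?x3.0 = False and k = "c" and l = "c" and n = "c'", unfolded if_True if_False e]
    L[where s = False and ?x2.0 = False and ?x3.0 = True and k = "True" and l = "True" and n = "True", unfolded if_True if_False e]
    L[where s = False and ?x2.0 = False and ?x3.0 = True and k = "False" and l = "False" and n = "False", unfolded if_True if_False e]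
  show ?thesis
    using Ls h unfolding slide_def slide_w_def slide_loop_def e
    by - (cases a; cases b; cases b'; cases k; simp add: xr_ac)
next
  assume h: "\<not> s" "\<not> y1" "y2"
  have e: "b = a" "a' = c" "c' = b'" "k = a" "l = c" "n = c"
    using y1 y2 s h by simp_all
  note Ls = L[where s = False and ?x2.0 = True and ?x3.0 = False and k = "c" and l = "c" and n = "c'", unfolded if_True if_False e]
    L[where s = False and ?x2.0 = False and ?x3.0 = True and k = "True" and l = "True" and n = "True", unfolded if_True if_False e]
    L[where s = False and ?x2.0 = False and ?x3.0 = True and k = "False" and l = "False" and n = "False", unfolded if_True if_False e]
  show ?thesis
    using Ls h unfolding slide_def slide_w_def slide_loop_def e
    by - (cases a; cases c; cases b'; simp add: xr_ac)
next
  assume h: "\<not> s" "\<not> y1" "\<not> y2"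
  have e: "c = b" "a' = a" "c' = b'" "k = b" "l = b" "n = b"
    using y1 y2 s h by simp_all
  show ?thesis
    using  h unfolding slide_def slide_w_def slide_loop_def e
    by - (cases a; cases b; cases b'; simp add: xr_ac)
qed

text \<open>If all three colours agree, \<open>slide\<close> yields three terms, two of which the
  hypothesis cancels; in the remaining one the circle has the opposite colour.\<close>

lemma slide_canonical:
  assumes "a = b \<and> b = c \<Longrightarrow> F False False True a a a = F False True False a a a"
  shows "slide F a b c b a (a \<noteq> b) (b = c) (a \<noteq> c) = F (a \<noteq> b) (a \<noteq> c) (b = c) (\<not> b) (\<not> a) (\<not> c)"
  using assms
  by (cases a; cases b; cases c; simp add: slide_def slide_w_def slide_loop_def xr_def; blast?)


text \<open>The map \<open>slide\<close> is linear in the chain and its coefficients depend only on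
  outer colours and smoothings, so it commutes with the coboundary of the crossings outside.\<close>

lemma slide_parity:
  assumes "finite v"
  shows "parity v (\<lambda>x. g x \<and> slide (F x) a b c b' c' s y1 y2) =
    slide (\<lambda>b1 b2 b3 k l n. parity v (\<lambda>x. g x \<and> F x b1 b2 b3 k l n)) a b c b' c' s y1 y2"
proof -
  have d: "(p \<and> (q \<oplus> r)) = ((p \<and> q) \<oplus> (p \<and> r))" for p q r by (auto simp: xr_def)
  show ?thesis
    unfolding slide_def slide_w_def slide_loop_def
    by (cases s; cases y1; cases y2; cases "a = b"; cases "c = b'"; simp add: d parity_xr[OF assms])
qed

text \<open>Crossings are matched by the strands they involve: \<open>x1\<close> with
  \<open>y3\<close>, \<open>x2\<close> with \<open>y2\<close>, \<open>x3\<close> with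
  \<open>y1\<close>. The names \<open>m1\<close>, \<open>m2\<close>, \<open>m3\<close> serve for the
  inner strands of both sides, so that both cubes live on one set of colourings.\<close>

locale R3 =
  fixes Om :: "'e colouring set" and X :: "'x set" and P Q :: "('x, 'e) smoothings"
    and x1 x2 x3 y1 y2 y3 :: 'x and pa pb pc qa qb qc m1 m2 m3 :: 'e
  assumes X: "finite X" "x1 \<notin> X" "x2 \<notin> X" "x3 \<notin> X" "x1 \<noteq> x2" "x1 \<noteq> x3" "x2 \<noteq> x3"
    and Y: "y3 \<notin> X" "y1 \<notin> X" "y2 \<notin> X" "y3 \<noteq> y1" "y3 \<noteq> y2" "y1 \<noteq> y2"
    and alg: "\<And>v. v \<subseteq> X \<Longrightarrow> alg (states Om X P v)"
    and PQ: "\<And>y b c. y \<in> X \<Longrightarrow> Q b y c = P b y c"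
    and par: "\<And>v c. v \<subseteq> X \<Longrightarrow> c \<in> states Om X P v \<Longrightarrow>
      ((c pa \<noteq> c pb) \<noteq> c pc) = ((c qa \<noteq> c qb) \<noteq> c qc)"
    and P1: "\<And>c. c \<in> Om \<Longrightarrow> P True x1 c \<longleftrightarrow> c pa = c m1 \<and> c pb = c m2"
      "\<And>c. c \<in> Om \<Longrightarrow> P False x1 c \<longleftrightarrow> c pa = c pb \<and> c m1 = c m2"
    and P2: "\<And>c. c \<in> Om \<Longrightarrow> P True x2 c \<longleftrightarrow> c m2 = c pc \<and> c m3 = c qc"
      "\<And>c. c \<in> Om \<Longrightarrow> P False x2 c \<longleftrightarrow> c m2 = c m3 \<and> c pc = c qc"
    and P3: "\<And>c. c \<in> Om \<Longrightarrow> P True x3 c \<longleftrightarrow> c m1 = c m3 \<and> c qa = c qb"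
      "\<And>c. c \<in> Om \<Longrightarrow> P False x3 c \<longleftrightarrow> c m1 = c qa \<and> c m3 = c qb"
    and Q1: "\<And>c. c \<in> Om \<Longrightarrow> Q True y1 c \<longleftrightarrow> c pb = c pc \<and> c m1 = c m2"
      "\<And>c. c \<in> Om \<Longrightarrow> Q False y1 c \<longleftrightarrow> c pb = c m1 \<and> c pc = c m2"
    and Q2: "\<And>c. c \<in> Om \<Longrightarrow> Q True y2 c \<longleftrightarrow> c pa = c m1 \<and> c qa = c m3"
      "\<And>c. c \<in> Om \<Longrightarrow> Q False y2 c \<longleftrightarrow> c pa = c qa \<and> c m1 = c m3"
    and Q3: "\<And>c. c \<in> Om \<Longrightarrow> Q True y3 c \<longleftrightarrow> c m3 = c qb \<and> c m2 = c qc"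
      "\<And>c. c \<in> Om \<Longrightarrow> Q False y3 c \<longleftrightarrow> c m3 = c m2 \<and> c qb = c qc"
    and upd: "\<And>c k l n. c \<in> Om \<Longrightarrow> c(m1 := k, m2 := l, m3 := n) \<in> Om"
    and outer: "\<And>y c b k l n. y \<in> X \<Longrightarrow> P b y (c(m1 := k, m2 := l, m3 := n)) = P b y c"
    and ne: "{pa, pb, pc, qa, qb, qc} \<inter> {m1, m2, m3} = {}" "m1 \<noteq> m2" "m1 \<noteq> m3" "m2 \<noteq> m3"
begin

definition U :: "bool \<Rightarrow> bool \<Rightarrow> bool \<Rightarrow> 'e colouring \<Rightarrow> 'e colouring" where
  "U k l n c = c(m1 := k, m2 := l, m3 := n)"

lemma U_simps [simp]:
  "U k l n c m1 = k" "U k l n c m2 = l" "U k l n c m3 = n"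
  "U k l n c pa = c pa" "U k l n c pb = c pb" "U k l n c pc = c pc"
  "U k l n c qa = c qa" "U k l n c qb = c qb" "U k l n c qc = c qc"
  "U k l n (U k' l' n' c) = U k l n c"
  using ne by (auto simp: U_def)

lemma U_id: "U (c m1) (c m2) (c m3) c = c"
  by (auto simp: U_def)

abbreviation "KL \<equiv> insert x1 (insert x2 (insert x3 X))"
abbreviation "KR \<equiv> insert y3 (insert y1 (insert y2 X))"
abbreviation "S v \<equiv> states Om X P v"

lemma U_Om: "c \<in> Om \<Longrightarrow> U k l n c \<in> Om"
  unfolding U_def by (rule upd)

lemma U_S: "c \<in> S v \<Longrightarrow> U k l n c \<in> S v"
  using upd outer by (simp add: states_def U_def)

lemma SQ: "states Om X Q v = S v"
  by (rule states_cong) (rule PQ)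

lemma bdQ: "v \<subseteq> X \<Longrightarrow> bd Q z v c = bd P z v c"
  unfolding bd_def by (rule parity_cong) (auto simp: PQ)

lemma bd_U: "v \<subseteq> X \<Longrightarrow> bd P z v (U k l n c) = parity v (\<lambda>x. P False x c \<and> z (v - {x}) (U k l n c))"
  unfolding bd_def by (rule parity_cong) (auto simp: U_def outer)

lemma res_U: "res X P (U k l n c) = res X P c" "res X Q c = res X P c"
  unfolding res_def U_def using outer PQ by auto

lemma wt_U: "wt X P (U k l n c) v = wt X P c v" "wt X Q c v = wt X P c v"
  by (rule wt_cong, simp add: outer U_def PQ)+

text \<open>Canonical colourings change colour at each crossing along a strand, which determines the
  inner colours from \<open>pa\<close>, \<open>pb\<close>, \<open>pc\<close>. On the left
  \<open>m1\<close>, \<open>m2\<close>, \<open>m3\<close> lie on the strands \<open>b\<close>,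
  \<open>a\<close>, \<open>c\<close>, on the right on \<open>c\<close>, \<open>b\<close>,
  \<open>a\<close>.\<close>

definition psi :: "'e colouring \<Rightarrow> 'e colouring" where
  "psi c = U (\<not> c pc) (\<not> c pb) (\<not> c pa) c"

definition phi :: "'e colouring \<Rightarrow> 'e colouring" where
  "phi c = U (\<not> c pb) (\<not> c pa) (\<not> c pc) c"

lemma canon_KL: "canon Om KL P = {c\<in>canon Om X P. c m1 = (\<not> c pb) \<and> c m2 = (\<not> c pa) \<and> c m3 = (\<not> c pc) \<and>
    c qa = c pc \<and> c qb = c pb \<and> c qc = c pa}"
  unfolding canon_def by (auto simp: P1 P2 P3)

lemma canon_KR: "canon Om KR Q = {c\<in>canon Om X P. c m1 = (\<not> c pc) \<and> c m2 = (\<not> c pb) \<and> c m3 = (\<not> c pa) \<and>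
    c qa = c pc \<and> c qb = c pb \<and> c qc = c pa}"
  unfolding canon_def by (auto simp: Q1 Q2 Q3 PQ)

lemma U_canon: "c \<in> canon Om X P \<Longrightarrow> U k l n c \<in> canon Om X P"
  using upd outer by (simp add: canon_def U_def)

lemma psi_canon: "bij_betw psi (canon Om KL P) (canon Om KR Q)"
proof (rule bij_betw_inverses[where g = phi])
  show "phi (psi c) = c" if "c \<in> canon Om KL P" for c
    using that U_id[of c] unfolding canon_KL phi_def psi_def by simp
  show "psi (phi c) = c" if "c \<in> canon Om KR Q" for c
    using that U_id[of c] unfolding canon_KR phi_def psi_def by simp
qed (auto simp: canon_KL canon_KR phi_def psi_def U_canon)

lemma P_canon:
  assumes "c \<in> canon Om KL P"
  shows "P b x1 c \<longleftrightarrow> b = (c pa \<noteq> c pb)" "P b x2 c \<longleftrightarrow> b = (c pa \<noteq> c pc)" "P b x3 c \<longleftrightarrow> b = (c pb = c pc)"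
proof -
  have c: "c m1 = (\<not> c pb)" "c m2 = (\<not> c pa)" "c m3 = (\<not> c pc)" "c qa = c pc" "c qb = c pb" "c qc = c pa"
    using assms unfolding canon_KL by blast+
  have "c \<in> Om" by (rule canon_Om[OF assms])
  note P = P1[OF this] P2[OF this] P3[OF this]
  show "P b x1 c \<longleftrightarrow> b = (c pa \<noteq> c pb)" by (cases b) (simp_all only: P c, blast+)
  show "P b x2 c \<longleftrightarrow> b = (c pa \<noteq> c pc)" by (cases b) (simp_all only: P c, blast+)
  show "P b x3 c \<longleftrightarrow> b = (c pb = c pc)" by (cases b) (simp_all only: P c, blast+)
qed

lemma Q_canon:
  assumes "c \<in> canon Om KR Q"
  shows "Q b y3 c \<longleftrightarrow> b = (c pa \<noteq> c pb)" "Q b y1 c \<longleftrightarrow> b = (c pb = c pc)" "Q b y2 c \<longleftrightarrow> b = (c pa \<noteq> c pc)"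
proof -
  have c: "c m1 = (\<not> c pc)" "c m2 = (\<not> c pb)" "c m3 = (\<not> c pa)" "c qa = c pc" "c qb = c pb" "c qc = c pa"
    using assms unfolding canon_KR by blast+
  have "c \<in> Om" by (rule canon_Om[OF assms])
  note Q = Q1[OF this] Q2[OF this] Q3[OF this]
  show "Q b y3 c \<longleftrightarrow> b = (c pa \<noteq> c pb)" by (cases b) (simp_all only: Q c, blast+)
  show "Q b y1 c \<longleftrightarrow> b = (c pb = c pc)" by (cases b) (simp_all only: Q c, blast+)
  show "Q b y2 c \<longleftrightarrow> b = (c pa \<noteq> c pc)" by (cases b) (simp_all only: Q c, blast+)
qed

definition shift :: "'e colouring \<Rightarrow> int" where
  "shift c = (if c pa = c pb then 1 else - 2) + (if c pa = c pc then 1 else - 2) + (if c pb = c pc then - 2 else 1)"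

lemma wt_KL:
  assumes "c \<in> canon Om KL P" "v \<subseteq> X"
  shows "wt KL P c (vin x1 b1 (vin x2 b2 (vin x3 b3 v))) =
    wt X P c v + shift c + (if b1 then 1 else 0) + (if b2 then 1 else 0) + (if b3 then 1 else 0)"
  by (subst wt_insert3[OF X assms(2)]) (simp add: P_canon[OF assms(1)] shift_def)

lemma wt_KR:
  assumes "c \<in> canon Om KL P" "v \<subseteq> X"
  shows "wt KR Q (psi c) (vin y3 b1 (vin y1 b2 (vin y2 b3 v))) =
    wt X P c v + shift c + (if b1 then 1 else 0) + (if b2 then 1 else 0) + (if b3 then 1 else 0)"
proof -
  have "psi c \<in> canon Om KR Q" using bij_betwE[OF psi_canon] assms(1) by blast
  from Q_canon[OF this] show ?thesis
    by (subst wt_insert3[OF X(1) Y assms(2)]) (simp add: shift_def psi_def wt_U)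
qed

text \<open>States in which the smoothings determine the three inner colours.\<close>

definition Det :: "'x set \<Rightarrow> ('e colouring \<Rightarrow> bool) \<Rightarrow> 'e \<Rightarrow> 'e \<Rightarrow> 'e \<Rightarrow> 'e colouring set" where
  "Det v R d1 d2 d3 = {c\<in>S v. R c \<and> c m1 = c d1 \<and> c m2 = c d2 \<and> c m3 = c d3}"

abbreviation (input) "ends \<equiv> {pa, pb, pc, qa, qb, qc}"

lemma U_ends: "d \<in> ends \<Longrightarrow> U k l n c d = c d"
  by auto

lemma aff_U: "deg_le 1 f \<Longrightarrow> deg_le 1 g \<Longrightarrow> deg_le 1 h \<Longrightarrow> affine_on V (\<lambda>c. U (f c) (g c) (h c) c)"
  unfolding U_def by (intro affine_on_upd affine_on_id)

text \<open>When the ends determine the inner colours, it does not matter which ends they copy: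
  overwriting them gives a bijection between the two sets that only substitutes coordinates.\<close>

lemma det_transport:
  assumes R: "\<And>k l n c. R (U k l n c) = R c"
    and d: "d1 \<in> ends" "d2 \<in> ends" "d3 \<in> ends" and e: "e1 \<in> ends" "e2 \<in> ends" "e3 \<in> ends"
    and f: "fil (Det v R d1 d2 d3) a f"
  shows "fil (Det v R e1 e2 e3) a (\<lambda>c. f (U (c d1) (c d2) (c d3) c))"
proof (rule fil_subst[OF f])
  let ?g = "\<lambda>d1 d2 d3 c. U (c d1) (c d2) (c d3) c"
  have g: "?g e1 e2 e3 c \<in> Det v R e1 e2 e3" if "c \<in> Det v R d1 d2 d3" "e1 \<in> ends" "e2 \<in> ends" "e3 \<in> ends"
    for c d1 d2 d3 e1 e2 e3
    using that U_S R unfolding Det_def by (simp add: U_ends)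
  have i: "?g d1 d2 d3 (?g e1 e2 e3 c) = c" if "c \<in> Det v R d1 d2 d3" "d1 \<in> ends" "d2 \<in> ends" "d3 \<in> ends"
    for c d1 d2 d3 e1 e2 e3
    using that U_id[of c] unfolding Det_def by (simp add: U_ends)
  have "bij_betw (?g e1 e2 e3) (Det v R d1 d2 d3) (Det v R e1 e2 e3)"
    by (rule bij_betw_inverses[where g = "?g d1 d2 d3"]) (use g i d e in auto)
  then show "int (floor_log (card (Det v R d1 d2 d3))) + a \<le> int (floor_log (card (Det v R e1 e2 e3))) + a"
    using bij_betw_same_card by fastforce
  show "?g d1 d2 d3 c \<in> Det v R d1 d2 d3" if "c \<in> Det v R e1 e2 e3" for c
    using g[OF that d] .
  show "affine_on (Det v R e1 e2 e3) (?g d1 d2 d3)"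
    by (intro aff_U deg_coord) simp_all
qed

lemma states_KL:
  assumes "v \<subseteq> X"
  shows "states Om KL P (vin x1 b1 (vin x2 b2 (vin x3 b3 v))) =
    {c\<in>S v. (if b1 then c pa = c m1 \<and> c pb = c m2 else c pa = c pb \<and> c m1 = c m2) \<and>
      (if b2 then c m2 = c pc \<and> c m3 = c qc else c m2 = c m3 \<and> c pc = c qc) \<and>
      (if b3 then c m1 = c m3 \<and> c qa = c qb else c m1 = c qa \<and> c m3 = c qb)}"
  unfolding states_vin3[OF X(2-7) assms]
  by (rule Collect_cong, rule conj_cong, rule refl)
    (auto dest!: states_Om simp: P1 P2 P3)

lemma states_KR:
  assumes "v \<subseteq> X"
  shows "states Om KR Q (vin y3 b1 (vin y1 b2 (vin y2 b3 v))) =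
    {c\<in>S v. (if b1 then c m3 = c qb \<and> c m2 = c qc else c m3 = c m2 \<and> c qb = c qc) \<and>
      (if b2 then c pb = c pc \<and> c m1 = c m2 else c pb = c m1 \<and> c pc = c m2) \<and>
      (if b3 then c pa = c m1 \<and> c qa = c m3 else c pa = c qa \<and> c m1 = c m3)}"
  unfolding states_vin3[OF Y assms] SQ
  by (rule Collect_cong, rule conj_cong, rule refl)
    (auto dest!: states_Om simp: Q1 Q2 Q3)

end


section \<open>Filtration levels under the third move\<close>

lemma fil_set: "fil V a f \<Longrightarrow> a = b \<Longrightarrow> (\<And>c. c \<in> V \<longleftrightarrow> c \<in> V') \<Longrightarrow> fil V' b f"
  using set_eqI[of V V'] by simp

context R3
begin

lemma alg_Det:
  assumes v: "v \<subseteq> X" and R: "\<And>c. R c \<longleftrightarrow> c f1 = c g1 \<and> c f2 = c g2"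
  shows "alg (Det v R d1 d2 d3)"
proof -
  have "Det v R d1 d2 d3 = {c \<in> {c \<in> {c \<in> {c \<in> {c \<in> S v. c f1 = c g1}. c f2 = c g2}. c m1 = c d1}. c m2 = c d2}. c m3 = c d3}"
    by (auto simp: Det_def R)
  then show ?thesis using alg_eq[OF alg_eq[OF alg_eq[OF alg_eq[OF alg_eq[OF alg[OF v]]]]]] by simp
qed

lemma alg_loop: "v \<subseteq> X \<Longrightarrow> alg {c\<in>S v. (c f1 = c g1 \<and> c f2 = c g2 \<and> c f3 = c g3) \<and> c m1 = c m2 \<and> c m2 = c m3}"
proof -
  assume v: "v \<subseteq> X"
  have "{c\<in>S v. (c f1 = c g1 \<and> c f2 = c g2 \<and> c f3 = c g3) \<and> c m1 = c m2 \<and> c m2 = c m3} =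
      {c \<in> {c \<in> {c \<in> {c \<in> {c \<in> S v. c f1 = c g1}. c f2 = c g2}. c f3 = c g3}. c m1 = c m2}. c m2 = c m3}"
    by auto
  then show ?thesis using alg_eq[OF alg_eq[OF alg_eq[OF alg_eq[OF alg_eq[OF alg[OF v]]]]]] by simp
qed

lemma Det_saddle:
  assumes v: "v \<subseteq> X"
    and par: "\<And>c. c \<in> S v \<Longrightarrow> c f1 = c g1 \<Longrightarrow> (c p \<noteq> c q) = (c p' \<noteq> c q')"
    and f: "fil (Det v (\<lambda>c. c f1 = c g1 \<and> c p = c p' \<and> c q = c q') d1 d2 d3) a h" and b: "a + 1 \<le> b"
  shows "fil (Det v (\<lambda>c. c f1 = c g1 \<and> c p = c q \<and> c p' = c q') d1 d2 d3) b (\<lambda>c. c p = c p' \<and> h c)"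
proof -
  let ?V = "Det v (\<lambda>c. c f1 = c g1) d1 d2 d3"
  have eq: "Det v (\<lambda>c. c f1 = c g1 \<and> c p = c p' \<and> c q = c q') d1 d2 d3 = {c\<in>?V. c p = c p' \<and> c q = c q'}"
    for p p' q q' unfolding Det_def by auto
  have "alg ?V" by (rule alg_Det[OF v, where ?f1.0 = f1 and ?g1.0 = g1 and ?f2.0 = f1 and ?g2.0 = g1]) simp
  from fil_saddle[OF this _ f[unfolded eq] b] par show ?thesis
    unfolding eq by (simp add: Det_def)
qed

text \<open>The inner strands form a free circle. Fixing its colour to that of an end halves the set
  exactly, as the zero colouring with the circle recoloured shows.\<close>

lemma Det_loop:
  fixes f1 g1 f2 g2 f3 g3 d :: 'e
  defines "R \<equiv> \<lambda>c. c f1 = c g1 \<and> c f2 = c g2 \<and> c f3 = c g3"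
  assumes v: "v \<subseteq> X" and ends: "{f1, g1, f2, g2, f3, g3, d} \<subseteq> ends"
  shows "alg (Det v R d d d)" "card {c\<in>S v. R c \<and> c m1 = c m2 \<and> c m2 = c m3} \<le> 2 * card (Det v R d d d)"
    "2 * card (Det v R d d d) \<le> card {c\<in>S v. R c \<and> c m1 = c m2 \<and> c m2 = c m3}"
proof -
  let ?L = "{c\<in>S v. R c \<and> c m1 = c m2 \<and> c m2 = c m3}"
  have L: "alg ?L" unfolding R_def by (rule alg_loop[OF v])
  have D: "Det v R d d d = {c\<in>?L. c m1 = c d}" unfolding Det_def by auto
  show "alg (Det v R d d d)" unfolding D by (rule alg_eq[OF L])
  show "card ?L \<le> 2 * card (Det v R d d d)" unfolding D by (rule alg_halve(1)[OF L])
  have "(\<lambda>_. False) \<in> ?L" by (rule alg_zero[OF L])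
  then have "(\<lambda>_. False) \<in> S v" by simp
  then have u: "U True True True (\<lambda>_. False) \<in> ?L"
    using U_S ends by (simp add: R_def U_ends)
  have "2 * card {c\<in>?L. c m1 = c d} \<le> card ?L"
    by (rule alg_halve(2)[OF L u]) (use ends in \<open>simp add: U_ends\<close>)
  then show "2 * card (Det v R d d d) \<le> card ?L" unfolding D .
qed

text \<open>The terms of \<open>slide\<close> are composed of saddles, creations and removals of a
  circle, and renamings of inner colours, so their levels are assembled from
  \<open>Det_saddle\<close>, \<open>Det_loop\<close> and \<open>det_transport\<close>.\<close>

lemma sub_slide: "sub 0 Om KL P Om KR Q"
proof (rule subI[OF psi_canon])
  fix c0 z
  assume c0: "c0 \<in> canon Om KL P" and cz: "cyc Om KL P z"
  define f where "f b1 b2 b3 v = z (vin x1 b1 (vin x2 b2 (vin x3 b3 v)))" for b1 b2 b3 v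
  define F where "F v c b1 b2 b3 k l n = f b1 b2 b3 v (U k l n c)" for v c b1 b2 b3 k l n
  define Z where "Z s e1 e2 v c = slide (F v c) (c pa) (c pb) (c pc) (c qb) (c qc) s e1 e2" for s e1 e2 v c
  define z' where "z' = join3 y3 y1 y2 Z"
  have z': "z' (vin y3 s (vin y1 e1 (vin y2 e2 v))) = Z s e1 e2 v" if "v \<subseteq> X" for s e1 e2 v
    unfolding z'_def by (rule join3_vin) (use that Y in auto)
  have cz': "bd P (f b1 b2 b3) v c = ((b1 \<and> P False x1 c \<and> f False b2 b3 v c) \<oplus>
       ((b2 \<and> P False x2 c \<and> f b1 False b3 v c) \<oplus> (b3 \<and> P False x3 c \<and> f b1 b2 False v c)))"
    if "v \<subseteq> X" "c \<in> S v" "P b1 x1 c" "P b2 x2 c" "P b3 x3 c" for v c b1 b2 b3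
    using cz that unfolding cyc_insert3[OF X] f_def by simp
  have FU [simp]: "F v (U k l n c) = F v c" for v k l n c
    by (intro ext) (simp add: F_def)
  have "cyc Om KR Q z'"
    unfolding cyc_insert3[OF X(1) Y]
  proof (intro allI impI ballI)
    fix v s e1 e2 c
    assume v: "v \<subseteq> X" and c: "c \<in> states Om X Q v" "Q s y3 c" "Q e1 y1 c" "Q e2 y2 c"
    have S: "c \<in> S v" and cO: "c \<in> Om" using c(1) SQ states_Om by auto
    have fin: "finite v" using finite_subset[OF v X(1)] .
    define D where "D b1 b2 b3 k l n = bd P (f b1 b2 b3) v (U k l n c)" for b1 b2 b3 k l n
    have "bd Q (\<lambda>w. z' (vin y3 s (vin y1 e1 (vin y2 e2 w)))) v c = bd P (Z s e1 e2) v c"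
      unfolding bdQ[OF v] by (rule bd_cong) (use z' v in auto)
    also have "\<dots> = slide D (c pa) (c pb) (c pc) (c qb) (c qc) s e1 e2"
      unfolding D_def bd_U[OF v] unfolding bd_def Z_def slide_parity[OF fin] F_def ..
    also have "\<dots> = ((s \<and> (c m3 = c m2 \<and> c qb = c qc) \<and> Z False e1 e2 v c) \<oplus>
      ((e1 \<and> (c pb = c m1 \<and> c pc = c m2) \<and> Z s False e2 v c) \<oplus>
       (e2 \<and> (c pa = c qa \<and> c m1 = c m3) \<and> Z s e1 False v c)))"
      unfolding Z_def
    proof (rule slide_chain_map)
      fix b1 b2 b3 k l n
      have SU: "U k l n c \<in> S v" and OU: "U k l n c \<in> Om" using U_S[OF S] U_Om[OF cO] .
      show "(if b1 then c pa = k \<and> c pb = l else c pa = c pb \<and> k = l) \<and>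
        (if b2 then l = c pc \<and> n = c qc else l = n \<and> c pc = c qc) \<and>
        (if b3 then k = n \<and> c qa = c qb else k = c qa \<and> n = c qb) \<longrightarrow>
        D b1 b2 b3 k l n = ((b1 \<and> (c pa = c pb \<and> k = l) \<and> F v c False b2 b3 k l n) \<oplus>
          ((b2 \<and> (l = n \<and> c pc = c qc) \<and> F v c b1 False b3 k l n) \<oplus> (b3 \<and> (k = c qa \<and> n = c qb) \<and> F v c b1 b2 False k l n)))"
      proof (intro impI; elim conjE)
        assume h: "if b1 then c pa = k \<and> c pb = l else c pa = c pb \<and> k = l"
          "if b2 then l = c pc \<and> n = c qc else l = n \<and> c pc = c qc"
          "if b3 then k = n \<and> c qa = c qb else k = c qa \<and> n = c qb"
        have "P b1 x1 (U k l n c)" using h(1) P1[OF OU] by (cases b1) simp_all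
        moreover have "P b2 x2 (U k l n c)" using h(2) P2[OF OU] by (cases b2) simp_all
        moreover have "P b3 x3 (U k l n c)" using h(3) P3[OF OU] by (cases b3) simp_all
        ultimately have D: "D b1 b2 b3 k l n = ((b1 \<and> P False x1 (U k l n c) \<and> f False b2 b3 v (U k l n c)) \<oplus>
            ((b2 \<and> P False x2 (U k l n c) \<and> f b1 False b3 v (U k l n c)) \<oplus>
              (b3 \<and> P False x3 (U k l n c) \<and> f b1 b2 False v (U k l n c))))"
          unfolding D_def by (rule cz'[OF v SU])
        show "D b1 b2 b3 k l n = ((b1 \<and> (c pa = c pb \<and> k = l) \<and> F v c False b2 b3 k l n) \<oplus>
          ((b2 \<and> (l = n \<and> c pc = c qc) \<and> F v c b1 False b3 k l n) \<oplus> (b3 \<and> (k = c qa \<and> n = c qb) \<and> F v c b1 b2 False k l n)))"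
          unfolding D F_def P1(2)[OF OU] P2(2)[OF OU] P3(2)[OF OU] by (simp only: U_simps)
      qed
    next
      show "if e1 then c pb = c pc \<and> c m1 = c m2 else c pb = c m1 \<and> c pc = c m2"
        using c(3) Q1[OF cO] by (cases e1) simp_all
      show "if e2 then c pa = c m1 \<and> c qa = c m3 else c pa = c qa \<and> c m1 = c m3"
        using c(4) Q2[OF cO] by (cases e2) simp_all
      show "if s then c m3 = c qb \<and> c m2 = c qc else c m3 = c m2 \<and> c qb = c qc"
        using c(2) Q3[OF cO] by (cases s) simp_all
    qed
    finally show "bd Q (\<lambda>w. z' (vin y3 s (vin y1 e1 (vin y2 e2 w)))) v c =
      ((s \<and> Q False y3 c \<and> z' (vin y3 False (vin y1 e1 (vin y2 e2 v))) c) \<oplus>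
       ((e1 \<and> Q False y1 c \<and> z' (vin y3 s (vin y1 False (vin y2 e2 v))) c) \<oplus>
        (e2 \<and> Q False y2 c \<and> z' (vin y3 s (vin y1 e1 (vin y2 False v))) c)))"
      unfolding z'[OF v] by (simp add: Q1[OF cO] Q2[OF cO] Q3[OF cO])
  qed
  moreover have "z' (res KR Q (psi c)) (psi c) = z (res KL P c) c" if c: "c \<in> canon Om KL P" for c
  proof -
    have cO: "c \<in> Om" using canon_Om[OF c] .
    have cc: "c m1 = (\<not> c pb)" "c m2 = (\<not> c pa)" "c m3 = (\<not> c pc)"
      "c qa = c pc" "c qb = c pb" "c qc = c pa" "c \<in> canon Om X P"
      using c unfolding canon_KL by auto
    define v where "v = res X P c"
    have v: "v \<subseteq> X" unfolding v_def by (rule res_subset)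
    have pc: "psi c \<in> canon Om KR Q" using bij_betwE[OF psi_canon] c by blast
    \<comment> \<open>The hypothesis of \<open>slide_canonical\<close> comes from the cocycle
      equation at the state \<open>False\<close>, \<open>True\<close>, \<open>True\<close> on the
      left, to which no crossing outside contributes.\<close>
    have loop: "F v c False False True (c pa) (c pa) (c pa) = F v c False True False (c pa) (c pa) (c pa)"
      if eq: "c pa = c pb \<and> c pb = c pc"
    proof -
      let ?c = "U (c pa) (c pa) (c pa) c"
      have S: "?c \<in> S v" unfolding v_def by (rule U_S[OF res_states[OF cc(7)]])
      have P: "P b x2 ?c" "P b x3 ?c" "P False x1 ?c" for b
        using P1[OF states_Om[OF S]] P2[OF states_Om[OF S]] P3[OF states_Om[OF S]] cc eq by (cases b; simp)+
      have "bd P (f False True True) v ?c = False"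
        by (rule bd_no_mono) (use res_not_mono[OF cc(7)] outer v in \<open>auto simp: v_def U_def\<close>)
      then show ?thesis using cz'[OF v S P(3,1,2)] P unfolding F_def by (simp add: xr_def)
    qed
    have "z' (res KR Q (psi c)) (psi c) = Z (c pa \<noteq> c pb) (c pb = c pc) (c pa \<noteq> c pc) v (psi c)"
    proof -
      have "res X Q (psi c) = v" "psi c pa = c pa" "psi c pb = c pb" "psi c pc = c pc"
        by (simp_all add: psi_def res_U v_def)
      then show ?thesis by (simp add: res_insert Q_canon[OF pc] z'[OF v])
    qed
    also have "\<dots> = slide (F v c) (c pa) (c pb) (c pc) (c pb) (c pa) (c pa \<noteq> c pb) (c pb = c pc) (c pa \<noteq> c pc)"
      using cc by (simp add: Z_def psi_def)
    also have "\<dots> = F v c (c pa \<noteq> c pb) (c pa \<noteq> c pc) (c pb = c pc) (\<not> c pb) (\<not> c pa) (\<not> c pc)"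
      by (rule slide_canonical) (rule loop)
    also have "\<dots> = z (res KL P c) c"
      using U_id[of c] cc by (simp add: F_def f_def res_insert P_canon[OF c] v_def)
    finally show ?thesis .
  qed
  moreover have "fil (states Om KR Q w) (wt KR Q (psi c0) w - (j - 0)) (z' w)"
    if fz: "\<forall>w\<subseteq>KL. fil (states Om KL P w) (wt KL P c0 w - j) (z w)" and w: "w \<subseteq> KR" for j w
  proof -
    have "\<forall>w\<subseteq>KR. fil (states Om KR Q w) (wt KR Q (psi c0) w - j) (z' w)"
      unfolding all_subset_insert3[OF Y]
    proof (intro allI impI)
      fix v s e1 e2 assume v: "v \<subseteq> X"
      define A where "A = wt X P c0 v + shift c0 - j"
      \<comment> \<open>The five planar pairings of the six ends. Each state on either side realises
        one of them, possibly with an additional circle.\<close>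
      define RP where "RP c \<longleftrightarrow> c pa = c pb \<and> c pc = c qa \<and> c qc = c qb" for c :: "'e colouring"
      define RC where "RC c \<longleftrightarrow> c pa = c pb \<and> c pc = c qc \<and> c qa = c qb" for c :: "'e colouring"
      define RR where "RR c \<longleftrightarrow> c qb = c qc \<and> c pa = c qa \<and> c pb = c pc" for c :: "'e colouring"
      define RI where "RI c \<longleftrightarrow> c pb = c pc \<and> c pa = c qc \<and> c qa = c qb" for c :: "'e colouring"
      define RV where "RV c \<longleftrightarrow> c pc = c qc \<and> c pa = c qa \<and> c pb = c qb" for c :: "'e colouring"
      note R_defs = RP_def RC_def RR_def RI_def RV_def
      have R_inv: "RP (U k l n c) = RP c" "RC (U k l n c) = RC c" "RR (U k l n c) = RR c"
        "RI (U k l n c) = RI c" "RV (U k l n c) = RV c" for k l n c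
        by (simp_all add: R_defs)
      let ?loop = "\<lambda>R. {c\<in>S v. R c \<and> c m1 = c m2 \<and> c m2 = c m3}"
      have fL: "fil {c\<in>S v. (if b1 then c pa = c m1 \<and> c pb = c m2 else c pa = c pb \<and> c m1 = c m2) \<and>
          (if b2 then c m2 = c pc \<and> c m3 = c qc else c m2 = c m3 \<and> c pc = c qc) \<and>
          (if b3 then c m1 = c m3 \<and> c qa = c qb else c m1 = c qa \<and> c m3 = c qb)}
          (A + (if b1 then 1 else 0) + (if b2 then 1 else 0) + (if b3 then 1 else 0)) (f b1 b2 b3 v)" for b1 b2 b3
        using fz v unfolding all_subset_insert3[OF X(2-7)] states_KL[OF v, symmetric] f_def
        by (simp add: wt_KL[OF c0] A_def algebra_simps)
      have L: "fil (Det v RP pc pc qc) (A + 1) (f False True False v)"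
        "fil (Det v RC pc pc qc) (A + 2) (f False True True v)"
        "fil (Det v RI pa pb qc) (A + 3) (f True True True v)"
        "fil (Det v RR pa pb qc) (A + 2) (f True True False v)"
        "fil (Det v RC pa pb pb) (A + 2) (f True False True v)"
        "fil (Det v RV pa pb pb) (A + 1) (f True False False v)"
        "fil (?loop RC) (A + 1) (f False False True v)"
      proof -
        show "fil (Det v RP pc pc qc) (A + 1) (f False True False v)"
          by (rule fil_set[OF fL[of False True False]]) (auto simp: Det_def R_defs)
        show "fil (Det v RC pc pc qc) (A + 2) (f False True True v)"
          by (rule fil_set[OF fL[of False True True]]) (auto simp: Det_def R_defs)
        show "fil (Det v RI pa pb qc) (A + 3) (f True True True v)"
          by (rule fil_set[OF fL[of True True True]]) (auto simp: Det_def R_defs)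
        show "fil (Det v RR pa pb qc) (A + 2) (f True True False v)"
          by (rule fil_set[OF fL[of True True False]]) (auto simp: Det_def R_defs)
        show "fil (Det v RC pa pb pb) (A + 2) (f True False True v)"
          by (rule fil_set[OF fL[of True False True]]) (auto simp: Det_def R_defs)
        show "fil (Det v RV pa pb pb) (A + 1) (f True False False v)"
          by (rule fil_set[OF fL[of True False False]]) (auto simp: Det_def R_defs)
        show "fil (?loop RC) (A + 1) (f False False True v)"
          by (rule fil_set[OF fL[of False False True]]) (auto simp: Det_def R_defs)
      qed
      have RC_ends: "{pa, pb, pc, qc, qa, qb, pc} \<subseteq> ends" and RR_ends: "{qb, qc, pa, qa, pb, pc, pa} \<subseteq> ends"
        by simp_all
      note RC_loop = Det_loop[OF v RC_ends, folded RC_def] and RR_loop = Det_loop[OF v RR_ends, folded RR_def]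
      define G where "G c = slide_loop (F v c)" for c
      have GU [simp]: "G (U k l n c) = G c" for k l n c by (simp add: G_def)
      have G: "fil (Det v RC pc pc pc) A G"
      proof -
        have "fil (Det v RC pc pc pc) A (\<lambda>c. f False False True v (U True True True c) \<oplus> f False False True v (U False False False c))"
        proof (rule fil_death[OF L(7)])
          show "affine_on (Det v RC pc pc pc) (U True True True)"
            by (rule aff_U[of "\<lambda>_. True" "\<lambda>_. True" "\<lambda>_. True"]) (simp_all add: deg_const)
          show "(\<forall>c\<in>Det v RC pc pc pc. U False False False c e = U True True True c e) \<or>
            (\<forall>c\<in>Det v RC pc pc pc. U False False False c e = (\<not> U True True True c e))" for e
            by (auto simp: U_def)
        qed (use RC_loop alg_card_pos[OF RC_loop(1)] in \<open>auto simp: Det_def R_inv intro: U_S\<close>)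
        then show ?thesis by (simp add: G_def[abs_def] slide_loop_def F_def)
      qed
      \<comment> \<open>From \<open>RC\<close> to \<open>RP\<close> the saddle keeps
        \<open>pa = pb\<close> and reconnects the other four ends. It spends the one that was gained
        in \<open>G\<close> by removing the circle.\<close>
      have saddle1: "fil (Det v RP pc pc pc) (A + 1) (\<lambda>c. c pc = c qc \<and> G c)"
        unfolding RP_def
      proof (rule Det_saddle[OF v])
        show "fil (Det v (\<lambda>c. c pa = c pb \<and> c pc = c qc \<and> c qa = c qb) pc pc pc) A G"
          using G unfolding RC_def[abs_def] .
      qed (use par[OF v] in auto)
      define W where "W c = slide_w (F v c) (c pc) (c qb) (c qc)" for c
      have WU [simp]: "W (U k l n c) = W c" for k l n c by (simp add: W_def)
      have W: "fil (Det v RP pb pc pc) (A + 1) W"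
      proof -
        have "fil (Det v RP pb pc pc) (A + 1) (\<lambda>c. f False True False v (U (c pc) (c pc) (c qc) c))"
          by (rule det_transport[OF R_inv(1) _ _ _ _ _ _ L(1)]) simp_all
        moreover have "fil (Det v RP pb pc pc) (A + 1) (\<lambda>c. c pc = c qc \<and> G c)"
          using det_transport[OF R_inv(1) _ _ _ _ _ _ saddle1, of pb pc pc] by simp
        ultimately have "fil (Det v RP pb pc pc) (A + 1)
            (\<lambda>c. f False True False v (U (c pc) (c pc) (c qc) c) \<oplus> (c pc = c qc \<and> G c))"
          by (rule fil_xor)
        then show ?thesis
          by (rule fil_cong) (simp add: W_def slide_w_def F_def G_def Det_def RP_def)
      qed
      have saddle2: "fil (Det v RR pa pa pa) (A + 2) (\<lambda>c. c pa = c pb \<and> W c)"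
        unfolding RR_def
      proof (rule Det_saddle[OF v])
        have "fil (Det v RP pa pa pa) (A + 1) W"
          using det_transport[OF R_inv(1) _ _ _ _ _ _ W, of pa pa pa] by simp
        then show "fil (Det v (\<lambda>c. c qb = c qc \<and> c pa = c pb \<and> c qa = c pc) pa pa pa) (A + 1) W"
          by (rule fil_set) (auto simp: Det_def RP_def)
      qed (use par[OF v] in auto)
      \<comment> \<open>The constant extension over the circle on the right gains back the one spent
        in \<open>saddle2\<close>.\<close>
      have W': "fil (?loop RR) (A + 1) (\<lambda>c. c pa = c pb \<and> W c)"
      proof -
        have "fil (?loop RR) (A + 1) (\<lambda>c. U (c pa) (c pa) (c pa) c pa = U (c pa) (c pa) (c pa) c pb \<and> W (U (c pa) (c pa) (c pa) c))"
        proof (rule fil_pull[where n = 1, OF saddle2])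
          show "affine_on (?loop RR) (\<lambda>c. U (c pa) (c pa) (c pa) c)"
            by (intro aff_U deg_coord) simp_all
        qed (use RR_loop alg_card_pos[OF RR_loop(1)] in \<open>auto simp: Det_def R_inv intro: U_S\<close>)
        then show ?thesis by simp
      qed
      have saddle3: "fil (Det v RV pc pc pc) (A + 1) (\<lambda>c. c pa = c pb \<and> G c)"
        unfolding RV_def
      proof (rule Det_saddle[OF v])
        show "fil (Det v (\<lambda>c. c pc = c qc \<and> c pa = c pb \<and> c qa = c qb) pc pc pc) A G"
          using G by (rule fil_set) (auto simp: Det_def RC_def)
      qed (use par[OF v] in auto)
      have FUF: "f b1 b2 b3 v (U k l n c) = F v c b1 b2 b3 k l n" for b1 b2 b3 k l n c
        by (simp add: F_def)
      have R: "fil (Det v RI pa qc qb) (A + 3) (\<lambda>c. F v c True True True (c pa) (c pb) (c qc))"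
        "fil (Det v RR qb qb qb) (A + 2) (\<lambda>c. F v c True True False (c pa) (c pb) (c qc))"
        "fil (Det v RC pb pc qb) (A + 2) (\<lambda>c. F v c True False True (c pa) (c pb) (c pb))"
        "fil (Det v RC pb pc qb) (A + 2) (\<lambda>c. F v c False True True (c pc) (c pc) (c qc))"
        "fil (Det v RV pb pc pb) (A + 1) (\<lambda>c. F v c True False False (c pa) (c pb) (c pb))"
        "fil (Det v RV pb pc pb) (A + 1) (\<lambda>c. c pa = c pb \<and> G c)"
        using det_transport[OF R_inv(4) _ _ _ _ _ _ L(3), of pa qc qb]
          det_transport[OF R_inv(3) _ _ _ _ _ _ L(4), of qb qb qb]
          det_transport[OF R_inv(2) _ _ _ _ _ _ L(5), of pb pc qb]
          det_transport[OF R_inv(2) _ _ _ _ _ _ L(2), of pb pc qb]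
          det_transport[OF R_inv(5) _ _ _ _ _ _ L(6), of pb pc pb]
          det_transport[OF R_inv(5) _ _ _ _ _ _ saddle3, of pb pc pb]
        by (simp_all add: FUF)
      have fR: "fil {c\<in>S v. (if s then c m3 = c qb \<and> c m2 = c qc else c m3 = c m2 \<and> c qb = c qc) \<and>
          (if e1 then c pb = c pc \<and> c m1 = c m2 else c pb = c m1 \<and> c pc = c m2) \<and>
          (if e2 then c pa = c m1 \<and> c qa = c m3 else c pa = c qa \<and> c m1 = c m3)}
          (A + (if s then 1 else 0) + (if e1 then 1 else 0) + (if e2 then 1 else 0)) (Z s e1 e2 v)"
      proof (cases s; cases e1; cases e2)
        assume h: "s" "e1" "e2"
        have eq: "Z s e1 e2 v = (\<lambda>c. F v c True True True (c pa) (c pb) (c qc))"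
          by (rule ext) (simp add: Z_def slide_def h)
        show ?thesis unfolding eq by (rule fil_set[OF R(1)]) (auto simp: h Det_def R_defs)
      next
        assume h: "s" "e1" "\<not> e2"
        have eq: "Z s e1 e2 v = (\<lambda>c. F v c True True False (c pa) (c pb) (c qc))"
          by (rule ext) (simp add: Z_def slide_def h)
        show ?thesis unfolding eq by (rule fil_set[OF R(2)]) (auto simp: h Det_def R_defs)
      next
        assume h: "s" "\<not> e1" "e2"
        have eq: "Z s e1 e2 v = (\<lambda>c. F v c True False True (c pa) (c pb) (c pb) \<oplus> F v c False True True (c pc) (c pc) (c qc))"
          by (rule ext) (simp add: Z_def slide_def h)
        show ?thesis unfolding eq by (rule fil_set[OF fil_xor[OF R(3,4)]]) (auto simp: h Det_def R_defs)
      next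
        assume h: "s" "\<not> e1" "\<not> e2"
        have eq: "Z s e1 e2 v = (\<lambda>c. F v c True False False (c pa) (c pb) (c pb) \<oplus> (c pa = c pb \<and> G c))"
          by (rule ext) (simp add: Z_def slide_def h G_def)
        show ?thesis unfolding eq by (rule fil_set[OF fil_xor[OF R(5,6)]]) (auto simp: h Det_def R_defs)
      next
        assume h: "\<not> s" "e1" "\<not> e2"
        have eq: "Z s e1 e2 v = (\<lambda>c. c pa = c pb \<and> W c)"
          by (rule ext) (simp add: Z_def slide_def h W_def)
        show ?thesis unfolding eq by (rule fil_set[OF W']) (auto simp: h Det_def R_defs)
      next
        assume h: "\<not> s" "\<not> e1" "e2"
        have eq: "Z s e1 e2 v = W"
          by (rule ext) (simp add: Z_def slide_def h W_def)
        show ?thesis unfolding eq by (rule fil_set[OF W]) (auto simp: h Det_def R_defs)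
      next
        assume h: "\<not> s" "e1" "e2"
        have "Z s e1 e2 v = (\<lambda>_. False)"
          by (rule ext) (simp add: Z_def slide_def h)
        then show ?thesis by (simp only: fil_False)
      next
        assume h: "\<not> s" "\<not> e1" "\<not> e2"
        have "Z s e1 e2 v = (\<lambda>_. False)"
          by (rule ext) (simp add: Z_def slide_def h)
        then show ?thesis by (simp only: fil_False)
      qed
      show "fil (states Om KR Q (vin y3 s (vin y1 e1 (vin y2 e2 v))))
          (wt KR Q (psi c0) (vin y3 s (vin y1 e1 (vin y2 e2 v))) - j) (z' (vin y3 s (vin y1 e1 (vin y2 e2 v))))"
        unfolding states_KR[OF v] z'[OF v] wt_KR[OF c0 v] using fR by (simp add: A_def algebra_simps)
    qed
    then show ?thesis using w by simp
  qed
  ultimately show "\<exists>z'. cyc Om KR Q z' \<and> (\<forall>c\<in>canon Om KL P. z' (res KR Q (psi c)) (psi c) = z (res KL P c) c) \<and>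
      (\<forall>j. (\<forall>v\<subseteq>KL. fil (states Om KL P v) (wt KL P c0 v - j) (z v)) \<longrightarrow>
         (\<forall>v\<subseteq>KR. fil (states Om KR Q v) (wt KR Q (psi c0) v - (j - 0)) (z' v)))"
    by (intro exI[of _ z'] conjI ballI allI impI) simp_all
qed

end


section \<open>Colourings of sliced diagrams\<close>

text \<open>
  A diagram is read as a sequence of events, one at each time, where \<open>None\<close> stands for a time at which
  nothing happens; this allows to compare diagrams of different lengths.  The point \<open>(t, j)\<close> is the
  strand \<open>j\<close> at height \<open>t\<close>, and there are infinitely many strands of colour \<open>False\<close> to the right.
\<close>

definition step :: "event option \<Rightarrow> (nat \<Rightarrow> bool) \<Rightarrow> (nat \<Rightarrow> bool) \<Rightarrow> bool" where
  "step ev w w' = (case ev of None \<Rightarrow> w' = w | Some (e, i) \<Rightarrow>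
     (\<forall>k<i. w' k = w k) \<and> (\<forall>k\<ge>i. w' (k + outs e) = w (k + ins e)) \<and>
     (e = Cap \<longrightarrow> w i = w (Suc i)) \<and> (e = Cup \<longrightarrow> w' i = w' (Suc i)))"

text \<open>At a crossing \<open>step\<close> leaves the four ends free, and the smoothing ties them
  together. For the positive generator, with \<open>s\<close> true, \<open>False\<close> is the
  vertical smoothing, which is the oriented one in a braid.\<close>

definition smooth :: "event option \<Rightarrow> bool \<Rightarrow> (nat \<Rightarrow> bool) \<Rightarrow> (nat \<Rightarrow> bool) \<Rightarrow> bool" where
  "smooth ev b w w' = (case ev of Some (Crossing s, i) \<Rightarrow>
     if b = s then w i = w (Suc i) \<and> w' i = w' (Suc i) else w i = w' i \<and> w (Suc i) = w' (Suc i) | _ \<Rightarrow> False)"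

definition lv :: "(nat \<times> nat \<Rightarrow> bool) \<Rightarrow> nat \<Rightarrow> nat \<Rightarrow> bool" where
  "lv c t j = c (t, j)"

definition Cs :: "(nat \<Rightarrow> event option) \<Rightarrow> (nat \<times> nat) colouring set" where
  "Cs E = {c. (\<forall>j. \<not> c (0, j)) \<and> (\<forall>t. step (E t) (lv c t) (lv c (Suc t)))}"

definition Xs :: "(nat \<Rightarrow> event option) \<Rightarrow> nat set" where
  "Xs E = {t. \<exists>s i. E t = Some (Crossing s, i)}"

definition Ps :: "(nat \<Rightarrow> event option) \<Rightarrow> (nat, nat \<times> nat) smoothings" where
  "Ps E b t c = smooth (E t) b (lv c t) (lv c (Suc t))"

primrec width :: "(nat \<Rightarrow> event option) \<Rightarrow> nat \<Rightarrow> nat" where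
  "width E 0 = 0"
| "width E (Suc t) = (case E t of None \<Rightarrow> width E t | Some (e, i) \<Rightarrow> width E t - ins e + outs e)"

definition valid :: "(nat \<Rightarrow> event option) \<Rightarrow> bool" where
  "valid E \<longleftrightarrow> (\<forall>t e i. E t = Some (e, i) \<longrightarrow> i + ins e \<le> width E t) \<and>
     (\<exists>N. \<forall>t\<ge>N. E t = None \<and> width E t = 0)"

lemma step_None [simp]: "step None w w' \<longleftrightarrow> w' = w"
  by (simp add: step_def)

lemma step_Some: "step (Some (e, i)) w w' \<longleftrightarrow>
     (\<forall>k<i. w' k = w k) \<and> (\<forall>k\<ge>i. w' (k + outs e) = w (k + ins e)) \<and>
     (e = Cap \<longrightarrow> w i = w (Suc i)) \<and> (e = Cup \<longrightarrow> w' i = w' (Suc i))"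
  by (simp add: step_def)

lemma smooth_crossing: "smooth (Some (Crossing s, i)) b w w' \<longleftrightarrow>
    (if b = s then w i = w (Suc i) \<and> w' i = w' (Suc i) else w i = w' i \<and> w (Suc i) = w' (Suc i))"
  by (simp add: smooth_def)

lemma Cs_step: "c \<in> Cs E \<Longrightarrow> step (E t) (lv c t) (lv c (Suc t))"
  by (simp add: Cs_def)

lemma Cs_zero: "c \<in> Cs E \<Longrightarrow> \<not> c (0, j)"
  by (simp add: Cs_def)

lemma step_xr:
  assumes "step ev w w'" "step ev v v'"
  shows "step ev (\<lambda>k. w k \<oplus> v k) (\<lambda>k. w' k \<oplus> v' k)"
proof (cases ev)
  case None
  then show ?thesis using assms by simp
next
  case (Some ei)
  obtain e i where ei: "ei = (e, i)" by (cases ei)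
  show ?thesis using assms unfolding Some ei step_Some by simp
qed

lemma step_conj:
  assumes "step ev w w'" "step ev v v'"
  shows "step ev (\<lambda>k. w k \<and> v k) (\<lambda>k. w' k \<and> v' k)"
proof (cases ev)
  case None
  then show ?thesis using assms by simp
next
  case (Some ei)
  obtain e i where ei: "ei = (e, i)" by (cases ei)
  show ?thesis using assms unfolding Some ei step_Some by simp
qed

lemma smooth_imp_crossing: "smooth ev b w w' \<Longrightarrow> \<exists>s i. ev = Some (Crossing s, i)"
  by (simp add: smooth_def split: option.splits prod.splits piece.splits)

lemma smooth_xr:
  assumes "smooth ev b w w'" "smooth ev b v v'"
  shows "smooth ev b (\<lambda>k. w k \<oplus> v k) (\<lambda>k. w' k \<oplus> v' k)"
proof -
  obtain s i where ev: "ev = Some (Crossing s, i)" using smooth_imp_crossing[OF assms(1)] by blast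
  show ?thesis using assms unfolding ev smooth_crossing by (cases "b = s") simp_all
qed

lemma smooth_conj:
  assumes "smooth ev b w w'" "smooth ev b v v'"
  shows "smooth ev b (\<lambda>k. w k \<and> v k) (\<lambda>k. w' k \<and> v' k)"
proof -
  obtain s i where ev: "ev = Some (Crossing s, i)" using smooth_imp_crossing[OF assms(1)] by blast
  show ?thesis using assms unfolding ev smooth_crossing by (cases "b = s") simp_all
qed

lemma Cs_beyond:
  assumes "valid E" "c \<in> Cs E" "width E t \<le> j"
  shows "\<not> c (t, j)"
  using assms(3)
proof (induction t arbitrary: j)
  case 0
  then show ?case using Cs_zero[OF assms(2)] by simp
next
  case (Suc t)
  show ?case
  proof (cases "E t")
    case None
    then have "lv c (Suc t) j = lv c t j" using Cs_step[OF assms(2), of t] by simp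
    then show ?thesis using Suc.IH[of j] Suc.prems None by (simp add: lv_def)
  next
    case (Some ev)
    obtain e i where ev: "ev = (e, i)" by (cases ev)
    have i: "i + ins e \<le> width E t" using assms(1) Some ev by (auto simp: valid_def)
    have w: "width E (Suc t) = width E t - ins e + outs e" using Some ev by simp
    define k where "k = j - outs e"
    have k: "j = k + outs e" "i \<le> k" "width E t \<le> k + ins e" using Suc.prems w i by (auto simp: k_def)
    have "lv c (Suc t) (k + outs e) = lv c t (k + ins e)"
      using Cs_step[OF assms(2), of t] k(2) unfolding Some ev step_Some by blast
    then show ?thesis using Suc.IH[OF k(3)] k(1) by (simp add: lv_def)
  qed
qed

lemma finite_Xs: "valid E \<Longrightarrow> finite (Xs E)"
proof -
  assume "valid E"
  then obtain N where "\<forall>t\<ge>N. E t = None" unfolding valid_def by blast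
  then have "t < N" if "t \<in> Xs E" for t using that by (force simp: Xs_def not_less[symmetric])
  then have "Xs E \<subseteq> {..<N}" by blast
  then show ?thesis by (rule finite_subset) simp
qed

lemma finite_Cs: "valid E \<Longrightarrow> finite (Cs E)"
proof -
  assume E: "valid E"
  then obtain N where N: "\<forall>t\<ge>N. width E t = 0" unfolding valid_def by blast
  let ?S = "Sigma {..<N} (\<lambda>t. {..<width E t})"
  have "Cs E \<subseteq> (\<lambda>A p. p \<in> A) ` Pow ?S"
  proof
    fix c assume c: "c \<in> Cs E"
    have "{p. c p} \<subseteq> ?S"
    proof
      fix p assume p: "p \<in> {p. c p}"
      obtain t j where tj: "p = (t, j)" by (cases p)
      have "j < width E t" using Cs_beyond[OF E c, of t j] p tj by (simp add: not_le[symmetric]) blast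
      moreover from this have "t < N" using N by (metis not_less not_less_zero)
      ultimately show "p \<in> ?S" using tj by simp
    qed
    moreover have "c = (\<lambda>p. p \<in> {p. c p})" by simp
    ultimately show "c \<in> (\<lambda>A p. p \<in> A) ` Pow ?S" by (metis (no_types) PowI image_eqI)
  qed
  then show ?thesis by (rule finite_subset) simp
qed

lemma lv_xr: "lv (\<lambda>e. c e \<oplus> c' e) t = (\<lambda>k. lv c t k \<oplus> lv c' t k)"
  by (simp add: lv_def fun_eq_iff)

lemma lv_conj: "lv (\<lambda>e. c e \<and> c' e) t = (\<lambda>k. lv c t k \<and> lv c' t k)"
  by (simp add: lv_def fun_eq_iff)

lemma lv_False: "lv (\<lambda>_. False) t = (\<lambda>_. False)"
  by (simp add: lv_def fun_eq_iff)

lemma alg_Cs: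
  assumes "valid E" "X \<subseteq> Xs E"
  shows "alg (states (Cs E) X (Ps E) v)"
proof (rule algI)
  show "finite (states (Cs E) X (Ps E) v)"
    by (rule finite_subset[OF _ finite_Cs[OF assms(1)]]) (auto simp: states_def)
  have "step ev (\<lambda>_. False) (\<lambda>_. False)" for ev
    by (auto simp: step_def split: option.splits)
  moreover have "smooth (E t) b (\<lambda>_. False) (\<lambda>_. False)" if "t \<in> X" for t b
    using that assms(2) by (auto simp: Xs_def smooth_crossing)
  ultimately show "(\<lambda>_. False) \<in> states (Cs E) X (Ps E) v"
    by (simp add: states_def Cs_def Ps_def lv_False)
  fix c c' assume c: "c \<in> states (Cs E) X (Ps E) v" and c': "c' \<in> states (Cs E) X (Ps E) v"
  show "(\<lambda>e. c e \<oplus> c' e) \<in> states (Cs E) X (Ps E) v"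
    using c c' by (simp add: states_def Cs_def Ps_def lv_xr step_xr smooth_xr)
  show "(\<lambda>e. c e \<and> c' e) \<in> states (Cs E) X (Ps E) v"
    using c c' by (simp add: states_def Cs_def Ps_def lv_conj step_conj smooth_conj)
qed

lemma cube_Cs: "valid E \<Longrightarrow> cube (Cs E) (Xs E) (Ps E)"
  unfolding cube_def using finite_Xs alg_Cs by simp

definition SUB :: "int \<Rightarrow> (nat \<Rightarrow> event option) \<Rightarrow> (nat \<Rightarrow> event option) \<Rightarrow> bool" where
  "SUB a E E' = sub a (Cs E) (Xs E) (Ps E) (Cs E') (Xs E') (Ps E')"

subsection \<open>Parity\<close>

lemma parity_Un: "finite A \<Longrightarrow> finite B \<Longrightarrow> A \<inter> B = {} \<Longrightarrow> parity (A \<union> B) Q = (parity A Q \<oplus> parity B Q)"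
proof (induction A rule: finite_induct)
  case (insert x A)
  then show ?case by (simp add: parity_insert xr_ac)
qed simp

lemma parity_split:
  fixes i a n :: nat
  assumes "i + a \<le> n"
  shows "parity {..<n} w = (parity {..<i} w \<oplus> (parity {i..<i + a} w \<oplus> parity {i..<n - a} (\<lambda>k. w (k + a))))"
proof -
  have "{..<i} \<union> ({i..<i + a} \<union> {i + a..<n}) = {..<n}" using assms by auto
  moreover have "parity ({..<i} \<union> ({i..<i + a} \<union> {i + a..<n})) w
      = (parity {..<i} w \<oplus> (parity {i..<i + a} w \<oplus> parity {i + a..<n} w))"
    by (subst parity_Un, simp, simp, force, subst parity_Un) auto
  moreover have "{i + a..<n} = (\<lambda>k. k + a) ` {i..<n - a}"
    using assms by (simp add: image_add_atLeastLessThan')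
  moreover have "parity ((\<lambda>k. k + a) ` {i..<n - a}) w = parity {i..<n - a} (\<lambda>k. w (k + a))"
    by (rule parity_image) simp
  ultimately show ?thesis by (simp only:)
qed

lemma parity_two: "parity {i..<i + 2} w = (w i \<oplus> w (Suc i))"
proof -
  have "{i..<i + 2} = {i, Suc i}" by auto
  then show ?thesis by (simp add: parity_insert)
qed

lemma parity_three: "parity {i..<i + 3} w = (w i \<oplus> (w (Suc i) \<oplus> w (Suc (Suc i))))"
proof -
  have "{i..<i + 3} = {i, Suc i, Suc (Suc i)}" by auto
  then show ?thesis by (simp add: parity_insert)
qed

text \<open>Once crossings are smoothed, every piece pairs up equally coloured ends among those it
  touches, and it merely shifts the other strands.\<close>

lemma parity_step:
  assumes s: "step ev w w'" and ev: "ev = Some (e, i)" "i + ins e \<le> n"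
    and sm: "\<And>s. e = Crossing s \<Longrightarrow> \<exists>b. smooth ev b w w'"
  shows "parity {..<n - ins e + outs e} w' = parity {..<n} w"
proof -
  have st: "\<And>k. k < i \<Longrightarrow> w' k = w k" "\<And>k. k \<ge> i \<Longrightarrow> w' (k + outs e) = w (k + ins e)"
    "e = Cap \<Longrightarrow> w i = w (Suc i)" "e = Cup \<Longrightarrow> w' i = w' (Suc i)"
    using s unfolding ev(1) step_Some by blast+
  have "parity {..<i} w' = parity {..<i} w"
    by (rule parity_cong) (use st(1) in simp)
  moreover have "parity {i..<n - ins e} (\<lambda>k. w' (k + outs e)) = parity {i..<n - ins e} (\<lambda>k. w (k + ins e))"
    by (rule parity_cong) (use st(2) in simp)
  moreover have "parity {i..<i + outs e} w' = parity {i..<i + ins e} w"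
  proof (cases e)
    case Cup
    then show ?thesis using st(4) by (simp add: parity_two[simplified])
  next
    case Cap
    then show ?thesis using st(3) by (simp add: parity_two[simplified])
  next
    case (Crossing s)
    then obtain b where "smooth (Some (Crossing s, i)) b w w'" using sm ev by auto
    then show ?thesis using Crossing
      by (cases "b = s") (simp_all add: parity_two[simplified] smooth_crossing)
  qed
  moreover have "i + outs e \<le> n - ins e + outs e" using ev(2) by simp
  ultimately show ?thesis
    using parity_split[OF ev(2), of w] parity_split[of i "outs e" "n - ins e + outs e" w'] by simp
qed

lemma parity_level:
  assumes E: "valid E" and c: "c \<in> Cs E" and r: "t \<in> Xs E \<Longrightarrow> \<exists>b. Ps E b t c"
  shows "parity {..<width E (Suc t)} (lv c (Suc t)) = parity {..<width E t} (lv c t)"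
proof (cases "E t")
  case None
  then show ?thesis using Cs_step[OF c, of t] by simp
next
  case (Some ev)
  obtain e i where ev: "ev = (e, i)" by (cases ev)
  have "i + ins e \<le> width E t" using E Some ev by (auto simp: valid_def)
  from parity_step[OF Cs_step[OF c] _ this, of t] show ?thesis
    using Some ev r by (auto simp: Xs_def Ps_def)
qed

lemma parity_below:
  assumes "valid E" "c \<in> Cs E" "\<And>s. s < t \<Longrightarrow> s \<in> Xs E \<Longrightarrow> \<exists>b. Ps E b s c"
  shows "\<not> parity {..<width E t} (lv c t)"
  using assms(3)
proof (induction t)
  case (Suc t)
  then show ?case using parity_level[OF assms(1,2), of t] by simp
qed simp

text \<open>The width vanishes from some height on, so the parity is traced downwards from
  there.\<close>

lemma parity_above:
  assumes "valid E" "c \<in> Cs E" "\<And>s. s \<ge> t \<Longrightarrow> s \<in> Xs E \<Longrightarrow> \<exists>b. Ps E b s c"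
  shows "\<not> parity {..<width E t} (lv c t)"
proof -
  have "parity {..<width E (t + n)} (lv c (t + n)) = parity {..<width E t} (lv c t)" for n
    by (induction n) (use parity_level[OF assms(1,2)] assms(3) in simp_all)
  moreover obtain N where "\<forall>t\<ge>N. width E t = 0" using assms(1) unfolding valid_def by blast
  then have "width E (t + N) = 0" by simp
  ultimately show ?thesis by (metis lessThan_0 parity_empty)
qed


lemma Cs_change:
  assumes c: "c \<in> Cs E" and E': "\<And>s. s \<noteq> t \<Longrightarrow> s \<noteq> Suc t \<Longrightarrow> E' s = E s"
    and c': "\<And>s. s \<noteq> Suc t \<Longrightarrow> lv c' s = lv c s"
    and st: "step (E' t) (lv c t) (lv c' (Suc t))" "step (E' (Suc t)) (lv c' (Suc t)) (lv c (Suc (Suc t)))"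
  shows "c' \<in> Cs E'"
  unfolding Cs_def
proof (intro CollectI conjI allI)
  show "\<not> c' (0, j)" for j
    using Cs_zero[OF c, of j] fun_cong[OF c'[of 0], of j] by (simp add: lv_def)
  show "step (E' s) (lv c' s) (lv c' (Suc s))" for s
  proof -
    consider "s = t" | "s = Suc t" | "s \<noteq> t" "s \<noteq> Suc t" by blast
    then show ?thesis using Cs_step[OF c, of s] st by cases (simp_all add: c' E')
  qed
qed

lemma Ps_eq: "lv c' s = lv c s \<Longrightarrow> lv c' (Suc s) = lv c (Suc s) \<Longrightarrow> E' s = E s \<Longrightarrow> Ps E' b s c' = Ps E b s c"
  by (simp add: Ps_def)

lemma Xs_upd_None: "Xs (E(t := None)) = Xs E - {t}"
  by (auto simp: Xs_def)

lemma Ps_upd: "s \<noteq> t \<Longrightarrow> Ps (E(t := ev)) b s c = Ps E b s c"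
  by (simp add: Ps_def)

lemma step_vert: "step (Some (Crossing s, i)) w w' \<Longrightarrow> (w i = w' i \<and> w (Suc i) = w' (Suc i)) = (w' = w)"
proof
  assume st: "step (Some (Crossing s, i)) w w'" and eq: "w i = w' i \<and> w (Suc i) = w' (Suc i)"
  show "w' = w"
  proof
    fix k
    consider "k < i" | "k = i" | "k = Suc i" | "k \<ge> i + 2" by linarith
    then show "w' k = w k"
    proof cases
      case 4
      then have "k = (k - 2) + 2" "k - 2 \<ge> i" by simp_all
      then show ?thesis using st unfolding step_Some by (metis outs.simps(3) ins.simps(3))
    qed (use st eq in \<open>auto simp: step_Some\<close>)
  qed
qed simp

lemma step_crossing_refl: "step (Some (Crossing s, i)) w w"
  by (simp add: step_Some)

lemma step_crossing: "step (Some (Crossing s, i)) w w' \<longleftrightarrow> (\<forall>k. k \<noteq> i \<longrightarrow> k \<noteq> Suc i \<longrightarrow> w' k = w k)"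
proof
  assume st: "step (Some (Crossing s, i)) w w'"
  show "\<forall>k. k \<noteq> i \<longrightarrow> k \<noteq> Suc i \<longrightarrow> w' k = w k"
  proof (intro allI impI)
    fix k assume k: "k \<noteq> i" "k \<noteq> Suc i"
    show "w' k = w k"
    proof (cases "k < i")
      case False
      then have "k = (k - 2) + 2" "k - 2 \<ge> i" using k by simp_all
      then show ?thesis using st unfolding step_Some by (metis outs.simps(3) ins.simps(3))
    qed (use st in \<open>simp add: step_Some\<close>)
  qed
qed (simp add: step_Some)

text \<open>The vertical smoothing leaves the row of colours unchanged, exactly like an idle
  time.\<close>

lemma Cs_upd_None:
  assumes "E t = Some (Crossing s, i)"
  shows "Cs (E(t := None)) = {c\<in>Cs E. Ps E (\<not> s) t c}"
proof -
  have 1: "Ps E (\<not> s) t c \<longleftrightarrow> lv c t i = lv c (Suc t) i \<and> lv c t (Suc i) = lv c (Suc t) (Suc i)" for c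
    by (simp add: Ps_def assms smooth_crossing)
  have 2: "(\<forall>u. step ((E(t := None)) u) (lv c u) (lv c (Suc u))) \<longleftrightarrow>
      (\<forall>u. step (E u) (lv c u) (lv c (Suc u))) \<and> lv c (Suc t) = lv c t" for c
  proof (intro iffI conjI allI)
    assume h: "\<forall>u. step ((E(t := None)) u) (lv c u) (lv c (Suc u))"
    from h[rule_format, of t] show l: "lv c (Suc t) = lv c t" by simp
    show "step (E u) (lv c u) (lv c (Suc u))" for u
      using h[rule_format, of u] l step_crossing_refl[of s i "lv c t"] assms by (cases "u = t") simp_all
  next
    fix u assume h: "(\<forall>u. step (E u) (lv c u) (lv c (Suc u))) \<and> lv c (Suc t) = lv c t"
    then have "step (E u) (lv c u) (lv c (Suc u))" by blast
    then show "step ((E(t := None)) u) (lv c u) (lv c (Suc u))" using h by (cases "u = t") simp_all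
  qed
  have "step (E t) (lv c t) (lv c (Suc t)) \<Longrightarrow> Ps E (\<not> s) t c \<longleftrightarrow> lv c (Suc t) = lv c t" for c
    unfolding 1 assms by (rule step_vert)
  then have "(\<forall>u. step (E u) (lv c u) (lv c (Suc u))) \<and> Ps E (\<not> s) t c \<longleftrightarrow>
      (\<forall>u. step (E u) (lv c u) (lv c (Suc u))) \<and> lv c (Suc t) = lv c t" for c
    by metis
  then show ?thesis unfolding Cs_def 2 by simp
qed

lemma width_upd_None:
  assumes "valid E" "E t = Some (Crossing s, i)"
  shows "width (E(t := None)) u = width E u"
proof (induction u)
  case (Suc u)
  have "i + 2 \<le> width E t" using assms unfolding valid_def by fastforce
  then show ?case using Suc assms(2) by (cases "u = t") (auto split: option.splits)
qed simp

lemma valid_upd_None: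
  assumes "valid E" "E t = Some (Crossing s, i)"
  shows "valid (E(t := None))"
  using assms(1) unfolding valid_def width_upd_None[OF assms] by auto

lemma sub_P_cong:
  assumes "cube Om X P" "\<And>b x c. x \<in> X \<Longrightarrow> c \<in> Om \<Longrightarrow> P' b x c = P b x c"
  shows "sub 0 Om X P Om X P'"
  by (rule sub_iso[where h = "\<lambda>x. x" and t = "\<lambda>c. c" and s = "\<lambda>c. c"])
    (use assms in \<open>auto intro: affine_on_id\<close>)

lemma SUB_trans: "SUB a E E' \<Longrightarrow> SUB b E' E'' \<Longrightarrow> SUB (a + b) E E''"
  unfolding SUB_def by (rule sub_trans)

lemma SUB_refl: "SUB 0 E E"
  unfolding SUB_def by (rule sub_refl)

lemma sub_0_trans: "sub 0 Om X P Om' X' P' \<Longrightarrow> sub 0 Om' X' P' Om'' X'' P'' \<Longrightarrow> sub 0 Om X P Om'' X'' P''"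
  using sub_trans[of 0 Om X P Om' X' P' 0] by simp

lemma lv_upd: "lv (c((s, j) := b)) u = (if u = s then (lv c u)(j := b) else lv c u)"
  by (auto simp: lv_def fun_eq_iff)

subsection \<open>Invariance under the first move\<close>

lemma SUB_None:
  assumes E: "valid E" and t: "E t = Some (Crossing s, i)"
    and sub: "sub 0 {c\<in>Cs E. Ps E (\<not> s) t c} (Xs E - {t}) (Ps E) (Cs E) (insert t (Xs E - {t})) (Ps E)"
      "sub 0 (Cs E) (insert t (Xs E - {t})) (Ps E) {c\<in>Cs E. Ps E (\<not> s) t c} (Xs E - {t}) (Ps E)"
  shows "SUB 0 (E(t := None)) E" "SUB 0 E (E(t := None))"
proof -
  let ?E = "E(t := None)"
  have X: "Xs ?E = Xs E - {t}" by (rule Xs_upd_None)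
  have ins: "insert t (Xs E - {t}) = Xs E" using t by (auto simp: Xs_def)
  have C: "Cs ?E = {c\<in>Cs E. Ps E (\<not> s) t c}" by (rule Cs_upd_None[where E = E and t = t, OF t])
  have cu: "cube (Cs ?E) (Xs ?E) (Ps ?E)" by (rule cube_Cs[OF valid_upd_None[OF E t]])
  have Pe: "Ps E b x c = Ps ?E b x c" if "x \<in> Xs ?E" for b x c
    using that unfolding X by (simp add: Ps_upd)
  have st: "states (Cs ?E) (Xs ?E) (Ps E) v = states (Cs ?E) (Xs ?E) (Ps ?E) v" for v
    by (rule states_cong) (rule Pe)
  have cu': "cube (Cs ?E) (Xs ?E) (Ps E)" using cu unfolding cube_def st .
  have s1: "sub 0 (Cs ?E) (Xs ?E) (Ps ?E) (Cs ?E) (Xs ?E) (Ps E)" by (rule sub_P_cong[OF cu Pe])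
  have s2: "sub 0 (Cs ?E) (Xs ?E) (Ps E) (Cs ?E) (Xs ?E) (Ps ?E)" by (rule sub_P_cong[OF cu' Pe[symmetric]])
  show "SUB 0 ?E E" unfolding SUB_def
    by (rule sub_0_trans[OF s1]) (use sub(1) in \<open>simp only: C X ins\<close>)
  show "SUB 0 E ?E" unfolding SUB_def
    by (rule sub_0_trans[OF _ s2]) (use sub(2) in \<open>simp only: C X ins\<close>)
qed

text \<open>The two ends under the cap take the part of \<open>y1\<close>, \<open>y2\<close> and can
  be recoloured together. The smoothing named by \<open>s\<close> is the horizontal one and closes
  them off to a circle.\<close>

lemma SUB_R1_cap:
  assumes E: "valid E" and t: "E t = Some (Crossing s, i)" "E (Suc t) = Some (Cap, i)"
  shows "SUB 0 (E(t := None)) E" "SUB 0 E (E(t := None))"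
proof -
  have ins: "insert t (Xs E - {t}) = Xs E" using t by (auto simp: Xs_def)
  have cap: "lv c (Suc t) i = lv c (Suc t) (Suc i)" if "c \<in> Cs E" for c
    using Cs_step[OF that, of "Suc t"] unfolding t(2) step_Some by simp
  interpret R1 "Cs E" "Xs E - {t}" "Ps E" t s "(t, i)" "(t, Suc i)" "(Suc t, i)" "(Suc t, Suc i)"
  proof
    show "finite (Xs E - {t})" using finite_Xs[OF E] by simp
    show "cube (Cs E) (insert t (Xs E - {t})) (Ps E)" unfolding ins by (rule cube_Cs[OF E])
    show "c (Suc t, i) = c (Suc t, Suc i)" if "c \<in> Cs E" for c
      using cap[OF that] by (simp add: lv_def)
    show "Ps E s t c \<longleftrightarrow> c (t, i) = c (t, Suc i)" if "c \<in> Cs E" for c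
      using cap[OF that] by (simp add: Ps_def t(1) smooth_crossing lv_def)
    show "Ps E (\<not> s) t c \<longleftrightarrow> c (t, i) = c (Suc t, i) \<and> c (t, Suc i) = c (Suc t, Suc i)" for c
      by (simp add: Ps_def t(1) smooth_crossing lv_def)
    show "c((Suc t, i) := b, (Suc t, Suc i) := b) \<in> Cs E" if c: "c \<in> Cs E" for c b
    proof (rule Cs_change[OF c, where t = t])
      show "step (E t) (lv c t) (lv (c((Suc t, i) := b, (Suc t, Suc i) := b)) (Suc t))"
        using Cs_step[OF c, of t] by (simp add: t(1) step_crossing lv_upd)
      show "step (E (Suc t)) (lv (c((Suc t, i) := b, (Suc t, Suc i) := b)) (Suc t)) (lv c (Suc (Suc t)))"
        using Cs_step[OF c, of "Suc t"] by (simp add: t(2) step_Some lv_upd)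
    qed (simp_all add: lv_upd)
    show "Ps E b y (c((Suc t, i) := u, (Suc t, Suc i) := u)) = Ps E b y c" if "y \<in> Xs E - {t}" for y b u c
    proof (rule Ps_eq)
      have "y \<noteq> t" "y \<noteq> Suc t" using that t(2) by (auto simp: Xs_def)
      then show "lv (c((Suc t, i) := u, (Suc t, Suc i) := u)) y = lv c y"
        "lv (c((Suc t, i) := u, (Suc t, Suc i) := u)) (Suc y) = lv c (Suc y)"
        by (simp_all add: lv_upd)
    qed simp
  qed simp_all
  show "SUB 0 (E(t := None)) E" "SUB 0 E (E(t := None))"
    by (rule SUB_None[OF E t(1) sub_from sub_to])+
qed

lemma SUB_R1_cup:
  assumes E: "valid E" and t: "E t = Some (Cup, i)" "E (Suc t) = Some (Crossing s, i)"
  shows "SUB 0 (E(Suc t := None)) E" "SUB 0 E (E(Suc t := None))"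
proof -
  have ins: "insert (Suc t) (Xs E - {Suc t}) = Xs E" using t by (auto simp: Xs_def)
  have cup: "lv c (Suc t) i = lv c (Suc t) (Suc i)" if "c \<in> Cs E" for c
    using Cs_step[OF that, of t] unfolding t(1) step_Some by simp
  interpret R1 "Cs E" "Xs E - {Suc t}" "Ps E" "Suc t" s "(Suc (Suc t), i)" "(Suc (Suc t), Suc i)" "(Suc t, i)" "(Suc t, Suc i)"
  proof
    show "finite (Xs E - {Suc t})" using finite_Xs[OF E] by simp
    show "cube (Cs E) (insert (Suc t) (Xs E - {Suc t})) (Ps E)" unfolding ins by (rule cube_Cs[OF E])
    show "c (Suc t, i) = c (Suc t, Suc i)" if "c \<in> Cs E" for c
      using cup[OF that] by (simp add: lv_def)
    show "Ps E s (Suc t) c \<longleftrightarrow> c (Suc (Suc t), i) = c (Suc (Suc t), Suc i)" if "c \<in> Cs E" for c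
      using cup[OF that] by (simp add: Ps_def t(2) smooth_crossing lv_def)
    show "Ps E (\<not> s) (Suc t) c \<longleftrightarrow> c (Suc (Suc t), i) = c (Suc t, i) \<and> c (Suc (Suc t), Suc i) = c (Suc t, Suc i)" for c
      by (auto simp: Ps_def t(2) smooth_crossing lv_def)
    show "c((Suc t, i) := b, (Suc t, Suc i) := b) \<in> Cs E" if c: "c \<in> Cs E" for c b
    proof (rule Cs_change[OF c, where t = t])
      show "step (E t) (lv c t) (lv (c((Suc t, i) := b, (Suc t, Suc i) := b)) (Suc t))"
        using Cs_step[OF c, of t] by (simp add: t(1) step_Some lv_upd)
      show "step (E (Suc t)) (lv (c((Suc t, i) := b, (Suc t, Suc i) := b)) (Suc t)) (lv c (Suc (Suc t)))"
        using Cs_step[OF c, of "Suc t"] by (simp add: t(2) step_crossing lv_upd)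
    qed (simp_all add: lv_upd)
    show "Ps E b y (c((Suc t, i) := u, (Suc t, Suc i) := u)) = Ps E b y c" if "y \<in> Xs E - {Suc t}" for y b u c
    proof (rule Ps_eq)
      have "y \<noteq> t" "y \<noteq> Suc t" using that t(1) by (auto simp: Xs_def)
      then show "lv (c((Suc t, i) := u, (Suc t, Suc i) := u)) y = lv c y"
        "lv (c((Suc t, i) := u, (Suc t, Suc i) := u)) (Suc y) = lv c (Suc y)"
        by (simp_all add: lv_upd)
    qed simp
  qed simp_all
  show "SUB 0 (E(Suc t := None)) E" "SUB 0 E (E(Suc t := None))"
    by (rule SUB_None[OF E t(2) sub_from sub_to])+
qed

subsection \<open>Invariance under the second move\<close>

text \<open>The parity is traced from the bottom up to the block and from the top down to it, so
  crossings inside may stay unresolved. Outside the columns of the block the two rows agree, which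
  leaves equal parities of its lower and upper ends.\<close>

lemma parity_gap:
  assumes E: "valid E" and c: "c \<in> Cs E"
    and r: "\<And>s. s < t \<or> s \<ge> t' \<Longrightarrow> s \<in> Xs E \<Longrightarrow> \<exists>b. Ps E b s c"
    and w: "width E t' = width E t" "i + a \<le> width E t"
    and eq: "\<And>k. k < i \<or> k \<ge> i + a \<Longrightarrow> lv c t' k = lv c t k"
  shows "parity {i..<i + a} (lv c t) = parity {i..<i + a} (lv c t')"
proof -
  have "\<not> parity {..<width E t} (lv c t)" by (rule parity_below[OF E c]) (use r in auto)
  moreover have "\<not> parity {..<width E t} (lv c t')"
    using parity_above[OF E c, of t'] r w(1) by auto
  moreover have "parity {..<i} (lv c t) = parity {..<i} (lv c t')"
    by (rule parity_cong) (use eq in simp)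
  moreover have "parity {i..<width E t - a} (\<lambda>k. lv c t (k + a)) = parity {i..<width E t - a} (\<lambda>k. lv c t' (k + a))"
    by (rule parity_cong) (use eq in simp)
  ultimately show ?thesis
    unfolding parity_split[OF w(2)] by (auto simp: xr_def)
qed

lemma width_crossing: "valid E \<Longrightarrow> E t = Some (Crossing s, i) \<Longrightarrow> width E (Suc t) = width E t \<and> i + 2 \<le> width E t"
  unfolding valid_def by fastforce

lemma SUB_None2:
  assumes E: "valid E" and t: "E t = Some (Crossing s, i)" "E (Suc t) = Some (Crossing (\<not> s), i)"
    and X: "X = Xs E - {t, Suc t}"
    and sub: "sub 0 {c\<in>Cs E. Ps E (\<not> s) t c \<and> Ps E s (Suc t) c} X (Ps E) (Cs E) (insert t (insert (Suc t) X)) (Ps E)"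
      "sub 0 (Cs E) (insert t (insert (Suc t) X)) (Ps E) {c\<in>Cs E. Ps E (\<not> s) t c \<and> Ps E s (Suc t) c} X (Ps E)"
  shows "SUB 0 (E(t := None, Suc t := None)) E" "SUB 0 E (E(t := None, Suc t := None))"
proof -
  let ?F = "E(t := None)"
  let ?E = "E(t := None, Suc t := None)"
  have t': "?F (Suc t) = Some (Crossing (\<not> s), i)" using t(2) by simp
  have XE: "Xs ?E = X" unfolding X Xs_upd_None by auto
  have ins: "insert t (insert (Suc t) X) = Xs E" using t by (auto simp: Xs_def X)
  have C: "Cs ?E = {c\<in>Cs E. Ps E (\<not> s) t c \<and> Ps E s (Suc t) c}"
    unfolding Cs_upd_None[where E = ?F and t = "Suc t", OF t'] Cs_upd_None[where E = E and t = t, OF t(1)] by (auto simp: Ps_upd)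
  have cu: "cube (Cs ?E) (Xs ?E) (Ps ?E)"
    by (rule cube_Cs[OF valid_upd_None[OF valid_upd_None[OF E t(1)] t']])
  have Pe: "Ps E b x c = Ps ?E b x c" if "x \<in> Xs ?E" for b x c
    using that unfolding XE X by (simp add: Ps_upd)
  have st: "states (Cs ?E) (Xs ?E) (Ps E) v = states (Cs ?E) (Xs ?E) (Ps ?E) v" for v
    by (rule states_cong) (rule Pe)
  have cu': "cube (Cs ?E) (Xs ?E) (Ps E)" using cu unfolding cube_def st .
  have s1: "sub 0 (Cs ?E) (Xs ?E) (Ps ?E) (Cs ?E) (Xs ?E) (Ps E)" by (rule sub_P_cong[OF cu Pe])
  have s2: "sub 0 (Cs ?E) (Xs ?E) (Ps E) (Cs ?E) (Xs ?E) (Ps ?E)" by (rule sub_P_cong[OF cu' Pe[symmetric]])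
  show "SUB 0 ?E E" unfolding SUB_def
    by (rule sub_0_trans[OF s1]) (use sub(1) in \<open>simp only: C XE ins\<close>)
  show "SUB 0 E ?E" unfolding SUB_def
    by (rule sub_0_trans[OF _ s2]) (use sub(2) in \<open>simp only: C XE ins\<close>)
qed

lemma SUB_R2:
  assumes E: "valid E" and t: "E t = Some (Crossing s, i)" "E (Suc t) = Some (Crossing (\<not> s), i)"
  shows "SUB 0 (E(t := None, Suc t := None)) E" "SUB 0 E (E(t := None, Suc t := None))"
proof -
  define X where "X = Xs E - {t, Suc t}"
  have fX: "finite X" using finite_Xs[OF E] by (simp add: X_def)
  have alg: "alg (states (Cs E) X (Ps E) v)" for v
    by (rule alg_Cs[OF E]) (auto simp: X_def)
  have par: "(c (t, i) \<noteq> c (t, Suc i)) = (c (Suc (Suc t), i) \<noteq> c (Suc (Suc t), Suc i))"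
    if c: "c \<in> states (Cs E) X (Ps E) v" for c v
  proof -
    have cC: "c \<in> Cs E" using states_Om[OF c] .
    have "parity {i..<i + 2} (lv c t) = parity {i..<i + 2} (lv c (Suc (Suc t)))"
    proof (rule parity_gap[OF E cC])
      show "\<exists>b. Ps E b s c" if "s < t \<or> s \<ge> Suc (Suc t)" "s \<in> Xs E" for s
      proof -
        have "s \<in> X" using that by (auto simp: X_def)
        then show ?thesis using c unfolding states_def by blast
      qed
      show "width E (Suc (Suc t)) = width E t" "i + 2 \<le> width E t"
        using width_crossing[OF E t(1)] width_crossing[OF E t(2)] by auto
      show "lv c (Suc (Suc t)) k = lv c t k" if "k < i \<or> k \<ge> i + 2" for k
        using Cs_step[OF cC, of t] Cs_step[OF cC, of "Suc t"] that unfolding t step_crossing by auto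
    qed
    then show ?thesis unfolding parity_two by (auto simp: xr_def lv_def)
  qed
  have upd: "c((Suc t, i) := a, (Suc t, Suc i) := b) \<in> Cs E" if c: "c \<in> Cs E" for c a b
  proof (rule Cs_change[OF c, where t = t])
    show "step (E t) (lv c t) (lv (c((Suc t, i) := a, (Suc t, Suc i) := b)) (Suc t))"
      using Cs_step[OF c, of t] by (simp add: t(1) step_crossing lv_upd)
    show "step (E (Suc t)) (lv (c((Suc t, i) := a, (Suc t, Suc i) := b)) (Suc t)) (lv c (Suc (Suc t)))"
      using Cs_step[OF c, of "Suc t"] by (simp add: t(2) step_crossing lv_upd)
  qed (simp_all add: lv_upd)
  have outer: "Ps E b y (c((Suc t, i) := u, (Suc t, Suc i) := u')) = Ps E b y c" if "y \<in> X" for y b u u' c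
  proof (rule Ps_eq)
    have "y \<noteq> t" "y \<noteq> Suc t" using that by (auto simp: X_def)
    then show "lv (c((Suc t, i) := u, (Suc t, Suc i) := u')) y = lv c y"
      "lv (c((Suc t, i) := u, (Suc t, Suc i) := u')) (Suc y) = lv c (Suc y)"
      by (simp_all add: lv_upd)
  qed simp
  have Pt: "Ps E b t c \<longleftrightarrow> (if b = s then c (t, i) = c (t, Suc i) \<and> c (Suc t, i) = c (Suc t, Suc i)
      else c (t, i) = c (Suc t, i) \<and> c (t, Suc i) = c (Suc t, Suc i))" for b c
    by (simp add: Ps_def t(1) smooth_crossing lv_def)
  have Pt': "Ps E b (Suc t) c \<longleftrightarrow> (if b = s then c (Suc t, i) = c (Suc (Suc t), i) \<and> c (Suc t, Suc i) = c (Suc (Suc t), Suc i)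
      else c (Suc t, i) = c (Suc t, Suc i) \<and> c (Suc (Suc t), i) = c (Suc (Suc t), Suc i))" for b c
    by (auto simp: Ps_def t(2) smooth_crossing lv_def)
  have "sub 0 {c\<in>Cs E. Ps E (\<not> s) t c \<and> Ps E s (Suc t) c} X (Ps E) (Cs E) (insert t (insert (Suc t) X)) (Ps E) \<and>
      sub 0 (Cs E) (insert t (insert (Suc t) X)) (Ps E) {c\<in>Cs E. Ps E (\<not> s) t c \<and> Ps E s (Suc t) c} X (Ps E)"
  proof (cases s)
    case True
    interpret R2 "Cs E" X "Ps E" t "Suc t" "(t, i)" "(t, Suc i)" "(Suc (Suc t), i)" "(Suc (Suc t), Suc i)" "(Suc t, i)" "(Suc t, Suc i)"
      by unfold_locales (use fX alg par upd outer True in \<open>simp_all add: X_def Pt Pt'\<close>)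
    show ?thesis using sub_from sub_to True by simp
  next
    case False
    \<comment> \<open>The other sign is the same configuration upside down: the crossings and the
      two pairs of ends exchange roles.\<close>
    interpret R2 "Cs E" X "Ps E" "Suc t" t "(Suc (Suc t), i)" "(Suc (Suc t), Suc i)" "(t, i)" "(t, Suc i)" "(Suc t, i)" "(Suc t, Suc i)"
      by unfold_locales (use fX alg par upd outer False in \<open>simp_all add: X_def Pt Pt'\<close>, auto)
    have "{c\<in>Cs E. Ps E False (Suc t) c \<and> Ps E True t c} = {c\<in>Cs E. Ps E True t c \<and> Ps E False (Suc t) c}" by auto
    then show ?thesis using sub_from sub_to False by (simp add: insert_commute)
  qed
  then show "SUB 0 (E(t := None, Suc t := None)) E" "SUB 0 E (E(t := None, Suc t := None))"
    using SUB_None2[OF E t X_def] by blast+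
qed

subsection \<open>Crossing changes\<close>

lemma SUB_crossing_change:
  assumes E: "valid E" and t: "E t = Some (Crossing s, i)"
  shows "SUB 2 E (E(t := Some (Crossing (\<not> s), i)))"
proof -
  let ?E = "E(t := Some (Crossing (\<not> s), i))"
  have C: "Cs ?E = Cs E"
  proof -
    have "step (?E u) w w' = step (E u) w w'" for u w w'
      by (cases "u = t") (simp_all add: t step_crossing)
    then show ?thesis by (simp add: Cs_def)
  qed
  have X: "insert t (Xs E - {t}) = Xs E" "Xs ?E = Xs E" using t by (auto simp: Xs_def)
  have "sub 2 (Cs E) (insert t (Xs E - {t})) (Ps E) (Cs E) (insert t (Xs E - {t})) (Ps ?E)"
  \<comment> \<open>Under the smoothing \<open>True\<close> two arcs are left, and the two points
    lie one on each: for true \<open>s\<close> these are the arcs below and above, otherwise the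
    left and the right strand.\<close>
  proof (rule sub_crossing_change[where e = "(t, i)" and e' = "if s then (Suc t, i) else (t, Suc i)"])
    show "finite (Xs E - {t})" using finite_Xs[OF E] by simp
    show "Ps ?E b t c = Ps E (\<not> b) t c" for b c
      by (cases s; cases b) (simp_all add: Ps_def t smooth_crossing)
    show "Ps E False t c \<longleftrightarrow> c (t, i) = c (if s then (Suc t, i) else (t, Suc i))" if "Ps E True t c" for c
      using that by (cases s) (auto simp: Ps_def t smooth_crossing lv_def)
  qed (simp_all add: Ps_upd)
  then show ?thesis unfolding SUB_def C X .
qed


subsection \<open>Invariance under the third move\<close>

text \<open>Points that must have equal colours are contracted by \<open>r\<close>, with
  \<open>k\<close> choosing a representative, and the points in \<open>dead\<close> carry the colour
  \<open>False\<close>. This only relabels coordinates, hence is an isomorphism of cubes.\<close>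

lemma SUB_block:
  assumes E: "valid E" and X: "X \<subseteq> Xs E"
    and A: "\<And>c e. c \<in> Cs E \<Longrightarrow> c (k (r e)) = c e"
    and B: "\<And>e. e \<notin> dead \<Longrightarrow> r (k e) = e" and C: "\<And>e. r e \<notin> dead"
  defines "Om \<equiv> {c. (\<forall>e\<in>dead. \<not> c e) \<and> (\<lambda>e. c (r e)) \<in> Cs E}"
    and "P \<equiv> \<lambda>b x c. Ps E b x (\<lambda>e. c (r e))"
  shows "alg (states Om X P v)" "sub 0 (Cs E) (Xs E) (Ps E) Om (Xs E) P" "sub 0 Om (Xs E) P (Cs E) (Xs E) (Ps E)"
proof -
  let ?T = "\<lambda>c e. e \<notin> dead \<and> c (k e)"
  have ST: "(\<lambda>e. ?T c (r e)) = c" if "c \<in> Cs E" for c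
    using A[OF that] C by (simp add: fun_eq_iff)
  have TS: "?T (\<lambda>e. c (r e)) = c" if "c \<in> Om" for c
    using that B by (auto simp: fun_eq_iff Om_def)
  have TOm: "?T c \<in> Om" if "c \<in> Cs E" for c
    using ST[OF that] that by (simp add: Om_def)
  have SOm: "(\<lambda>e. c (r e)) \<in> Cs E" if "c \<in> Om" for c
    using that by (simp add: Om_def)
  have alg: "alg (states Om X P v)" if X: "X \<subseteq> Xs E" for X v
  proof -
    have st: "c \<in> states Om X P v \<longleftrightarrow> (\<forall>e\<in>dead. \<not> c e) \<and> (\<lambda>e. c (r e)) \<in> states (Cs E) X (Ps E) v" for c
      by (auto simp: states_def Om_def P_def)
    have alg': "alg (states (Cs E) X (Ps E) v)" by (rule alg_Cs[OF E X])
    show ?thesis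
    proof (rule algI)
      have "Om \<subseteq> ?T ` Cs E"
      proof
        fix c assume c: "c \<in> Om"
        show "c \<in> ?T ` Cs E" by (rule image_eqI[where f = ?T and x = "\<lambda>e. c (r e)", OF TS[OF c, symmetric] SOm[OF c]])
      qed
      then have "finite Om" by (rule finite_subset) (rule finite_imageI[OF finite_Cs[OF E]])
      then show "finite (states Om X P v)" by (rule finite_subset[rotated]) (auto simp: states_def)
      show "(\<lambda>_. False) \<in> states Om X P v" using alg_zero[OF alg'] by (simp add: st)
      fix c c' assume c: "c \<in> states Om X P v" and c': "c' \<in> states Om X P v"
      have cc: "(\<lambda>e. c (r e)) \<in> states (Cs E) X (Ps E) v" "(\<lambda>e. c' (r e)) \<in> states (Cs E) X (Ps E) v"
        "\<forall>e\<in>dead. \<not> c e" "\<forall>e\<in>dead. \<not> c' e"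
        using c c' by (simp_all add: st)
      show "(\<lambda>e. c e \<oplus> c' e) \<in> states Om X P v"
        using alg_xor[OF alg' cc(1,2)] cc(3,4) by (simp add: st)
      show "(\<lambda>e. c e \<and> c' e) \<in> states Om X P v"
        using alg_conj[OF alg' cc(1,2)] cc(3,4) by (simp add: st)
    qed
  qed
  then show "alg (states Om X P v)" using X by simp
  have cube: "cube Om (Xs E) P" unfolding cube_def using finite_Xs[OF E] alg by simp
  have affS: "affine_on Om (\<lambda>c e. c (r e))"
  proof (rule affine_onI)
    show "\<exists>g. deg_le 1 g \<and> (\<forall>c\<in>Om. c (r e) = g c)" for e
      by (rule exI[of _ "\<lambda>c. c (r e)"]) (simp add: deg_coord)
  qed
  have affT: "affine_on (Cs E) ?T"
  proof (rule affine_onI)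
    show "\<exists>g. deg_le 1 g \<and> (\<forall>c\<in>Cs E. (e \<notin> dead \<and> c (k e)) = g c)" for e
    proof (cases "e \<in> dead")
      case True
      then show ?thesis by (intro exI[of _ "\<lambda>_. False"]) (simp add: deg_False)
    next
      case False
      then show ?thesis by (intro exI[of _ "\<lambda>c. c (k e)"]) (simp add: deg_coord)
    qed
  qed
  show "sub 0 (Cs E) (Xs E) (Ps E) Om (Xs E) P"
    by (rule sub_iso[where h = "\<lambda>x. x" and t = ?T and s = "\<lambda>c e. c (r e)"])
      (use TOm SOm ST TS affS cube_Cs[OF E] in \<open>simp_all add: P_def\<close>)
  show "sub 0 Om (Xs E) P (Cs E) (Xs E) (Ps E)"
    by (rule sub_iso[where h = "\<lambda>x. x" and s = ?T and t = "\<lambda>c e. c (r e)"])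
      (use TOm SOm ST TS affT cube in \<open>simp_all add: P_def\<close>)
qed

text \<open>Passive strands in the two rows inside the block are contracted to the row below or
  above it, and the three inner strands are sent to \<open>k1\<close>, \<open>k2\<close>,
  \<open>k3\<close>.\<close>

definition ctrL where
  "ctrL t i k1 k2 k3 = (\<lambda>(s, j). if s = Suc t then if j = i then k1 else if j = Suc i then k2 else (t, j)
    else if s = Suc (Suc t) then if j = i then k1 else if j = Suc i then k3 else if j = Suc (Suc i)
      then (Suc (Suc (Suc t)), j) else (t, j) else (s, j :: nat))"

definition ctrR where
  "ctrR t i k1 k2 k3 = (\<lambda>(s, j). if s = Suc t then if j = i then (t, j) else if j = Suc i then k1 else
      if j = Suc (Suc i) then k2 else (t, j)
    else if s = Suc (Suc t) then if j = i then (Suc (Suc (Suc t)), j) else if j = Suc i then k3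
      else if j = Suc (Suc i) then k2 else (t, j) else (s, j :: nat))"

text \<open>Three points that name the inner strands on both sides of the move, regardless of where
  these strands run.\<close>

definition slots :: "nat \<Rightarrow> (nat \<times> nat) set" where
  "slots t = {(Suc t, 0), (Suc t, 1), (Suc t, 2)}"

definition dead :: "nat \<Rightarrow> (nat \<times> nat) set" where
  "dead t = {Suc t, Suc (Suc t)} \<times> UNIV - slots t"

text \<open>The colourings of the contracted diagram. The events of the block do not occur in it, so
  both sides of the move give the same set.\<close>

definition OmR3 :: "(nat \<Rightarrow> event option) \<Rightarrow> nat \<Rightarrow> nat \<Rightarrow> (nat \<times> nat \<Rightarrow> bool) set" where
  "OmR3 E t i = {c. (\<forall>e\<in>dead t. \<not> c e) \<and> (\<forall>j. \<not> c (0, j)) \<and>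
    (\<forall>s. s \<notin> {t, Suc t, Suc (Suc t)} \<longrightarrow> step (E s) (lv c s) (lv c (Suc s))) \<and>
    (\<forall>k. k \<notin> {i, Suc i, Suc (Suc i)} \<longrightarrow> c (Suc (Suc (Suc t)), k) = c (t, k))}"

lemma lv_ctr: "s \<noteq> Suc t \<Longrightarrow> s \<noteq> Suc (Suc t) \<Longrightarrow> lv (\<lambda>e. c (ctrL t i k1 k2 k3 e)) s = lv c s"
  "s \<noteq> Suc t \<Longrightarrow> s \<noteq> Suc (Suc t) \<Longrightarrow> lv (\<lambda>e. c (ctrR t i k1 k2 k3 e)) s = lv c s"
  by (simp_all add: lv_def ctrL_def ctrR_def fun_eq_iff)

lemma OmR3_eq:
  assumes L: "E t = Some (Crossing sa, i)" "E (Suc t) = Some (Crossing sb, Suc i)" "E (Suc (Suc t)) = Some (Crossing sc, i)"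
  shows "OmR3 E t i = {c. (\<forall>e\<in>dead t. \<not> c e) \<and> (\<lambda>e. c (ctrL t i k1 k2 k3 e)) \<in> Cs E}"
proof -
  let ?S = "\<lambda>c e. c (ctrL t i k1 k2 k3 e)"
  have "?S c \<in> Cs E \<longleftrightarrow> (\<forall>j. \<not> c (0, j)) \<and>
    (\<forall>s. s \<notin> {t, Suc t, Suc (Suc t)} \<longrightarrow> step (E s) (lv c s) (lv c (Suc s))) \<and>
    (\<forall>k. k \<notin> {i, Suc i, Suc (Suc i)} \<longrightarrow> c (Suc (Suc (Suc t)), k) = c (t, k))" for c
  proof -
    have 0: "?S c (0, j) = c (0, j)" for j by (simp add: ctrL_def)
    have 1: "step (E t) (lv (?S c) t) (lv (?S c) (Suc t))"
      unfolding L step_crossing by (simp add: lv_def ctrL_def)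
    have 2: "step (E (Suc t)) (lv (?S c) (Suc t)) (lv (?S c) (Suc (Suc t)))"
      unfolding L step_crossing by (simp add: lv_def ctrL_def)
    have 3: "step (E (Suc (Suc t))) (lv (?S c) (Suc (Suc t))) (lv (?S c) (Suc (Suc (Suc t)))) \<longleftrightarrow>
      (\<forall>k. k \<notin> {i, Suc i, Suc (Suc i)} \<longrightarrow> c (Suc (Suc (Suc t)), k) = c (t, k))"
      unfolding L step_crossing by (auto simp: lv_def ctrL_def)
    have 4: "step (E s) (lv (?S c) s) (lv (?S c) (Suc s)) = step (E s) (lv c s) (lv c (Suc s))"
      if "s \<notin> {t, Suc t, Suc (Suc t)}" for s
      using that by (simp add: lv_ctr)
    show ?thesis unfolding Cs_def mem_Collect_eq 0 using 1 2 3 4 by (metis insert_iff empty_iff)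
  qed
  then show ?thesis by (simp add: OmR3_def)
qed

lemma OmR3_eq':
  assumes R: "E t = Some (Crossing sa, Suc i)" "E (Suc t) = Some (Crossing sb, i)" "E (Suc (Suc t)) = Some (Crossing sc, Suc i)"
  shows "OmR3 E t i = {c. (\<forall>e\<in>dead t. \<not> c e) \<and> (\<lambda>e. c (ctrR t i k1 k2 k3 e)) \<in> Cs E}"
proof -
  let ?S = "\<lambda>c e. c (ctrR t i k1 k2 k3 e)"
  have "?S c \<in> Cs E \<longleftrightarrow> (\<forall>j. \<not> c (0, j)) \<and>
    (\<forall>s. s \<notin> {t, Suc t, Suc (Suc t)} \<longrightarrow> step (E s) (lv c s) (lv c (Suc s))) \<and>
    (\<forall>k. k \<notin> {i, Suc i, Suc (Suc i)} \<longrightarrow> c (Suc (Suc (Suc t)), k) = c (t, k))" for c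
  proof -
    have 0: "?S c (0, j) = c (0, j)" for j by (simp add: ctrR_def)
    have 1: "step (E t) (lv (?S c) t) (lv (?S c) (Suc t))"
      unfolding R step_crossing by (simp add: lv_def ctrR_def)
    have 2: "step (E (Suc t)) (lv (?S c) (Suc t)) (lv (?S c) (Suc (Suc t)))"
      unfolding R step_crossing by (simp add: lv_def ctrR_def)
    have 3: "step (E (Suc (Suc t))) (lv (?S c) (Suc (Suc t))) (lv (?S c) (Suc (Suc (Suc t)))) \<longleftrightarrow>
      (\<forall>k. k \<notin> {i, Suc i, Suc (Suc i)} \<longrightarrow> c (Suc (Suc (Suc t)), k) = c (t, k))"
      unfolding R step_crossing by (auto simp: lv_def ctrR_def)
    have 4: "step (E s) (lv (?S c) s) (lv (?S c) (Suc s)) = step (E s) (lv c s) (lv c (Suc s))"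
      if "s \<notin> {t, Suc t, Suc (Suc t)}" for s
      using that by (simp add: lv_ctr)
    show ?thesis unfolding Cs_def mem_Collect_eq 0 using 1 2 3 4 by (metis insert_iff empty_iff)
  qed
  then show ?thesis by (simp add: OmR3_def)
qed

lemma Cs_ctrL:
  assumes L: "E t = Some (Crossing sa, i)" "E (Suc t) = Some (Crossing sb, Suc i)" "E (Suc (Suc t)) = Some (Crossing sc, i)"
    and c: "c \<in> Cs E" and k: "distinct [k1, k2, k3]" "{k1, k2, k3} = slots t"
  shows "c ((id(k1 := (Suc t, i), k2 := (Suc t, Suc i), k3 := (Suc (Suc t), Suc i))) (ctrL t i k1 k2 k3 e)) = c e"
proof -
  obtain s j where e: "e = (s, j)" by (cases e)
  have ks: "k1 \<noteq> (u, l)" "k2 \<noteq> (u, l)" "k3 \<noteq> (u, l)" if "u \<noteq> Suc t" for u l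
    using k(2) that unfolding slots_def by blast+
  have 1: "j \<noteq> i \<Longrightarrow> j \<noteq> Suc i \<Longrightarrow> c (Suc t, j) = c (t, j)"
    "j \<noteq> Suc i \<Longrightarrow> j \<noteq> Suc (Suc i) \<Longrightarrow> c (Suc (Suc t), j) = c (Suc t, j)"
    "j \<noteq> i \<Longrightarrow> j \<noteq> Suc i \<Longrightarrow> c (Suc (Suc (Suc t)), j) = c (Suc (Suc t), j)"
    using Cs_step[OF c, of t] Cs_step[OF c, of "Suc t"] Cs_step[OF c, of "Suc (Suc t)"]
    unfolding L step_crossing lv_def by blast+
  have kt: "k1 \<noteq> (t, j)" "k2 \<noteq> (t, j)" "k3 \<noteq> (t, j)" "k1 \<noteq> (Suc (Suc (Suc t)), j)"
    "k2 \<noteq> (Suc (Suc (Suc t)), j)" "k3 \<noteq> (Suc (Suc (Suc t)), j)"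
    using ks[of t] ks[of "Suc (Suc (Suc t))"] by simp_all
  consider "s = Suc t" | "s = Suc (Suc t)" | "s \<noteq> Suc t" "s \<noteq> Suc (Suc t)" by blast
  then show ?thesis
    by cases (use 1 kt ks[of s] k(1) in \<open>auto simp: e ctrL_def\<close>)
qed

lemma Cs_ctrR:
  assumes R: "E t = Some (Crossing sa, Suc i)" "E (Suc t) = Some (Crossing sb, i)" "E (Suc (Suc t)) = Some (Crossing sc, Suc i)"
    and c: "c \<in> Cs E" and k: "distinct [k1, k2, k3]" "{k1, k2, k3} = slots t"
  shows "c ((id(k1 := (Suc t, Suc i), k2 := (Suc t, Suc (Suc i)), k3 := (Suc (Suc t), Suc i))) (ctrR t i k1 k2 k3 e)) = c e"
proof -
  obtain s j where e: "e = (s, j)" by (cases e)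
  have ks: "k1 \<noteq> (u, l)" "k2 \<noteq> (u, l)" "k3 \<noteq> (u, l)" if "u \<noteq> Suc t" for u l
    using k(2) that unfolding slots_def by blast+
  have 1: "j \<noteq> Suc i \<Longrightarrow> j \<noteq> Suc (Suc i) \<Longrightarrow> c (Suc t, j) = c (t, j)"
    "j \<noteq> i \<Longrightarrow> j \<noteq> Suc i \<Longrightarrow> c (Suc (Suc t), j) = c (Suc t, j)"
    "j \<noteq> Suc i \<Longrightarrow> j \<noteq> Suc (Suc i) \<Longrightarrow> c (Suc (Suc (Suc t)), j) = c (Suc (Suc t), j)"
    using Cs_step[OF c, of t] Cs_step[OF c, of "Suc t"] Cs_step[OF c, of "Suc (Suc t)"]
    unfolding R step_crossing lv_def by blast+
  have kt: "k1 \<noteq> (t, j)" "k2 \<noteq> (t, j)" "k3 \<noteq> (t, j)" "k1 \<noteq> (Suc (Suc (Suc t)), j)"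
    "k2 \<noteq> (Suc (Suc (Suc t)), j)" "k3 \<noteq> (Suc (Suc (Suc t)), j)"
    using ks[of t] ks[of "Suc (Suc (Suc t))"] by simp_all
  consider "s = Suc t" | "s = Suc (Suc t)" | "s \<noteq> Suc t" "s \<noteq> Suc (Suc t)" by blast
  then show ?thesis
    by cases (use 1 kt ks[of s] k(1) in \<open>auto simp: e ctrR_def\<close>)
qed

lemma ctr_dead:
  assumes k: "distinct [k1, k2, k3]" "{k1, k2, k3} = slots t"
  shows "e \<notin> dead t \<Longrightarrow> ctrL t i k1 k2 k3 ((id(k1 := (Suc t, i), k2 := (Suc t, Suc i), k3 := (Suc (Suc t), Suc i))) e) = e"
    "e \<notin> dead t \<Longrightarrow> ctrR t i k1 k2 k3 ((id(k1 := (Suc t, Suc i), k2 := (Suc t, Suc (Suc i)), k3 := (Suc (Suc t), Suc i))) e) = e"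
    "ctrL t i k1 k2 k3 e \<notin> dead t" "ctrR t i k1 k2 k3 e \<notin> dead t"
proof -
  have ks: "k1 \<in> slots t" "k2 \<in> slots t" "k3 \<in> slots t" using k(2) by blast+
  have d: "e \<notin> dead t \<longleftrightarrow> fst e \<noteq> Suc t \<and> fst e \<noteq> Suc (Suc t) \<or> e = k1 \<or> e = k2 \<or> e = k3" for e
    unfolding dead_def k(2)[symmetric] by (cases e) auto
  have kk: "k1 \<noteq> k2" "k1 \<noteq> k3" "k2 \<noteq> k3" using k(1) by auto
  show "ctrL t i k1 k2 k3 ((id(k1 := (Suc t, i), k2 := (Suc t, Suc i), k3 := (Suc (Suc t), Suc i))) e) = e" if "e \<notin> dead t"
    using that kk unfolding d ctrL_def by (cases e) auto
  show "ctrR t i k1 k2 k3 ((id(k1 := (Suc t, Suc i), k2 := (Suc t, Suc (Suc i)), k3 := (Suc (Suc t), Suc i))) e) = e" if "e \<notin> dead t"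
    using that kk unfolding d ctrR_def by (cases e) auto
  show "ctrL t i k1 k2 k3 e \<notin> dead t" "ctrR t i k1 k2 k3 e \<notin> dead t"
    unfolding d ctrL_def ctrR_def by (cases e; simp)+
qed


text \<open>One sign pattern is treated, in both directions; the other admissible ones follow from
  it by \<open>reidemeister3_from_one\<close>.\<close>

lemma SUB_R3:
  assumes E: "valid E" "E t = Some (Crossing False, i)" "E (Suc t) = Some (Crossing True, Suc i)"
      "E (Suc (Suc t)) = Some (Crossing True, i)"
    and E': "valid E'" "E' t = Some (Crossing True, Suc i)" "E' (Suc t) = Some (Crossing True, i)"
      "E' (Suc (Suc t)) = Some (Crossing False, Suc i)"
    and eq: "\<And>s. s \<notin> {t, Suc t, Suc (Suc t)} \<Longrightarrow> E' s = E s"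
  shows "SUB 0 E E'" "SUB 0 E' E"
proof -
  let ?a1 = "(Suc t, 0 :: nat)" and ?a2 = "(Suc t, Suc 0)" and ?a3 = "(Suc t, 2 :: nat)"
  define X where "X = Xs E - {t, Suc t, Suc (Suc t)}"
  define Om where "Om = OmR3 E t i"
  have XE: "Xs E = insert t (insert (Suc t) (insert (Suc (Suc t)) X))"
    using E(2-4) by (auto simp: X_def Xs_def)
  have XE': "Xs E' = insert t (insert (Suc t) (insert (Suc (Suc t)) X))"
  proof -
    have "s \<in> Xs E' \<longleftrightarrow> s \<in> Xs E" for s
      using E(2-4) E'(2-4) eq[of s] by (cases "s \<in> {t, Suc t, Suc (Suc t)}") (auto simp: Xs_def)
    then show ?thesis using XE by blast
  qed
  have fX: "finite X" using finite_Xs[OF E(1)] by (simp add: X_def)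
  have OmE': "OmR3 E' t i = Om" unfolding Om_def OmR3_def using eq by auto
  have OmL: "Om = {c. (\<forall>e\<in>dead t. \<not> c e) \<and> (\<lambda>e. c (ctrL t i k1 k2 k3 e)) \<in> Cs E}" for k1 k2 k3
    unfolding Om_def by (rule OmR3_eq[OF E(2-4)])
  have OmR: "Om = {c. (\<forall>e\<in>dead t. \<not> c e) \<and> (\<lambda>e. c (ctrR t i k1 k2 k3 e)) \<in> Cs E'}" for k1 k2 k3
    unfolding OmE'[symmetric] by (rule OmR3_eq'[OF E'(2-4)])
  define PL where "PL k1 k2 k3 b x c = Ps E b x (\<lambda>e. c (ctrL t i k1 k2 k3 e))" for k1 k2 k3 b x c
  define PR where "PR k1 k2 k3 b x c = Ps E' b x (\<lambda>e. c (ctrR t i k1 k2 k3 e))" for k1 k2 k3 b x c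
  have PL: "PL k1 k2 k3 b t c \<longleftrightarrow> (if b then c (t, i) = c k1 \<and> c (t, Suc i) = c k2 else c (t, i) = c (t, Suc i) \<and> c k1 = c k2)"
    "PL k1 k2 k3 b (Suc t) c \<longleftrightarrow> (if b then c k2 = c (t, Suc (Suc i)) \<and> c k3 = c (Suc (Suc (Suc t)), Suc (Suc i))
       else c k2 = c k3 \<and> c (t, Suc (Suc i)) = c (Suc (Suc (Suc t)), Suc (Suc i)))"
    "PL k1 k2 k3 b (Suc (Suc t)) c \<longleftrightarrow> (if b then c k1 = c k3 \<and> c (Suc (Suc (Suc t)), i) = c (Suc (Suc (Suc t)), Suc i)
       else c k1 = c (Suc (Suc (Suc t)), i) \<and> c k3 = c (Suc (Suc (Suc t)), Suc i))"
    for k1 k2 k3 b c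
    by (simp_all add: PL_def Ps_def E(2-4) smooth_crossing lv_def ctrL_def)
  have PR: "PR k1 k2 k3 b t c \<longleftrightarrow> (if b then c (t, Suc i) = c (t, Suc (Suc i)) \<and> c k1 = c k2
       else c (t, Suc i) = c k1 \<and> c (t, Suc (Suc i)) = c k2)"
    "PR k1 k2 k3 b (Suc t) c \<longleftrightarrow> (if b then c (t, i) = c k1 \<and> c (Suc (Suc (Suc t)), i) = c k3
       else c (t, i) = c (Suc (Suc (Suc t)), i) \<and> c k1 = c k3)"
    "PR k1 k2 k3 b (Suc (Suc t)) c \<longleftrightarrow> (if b then c k3 = c (Suc (Suc (Suc t)), Suc i) \<and> c k2 = c (Suc (Suc (Suc t)), Suc (Suc i))
       else c k3 = c k2 \<and> c (Suc (Suc (Suc t)), Suc i) = c (Suc (Suc (Suc t)), Suc (Suc i)))"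
    for k1 k2 k3 b c
    by (simp_all add: PR_def Ps_def E'(2-4) smooth_crossing lv_def ctrR_def)
  have outside: "PL k1 k2 k3 b y c = Ps E b y c" "PR k1 k2 k3 b y c = Ps E b y c" if "y \<in> X" for k1 k2 k3 b y c
  proof -
    have y: "y \<notin> {t, Suc t, Suc (Suc t)}" using that by (simp add: X_def)
    show "PL k1 k2 k3 b y c = Ps E b y c" unfolding PL_def by (rule Ps_eq) (use y in \<open>simp_all add: lv_ctr\<close>)
    show "PR k1 k2 k3 b y c = Ps E b y c" unfolding PR_def by (rule Ps_eq) (use y eq in \<open>simp_all add: lv_ctr\<close>)
  qed
  have XX: "X \<subseteq> Xs E" "X \<subseteq> Xs E'" using XE XE' by auto
  have bL: "alg (states Om X (PL k1 k2 k3) v)" "sub 0 (Cs E) (Xs E) (Ps E) Om (Xs E) (PL k1 k2 k3)"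
    "sub 0 Om (Xs E) (PL k1 k2 k3) (Cs E) (Xs E) (Ps E)"
    if k: "distinct [k1, k2, k3]" "{k1, k2, k3} = slots t" for k1 k2 k3 v
    unfolding OmL[of k1 k2 k3] PL_def[abs_def]
    by (rule SUB_block[OF E(1) XX(1) Cs_ctrL[OF E(2-4) _ k] ctr_dead(1,3)[OF k]]; assumption)+
  have bR: "alg (states Om X (PR k1 k2 k3) v)" "sub 0 (Cs E') (Xs E') (Ps E') Om (Xs E') (PR k1 k2 k3)"
    "sub 0 Om (Xs E') (PR k1 k2 k3) (Cs E') (Xs E') (Ps E')"
    if k: "distinct [k1, k2, k3]" "{k1, k2, k3} = slots t" for k1 k2 k3 v
    unfolding OmR[of k1 k2 k3] PR_def[abs_def]
    by (rule SUB_block[OF E'(1) XX(2) Cs_ctrR[OF E'(2-4) _ k] ctr_dead(2,4)[OF k]]; assumption)+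
  have upd: "c(k1 := b1, k2 := b2, k3 := b3) \<in> Om"
    if c: "c \<in> Om" and k: "k1 \<in> slots t" "k2 \<in> slots t" "k3 \<in> slots t" for c k1 k2 k3 b1 b2 b3
  proof -
    let ?c = "c(k1 := b1, k2 := b2, k3 := b3)"
    have 1: "?c (s, j) = c (s, j)" if "s \<noteq> Suc t" for s j
      using that k by (auto simp: slots_def)
    have 2: "lv ?c s = lv c s" if "s \<noteq> Suc t" for s
      unfolding lv_def using 1[OF that] by simp
    have 3: "?c e = c e" if "e \<in> dead t" for e
      using that k by (auto simp: dead_def)
    show ?thesis using c unfolding Om_def OmR3_def by (simp add: 1 2 3 del: fun_upd_apply)
  qed
  have outer: "Ps E b y (c(k1 := b1, k2 := b2, k3 := b3)) = Ps E b y c"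
    if y: "y \<in> X" and k: "k1 \<in> slots t" "k2 \<in> slots t" "k3 \<in> slots t" for c k1 k2 k3 b b1 b2 b3 y
  proof -
    let ?c = "c(k1 := b1, k2 := b2, k3 := b3)"
    have "lv ?c s = lv c s" if "s \<noteq> Suc t" for s
      using that k by (auto simp: lv_def slots_def fun_eq_iff)
    moreover have "y \<noteq> Suc t" "Suc y \<noteq> Suc t" using y by (auto simp: X_def)
    ultimately show ?thesis by (simp add: Ps_def)
  qed
  have k: "distinct [?a1, ?a2, ?a3]" "{?a1, ?a2, ?a3} = slots t" "?a1 \<in> slots t" "?a2 \<in> slots t" "?a3 \<in> slots t"
    by (auto simp: slots_def)
  have k': "distinct [?a3, ?a1, ?a2]" "{?a3, ?a1, ?a2} = slots t"
    by (auto simp: slots_def)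
  have par: "((c (t, i) \<noteq> c (t, Suc i)) \<noteq> c (t, Suc (Suc i))) =
      ((c (Suc (Suc (Suc t)), i) \<noteq> c (Suc (Suc (Suc t)), Suc i)) \<noteq> c (Suc (Suc (Suc t)), Suc (Suc i)))"
    if c: "c \<in> Om" and r: "\<And>y. y \<in> X \<Longrightarrow> \<exists>b. Ps E b y c" for c
  proof -
    let ?c = "\<lambda>e. c (ctrL t i ?a1 ?a2 ?a3 e)"
    have C: "?c \<in> Cs E" using c OmL[of ?a1 ?a2 ?a3] by blast
    have "parity {i..<i + 3} (lv ?c t) = parity {i..<i + 3} (lv ?c (Suc (Suc (Suc t))))"
    proof (rule parity_gap[OF E(1) C])
      show "\<exists>b. Ps E b s ?c" if "s < t \<or> s \<ge> Suc (Suc (Suc t))" "s \<in> Xs E" for s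
      proof -
        have s: "s \<in> X" using that by (auto simp: X_def)
        show ?thesis using r[OF s] outside(1)[OF s, of ?a1 ?a2 ?a3 _ c] by (simp add: PL_def)
      qed
      show "width E (Suc (Suc (Suc t))) = width E t" "i + 3 \<le> width E t"
        using width_crossing[OF E(1,2)] width_crossing[OF E(1,3)] width_crossing[OF E(1,4)] by auto
      show "lv ?c (Suc (Suc (Suc t))) k = lv ?c t k" if "k < i \<or> k \<ge> i + 3" for k
        using c that by (auto simp: Om_def OmR3_def lv_def ctrL_def)
    qed
    then show ?thesis unfolding parity_three by (auto simp: xr_def lv_def ctrL_def)
  qed
  have parS: "\<exists>b. Ps E b y c" if "c \<in> states Om X Q v" "y \<in> X" "Q = PL k1 k2 k3 \<or> Q = PR k1 k2 k3" for c Q v y k1 k2 k3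
  proof -
    have "Q (y \<in> v) y c" using that(1,2) by (simp add: states_def)
    then have "Ps E (y \<in> v) y c"
      using that(3) outside(1)[OF that(2), of k1 k2 k3 "y \<in> v" c] outside(2)[OF that(2), of k1 k2 k3 "y \<in> v" c]
      by (elim disjE) simp_all
    then show ?thesis by (rule exI)
  qed
  have "sub 0 Om (Xs E) (PL ?a1 ?a2 ?a3) Om (Xs E') (PR ?a1 ?a2 ?a3)"
  proof -
    interpret R3 Om X "PL ?a1 ?a2 ?a3" "PR ?a1 ?a2 ?a3" t "Suc t" "Suc (Suc t)" t "Suc t" "Suc (Suc t)"
      "(t, i)" "(t, Suc i)" "(t, Suc (Suc i))" "(Suc (Suc (Suc t)), i)" "(Suc (Suc (Suc t)), Suc i)" "(Suc (Suc (Suc t)), Suc (Suc i))"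
      ?a1 ?a2 ?a3
    proof
      show "((c (t, i) \<noteq> c (t, Suc i)) \<noteq> c (t, Suc (Suc i))) =
      ((c (Suc (Suc (Suc t)), i) \<noteq> c (Suc (Suc (Suc t)), Suc i)) \<noteq> c (Suc (Suc (Suc t)), Suc (Suc i)))"
        if "c \<in> states Om X (PL ?a1 ?a2 ?a3) v" for c v
        by (rule par[OF states_Om[OF that]]) (rule parS[OF that], assumption, blast)
      show "c(?a1 := k, ?a2 := l, ?a3 := n) \<in> Om" if "c \<in> Om" for c k l n
        by (rule upd[OF that k(3-5)])
      show "PL ?a1 ?a2 ?a3 b y (c(?a1 := u, ?a2 := l, ?a3 := n)) = PL ?a1 ?a2 ?a3 b y c" if "y \<in> X" for y b c u l n
        unfolding outside[OF that] by (rule outer[OF that k(3-5)])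
    qed (simp_all add: fX bL(1)[OF k(1,2)] outside PL PR, simp_all add: X_def)
    show ?thesis using sub_slide unfolding XE XE' by (simp add: insert_commute)
  qed
  from sub_0_trans[OF sub_0_trans[OF bL(2)[OF k(1,2)] this] bR(3)[OF k(1,2)]]
  show "SUB 0 E E'" unfolding SUB_def .
  \<comment> \<open>Half a turn of the picture exchanges the two sides, so the same map serves for
    the way back. The names of the inner strands are permuted accordingly, which explains
    \<open>PL ?a3 ?a1 ?a2\<close>.\<close>
  have "sub 0 Om (Xs E') (PR ?a1 ?a2 ?a3) Om (Xs E) (PL ?a3 ?a1 ?a2)"
  proof -
    interpret R3 Om X "PR ?a1 ?a2 ?a3" "PL ?a3 ?a1 ?a2" "Suc (Suc t)" "Suc t" t "Suc (Suc t)" "Suc t" t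
      "(Suc (Suc (Suc t)), Suc (Suc i))" "(Suc (Suc (Suc t)), Suc i)" "(Suc (Suc (Suc t)), i)" "(t, Suc (Suc i))" "(t, Suc i)" "(t, i)"
      ?a2 ?a3 ?a1
    proof
      show "((c (Suc (Suc (Suc t)), Suc (Suc i)) \<noteq> c (Suc (Suc (Suc t)), Suc i)) \<noteq> c (Suc (Suc (Suc t)), i)) =
        ((c (t, Suc (Suc i)) \<noteq> c (t, Suc i)) \<noteq> c (t, i))"
        if "c \<in> states Om X (PR ?a1 ?a2 ?a3) v" for c v
      proof -
        have "((c (t, i) \<noteq> c (t, Suc i)) \<noteq> c (t, Suc (Suc i))) =
          ((c (Suc (Suc (Suc t)), i) \<noteq> c (Suc (Suc (Suc t)), Suc i)) \<noteq> c (Suc (Suc (Suc t)), Suc (Suc i)))"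
          by (rule par[OF states_Om[OF that]]) (rule parS[OF that], assumption, blast)
        then show ?thesis by argo
      qed
      show "c(?a2 := k, ?a3 := l, ?a1 := n) \<in> Om" if "c \<in> Om" for c k l n
        by (rule upd[OF that k(4,5,3)])
      show "PR ?a1 ?a2 ?a3 b y (c(?a2 := u, ?a3 := l, ?a1 := n)) = PR ?a1 ?a2 ?a3 b y c" if "y \<in> X" for y b c u l n
        unfolding outside[OF that] by (rule outer[OF that k(4,5,3)])
    qed (simp_all add: fX bR(1)[OF k(1,2)] outside PL PR, simp_all add: X_def, auto)
    show ?thesis using sub_slide unfolding XE XE' by (simp add: insert_commute)
  qed
  from sub_0_trans[OF sub_0_trans[OF bR(2)[OF k(1,2)] this] bL(3)[OF k']]
  show "SUB 0 E' E" unfolding SUB_def .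
qed


subsection \<open>Invariance under isotopies of the plane\<close>

text \<open>
  An isotopy of two consecutive events only changes the word between them, which both before and
  after is read off the words \<open>w\<close> below and \<open>w'\<close> above by the maps \<open>r\<close> and \<open>r'\<close>; \<open>sw\<close> says whether the
  events are exchanged.
\<close>

definition pick :: "(nat \<Rightarrow> bool) \<Rightarrow> (nat \<Rightarrow> bool) \<Rightarrow> (nat \<Rightarrow> bool \<times> nat) \<Rightarrow> nat \<Rightarrow> bool" where
  "pick w w' r k = (if fst (r k) then w' (snd (r k)) else w (snd (r k)))"

definition isotopic where
  "isotopic sw a b a' b' r r' \<longleftrightarrow> (\<forall>w u w'. step a w u \<longrightarrow> step b u w' \<longrightarrow>
     u = pick w w' r \<and> step a' w (pick w w' r') \<and> step b' (pick w w' r') w' \<and>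
     (\<forall>x. if sw then smooth b' x (pick w w' r') w' = smooth a x w u \<and> smooth a' x w (pick w w' r') = smooth b x u w'
        else smooth a' x w (pick w w' r') = smooth a x w u \<and> smooth b' x (pick w w' r') w' = smooth b x u w'))"

definition crossing :: "event option \<Rightarrow> bool" where
  "crossing ev \<longleftrightarrow> (\<exists>s i. ev = Some (Crossing s, i))"

lemma Xs_crossing: "t \<in> Xs E \<longleftrightarrow> crossing (E t)"
  by (simp add: Xs_def crossing_def)

lemma involution_image:
  assumes "\<And>x. h (h x) = x" "\<And>x. x \<in> A \<longleftrightarrow> h x \<in> B"
  shows "A = h ` B"
proof (intro set_eqI iffI)
  fix x assume "x \<in> A"
  then have "h x \<in> B" by (simp add: assms(2))
  then show "x \<in> h ` B" by (rule rev_image_eqI) (simp add: assms(1))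
qed (auto simp: assms)

text \<open>The row between the two events is determined by its neighbours, so overwriting it is a
  bijection of colourings that copies coordinates. If the events are exchanged, so are the times
  that serve as names of the crossings.\<close>

lemma SUB_level:
  assumes iso: "isotopic sw a b a' b' r r'" "isotopic sw a' b' a b r' r"
    and cr: "if sw then crossing a' = crossing b \<and> crossing b' = crossing a else crossing a' = crossing a \<and> crossing b' = crossing b"
    and E: "valid E" "E t = a" "E (Suc t) = b" "E' t = a'" "E' (Suc t) = b'"
    and eq: "\<And>s. s \<noteq> t \<Longrightarrow> s \<noteq> Suc t \<Longrightarrow> E' s = E s"
  shows "SUB 0 E E'"
proof -
  define ov where "ov q c = (\<lambda>(s, j). if s = Suc t then pick (lv c t) (lv c (Suc (Suc t))) q j else c (s, j))"
    for q :: "nat \<Rightarrow> bool \<times> nat" and c :: "nat \<times> nat \<Rightarrow> bool"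
  define h where "h x = (if sw then if x = t then Suc t else if x = Suc t then t else x else x)" for x :: nat
  have ov1: "lv (ov q c) s = lv c s" if "s \<noteq> Suc t" for q c s
    using that by (simp add: ov_def lv_def fun_eq_iff)
  have ov2: "lv (ov q c) (Suc t) = pick (lv c t) (lv c (Suc (Suc t))) q" for q c
    by (simp add: ov_def lv_def fun_eq_iff)
  have ov3: "ov q (ov q' c) = ov q c" for q q' c
  proof -
    have "lv (ov q' c) t = lv c t" "lv (ov q' c) (Suc (Suc t)) = lv c (Suc (Suc t))" by (simp_all add: ov1)
    note eqs = this
    show ?thesis
    proof (rule ext)
      fix e :: "nat \<times> nat"
      obtain s j where e: "e = (s, j)" by (cases e)
      show "ov q (ov q' c) e = ov q c e"
      proof (cases "s = Suc t")
        case True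
        then show ?thesis unfolding e ov_def[of q] eqs by simp
      qed (simp add: e ov_def)
    qed
  qed
  have ov4: "ov q c = c" if "lv c (Suc t) = pick (lv c t) (lv c (Suc (Suc t))) q" for q c
    unfolding ov_def that[symmetric] by (auto simp: lv_def fun_eq_iff)
  have i1: "lv c (Suc t) = pick (lv c t) (lv c (Suc (Suc t))) r"
    "step a' (lv c t) (pick (lv c t) (lv c (Suc (Suc t))) r')"
    "step b' (pick (lv c t) (lv c (Suc (Suc t))) r') (lv c (Suc (Suc t)))"
    "if sw then smooth b' x (pick (lv c t) (lv c (Suc (Suc t))) r') (lv c (Suc (Suc t))) = smooth a x (lv c t) (lv c (Suc t)) \<and>
        smooth a' x (lv c t) (pick (lv c t) (lv c (Suc (Suc t))) r') = smooth b x (lv c (Suc t)) (lv c (Suc (Suc t)))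
      else smooth a' x (lv c t) (pick (lv c t) (lv c (Suc (Suc t))) r') = smooth a x (lv c t) (lv c (Suc t)) \<and>
        smooth b' x (pick (lv c t) (lv c (Suc (Suc t))) r') (lv c (Suc (Suc t))) = smooth b x (lv c (Suc t)) (lv c (Suc (Suc t)))"
    if "c \<in> Cs E" for c x
  proof -
    have "step a (lv c t) (lv c (Suc t))" "step b (lv c (Suc t)) (lv c (Suc (Suc t)))"
      using Cs_step[OF that, of t] Cs_step[OF that, of "Suc t"] unfolding E .
    note I = iso(1)[unfolded isotopic_def, THEN spec, THEN spec, THEN spec, THEN mp, THEN mp, OF this]
    show "lv c (Suc t) = pick (lv c t) (lv c (Suc (Suc t))) r"
      "step a' (lv c t) (pick (lv c t) (lv c (Suc (Suc t))) r')"
      "step b' (pick (lv c t) (lv c (Suc (Suc t))) r') (lv c (Suc (Suc t)))"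
      using I by blast+
    show "if sw then smooth b' x (pick (lv c t) (lv c (Suc (Suc t))) r') (lv c (Suc (Suc t))) = smooth a x (lv c t) (lv c (Suc t)) \<and>
        smooth a' x (lv c t) (pick (lv c t) (lv c (Suc (Suc t))) r') = smooth b x (lv c (Suc t)) (lv c (Suc (Suc t)))
      else smooth a' x (lv c t) (pick (lv c t) (lv c (Suc (Suc t))) r') = smooth a x (lv c t) (lv c (Suc t)) \<and>
        smooth b' x (pick (lv c t) (lv c (Suc (Suc t))) r') (lv c (Suc (Suc t))) = smooth b x (lv c (Suc t)) (lv c (Suc (Suc t)))"
      by (rule I[THEN conjunct2, THEN conjunct2, THEN conjunct2, THEN spec])
  qed
  have i2: "lv c (Suc t) = pick (lv c t) (lv c (Suc (Suc t))) r'"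
    "step a (lv c t) (pick (lv c t) (lv c (Suc (Suc t))) r)"
    "step b (pick (lv c t) (lv c (Suc (Suc t))) r) (lv c (Suc (Suc t)))"
    if "c \<in> Cs E'" for c
    using Cs_step[OF that, of t] Cs_step[OF that, of "Suc t"] iso(2)[unfolded isotopic_def E(4,5)[symmetric]] by blast+
  show ?thesis
    unfolding SUB_def
  proof (rule sub_iso[where h = h and t = "ov r'" and s = "ov r"])
    show "inj_on h (Xs E)" by (auto simp: inj_on_def h_def)
    show "Xs E' = h ` Xs E"
    proof -
      have "h (h x) = x" for x by (simp add: h_def)
      moreover have "x \<in> Xs E' \<longleftrightarrow> h x \<in> Xs E" for x
        unfolding Xs_crossing using cr E eq[of x] by (auto simp: h_def split: if_splits)
      ultimately show ?thesis by (rule involution_image)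
    qed
    show "ov r' c \<in> Cs E'" if c: "c \<in> Cs E" for c
      by (rule Cs_change[OF c, where t = t]) (use i1(2,3)[OF c] in \<open>simp_all add: eq ov1 ov2 E\<close>)
    show "ov r c \<in> Cs E" if c: "c \<in> Cs E'" for c
      by (rule Cs_change[OF c, where t = t]) (use i2(2,3)[OF c] in \<open>simp_all add: eq ov1 ov2 E\<close>)
    show "ov r (ov r' c) = c" if "c \<in> Cs E" for c
      unfolding ov3 by (rule ov4[OF i1(1)[OF that]])
    show "ov r' (ov r c) = c" if "c \<in> Cs E'" for c
      unfolding ov3 by (rule ov4[OF i2(1)[OF that]])
    show "Ps E' x (h y) (ov r' c) = Ps E x y c" if c: "c \<in> Cs E" for x y c
    proof (cases "y = t \<or> y = Suc t")
      case True
      then show ?thesis using i1(4)[OF c, of x]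
        by (cases sw) (auto simp: Ps_def h_def E ov1 ov2)
    next
      case False
      then have "h y = y" by (simp add: h_def)
      then show ?thesis using False by (simp add: Ps_def ov1 eq)
    qed
    show "affine_on (Cs E') (ov r)"
    proof (rule affine_onI)
      fix e :: "nat \<times> nat"
      obtain s j where e: "e = (s, j)" by (cases e)
      define e' where "e' = (if s = Suc t then (if fst (r j) then Suc (Suc t) else t, snd (r j)) else e)"
      have "ov r c e = c e'" for c by (simp add: ov_def e e'_def pick_def lv_def)
      then show "\<exists>g. deg_le 1 g \<and> (\<forall>c\<in>Cs E'. ov r c e = g c)"
        by (intro exI[of _ "\<lambda>c. c e'"]) (simp add: deg_coord)
    qed
    show "cube (Cs E) (Xs E) (Ps E)" by (rule cube_Cs[OF E(1)])
  qed
qed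

lemma insert_two:
  fixes v v' :: "nat \<Rightarrow> bool"
  shows "(\<forall>k<i. v' k = v k) \<and> (\<forall>k\<ge>i. v' (k + 2) = v k) \<longleftrightarrow> (\<forall>k. v k = (if k < i then v' k else v' (k + 2)))"
proof (rule iffI, rule allI)
  fix k assume h: "(\<forall>k<i. v' k = v k) \<and> (\<forall>k\<ge>i. v' (k + 2) = v k)"
  show "v k = (if k < i then v' k else v' (k + 2))"
    using h[THEN conjunct1, rule_format, of k] h[THEN conjunct2, rule_format, of k] by (cases "k < i") simp_all
next
  assume h: "\<forall>k. v k = (if k < i then v' k else v' (k + 2))"
  show "(\<forall>k<i. v' k = v k) \<and> (\<forall>k\<ge>i. v' (k + 2) = v k)"
  proof (intro conjI allI impI)
    show "v' k = v k" if "k < i" for k using h[rule_format, of k] that by simp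
    show "v' (k + 2) = v k" if "i \<le> k" for k using h[rule_format, of k] that by simp
  qed
qed

lemma step_cup: "step (Some (Cup, i)) w w' \<longleftrightarrow> w' i = w' (Suc i) \<and> (\<forall>k. w k = (if k < i then w' k else w' (k + 2)))"
  unfolding step_Some insert_two[of i w' w, symmetric] by (simp, blast)

lemma step_cap: "step (Some (Cap, i)) w w' \<longleftrightarrow> w i = w (Suc i) \<and> (\<forall>k. w' k = (if k < i then w k else w (k + 2)))"
  unfolding step_Some insert_two[of i w w', symmetric] by (simp, metis)

lemma smooth_no_crossing [simp]: "smooth None b w w' = False" "smooth (Some (Cup, i)) b w w' = False"
  "smooth (Some (Cap, i)) b w w' = False"
  by (simp_all add: smooth_def)

text \<open>With \<open>e\<close> first, the middle row already has its later form to the left of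
  \<open>f\<close>, and from \<open>f\<close> on still its earlier form, shifted by the strands that
  \<open>e\<close> inserts or removes. With \<open>f\<close> first it is the other way
  round.\<close>

lemma isotopic_exchange:
  fixes e f :: piece and i j :: nat
  assumes ij: "i \<le> j"
  defines "r \<equiv> \<lambda>k. if k < j + outs e then (True, k) else (False, k - outs e + ins e)"
    and "r' \<equiv> \<lambda>k. if k < j + ins e then (False, k) else (True, k - ins e + outs e)"
  shows "isotopic True (Some (e, i)) (Some (f, j + outs e)) (Some (f, j + ins e)) (Some (e, i)) r r'"
    "isotopic True (Some (f, j + ins e)) (Some (e, i)) (Some (e, i)) (Some (f, j + outs e)) r' r"
proof -
  have r: "pick w w' r k = w' k" if "k < j + outs e" for w w' k
    using that by (simp add: pick_def r_def)
  have r2: "pick w w' r (k + outs e) = w (k + ins e)" if "k \<ge> j" for w w' k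
    using that by (simp add: pick_def r_def)
  have r': "pick w w' r' k = w k" if "k < j + ins e" for w w' k
    using that by (simp add: pick_def r'_def)
  have r'2: "pick w w' r' (k + ins e) = w' (k + outs e)" if "k \<ge> j" for w w' k
    using that by (simp add: pick_def r'_def)
  have outs: "outs e = 0 \<or> outs e = 2" "ins e = 0 \<or> ins e = 2" "e = Cup \<Longrightarrow> outs e = 2" "e = Cap \<Longrightarrow> ins e = 2"
    "outs (Crossing s) = 2" "ins (Crossing s) = 2" for s
    by (cases e; simp)+
  have ext: "u = v" if "\<And>k. k < j + n \<Longrightarrow> u k = v k" "\<And>k. k \<ge> j \<Longrightarrow> u (k + n) = v (k + n)" for u v :: "nat \<Rightarrow> bool" and n
  proof
    fix k
    show "u k = v k"
    proof (cases "k < j + n")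
      case False
      then have "k = (k - n) + n" "k - n \<ge> j" by simp_all
      then show ?thesis using that(2) by metis
    qed (rule that(1))
  qed
  have sm: "smooth (Some (g, n)) x v v' = smooth (Some (g, n')) x u u'"
    if "v n = u n'" "v (Suc n) = u (Suc n')" "v' n = u' n'" "v' (Suc n) = u' (Suc n')" for g n n' x v v' u u'
    using that by (cases g) (simp_all add: smooth_crossing)
  show "isotopic True (Some (e, i)) (Some (f, j + outs e)) (Some (f, j + ins e)) (Some (e, i)) r r'"
    unfolding isotopic_def
  proof (intro allI impI)
    fix w u w' assume "step (Some (e, i)) w u" "step (Some (f, j + outs e)) u w'"
    then have s: "\<And>k. k < i \<Longrightarrow> u k = w k" "\<And>k. k \<ge> i \<Longrightarrow> u (k + outs e) = w (k + ins e)"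
      "e = Cap \<Longrightarrow> w i = w (Suc i)" "e = Cup \<Longrightarrow> u i = u (Suc i)"
      "\<And>k. k < j + outs e \<Longrightarrow> w' k = u k" "\<And>k. k \<ge> j + outs e \<Longrightarrow> w' (k + outs f) = u (k + ins f)"
      "f = Cap \<Longrightarrow> u (j + outs e) = u (Suc (j + outs e))" "f = Cup \<Longrightarrow> w' (j + outs e) = w' (Suc (j + outs e))"
      unfolding step_Some by blast+
    have u: "u = pick w w' r"
      by (rule ext[of "outs e"]) (use s ij in \<open>simp_all add: r r2\<close>)
    let ?p = "pick w w' r'"
    have shift: "?p (k + ins e) = w' (k + outs e)" "w (k + ins e) = u (k + outs e)" if "k \<ge> j" for k
      using that ij s(2)[of k] r'2 by simp_all
    have p1: "step (Some (f, j + ins e)) w ?p"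
      unfolding step_Some
    proof (intro conjI allI impI)
      fix k assume "k \<ge> j + ins e"
      then have k1: "k = (k - ins e) + ins e" "k - ins e \<ge> j" by simp_all
      define k1 where "k1 = k - ins e"
      note k1 = k1[folded k1_def]
      have "?p (k1 + outs f + ins e) = w' (k1 + outs f + outs e)" using shift(1)[of "k1 + outs f"] k1 by simp
      also have "\<dots> = u (k1 + ins f + outs e)" using s(6)[of "k1 + outs e"] k1(2) by (simp add: ac_simps)
      also have "\<dots> = w (k1 + ins f + ins e)" using shift(2)[of "k1 + ins f"] k1 by simp
      finally show "?p (k + outs f) = w (k + ins f)" unfolding k1(1) by (simp add: ac_simps)
    next
      show "w (j + ins e) = w (Suc (j + ins e))" if "f = Cap"
        using s(7)[OF that] shift(2)[of j] shift(2)[of "Suc j"] by simp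
      show "?p (j + ins e) = ?p (Suc (j + ins e))" if "f = Cup"
        using s(8)[OF that] shift(1)[of j] shift(1)[of "Suc j"] by simp
    qed (simp add: r')
    have p2: "step (Some (e, i)) ?p w'"
      unfolding step_Some
    proof (intro conjI allI impI)
      show "w' k = ?p k" if "k < i" for k using that ij s(1,5)[of k] r'[of k] by simp
      show "w' (k + outs e) = ?p (k + ins e)" if "k \<ge> i" for k
      proof (cases "k < j")
        case True
        then show ?thesis using that s(2)[of k] s(5)[of "k + outs e"] r'[of "k + ins e"] by simp
      qed (use shift(1)[of k] in simp)
      show "?p i = ?p (Suc i)" if "e = Cap" using s(3)[OF that] that ij by (simp add: r')
      show "w' i = w' (Suc i)" if "e = Cup" using s(4)[OF that] that ij s(5)[of i] s(5)[of "Suc i"] by simp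
    qed
    have p3: "smooth (Some (e, i)) x ?p w' = smooth (Some (e, i)) x w u" for x
    proof (cases e)
      case (Crossing sg)
      then show ?thesis using ij s(5)[of i] s(5)[of "Suc i"] by (intro sm) (simp_all add: r')
    qed simp_all
    have p4: "smooth (Some (f, j + ins e)) x w ?p = smooth (Some (f, j + outs e)) x u w'" for x
      using shift[of j] shift[of "Suc j"] by (intro sm) simp_all
    show "u = pick w w' r \<and> step (Some (f, j + ins e)) w ?p \<and> step (Some (e, i)) ?p w' \<and>
      (\<forall>x. if True then smooth (Some (e, i)) x ?p w' = smooth (Some (e, i)) x w u \<and>
        smooth (Some (f, j + ins e)) x w ?p = smooth (Some (f, j + outs e)) x u w'
       else smooth (Some (f, j + ins e)) x w ?p = smooth (Some (e, i)) x w u \<and>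
        smooth (Some (e, i)) x ?p w' = smooth (Some (f, j + outs e)) x u w')"
      using u p1 p2 p3 p4 by simp
  qed
  show "isotopic True (Some (f, j + ins e)) (Some (e, i)) (Some (e, i)) (Some (f, j + outs e)) r' r"
    unfolding isotopic_def
  proof (intro allI impI)
    fix w u w' assume "step (Some (f, j + ins e)) w u" "step (Some (e, i)) u w'"
    then have s: "\<And>k. k < j + ins e \<Longrightarrow> u k = w k" "\<And>k. k \<ge> j + ins e \<Longrightarrow> u (k + outs f) = w (k + ins f)"
      "f = Cap \<Longrightarrow> w (j + ins e) = w (Suc (j + ins e))" "f = Cup \<Longrightarrow> u (j + ins e) = u (Suc (j + ins e))"
      "\<And>k. k < i \<Longrightarrow> w' k = u k" "\<And>k. k \<ge> i \<Longrightarrow> w' (k + outs e) = u (k + ins e)"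
      "e = Cap \<Longrightarrow> u i = u (Suc i)" "e = Cup \<Longrightarrow> w' i = w' (Suc i)"
      unfolding step_Some by blast+
    have u: "u = pick w w' r'"
      by (rule ext[of "ins e"]) (use s ij in \<open>simp_all add: r' r'2\<close>)
    let ?p = "pick w w' r"
    have shift: "?p (k + outs e) = w (k + ins e)" "w' (k + outs e) = u (k + ins e)" if "k \<ge> j" for k
      using that ij s(6)[of k] r2 by simp_all
    have p1: "step (Some (f, j + outs e)) ?p w'"
      unfolding step_Some
    proof (intro conjI allI impI)
      fix k assume "k \<ge> j + outs e"
      then have k1: "k = (k - outs e) + outs e" "k - outs e \<ge> j" by simp_all
      define k1 where "k1 = k - outs e"
      note k1 = k1[folded k1_def]
      have "w' (k1 + outs f + outs e) = u (k1 + outs f + ins e)" using shift(2)[of "k1 + outs f"] k1 by simp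
      also have "\<dots> = w (k1 + ins f + ins e)" using s(2)[of "k1 + ins e"] k1(2) by (simp add: ac_simps)
      also have "\<dots> = ?p (k1 + ins f + outs e)" using shift(1)[of "k1 + ins f"] k1 by simp
      finally show "w' (k + outs f) = ?p (k + ins f)" unfolding k1(1) by (simp add: ac_simps)
    next
      show "?p (j + outs e) = ?p (Suc (j + outs e))" if "f = Cap"
        using s(3)[OF that] shift(1)[of j] shift(1)[of "Suc j"] by simp
      show "w' (j + outs e) = w' (Suc (j + outs e))" if "f = Cup"
        using s(4)[OF that] shift(2)[of j] shift(2)[of "Suc j"] by simp
    qed (simp add: r)
    have p2: "step (Some (e, i)) w ?p"
      unfolding step_Some
    proof (intro conjI allI impI)
      show "?p k = w k" if "k < i" for k using that ij s(1,5)[of k] r[of k] by simp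
      show "?p (k + outs e) = w (k + ins e)" if "k \<ge> i" for k
      proof (cases "k < j")
        case True
        then show ?thesis using that s(6)[of k] s(1)[of "k + ins e"] r[of "k + outs e"] by simp
      qed (use shift(1)[of k] in simp)
      show "?p i = ?p (Suc i)" if "e = Cup" using s(8)[OF that] that ij by (simp add: r)
      show "w i = w (Suc i)" if "e = Cap" using s(7)[OF that] that ij s(1)[of i] s(1)[of "Suc i"] by simp
    qed
    have p3: "smooth (Some (e, i)) x w ?p = smooth (Some (e, i)) x u w'" for x
    proof (cases e)
      case (Crossing sg)
      then show ?thesis using ij s(1)[of i] s(1)[of "Suc i"] by (intro sm) (simp_all add: r)
    qed simp_all
    have p4: "smooth (Some (f, j + outs e)) x ?p w' = smooth (Some (f, j + ins e)) x w u" for x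
      using shift[of j] shift[of "Suc j"] by (intro sm) simp_all
    show "u = pick w w' r' \<and> step (Some (e, i)) w ?p \<and> step (Some (f, j + outs e)) ?p w' \<and>
      (\<forall>x. if True then smooth (Some (f, j + outs e)) x ?p w' = smooth (Some (f, j + ins e)) x w u \<and>
        smooth (Some (e, i)) x w ?p = smooth (Some (e, i)) x u w'
       else smooth (Some (e, i)) x w ?p = smooth (Some (f, j + ins e)) x w u \<and>
        smooth (Some (f, j + outs e)) x ?p w' = smooth (Some (e, i)) x u w')"
      using u p1 p2 p3 p4 by simp
  qed
qed

lemma nat_cases_near:
  fixes i k :: nat
  obtains "k < i" | "k = i" | "k = Suc i" | "k = Suc (Suc i)" | n where "k = n + 2" "n > i"
proof -
  consider "k < i" | "k = i" | "k = Suc i" | "k = Suc (Suc i)" | "k = (k - 2) + 2" "k - 2 > i" by linarith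
  then show ?thesis using that by cases blast+
qed

text \<open>All three parts of the zigzag have the colour of the strand \<open>i\<close>. Two idle
  times take the place of cup and cap, so that no height changes.\<close>

lemma isotopic_zigzag:
  fixes i :: nat
  assumes "ab = (i, Suc i) \<or> ab = (Suc i, i)"
  defines "r \<equiv> \<lambda>k. (False, if k \<le> i then k else if k \<le> Suc (Suc i) then i else k - 2)"
  shows "isotopic False (Some (Cup, fst ab)) (Some (Cap, snd ab)) None None r (\<lambda>k. (False, k))"
    "isotopic False None None (Some (Cup, fst ab)) (Some (Cap, snd ab)) (\<lambda>k. (False, k)) r"
proof -
  have p: "pick w w' (\<lambda>k. (False, k)) = w" for w w' by (simp add: pick_def fun_eq_iff)
  show "isotopic False (Some (Cup, fst ab)) (Some (Cap, snd ab)) None None r (\<lambda>k. (False, k))"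
    unfolding isotopic_def p
  proof (intro allI impI)
    fix w u w' assume s: "step (Some (Cup, fst ab)) w u" "step (Some (Cap, snd ab)) u w'"
    have "u k = pick w w' r k" for k
      by (rule nat_cases_near[of k i])
        (use s assms(1) in \<open>auto simp: step_cup step_cap pick_def r_def\<close>)
    moreover have "w' k = w k" for k
      by (rule nat_cases_near[of k i])
        (use s assms(1) in \<open>auto simp: step_cup step_cap\<close>)
    ultimately show "u = pick w w' r \<and> step None w w \<and> step None w w' \<and>
      (\<forall>x. if False then smooth None x w w' = smooth (Some (Cup, fst ab)) x w u \<and> smooth None x w w = smooth (Some (Cap, snd ab)) x u w'
        else smooth None x w w = smooth (Some (Cup, fst ab)) x w u \<and> smooth None x w w' = smooth (Some (Cap, snd ab)) x u w')"
      by (simp add: fun_eq_iff)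
  qed
  have "step (Some (Cup, fst ab)) w (pick w w r)" "step (Some (Cap, snd ab)) (pick w w r) w" for w
    using assms(1) by (auto simp: step_cup step_cap pick_def r_def)
  then show "isotopic False None None (Some (Cup, fst ab)) (Some (Cap, snd ab)) (\<lambda>k. (False, k)) r"
    unfolding isotopic_def p by simp
qed

text \<open>Swinging the cap turns the crossing by a quarter, which exchanges horizontal and
  vertical smoothing; the negated sign restores their labels.\<close>

lemma isotopic_swing_cap:
  fixes i :: nat
  defines "r \<equiv> \<lambda>k. if k = i then (True, i) else if k = Suc i then (False, Suc (Suc i)) else (False, k)"
    and "r' \<equiv> \<lambda>k. if k = Suc i then (False, i) else if k = Suc (Suc i) then (True, i) else (False, k)"
  shows "isotopic False (Some (Crossing s, i)) (Some (Cap, Suc i)) (Some (Crossing (\<not> s), Suc i)) (Some (Cap, i)) r r'"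
    "isotopic False (Some (Crossing (\<not> s), Suc i)) (Some (Cap, i)) (Some (Crossing s, i)) (Some (Cap, Suc i)) r' r"
proof -
  show "isotopic False (Some (Crossing s, i)) (Some (Cap, Suc i)) (Some (Crossing (\<not> s), Suc i)) (Some (Cap, i)) r r'"
    unfolding isotopic_def
  proof (intro allI impI)
    fix w u w' assume st: "step (Some (Crossing s, i)) w u" "step (Some (Cap, Suc i)) u w'"
    have u: "u = pick w w' r"
      using st by (auto simp: fun_eq_iff step_crossing step_cap pick_def r_def)
    have "step (Some (Cap, i)) (pick w w' r') w'"
      using st by (auto simp: step_crossing step_cap pick_def r'_def less_Suc_eq)
    moreover have "step (Some (Crossing (\<not> s), Suc i)) w (pick w w' r')"
      by (simp add: step_crossing pick_def r'_def)
    moreover have "smooth (Some (Crossing (\<not> s), Suc i)) x w (pick w w' r') = smooth (Some (Crossing s, i)) x w u" for x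
      unfolding u smooth_crossing pick_def r_def r'_def by (cases x; cases s) auto
    ultimately show "u = pick w w' r \<and> step (Some (Crossing (\<not> s), Suc i)) w (pick w w' r') \<and> step (Some (Cap, i)) (pick w w' r') w' \<and>
      (\<forall>x. if False then smooth (Some (Cap, i)) x (pick w w' r') w' = smooth (Some (Crossing s, i)) x w u \<and>
          smooth (Some (Crossing (\<not> s), Suc i)) x w (pick w w' r') = smooth (Some (Cap, Suc i)) x u w'
        else smooth (Some (Crossing (\<not> s), Suc i)) x w (pick w w' r') = smooth (Some (Crossing s, i)) x w u \<and>
          smooth (Some (Cap, i)) x (pick w w' r') w' = smooth (Some (Cap, Suc i)) x u w')"
      using u by simp
  qed
  show "isotopic False (Some (Crossing (\<not> s), Suc i)) (Some (Cap, i)) (Some (Crossing s, i)) (Some (Cap, Suc i)) r' r"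
    unfolding isotopic_def
  proof (intro allI impI)
    fix w u w' assume st: "step (Some (Crossing (\<not> s), Suc i)) w u" "step (Some (Cap, i)) u w'"
    have u: "u = pick w w' r'"
      using st by (auto simp: fun_eq_iff step_crossing step_cap pick_def r'_def)
    have "step (Some (Cap, Suc i)) (pick w w' r) w'"
      using st by (auto simp: step_crossing step_cap pick_def r_def less_Suc_eq)
    moreover have "step (Some (Crossing s, i)) w (pick w w' r)"
      by (simp add: step_crossing pick_def r_def)
    moreover have "smooth (Some (Crossing s, i)) x w (pick w w' r) = smooth (Some (Crossing (\<not> s), Suc i)) x w u" for x
      unfolding u smooth_crossing pick_def r_def r'_def by (cases x; cases s) auto
    ultimately show "u = pick w w' r' \<and> step (Some (Crossing s, i)) w (pick w w' r) \<and> step (Some (Cap, Suc i)) (pick w w' r) w' \<and>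
      (\<forall>x. if False then smooth (Some (Cap, Suc i)) x (pick w w' r) w' = smooth (Some (Crossing (\<not> s), Suc i)) x w u \<and>
          smooth (Some (Crossing s, i)) x w (pick w w' r) = smooth (Some (Cap, i)) x u w'
        else smooth (Some (Crossing s, i)) x w (pick w w' r) = smooth (Some (Crossing (\<not> s), Suc i)) x w u \<and>
          smooth (Some (Cap, Suc i)) x (pick w w' r) w' = smooth (Some (Cap, i)) x u w')"
      using u by simp
  qed
qed

lemma isotopic_swing_cup:
  fixes i :: nat
  defines "r \<equiv> \<lambda>k. if k = i then (False, i) else if k = Suc i then (True, Suc (Suc i)) else (True, k)"
    and "r' \<equiv> \<lambda>k. if k = Suc i then (True, i) else if k = Suc (Suc i) then (False, i) else (True, k)"
  shows "isotopic False (Some (Cup, Suc i)) (Some (Crossing s, i)) (Some (Cup, i)) (Some (Crossing (\<not> s), Suc i)) r r'"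
    "isotopic False (Some (Cup, i)) (Some (Crossing (\<not> s), Suc i)) (Some (Cup, Suc i)) (Some (Crossing s, i)) r' r"
proof -
  show "isotopic False (Some (Cup, Suc i)) (Some (Crossing s, i)) (Some (Cup, i)) (Some (Crossing (\<not> s), Suc i)) r r'"
    unfolding isotopic_def
  proof (intro allI impI)
    fix w u w' assume st: "step (Some (Cup, Suc i)) w u" "step (Some (Crossing s, i)) u w'"
    have u: "u = pick w w' r"
      using st by (auto simp: fun_eq_iff step_crossing step_cup pick_def r_def)
    have "step (Some (Cup, i)) w (pick w w' r')"
      using st by (auto simp: step_crossing step_cup pick_def r'_def less_Suc_eq)
    moreover have "step (Some (Crossing (\<not> s), Suc i)) (pick w w' r') w'"
      by (simp add: step_crossing pick_def r'_def)
    moreover have "smooth (Some (Crossing (\<not> s), Suc i)) x (pick w w' r') w' = smooth (Some (Crossing s, i)) x u w'" for x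
      unfolding u smooth_crossing pick_def r_def r'_def by (cases x; cases s) auto
    ultimately show "u = pick w w' r \<and> step (Some (Cup, i)) w (pick w w' r') \<and> step (Some (Crossing (\<not> s), Suc i)) (pick w w' r') w' \<and>
      (\<forall>x. if False then smooth (Some (Crossing (\<not> s), Suc i)) x (pick w w' r') w' = smooth (Some (Cup, Suc i)) x w u \<and>
          smooth (Some (Cup, i)) x w (pick w w' r') = smooth (Some (Crossing s, i)) x u w'
        else smooth (Some (Cup, i)) x w (pick w w' r') = smooth (Some (Cup, Suc i)) x w u \<and>
          smooth (Some (Crossing (\<not> s), Suc i)) x (pick w w' r') w' = smooth (Some (Crossing s, i)) x u w')"
      using u by simp
  qed
  show "isotopic False (Some (Cup, i)) (Some (Crossing (\<not> s), Suc i)) (Some (Cup, Suc i)) (Some (Crossing s, i)) r' r"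
    unfolding isotopic_def
  proof (intro allI impI)
    fix w u w' assume st: "step (Some (Cup, i)) w u" "step (Some (Crossing (\<not> s), Suc i)) u w'"
    have u: "u = pick w w' r'"
      using st by (auto simp: fun_eq_iff step_crossing step_cup pick_def r'_def)
    have "step (Some (Cup, Suc i)) w (pick w w' r)"
      using st by (auto simp: step_crossing step_cup pick_def r_def less_Suc_eq)
    moreover have "step (Some (Crossing s, i)) (pick w w' r) w'"
      by (simp add: step_crossing pick_def r_def)
    moreover have "smooth (Some (Crossing s, i)) x (pick w w' r) w' = smooth (Some (Crossing (\<not> s), Suc i)) x u w'" for x
      unfolding u smooth_crossing pick_def r_def r'_def by (cases x; cases s) auto
    ultimately show "u = pick w w' r' \<and> step (Some (Cup, Suc i)) w (pick w w' r) \<and> step (Some (Crossing s, i)) (pick w w' r) w' \<and>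
      (\<forall>x. if False then smooth (Some (Crossing s, i)) x (pick w w' r) w' = smooth (Some (Cup, i)) x w u \<and>
          smooth (Some (Cup, Suc i)) x w (pick w w' r) = smooth (Some (Crossing (\<not> s), Suc i)) x u w'
        else smooth (Some (Cup, Suc i)) x w (pick w w' r) = smooth (Some (Cup, i)) x w u \<and>
          smooth (Some (Crossing s, i)) x (pick w w' r) w' = smooth (Some (Crossing (\<not> s), Suc i)) x u w')"
      using u by simp
  qed
qed


section \<open>Idle times in sequences of events\<close>

definition ins_nop :: "nat \<Rightarrow> (nat \<Rightarrow> event option) \<Rightarrow> nat \<Rightarrow> event option" where
  "ins_nop t E s = (if s < t then E s else if s = t then None else E (s - 1))"

lemma width_ins_nop: "width (ins_nop t E) s = width E (if s \<le> t then s else s - 1)"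
proof (induction s)
  case (Suc s)
  consider "s < t" | "s = t" | "s > t" by linarith
  then show ?case
  proof cases
    case 1
    then have "ins_nop t E s = E s" by (simp add: ins_nop_def)
    then show ?thesis using Suc 1 by (simp cong: option.case_cong)
  next
    case 2
    then have "ins_nop t E s = None" by (simp add: ins_nop_def)
    then show ?thesis using Suc 2 by simp
  next
    case 3
    then obtain u where u: "s = Suc u" by (cases s) auto
    have "ins_nop t E (Suc u) = E u" using 3 u by (simp add: ins_nop_def)
    moreover have "width (ins_nop t E) (Suc u) = width E u" using Suc.IH 3 u by (simp del: width.simps)
    ultimately have "width (ins_nop t E) (Suc (Suc u)) = width E (Suc u)"
      by (simp only: width.simps(2)[of _ "Suc u"] width.simps(2)[of _ u])
    then show ?thesis using 3 u by (simp del: width.simps)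
  qed
qed simp

lemma valid_ins_nop:
  assumes "valid E"
  shows "valid (ins_nop t E)"
proof -
  obtain N where N: "\<forall>s\<ge>N. E s = None \<and> width E s = 0" using assms unfolding valid_def by blast
  have "ins_nop t E s = None \<and> width (ins_nop t E) s = 0" if "s \<ge> N + t + 1" for s
    using N that by (simp add: width_ins_nop ins_nop_def)
  moreover have "i + ins e \<le> width (ins_nop t E) s" if "ins_nop t E s = Some (e, i)" for s e i
  proof (cases "s < t")
    case True
    then show ?thesis using assms that unfolding valid_def width_ins_nop by (simp add: ins_nop_def)
  next
    case False
    then have "s > t" "E (s - 1) = Some (e, i)" using that by (auto simp: ins_nop_def split: if_splits)
    then show ?thesis using assms unfolding valid_def width_ins_nop by simp
  qed
  ultimately show ?thesis unfolding valid_def by blast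
qed

lemma affine_on_reindex: "affine_on V (\<lambda>c e. c (k e))"
proof (rule affine_onI)
  show "\<exists>g. deg_le 1 g \<and> (\<forall>c\<in>V. c (k e) = g c)" for e
    by (rule exI[of _ "\<lambda>c. c (k e)"]) (simp add: deg_coord)
qed

lemma SUB_nop:
  assumes E: "valid E"
  shows "SUB 0 E (ins_nop t E)" "SUB 0 (ins_nop t E) E"
proof -
  let ?F = "ins_nop t E"
  define a where "a = (\<lambda>(s, j :: nat). (if s \<le> t then s else s - 1, j))"
  define b where "b = (\<lambda>(s, j :: nat). (if s \<le> t then s else Suc s, j))"
  let ?T = "\<lambda>c e. c (a e)" and ?S = "\<lambda>c e. c (b e)"
  have la: "lv (?T c) s = lv c (if s \<le> t then s else s - 1)" for c s
    by (simp add: lv_def a_def fun_eq_iff)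
  have lb: "lv (?S c) s = lv c (if s \<le> t then s else Suc s)" for c s
    by (simp add: lv_def b_def fun_eq_iff)
  have T: "?T c \<in> Cs ?F" if c: "c \<in> Cs E" for c
    unfolding Cs_def mem_Collect_eq
  proof (intro conjI allI)
    show "\<not> ?T c (0, j)" for j using Cs_zero[OF c] by (simp add: a_def)
    show "step (?F s) (lv (?T c) s) (lv (?T c) (Suc s))" for s
    proof -
      consider "s < t" | "s = t" | "s > t" by linarith
      then show ?thesis
      proof cases
        case 3
        then show ?thesis using Cs_step[OF c, of "s - 1"] unfolding la by (simp add: ins_nop_def)
      qed (use Cs_step[OF c, of s] in \<open>simp_all add: la ins_nop_def\<close>)
    qed
  qed
  have S: "?S c \<in> Cs E" if c: "c \<in> Cs ?F" for c
    unfolding Cs_def mem_Collect_eq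
  proof (intro conjI allI)
    show "\<not> ?S c (0, j)" for j using Cs_zero[OF c] by (simp add: b_def)
    have l: "lv c (Suc t) = lv c t" using Cs_step[OF c, of t] by (simp add: ins_nop_def)
    show "step (E s) (lv (?S c) s) (lv (?S c) (Suc s))" for s
    proof -
      consider "s < t" | "s = t" | "s > t" by linarith
      then show ?thesis
      proof cases
        case 1
        then show ?thesis using Cs_step[OF c, of s] by (simp add: lb ins_nop_def)
      next
        case 2
        then show ?thesis using Cs_step[OF c, of "Suc t"] by (simp add: lb ins_nop_def l)
      next
        case 3
        then show ?thesis using Cs_step[OF c, of "Suc s"] by (simp add: lb ins_nop_def)
      qed
    qed
  qed
  have ab: "a (b e) = e" for e :: "nat \<times> nat" by (cases e) (simp add: a_def b_def)
  have ST: "?S (?T c) = c" for c by (simp add: ab)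
  have TS: "?T (?S c) = c" if c: "c \<in> Cs ?F" for c
  proof
    fix e :: "nat \<times> nat"
    obtain s j where e: "e = (s, j)" by (cases e)
    have l: "lv c (Suc t) = lv c t" using Cs_step[OF c, of t] by (simp add: ins_nop_def)
    show "c (b (a e)) = c e"
      using fun_cong[OF l, of j] by (cases "s = Suc t") (auto simp: e a_def b_def lv_def)
  qed
  define h where "h x = (if x < t then x else Suc x)" for x
  define h' where "h' x = (if x \<le> t then x else x - 1)" for x
  have X: "Xs ?F = h ` Xs E"
  proof -
    have "x \<in> Xs ?F \<Longrightarrow> x \<noteq> t \<and> h' x \<in> Xs E" for x
      by (auto simp: Xs_crossing ins_nop_def h'_def crossing_def split: if_splits)
    moreover have "x \<noteq> t \<Longrightarrow> h (h' x) = x" for x by (auto simp: h_def h'_def)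
    moreover have "x \<in> Xs E \<Longrightarrow> h x \<in> Xs ?F" for x
      by (auto simp: Xs_crossing ins_nop_def h_def)
    ultimately show ?thesis by (metis (no_types, opaque_lifting) image_iff subsetI subset_antisym image_subset_iff)
  qed
  have X': "Xs E = h' ` Xs ?F" unfolding X image_image by (auto simp: h_def h'_def)
  have ih: "inj_on h (Xs E)" by (auto simp: inj_on_def h_def split: if_splits)
  have ih': "inj_on h' (Xs ?F)" unfolding X by (auto simp: inj_on_def h_def h'_def split: if_splits)
  have P: "Ps ?F x (h y) (?T c) = Ps E x y c" for x y c
    unfolding Ps_def la by (auto simp: h_def ins_nop_def)
  have P': "Ps E x (h' y) (?S c) = Ps ?F x y c" if "y \<in> Xs ?F" "c \<in> Cs ?F" for x y c
  proof -
    have l: "lv c (Suc t) = lv c t" using Cs_step[OF that(2), of t] by (simp add: ins_nop_def)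
    have "y \<noteq> t" using that(1) by (auto simp: Xs_def ins_nop_def)
    then show ?thesis unfolding Ps_def lb
      by (cases "y < t"; cases "y = Suc t") (auto simp: h'_def ins_nop_def l)
  qed
  show "SUB 0 E ?F" unfolding SUB_def
    by (rule sub_iso[where h = h and t = ?T and s = ?S, OF ih X T S ST TS P affine_on_reindex cube_Cs[OF E]])
  show "SUB 0 ?F E" unfolding SUB_def
    by (rule sub_iso[where h = h' and t = ?S and s = ?T, OF ih' X' S T TS ST P' affine_on_reindex cube_Cs[OF valid_ins_nop[OF E]]])
qed

subsection \<open>Diagrams as lists\<close>

definition evD :: "diagram \<Rightarrow> nat \<Rightarrow> event option" where
  "evD D t = (if t < length D then Some (D ! t) else None)"

lemma width_evD:
  assumes "tangle n D m" "width E t0 = n" "\<And>k. k < length D \<Longrightarrow> E (t0 + k) = Some (D ! k)"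
  shows "(\<forall>k e i. k < length D \<longrightarrow> D ! k = (e, i) \<longrightarrow> i + ins e \<le> width E (t0 + k)) \<and> width E (t0 + length D) = m"
  using assms
proof (induction D arbitrary: n t0)
  case (Cons ev D)
  obtain e i where ev: "ev = (e, i)" by (cases ev)
  have E0: "E t0 = Some (e, i)" using Cons.prems(3)[of 0] ev by simp
  have w: "width E (Suc t0) = n - ins e + outs e" using Cons.prems(2) E0 by simp
  have "tangle (n - ins e + outs e) D m" and i: "i + ins e \<le> n" using Cons.prems(1) ev by auto
  from Cons.IH[OF this(1) w] Cons.prems(3)[of "Suc _"]
  have IH: "\<forall>k e i. k < length D \<longrightarrow> D ! k = (e, i) \<longrightarrow> i + ins e \<le> width E (Suc t0 + k)"
    "width E (Suc t0 + length D) = m" by auto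
  have "i' + ins e' \<le> width E (t0 + k)" if "k < length (ev # D)" "(ev # D) ! k = (e', i')" for k e' i'
    using that IH(1) i Cons.prems(2) ev by (cases k) auto
  then show ?case using IH(2) by simp
qed simp

lemma valid_evD:
  assumes "link_diagram D"
  shows "valid (evD D)"
proof -
  have t: "tangle 0 D 0" using assms by (simp add: link_diagram_def)
  have w: "(\<forall>k e i. k < length D \<longrightarrow> D ! k = (e, i) \<longrightarrow> i + ins e \<le> width (evD D) (0 + k)) \<and> width (evD D) (0 + length D) = 0"
    by (rule width_evD[OF t]) (simp_all add: evD_def)
  have n: "evD D s = None" if "s \<ge> length D" for s using that by (simp add: evD_def)
  have "width (evD D) (length D + n) = 0" for n
    by (induction n) (use w n in simp_all)
  then have "\<forall>s\<ge>length D. evD D s = None \<and> width (evD D) s = 0"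
    using n by (metis le_iff_add)
  moreover have "i + ins e \<le> width (evD D) s" if "evD D s = Some (e, i)" for s e i
  proof -
    have "s < length D" "D ! s = (e, i)" using that by (simp_all add: evD_def split: if_splits)
    then show ?thesis using w by simp
  qed
  ultimately show ?thesis unfolding valid_def by blast
qed

definition dsub :: "int \<Rightarrow> diagram \<Rightarrow> diagram \<Rightarrow> bool" where
  "dsub a D D' = SUB a (evD D) (evD D')"

definition diso :: "diagram \<Rightarrow> diagram \<Rightarrow> bool" where
  "diso D D' \<longleftrightarrow> dsub 0 D D' \<and> dsub 0 D' D"

lemma SUB0_trans: "SUB 0 E E' \<Longrightarrow> SUB 0 E' E'' \<Longrightarrow> SUB 0 E E''"
  using SUB_trans[of 0 E E' 0] by simp

lemma diso_refl: "diso D D"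
  by (simp add: diso_def dsub_def SUB_refl)

lemma diso_sym: "diso D D' \<Longrightarrow> diso D' D"
  by (simp add: diso_def)

lemma diso_trans: "diso D D' \<Longrightarrow> diso D' D'' \<Longrightarrow> diso D D''"
  unfolding diso_def dsub_def using SUB0_trans by blast

lemma disoI: "SUB 0 (evD D) F \<Longrightarrow> SUB 0 F (evD D) \<Longrightarrow> SUB 0 (evD D') F \<Longrightarrow> SUB 0 F (evD D') \<Longrightarrow> diso D D'"
  unfolding diso_def dsub_def using SUB0_trans by blast

lemma evD_two: "evD (A @ [x, y] @ B) (length A) = Some x" "evD (A @ [x, y] @ B) (Suc (length A)) = Some y"
  "s \<noteq> length A \<Longrightarrow> s \<noteq> Suc (length A) \<Longrightarrow> evD (A @ [x, y] @ B) s = evD (A @ [x', y'] @ B) s"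
  by (auto simp: evD_def nth_append nth_Cons' )

text \<open>Overwriting an event by \<open>None\<close> in place, as in the invariance lemmas,
  equals inserting an idle time into the shorter list.\<close>

lemma evD_nop:
  "(evD (A @ [x, y] @ B))(length A := None) = ins_nop (length A) (evD (A @ [y] @ B))"
  "(evD (A @ [x, y] @ B))(Suc (length A) := None) = ins_nop (Suc (length A)) (evD (A @ [x] @ B))"
  "(evD (A @ [x, y] @ B))(length A := None, Suc (length A) := None) = ins_nop (length A) (ins_nop (length A) (evD (A @ B)))"
  by (auto simp: evD_def ins_nop_def nth_append nth_Cons' fun_eq_iff)

lemma diso_level:
  assumes iso: "isotopic sw (Some a) (Some b) (Some a') (Some b') r r'" "isotopic sw (Some a') (Some b') (Some a) (Some b) r' r"
    and cr: "if sw then crossing (Some a') = crossing (Some b) \<and> crossing (Some b') = crossing (Some a)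
      else crossing (Some a') = crossing (Some a) \<and> crossing (Some b') = crossing (Some b)"
    and D: "link_diagram (A @ [a, b] @ B)" "link_diagram (A @ [a', b'] @ B)"
  shows "diso (A @ [a, b] @ B) (A @ [a', b'] @ B)"
proof -
  have cr': "if sw then crossing (Some a) = crossing (Some b') \<and> crossing (Some b) = crossing (Some a')
      else crossing (Some a) = crossing (Some a') \<and> crossing (Some b) = crossing (Some b')"
    using cr by (simp split: if_splits)
  show ?thesis unfolding diso_def dsub_def
    using SUB_level[OF iso cr valid_evD[OF D(1)] evD_two(1,2) evD_two(1,2) evD_two(3)]
      SUB_level[OF iso(2,1) cr' valid_evD[OF D(2)] evD_two(1,2) evD_two(1,2) evD_two(3)] by blast
qed

lemma diso_delete:
  assumes iso: "isotopic False (Some a) (Some b) None None r r'" "isotopic False None None (Some a) (Some b) r' r"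
    and cr: "\<not> crossing (Some a)" "\<not> crossing (Some b)"
    and D: "link_diagram (A @ [a, b] @ B)" "link_diagram (A @ B)"
  shows "diso (A @ [a, b] @ B) (A @ B)"
proof -
  let ?t = "length A"
  let ?E = "evD (A @ [a, b] @ B)"
  let ?F = "?E(?t := None, Suc ?t := None)"
  have F: "?F = ins_nop ?t (ins_nop ?t (evD (A @ B)))" by (rule evD_nop(3))
  have v: "valid ?F" unfolding F by (intro valid_ins_nop valid_evD D(2))
  have n: "\<not> crossing None" by (simp add: crossing_def)
  have 1: "SUB 0 ?E ?F"
    by (rule SUB_level[OF iso _ valid_evD[OF D(1)] evD_two(1,2)]) (use cr n in simp_all)
  have 2: "SUB 0 ?F ?E"
    by (rule SUB_level[OF iso(2,1) _ v _ _ evD_two(1,2)]) (use cr n in simp_all)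
  have "SUB 0 (evD (A @ B)) ?F" "SUB 0 ?F (evD (A @ B))"
    unfolding F using SUB_nop[OF valid_evD[OF D(2)]] SUB_nop[OF valid_ins_nop[OF valid_evD[OF D(2)]]] SUB0_trans
    by blast+
  then show ?thesis using disoI[OF 1 2] by blast
qed

lemma diso_R1:
  assumes "link_diagram (A @ [(Crossing s, i), (Cap, i)] @ B)" "link_diagram (A @ [(Cap, i)] @ B)"
  shows "diso (A @ [(Crossing s, i), (Cap, i)] @ B) (A @ [(Cap, i)] @ B)"
  using SUB_R1_cap[OF valid_evD[OF assms(1)] evD_two(1,2)] SUB_nop[OF valid_evD[OF assms(2)], of "length A"]
  unfolding evD_nop(1) by (intro disoI[of _ "ins_nop (length A) (evD (A @ [(Cap, i)] @ B))"])

lemma diso_R1':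
  assumes "link_diagram (A @ [(Cup, i), (Crossing s, i)] @ B)" "link_diagram (A @ [(Cup, i)] @ B)"
  shows "diso (A @ [(Cup, i), (Crossing s, i)] @ B) (A @ [(Cup, i)] @ B)"
  using SUB_R1_cup[OF valid_evD[OF assms(1)] evD_two(1,2)] SUB_nop[OF valid_evD[OF assms(2)], of "Suc (length A)"]
  unfolding evD_nop(2) by (intro disoI[of _ "ins_nop (Suc (length A)) (evD (A @ [(Cup, i)] @ B))"])

lemma diso_R2:
  assumes "link_diagram (A @ [(Crossing s, i), (Crossing (\<not> s), i)] @ B)" "link_diagram (A @ B)"
  shows "diso (A @ [(Crossing s, i), (Crossing (\<not> s), i)] @ B) (A @ B)"
proof -
  let ?F = "ins_nop (length A) (ins_nop (length A) (evD (A @ B)))"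
  have "SUB 0 (evD (A @ B)) ?F" "SUB 0 ?F (evD (A @ B))"
    using SUB_nop[OF valid_evD[OF assms(2)]] SUB_nop[OF valid_ins_nop[OF valid_evD[OF assms(2)]]] SUB0_trans
    by blast+
  then show ?thesis
    using SUB_R2[OF valid_evD[OF assms(1)] evD_two(1,2)] unfolding evD_nop(3) by (intro disoI[of _ ?F])
qed

lemma diso_R3:
  assumes D: "link_diagram (A @ [(Crossing False, i), (Crossing True, Suc i), (Crossing True, i)] @ B)"
    "link_diagram (A @ [(Crossing True, Suc i), (Crossing True, i), (Crossing False, Suc i)] @ B)"
  shows "diso (A @ [(Crossing False, i), (Crossing True, Suc i), (Crossing True, i)] @ B)
    (A @ [(Crossing True, Suc i), (Crossing True, i), (Crossing False, Suc i)] @ B)"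
proof -
  have 1: "evD (A @ [x, y, z] @ B) (length A) = Some x" "evD (A @ [x, y, z] @ B) (Suc (length A)) = Some y"
    "evD (A @ [x, y, z] @ B) (Suc (Suc (length A))) = Some z" for x y z
    by (simp_all add: evD_def nth_append)
  have 2: "evD (A @ [x', y', z'] @ B) s = evD (A @ [x, y, z] @ B) s"
    if "s \<notin> {length A, Suc (length A), Suc (Suc (length A))}" for s x y z x' y' z'
    using that by (auto simp: evD_def nth_append nth_Cons')
  show ?thesis unfolding diso_def dsub_def
    using SUB_R3[OF valid_evD[OF D(1)] 1 valid_evD[OF D(2)] 1 2] by simp
qed


text \<open>A computation in the braid group on three strands, with \<open>?a\<close>,
  \<open>?b\<close> the two generators and capitals their inverses: once inverses cancel, every
  admissible sign pattern is equivalent to the relation \<open>base\<close>.\<close>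

lemma reidemeister3_from_one:
  fixes R :: "(bool \<times> bool) list \<Rightarrow> (bool \<times> bool) list \<Rightarrow> bool"
  assumes refl: "\<And>x. R x x" and sym: "\<And>x y. R x y \<Longrightarrow> R y x" and trans: "\<And>x y z. R x y \<Longrightarrow> R y z \<Longrightarrow> R x z"
    and ctx: "\<And>x y u v. R x y \<Longrightarrow> R (u @ x @ v) (u @ y @ v)"
    and canc: "\<And>s b. R [(s, b), (\<not> s, b)] []"
    and base: "R [(False, False), (True, True), (True, False)] [(True, True), (True, False), (False, True)]"
    and stu: "s = t \<or> t = u"
  shows "R [(s, False), (t, True), (u, False)] [(u, True), (t, False), (s, True)]"
proof -
  let ?a = "(True, False)" and ?A = "(False, False)" and ?b = "(True, True)" and ?B = "(False, True)"
  have c: "R [?a, ?A] []" "R [?A, ?a] []" "R [?b, ?B] []" "R [?B, ?b] []"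
    using canc[of True False] canc[of False False] canc[of True True] canc[of False True] by simp_all
  have base: "R [?A, ?b, ?a] [?b, ?a, ?B]" by (rule base)
  have TTT: "R [?a, ?b, ?a] [?b, ?a, ?b]"
  proof -
    have 1: "R [?a, ?b, ?a] [?a, ?b, ?a, ?B, ?b]" using sym[OF ctx[OF c(4), of "[?a, ?b, ?a]" "[]"]] by simp
    have 2: "R [?a, ?b, ?a, ?B, ?b] [?a, ?A, ?b, ?a, ?b]" using ctx[OF sym[OF base], of "[?a]" "[?b]"] by simp
    have 3: "R [?a, ?A, ?b, ?a, ?b] [?b, ?a, ?b]" using ctx[OF c(1), of "[]" "[?b, ?a, ?b]"] by simp
    show ?thesis using trans[OF trans[OF 1 2] 3] .
  qed
  \<comment> \<open>Uniqueness of inverses, applied to the two sides of \<open>TTT\<close>.\<close>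
  have FFF: "R [?A, ?B, ?A] [?B, ?A, ?B]"
  proof -
    have 1: "R [?a, ?b, ?a, ?B, ?A, ?B] []"
    proof -
      have "R [?a, ?b, ?a, ?B, ?A, ?B] [?b, ?a, ?b, ?B, ?A, ?B]" using ctx[OF TTT, of "[]" "[?B, ?A, ?B]"] by simp
      moreover have "R [?b, ?a, ?b, ?B, ?A, ?B] [?b, ?a, ?A, ?B]" using ctx[OF c(3), of "[?b, ?a]" "[?A, ?B]"] by simp
      moreover have "R [?b, ?a, ?A, ?B] [?b, ?B]" using ctx[OF c(1), of "[?b]" "[?B]"] by simp
      ultimately show ?thesis using trans c(3) by blast
    qed
    have 2: "R [?A, ?B, ?A, ?a, ?b, ?a] []"
    proof -
      have "R [?A, ?B, ?A, ?a, ?b, ?a] [?A, ?B, ?b, ?a]" using ctx[OF c(2), of "[?A, ?B]" "[?b, ?a]"] by simp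
      moreover have "R [?A, ?B, ?b, ?a] [?A, ?a]" using ctx[OF c(4), of "[?A]" "[?a]"] by simp
      ultimately show ?thesis using trans c(2) by blast
    qed
    have "R [?A, ?B, ?A] [?A, ?B, ?A, ?a, ?b, ?a, ?B, ?A, ?B]" using sym[OF ctx[OF 1, of "[?A, ?B, ?A]" "[]"]] by simp
    moreover have "R [?A, ?B, ?A, ?a, ?b, ?a, ?B, ?A, ?B] [?B, ?A, ?B]" using ctx[OF 2, of "[]" "[?B, ?A, ?B]"] by simp
    ultimately show ?thesis by (rule trans)
  qed
  have TTF: "R [?a, ?b, ?A] [?B, ?a, ?b]"
  proof -
    have "R [?a, ?b, ?A] [?B, ?b, ?a, ?b, ?A]" using sym[OF ctx[OF c(4), of "[]" "[?a, ?b, ?A]"]] by simp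
    moreover have "R [?B, ?b, ?a, ?b, ?A] [?B, ?a, ?b, ?a, ?A]" using ctx[OF sym[OF TTT], of "[?B]" "[?A]"] by simp
    moreover have "R [?B, ?a, ?b, ?a, ?A] [?B, ?a, ?b]" using ctx[OF c(1), of "[?B, ?a, ?b]" "[]"] by simp
    ultimately show ?thesis using trans by blast
  qed
  have FFT: "R [?A, ?B, ?a] [?b, ?A, ?B]"
  proof -
    have "R [?A, ?B, ?a] [?b, ?B, ?A, ?B, ?a]" using sym[OF ctx[OF c(3), of "[]" "[?A, ?B, ?a]"]] by simp
    moreover have "R [?b, ?B, ?A, ?B, ?a] [?b, ?A, ?B, ?A, ?a]" using ctx[OF sym[OF FFF], of "[?b]" "[?a]"] by simp
    moreover have "R [?b, ?A, ?B, ?A, ?a] [?b, ?A, ?B]" using ctx[OF c(2), of "[?b, ?A, ?B]" "[]"] by simp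
    ultimately show ?thesis using trans by blast
  qed
  have TFF: "R [?a, ?B, ?A] [?B, ?A, ?b]"
  proof -
    have "R [?a, ?B, ?A] [?a, ?B, ?A, ?B, ?b]" using sym[OF ctx[OF c(4), of "[?a, ?B, ?A]" "[]"]] by simp
    moreover have "R [?a, ?B, ?A, ?B, ?b] [?a, ?A, ?B, ?A, ?b]" using ctx[OF sym[OF FFF], of "[?a]" "[?b]"] by simp
    moreover have "R [?a, ?A, ?B, ?A, ?b] [?B, ?A, ?b]" using ctx[OF c(1), of "[]" "[?B, ?A, ?b]"] by simp
    ultimately show ?thesis using trans by blast
  qed
  show ?thesis using stu by (cases s; cases t; cases u) (simp_all add: TTT FFF TTF FFT TFF base)
qed

lemma tangle_append_iff: "tangle n (A @ B) m \<longleftrightarrow> (\<exists>k. tangle n A k \<and> tangle k B m)"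
proof (induction A arbitrary: n)
  case (Cons a A)
  obtain e i where "a = (e, i)" by (cases a)
  then show ?case using Cons.IH[of "n - ins e + outs e"] by simp
qed simp

lemma diso_R3_all:
  assumes stu: "s = t \<or> t = u"
    and D: "link_diagram (A @ [(Crossing s, i), (Crossing t, Suc i), (Crossing u, i)] @ B)"
  shows "diso (A @ [(Crossing s, i), (Crossing t, Suc i), (Crossing u, i)] @ B)
    (A @ [(Crossing u, Suc i), (Crossing t, i), (Crossing s, Suc i)] @ B)"
proof -
  define g :: "bool \<times> bool \<Rightarrow> event" where "g = (\<lambda>(s, b). (Crossing s, if b then Suc i else i))"
  obtain n where A: "tangle 0 A n" and i: "i + 3 \<le> n" and B: "tangle n B 0"
  proof -
    obtain n where A: "tangle 0 A n"
      and r: "tangle n ([(Crossing s, i), (Crossing t, Suc i), (Crossing u, i)] @ B) 0"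
      using D unfolding link_diagram_def tangle_append_iff[of 0 A] by blast
    then have "i + 3 \<le> n" by auto
    moreover from this have "n - 2 + 2 = n" by simp
    then have "tangle n B 0" using r by simp
    ultimately show thesis using A that by blast
  qed
  have g: "tangle n (map g w) n" for w
    by (induction w) (use i in \<open>auto simp: g_def le_add_diff_inverse2 simp flip: add_2_eq_Suc'\<close>)
  have ld: "link_diagram (A @ map g w @ B)" for w
    unfolding link_diagram_def tangle_append_iff using A B g by blast
  \<comment> \<open>Quantifying over \<open>u\<close> and \<open>v\<close> builds compatibility with
    contexts into the relation.\<close>
  define R where "R w w' \<longleftrightarrow> (\<forall>u v. diso (A @ map g (u @ w @ v) @ B) (A @ map g (u @ w' @ v) @ B))" for w w'
  have "R [(s, False), (t, True), (u, False)] [(u, True), (t, False), (s, True)]"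
  proof (rule reidemeister3_from_one[OF _ _ _ _ _ _ stu])
    show "R x x" for x unfolding R_def by (simp add: diso_refl)
    show "R y x" if "R x y" for x y using that unfolding R_def by (simp add: diso_sym)
    show "R x z" if "R x y" "R y z" for x y z 
      unfolding R_def by (intro allI, rule diso_trans[OF that(1)[unfolded R_def, THEN spec, THEN spec] that(2)[unfolded R_def, THEN spec, THEN spec]])
    show "R (u @ x @ v) (u @ y @ v)" if "R x y" for x y u v
      unfolding R_def
    proof (intro allI)
      fix u' v'
      show "diso (A @ map g (u' @ (u @ x @ v) @ v') @ B) (A @ map g (u' @ (u @ y @ v) @ v') @ B)"
        using that[unfolded R_def, THEN spec, THEN spec, of "u' @ u" "v @ v'"] by (simp only: append_assoc)
    qed
    show "R [(s, b), (\<not> s, b)] []" for s b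
      unfolding R_def
    proof (intro allI)
      fix u v
      show "diso (A @ map g (u @ [(s, b), (\<not> s, b)] @ v) @ B) (A @ map g (u @ [] @ v) @ B)"
        using diso_R2[of "A @ map g u" s "if b then Suc i else i" "map g v @ B"]
          ld[of "u @ [(s, b), (\<not> s, b)] @ v"] ld[of "u @ v"] by (simp add: g_def)
    qed
    show "R [(False, False), (True, True), (True, False)] [(True, True), (True, False), (False, True)]"
      unfolding R_def
    proof (intro allI)
      fix u v
      show "diso (A @ map g (u @ [(False, False), (True, True), (True, False)] @ v) @ B)
          (A @ map g (u @ [(True, True), (True, False), (False, True)] @ v) @ B)"
        using diso_R3[of "A @ map g u" i "map g v @ B"] ld[of "u @ [(False, False), (True, True), (True, False)] @ v"]
          ld[of "u @ [(True, True), (True, False), (False, True)] @ v"] by (simp add: g_def)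
    qed
  qed
  from this[unfolded R_def, THEN spec, THEN spec, of "[]" "[]"] show ?thesis by (simp add: g_def)
qed

lemma diso_local_move:
  assumes m: "local_move L R" and D: "link_diagram (A @ L @ B)" "link_diagram (A @ R @ B)"
  shows "diso (A @ L @ B) (A @ R @ B)"
  using m
proof cases
  case (exchange i j e f)
  show ?thesis unfolding exchange(1,2)
    by (rule diso_level[OF isotopic_exchange[OF exchange(3)] _ D[unfolded exchange(1,2)]]) (simp add: crossing_def)
next
  case (zigzag_left i)
  show ?thesis
    using diso_delete[OF isotopic_zigzag[of "(Suc i, i)" i, OF disjI2[OF HOL.refl], simplified], of A B] D
    unfolding zigzag_left by (simp add: crossing_def)
next
  case (zigzag_right i)
  show ?thesis
    using diso_delete[OF isotopic_zigzag[of "(i, Suc i)" i, OF disjI1[OF HOL.refl], simplified], of A B] D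
    unfolding zigzag_right by (simp add: crossing_def)
next
  case (swing_cap s i)
  show ?thesis unfolding swing_cap
    by (rule diso_level[OF isotopic_swing_cap _ D[unfolded swing_cap]]) (simp add: crossing_def)
next
  case (swing_cup i s)
  show ?thesis unfolding swing_cup
    by (rule diso_level[OF isotopic_swing_cup _ D[unfolded swing_cup]]) (simp add: crossing_def)
next
  case (reidemeister1_cap s i)
  show ?thesis unfolding reidemeister1_cap by (rule diso_R1[OF D[unfolded reidemeister1_cap]])
next
  case (reidemeister1_cup i s)
  show ?thesis unfolding reidemeister1_cup by (rule diso_R1'[OF D[unfolded reidemeister1_cup]])
next
  case (reidemeister2 s i)
  show ?thesis using diso_R2[of A s i B] D unfolding reidemeister2 by simp
next
  case (reidemeister3 s t u i)
  show ?thesis unfolding reidemeister3(1,2) by (rule diso_R3_all[OF reidemeister3(3) D(1)[unfolded reidemeister3(1)]])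
qed

lemma same_link_diso:
  assumes "same_link D D'" "link_diagram D"
  shows "link_diagram D' \<and> diso D D'"
  using assms(1)[unfolded same_link_def]
proof (induction rule: equivclp_induct)
  case base
  show ?case using assms(2) diso_refl by simp
next
  case (step y z)
  have "diagram_move y z \<or> diagram_move z y" using step.hyps by blast
  then have "link_diagram z \<and> diso y z"
    unfolding diagram_move_def using diso_local_move diso_sym by blast
  then show ?case using step.IH diso_trans by blast
qed

subsection \<open>Crossing changes of lists\<close>

lemma change_crossings_insert:
  assumes "k \<notin> S" "D ! k = (Crossing s, i)" "k < length D"
  shows "evD (change_crossings (insert k S) D) = (evD (change_crossings S D))(k := Some (Crossing (\<not> s), i))"
    "evD (change_crossings S D) k = Some (Crossing s, i)"
  using assms by (auto simp: evD_def change_crossings_def map_at_def fun_eq_iff)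

lemma tangle_change_crossings: "tangle n D m \<Longrightarrow> tangle n (change_crossings S D) m"
proof -
  have f: "\<exists>e'. flip_crossing (e, i) = (e', i) \<and> ins e' = ins e \<and> outs e' = outs e" for e i
    by (cases e) auto
  let ?P = "\<lambda>x y. snd y = snd x \<and> ins (fst y) = ins (fst x) \<and> outs (fst y) = outs (fst x)"
  have "?P x (flip_crossing x)" for x using f[of "fst x" "snd x"] by auto
  then have "list_all2 ?P D (change_crossings S D)"
    by (auto simp: list_all2_conv_all_nth change_crossings_def map_at_def)
  moreover have "tangle n D' m" if "list_all2 ?P D D'" "tangle n D m" for D'
    using that by (induction D D' arbitrary: n rule: list_all2_induct) auto
  ultimately show "tangle n D m \<Longrightarrow> tangle n (change_crossings S D) m" by blast
qed

lemma dsub_change_crossings: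
  assumes D: "link_diagram D" and S: "S \<subseteq> crossings D"
  shows "dsub (2 * int (card S)) D (change_crossings S D)"
proof -
  have "finite S" by (rule finite_subset[OF S]) (simp add: crossings_def)
  then show ?thesis using S
  proof (induction S rule: finite_induct)
    case empty
    have "change_crossings {} D = D" by (simp add: change_crossings_def map_at_def map_nth)
    then show ?case by (simp add: dsub_def SUB_refl)
  next
    case (insert k S)
    obtain s i where k: "D ! k = (Crossing s, i)" "k < length D" using insert.prems by (auto simp: crossings_def)
    note c = change_crossings_insert[OF insert.hyps(2) k]
    have v: "valid (evD (change_crossings S D))"
      using D by (intro valid_evD) (simp add: link_diagram_def tangle_change_crossings)
    have "SUB 2 (evD (change_crossings S D)) (evD (change_crossings (insert k S) D))"
      unfolding c(1) by (rule SUB_crossing_change[OF v c(2)])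
    then have "SUB (2 * int (card S) + 2) (evD D) (evD (change_crossings (insert k S) D))"
      using insert.IH insert.prems SUB_trans unfolding dsub_def by blast
    then show ?case using insert.hyps by (simp add: dsub_def add.commute)
  qed
qed


section \<open>The trivial link\<close>

lemma deg_negative: "deg_le r f \<Longrightarrow> r < 0 \<Longrightarrow> \<not> f c"
  by (induction rule: deg_le.induct) auto

text \<open>The circle \<open>m\<close> of the unlink is met only at height
  \<open>2 * m + 1\<close>, as the strands 0 and 1.\<close>

definition discs :: "nat set \<Rightarrow> nat \<times> nat \<Rightarrow> bool" where
  "discs T e \<longleftrightarrow> snd e < 2 \<and> (\<exists>m\<in>T. fst e = Suc (2 * m))"

text \<open>Adding the values for both colours of the last circle yields the indicator of a point of
  the smaller cube and lowers the degree by one; at the end a nonzero constant is left.\<close>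

lemma indicator_degree:
  assumes "deg_le r g" "T0 \<subseteq> {..<k}" "\<And>T. T \<subseteq> {..<k} \<Longrightarrow> g (discs T) \<longleftrightarrow> T = T0"
  shows "int k \<le> r"
  using assms
proof (induction k arbitrary: r g T0)
  case 0
  then have "g (discs {})" by simp
  then have "\<not> r < 0" using deg_negative[OF 0(1)] by blast
  then show ?case by simp
next
  case (Suc k)
  define s where "s b c e = (if snd e < 2 \<and> fst e = Suc (2 * k) then b else c e)" for b :: bool and c and e :: "nat \<times> nat"
  define g' where "g' c = (g (s False c) \<oplus> g (s True c))" for c
  have g': "deg_le (r - 1) g'" unfolding g'_def
  proof (rule deg_derivative[OF Suc.prems(1)])
    fix e :: "nat \<times> nat"
    consider (a) "\<And>b c. s b c e = b" | (b) "\<And>b c. s b c e = c e"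
      by (cases "snd e < 2 \<and> fst e = Suc (2 * k)") (simp_all add: s_def)
    note e = this
    show "deg_le 1 (\<lambda>c. s False c e)" by (cases rule: e) (simp_all add: deg_const deg_coord)
    show "(\<forall>c. s True c e = s False c e) \<or> (\<forall>c. s True c e = (\<not> s False c e))"
      by (cases rule: e) simp_all
  qed
  have T: "g' (discs T) \<longleftrightarrow> T = T0 - {k}" if T: "T \<subseteq> {..<k}" for T
  proof -
    have k: "k \<notin> T" using T by auto
    have "s False (discs T) = discs T" "s True (discs T) = discs (insert k T)"
      using k by (auto simp: s_def discs_def fun_eq_iff)
    moreover have "T \<subseteq> {..<Suc k}" "insert k T \<subseteq> {..<Suc k}" using T by auto
    ultimately have "g' (discs T) = ((T = T0) \<oplus> (insert k T = T0))" using Suc.prems(3) unfolding g'_def by simp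
    then show ?thesis using k by (auto simp: xr_def)
  qed
  have "T0 - {k} \<subseteq> {..<k}" using Suc.prems(2) by (auto simp: less_Suc_eq)
  from Suc.IH[OF g' this T] have "int k \<le> r - 1" .
  then show ?case by simp
qed

lemma evD_unlink: "evD (unlink k) t = (if t < 2 * k then Some (if even t then Cup else Cap, 0) else None)"
proof -
  have "length (unlink k) = 2 * k" for k by (simp add: unlink_def length_concat sum_list_replicate)
  moreover have "t < 2 * k \<Longrightarrow> unlink k ! t = (if even t then Cup else Cap, 0)" for t
  proof (induction k arbitrary: t)
    case (Suc k)
    have "unlink (Suc k) = (Cup, 0) # (Cap, 0) # unlink k" by (simp add: unlink_def)
    then show ?case using Suc.IH[of "t - 2"] Suc.prems by (cases t; cases "t - 1") auto
  qed simp
  ultimately show ?thesis by (simp add: evD_def)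
qed

lemma Xs_unlink: "Xs (evD (unlink k)) = {}"
  by (auto simp: Xs_def evD_unlink split: if_splits)

lemma Cs_unlink: "Cs (evD (unlink k)) = discs ` Pow {..<k}"
proof
  show "discs ` Pow {..<k} \<subseteq> Cs (evD (unlink k))"
  proof (rule image_subsetI)
    fix T assume T: "T \<in> Pow {..<k}"
    have "step (evD (unlink k) t) (lv (discs T) t) (lv (discs T) (Suc t))" for t
    proof (cases "t < 2 * k")
      case True
      show ?thesis
      proof (cases "even t")
        case True
        then show ?thesis using \<open>t < 2 * k\<close> by (auto simp: evD_unlink step_Some lv_def discs_def elim!: evenE simp: double_not_eq_Suc_double)
      next
        case False
        then show ?thesis using \<open>t < 2 * k\<close> by (auto simp: evD_unlink step_Some lv_def discs_def elim!: oddE simp: Suc_double_not_eq_double)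
      qed
    next
      case False
      then have "\<not> discs T (t, j)" "\<not> discs T (Suc t, j)" for j using T by (auto simp: discs_def)
      then show ?thesis using False by (simp add: evD_unlink lv_def fun_eq_iff)
    qed
    moreover have "\<not> discs T (0, j)" for j by (simp add: discs_def)
    ultimately show "discs T \<in> Cs (evD (unlink k))" by (simp add: Cs_def)
  qed
  show "Cs (evD (unlink k)) \<subseteq> discs ` Pow {..<k}"
  proof
    fix c assume c: "c \<in> Cs (evD (unlink k))"
    have odd: "c (Suc (2 * m), j) \<longleftrightarrow> m < k \<and> j < 2 \<and> c (Suc (2 * m), 0)" if z: "\<And>j. \<not> c (2 * m, j)" for m j
    proof (cases "m < k")
      case True
      have s: "step (Some (Cup, 0)) (lv c (2 * m)) (lv c (Suc (2 * m)))"
        using Cs_step[OF c, of "2 * m"] True by (simp add: evD_unlink)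
      consider "j = 0" | "j = 1" | "j \<ge> 2" by linarith
      then show ?thesis
      proof cases
        case 3
        then obtain l where "j = l + 2" by (metis le_add_diff_inverse2)
        then show ?thesis using s z unfolding step_cup by (simp add: lv_def)
      qed (use s True in \<open>auto simp: step_cup lv_def\<close>)
    next
      case False
      then show ?thesis using Cs_step[OF c, of "2 * m"] z by (simp add: evD_unlink lv_def fun_eq_iff)
    qed
    have even: "\<not> c (2 * m, j)" for m j
    proof (induction m arbitrary: j)
      case 0
      then show ?case using Cs_zero[OF c] by simp
    next
      case (Suc m)
      show ?case
      proof (cases "m < k")
        case True
        then have "step (Some (Cap, 0)) (lv c (Suc (2 * m))) (lv c (2 * Suc m))"
          using Cs_step[OF c, of "Suc (2 * m)"] by (simp add: evD_unlink)
        then show ?thesis using odd[OF Suc.IH, of "j + 2"] unfolding step_cap by (simp add: lv_def)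
      next
        case False
        then have "lv c (2 * Suc m) = lv c (Suc (2 * m))"
          using Cs_step[OF c, of "Suc (2 * m)"] by (simp add: evD_unlink)
        from fun_cong[OF this, of j] show ?thesis using odd[OF Suc.IH, of j] False by (simp add: lv_def)
      qed
    qed
    let ?T = "{m. m < k \<and> c (Suc (2 * m), 0)}"
    have e: "c (t, j) = discs ?T (t, j)" for t j
    proof (cases "even t")
      case True
      then show ?thesis using even by (auto simp: discs_def double_not_eq_Suc_double elim!: evenE)
    next
      case False
      then obtain m where "t = Suc (2 * m)" by (auto elim!: oddE)
      then show ?thesis using odd[OF even, of m j] by (auto simp: discs_def)
    qed
    have "c = discs ?T"
    proof
      show "c x = discs ?T x" for x using e[of "fst x" "snd x"] unfolding prod.collapse .
    qed
    then show "c \<in> discs ` Pow {..<k}" by blast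
  qed
qed

lemma inj_discs: "inj discs"
proof (rule injI)
  fix T T' assume e: "discs T = discs T'"
  have "m \<in> T \<longleftrightarrow> m \<in> T'" for m using fun_cong[OF e, of "(Suc (2 * m), 0)"] by (simp add: discs_def)
  then show "T = T'" by blast
qed

lemma canon_empty: "canon Om {} P = Om"
  by (simp add: canon_def)

lemma card_Cs_unlink: "card (Cs (evD (unlink k))) = 2 ^ k"
proof -
  have "card (discs ` Pow {..<k}) = card (Pow {..<k})" by (rule card_image[OF inj_on_subset[OF inj_discs]]) simp
  then show ?thesis unfolding Cs_unlink by (simp add: card_Pow)
qed

text \<open>Without crossings the cocycle is the indicator of \<open>c0\<close>, which has degree at
  least \<open>k\<close>, so its quantum degree is at most \<open>k - 2 * k\<close>.\<close>

lemma lev_unlink: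
  assumes "lev (Cs (evD (unlink k))) (Xs (evD (unlink k))) P c0 j" "c0 \<in> canon (Cs (evD (unlink k))) (Xs (evD (unlink k))) P"
  shows "j \<le> - int k"
proof -
  let ?C = "Cs (evD (unlink k))"
  obtain T0 where T0: "c0 = discs T0" "T0 \<subseteq> {..<k}" using assms(2) unfolding Xs_unlink canon_empty Cs_unlink by blast
  obtain z where "\<forall>c\<in>?C. z {} c \<longleftrightarrow> c = c0" "fil ?C (- j) (z {})"
    using assms(1) unfolding lev_def Xs_unlink canon_empty
    by (auto simp: res_def states_def wt_def)
  then obtain r g where g: "deg_le r g" "\<forall>c\<in>?C. g c \<longleftrightarrow> c = c0" "2 * r \<le> int (floor_log (card ?C)) - j"
    unfolding fil_def by auto
  have "int k \<le> r"
  proof (rule indicator_degree[OF g(1) T0(2)])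
    fix T assume "T \<subseteq> {..<k}"
    then have "discs T \<in> ?C" unfolding Cs_unlink by blast
    then show "g (discs T) \<longleftrightarrow> T = T0" using g(2) inj_discs by (simp add: T0(1) inj_eq)
  qed
  moreover have "floor_log (card ?C) = k" by (simp add: card_Cs_unlink)
  ultimately show ?thesis using g(3) by linarith
qed

section \<open>Closures of positive braids\<close>

lemma closure_events:
  assumes "\<forall>l\<in>set w. \<exists>i. l = Gen i \<and> 1 \<le> i \<and> i < p"
  defines "E \<equiv> evD (closure p w)" and "M \<equiv> length w"
  shows "t < p \<Longrightarrow> E t = Some (Cup, t)"
    and "p \<le> t \<Longrightarrow> t < p + M \<Longrightarrow> \<exists>i. E t = Some (Crossing True, i) \<and> Suc i < p"
    and "h < p \<Longrightarrow> E (2 * p + M - Suc h) = Some (Cap, h)"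
    and "2 * p + M \<le> t \<Longrightarrow> E t = None"
proof -
  have len: "length (closure p w) = 2 * p + M" by (simp add: closure_def M_def)
  show "E t = Some (Cup, t)" if "t < p" using that len by (simp add: E_def evD_def closure_def nth_append)
  show "E t = None" if "2 * p + M \<le> t" using that len by (simp add: E_def evD_def)
  show "\<exists>i. E t = Some (Crossing True, i) \<and> Suc i < p" if t: "p \<le> t" "t < p + M"
  proof -
    have "w ! (t - p) \<in> set w" using t by (simp add: M_def less_diff_conv2)
    then obtain i where i: "w ! (t - p) = Gen i" "1 \<le> i" "i < p" using assms(1) by blast
    have "closure p w ! t = letter_event (w ! (t - p))"
      using t by (simp add: closure_def nth_append M_def less_diff_conv2)
    then have "E t = Some (Crossing True, i - 1)" using t len i by (simp add: E_def evD_def)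
    then show ?thesis using i by auto
  qed
  show "E (2 * p + M - Suc h) = Some (Cap, h)" if "h < p"
  proof -
    have "2 * p + M - Suc h = length (map (\<lambda>i. (Cup, i)) [0..<p]) + (length (map letter_event w) + (p - Suc h))"
      using that by (simp add: M_def)
    then have "closure p w ! (2 * p + M - Suc h) = map (\<lambda>i. (Cap, i)) (rev [0..<p]) ! (p - Suc h)"
      unfolding closure_def by (simp only: nth_append_length_plus)
    also have "\<dots> = (Cap, rev [0..<p] ! (p - Suc h))" using that by simp
    finally have "closure p w ! (2 * p + M - Suc h) = (Cap, rev [0..<p] ! (p - Suc h))" .
    then show ?thesis using that len by (simp add: E_def evD_def rev_nth)
  qed
qed

text \<open>The oriented smoothing of a closed braid consists of \<open>p\<close> nested circles,
  and the circle through strand \<open>i\<close> gets the colour \<open>f i\<close>. A given height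
  meets \<open>h\<close> of them, first on their left sides and then, in reverse order, on their
  right sides.\<close>

definition arcs :: "nat \<Rightarrow> nat \<Rightarrow> (nat \<Rightarrow> bool) \<Rightarrow> nat \<times> nat \<Rightarrow> bool" where
  "arcs p N f e = (let h = min p (min (fst e) (N - fst e)); j = snd e in
     if j < h then f j else if j < 2 * h then f (2 * h - 1 - j) else False)"

lemma arcs_Cs:
  assumes w: "\<forall>l\<in>set w. \<exists>i. l = Gen i \<and> 1 \<le> i \<and> i < p"
  shows "arcs p (2 * p + length w) f \<in> Cs (evD (closure p w))"
proof -
  let ?N = "2 * p + length w" and ?E = "evD (closure p w)" and ?c = "arcs p (2 * p + length w) f"
  note ev = closure_events[OF w]
  define A where "A h j = (if j < h then f j else if j < 2 * h then f (2 * h - 1 - j) else False)" for h j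
  have l: "lv ?c t = A h" if "h = min p (min t (?N - t))" for t h
    unfolding lv_def arcs_def Let_def that fst_conv snd_conv A_def by (rule refl)
  have A: "A h k = (if k < h then A (Suc h) k else A (Suc h) (k + 2))" for h k
  proof -
    have "2 * Suc h - 1 - (k + 2) = 2 * h - 1 - k" by simp
    then show ?thesis by (simp add: A_def del: diff_diff_left)
  qed
  have A': "A (Suc h) h = A (Suc h) (Suc h)" for h by (simp add: A_def)
  have "step (?E t) (lv ?c t) (lv ?c (Suc t))" for t
  proof -
    consider "t < p" | "p \<le> t" "t < p + length w" | "p + length w \<le> t" "t < ?N" | "?N \<le> t" by linarith
    then show ?thesis
    proof cases
      case 1
      then have h: "t = min p (min t (?N - t))" "Suc t = min p (min (Suc t) (?N - Suc t))" by auto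
      show ?thesis unfolding ev(1)[OF 1] step_cup l[OF h(1)] l[OF h(2)] using A A' by blast
    next
      case 2
      then have h: "p = min p (min t (?N - t))" "p = min p (min (Suc t) (?N - Suc t))" by auto
      have "lv ?c (Suc t) = lv ?c t" unfolding l[OF h(1)] l[OF h(2)] by (rule refl)
      moreover obtain i where "?E t = Some (Crossing True, i)" using ev(2)[OF 2] by blast
      ultimately show ?thesis by (simp add: step_crossing)
    next
      case 3
      define i where "i = ?N - Suc t"
      have i: "i < p" "t = ?N - Suc i" using 3 by (auto simp: i_def)
      have h: "Suc i = min p (min t (?N - t))" "i = min p (min (Suc t) (?N - Suc t))" using 3 i by auto
      have e: "?E t = Some (Cap, i)" using ev(3)[OF i(1)] by (simp only: i(2)[symmetric])
      show ?thesis unfolding e step_cap l[OF h(1)] l[OF h(2)] using A A' by blast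
    next
      case 4
      have h: "0 = min p (min t (?N - t))" "0 = min p (min (Suc t) (?N - Suc t))" using 4 by auto
      show ?thesis unfolding ev(4)[OF 4] l[OF h(1)] l[OF h(2)] by simp
    qed
  qed
  moreover have "\<not> ?c (0, j)" for j by (simp add: arcs_def)
  ultimately show ?thesis by (simp add: Cs_def)
qed

text \<open>Under \<open>odd\<close> neighbouring strands of the braid have different colours, so no
  horizontal smoothing is possible: this is the canonical colouring for the orientation of the
  braid.\<close>

lemma arcs_smooth:
  assumes w: "\<forall>l\<in>set w. \<exists>i. l = Gen i \<and> 1 \<le> i \<and> i < p"
    and t: "t \<in> Xs (evD (closure p w))"
  shows "Ps (evD (closure p w)) False t (arcs p (2 * p + length w) f)"
    and "Ps (evD (closure p w)) True t (arcs p (2 * p + length w) odd) \<Longrightarrow> False"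
proof -
  let ?N = "2 * p + length w" and ?E = "evD (closure p w)"
  note ev = closure_events[OF w]
  have "p \<le> t \<and> t < p + length w"
  proof (rule ccontr)
    assume "\<not> (p \<le> t \<and> t < p + length w)"
    then consider "t < p" | "p + length w \<le> t" "t < ?N" | "?N \<le> t" by linarith
    then show False
    proof cases
      case 2
      define i where "i = ?N - Suc t"
      have i: "i < p" "t = ?N - Suc i" using 2 by (auto simp: i_def)
      show False using ev(3)[OF i(1)] t unfolding i(2)[symmetric] by (simp add: Xs_def)
    qed (use ev(1,4) t in \<open>auto simp: Xs_def\<close>)
  qed
  then obtain i where i: "?E t = Some (Crossing True, i)" "Suc i < p" and t: "p \<le> t" "t < p + length w"
    using ev(2) by blast
  have l: "lv (arcs p ?N f) t j = f j" "lv (arcs p ?N f) (Suc t) j = f j" if "j < p" for f j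
    using that t by (simp_all add: lv_def arcs_def)
  show "Ps ?E False t (arcs p ?N f)" unfolding Ps_def i(1) smooth_crossing using i(2) l by simp
  show False if "Ps ?E True t (arcs p ?N odd)"
    using that unfolding Ps_def i(1) smooth_crossing using i(2) l by simp
qed

text \<open>Every circle of the oriented smoothing passes through height \<open>p\<close> among the
  \<open>p\<close> left strands. Applied to a difference of two colourings, this says that they are
  determined by that row.\<close>

lemma oriented_state_determined:
  assumes w: "\<forall>l\<in>set w. \<exists>i. l = Gen i \<and> 1 \<le> i \<and> i < p"
    and E: "E = evD (closure p w)"
    and c: "c \<in> states (Cs E) (Xs E) (Ps E) {}" and z: "\<And>i. i < p \<Longrightarrow> \<not> c (p, i)"
  shows "\<not> c e"
proof -
  note ev = closure_events[OF w, folded E]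
  have cC: "c \<in> Cs E" and cP: "\<And>t. t \<in> Xs E \<Longrightarrow> Ps E False t c" using c by (auto simp: states_def)
  have low: "\<not> c (t, j)" if "t \<le> p" "\<And>i. i < t \<Longrightarrow> \<not> c (t, i)" for t j
    using that
  proof (induction t arbitrary: j)
    case 0
    then show ?case using Cs_zero[OF cC] by simp
  next
    case (Suc t)
    have s: "step (Some (Cup, t)) (lv c t) (lv c (Suc t))" using Cs_step[OF cC, of t] ev(1)[of t] Suc.prems(1) by simp
    then have "\<not> c (t, i)" if "i < t" for i using Suc.prems(2)[of i] that by (simp add: step_cup lv_def)
    then have 0: "\<not> c (t, i)" for i using Suc.IH Suc.prems(1) by simp
    consider "j \<le> t" | "j = Suc t" | "j \<ge> t + 2" by linarith
    then show ?case
    proof cases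
      case 3
      then obtain l where "j = l + 2" "l \<ge> t" by (metis le_add_diff_inverse2 add_leD2 add_le_cancel_right)
      then show ?thesis using s 0[of l] by (simp add: step_cup lv_def)
    qed (use Suc.prems(2) s in \<open>auto simp: step_cup lv_def\<close>)
  qed
  have high: "\<not> c (p + n, j)" for n j
  proof (induction n arbitrary: j)
    case 0
    then show ?case using low[of p] z by simp
  next
    case (Suc n)
    let ?t = "p + n"
    consider "?t < p + length w" | "p + length w \<le> ?t" "?t < 2 * p + length w" | "2 * p + length w \<le> ?t" by linarith
    then show ?case
    proof cases
      case 1
      then obtain i where i: "E ?t = Some (Crossing True, i)" using ev(2)[of ?t] by auto
      have s: "step (E ?t) (lv c ?t) (lv c (Suc ?t))" by (rule Cs_step[OF cC])
      have "?t \<in> Xs E" unfolding Xs_def using i by blast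
      then have "Ps E False ?t c" by (rule cP)
      then show ?thesis using s Suc.IH unfolding Ps_def i smooth_crossing step_crossing
        by (cases "j = i"; cases "j = Suc i") (auto simp: lv_def)
    next
      case 2
      define i where "i = 2 * p + length w - Suc ?t"
      have i: "i < p" "?t = 2 * p + length w - Suc i" using 2 by (auto simp: i_def)
      have "E ?t = Some (Cap, i)" using ev(3)[OF i(1)] i(2) by simp
      then show ?thesis using Cs_step[OF cC, of ?t] Suc.IH by (simp add: step_cap lv_def)
    next
      case 3
      then show ?thesis using Cs_step[OF cC, of ?t] Suc.IH ev(4)[of ?t] by (simp add: lv_def fun_eq_iff)
    qed
  qed
  have down: "\<not> c (t, i)" if "t \<le> p" for t i
    using that
  proof (induction "p - t" arbitrary: t i)
    case 0
    then show ?case using high[of 0] by simp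
  next
    case (Suc n)
    then have t: "t < p" "n = p - Suc t" by auto
    have "step (Some (Cup, t)) (lv c t) (lv c (Suc t))" using Cs_step[OF cC, of t] ev(1)[of t] t by simp
    then show ?case using Suc.hyps(1)[OF t(2)] t(1) by (simp add: step_cup lv_def)
  qed
  obtain t i where e: "e = (t, i)" by (cases e)
  show ?thesis using down[of t i] high[of "t - p" i] by (cases "t \<le> p") (simp_all add: e)
qed

text \<open>The class sits at the initial vertex and is represented by the indicator of one
  colouring; this is closed because the colouring does not extend to the smoothing
  \<open>True\<close> of any crossing. With \<open>p\<close> circles, degree \<open>p\<close> and
  weight \<open>length w\<close>, the level is \<open>p - 2 * p + length w\<close>.\<close>

lemma lev_positive_braid:
  assumes w: "\<forall>l\<in>set w. \<exists>i. l = Gen i \<and> 1 \<le> i \<and> i < p"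
    and valid: "valid (evD (closure p w))"
  defines "E \<equiv> evD (closure p w)"
  shows "\<exists>c0 \<in> canon (Cs E) (Xs E) (Ps E). lev (Cs E) (Xs E) (Ps E) c0 (int (length w) - int p)"
proof -
  let ?N = "2 * p + length w"
  let ?c = "arcs p ?N" and ?V = "states (Cs E) (Xs E) (Ps E) {}"
  let ?z = "\<lambda>v c. v = {} \<and> c = ?c odd"
  note P = arcs_smooth[OF w, folded E_def]
  have V: "?c f \<in> ?V" for f using arcs_Cs[OF w, folded E_def] P(1) by (simp add: states_def)
  have algV: "alg ?V" using alg_Cs[OF valid, folded E_def] by simp
  have val: "?c f (p, j) = f j" if "j < p" for f j using that by (simp add: arcs_def)
  have c0: "?c odd \<in> canon (Cs E) (Xs E) (Ps E)"
    using arcs_Cs[OF w, folded E_def] P by (auto simp: canon_def)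
  have res0: "res (Xs E) (Ps E) (?c odd) = {}" using P(2) by (auto simp: res_def)
  have card: "2 ^ p \<le> card ?V"
  proof -
    let ?g = "\<lambda>T. ?c (\<lambda>i. i \<in> T)"
    have "inj_on ?g (Pow {..<p})"
    proof (rule inj_onI)
      fix S T assume "S \<in> Pow {..<p}" "T \<in> Pow {..<p}" and e: "?g S = ?g T"
      then have "i < p" if "i \<in> S \<union> T" for i using that by auto
      moreover have "i \<in> S \<longleftrightarrow> i \<in> T" if "i < p" for i using fun_cong[OF e, of "(p, i)"] that by (simp add: val)
      ultimately show "S = T" by blast
    qed
    then have "card (Pow {..<p}) \<le> card ?V"
      by (rule card_inj_on_le) (use V alg_finite[OF algV] in auto)
    then show ?thesis by (simp add: card_Pow)
  qed
  \<comment> \<open>The indicator is a product of \<open>p\<close> affine functions, one for each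
    circle.\<close>
  have deg: "deg_le (int n) (\<lambda>c. \<forall>i<n. c (p, i) = odd i)" for n
  proof (induction n)
    case 0
    then show ?case by (simp add: deg_const)
  next
    case (Suc n)
    have "deg_le (1 + int n) (\<lambda>c. c (p, n) = odd n \<and> (\<forall>i<n. c (p, i) = odd i))"
      by (rule deg_conj[OF deg_eq[OF deg_coord deg_const] Suc.IH]) simp_all
    moreover have "(\<lambda>c. c (p, n) = odd n \<and> (\<forall>i<n. c (p, i) = odd i)) = (\<lambda>c. \<forall>i<Suc n. c (p, i) = odd i)"
      by (auto simp: less_Suc_eq fun_eq_iff)
    ultimately show ?case by simp
  qed
  have eq: "c = ?c odd \<longleftrightarrow> (\<forall>i<p. c (p, i) = odd i)" if c: "c \<in> ?V" for c
  proof
    assume "\<forall>i<p. c (p, i) = odd i"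
    then have "\<not> (c (p, i) \<oplus> ?c odd (p, i))" if "i < p" for i using that val[OF that] by (simp add: xr_def)
    then have "\<not> (c e \<oplus> ?c odd e)" for e
      using oriented_state_determined[OF w E_def[THEN meta_eq_to_obj_eq] alg_xor[OF algV c V]] by blast
    then show "c = ?c odd" by (simp add: xr_def fun_eq_iff)
  qed (simp add: val)
  have "lev (Cs E) (Xs E) (Ps E) (?c odd) (int (length w) - int p)"
    unfolding lev_def
  proof (intro exI[of _ ?z] conjI allI impI ballI)
    show "cyc (Cs E) (Xs E) (Ps E) ?z"
      unfolding cyc_def
    proof (intro allI impI ballI)
      fix v c assume v: "v \<subseteq> Xs E" and c: "c \<in> states (Cs E) (Xs E) (Ps E) v"
      have "\<not> ?z (v - {x}) c" if x: "x \<in> v" for x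
      proof
        assume "?z (v - {x}) c"
        then have "c = ?c odd" by blast
        moreover have "Ps E (x \<in> v) x c" using c v x unfolding states_def by blast
        ultimately have "Ps E True x (?c odd)" using x by simp
        then show False using P(2) v x by blast
      qed
      then have "{x\<in>v. Ps E False x c \<and> ?z (v - {x}) c} = {}" by blast
      then show "\<not> bd (Ps E) ?z v c" unfolding bd_def parity_def by (simp only: card.empty) simp
    qed
    show "?z (res (Xs E) (Ps E) c) c \<longleftrightarrow> c = ?c odd" if "c \<in> canon (Cs E) (Xs E) (Ps E)" for c
      using res0 by auto
    fix v assume v: "v \<subseteq> Xs E"
    show "fil (states (Cs E) (Xs E) (Ps E) v) (wt (Xs E) (Ps E) (?c odd) v - (int (length w) - int p)) (?z v)"
    proof (cases "v = {}")
      case True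
      have X: "Xs E = {p..<p + length w}"
      proof (rule set_eqI)
        fix t
        show "t \<in> Xs E \<longleftrightarrow> t \<in> {p..<p + length w}"
        proof
          assume t: "t \<in> Xs E"
          have "\<not> t < p" using t closure_events(1)[OF w, folded E_def, of t] by (auto simp: Xs_def)
          moreover have "t < ?N" using t closure_events(4)[OF w, folded E_def, of t] by (auto simp: Xs_def not_le[symmetric])
          moreover have "t < p + length w"
          proof (rule ccontr)
            assume "\<not> t < p + length w"
            then have "?N - Suc t < p" "?N - Suc (?N - Suc t) = t" using \<open>t < ?N\<close> by auto
            then show False using t closure_events(3)[OF w, folded E_def, of "?N - Suc t"] by (auto simp: Xs_def)
          qed
          ultimately show "t \<in> {p..<p + length w}" by simp
        next
          assume "t \<in> {p..<p + length w}"
          then show "t \<in> Xs E" using closure_events(2)[OF w, folded E_def, of t] by (auto simp: Xs_def)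
        qed
      qed
      have "{x\<in>Xs E. Ps E False x (?c odd)} = Xs E" "{x\<in>Xs E. Ps E True x (?c odd)} = {}" using P by auto
      then have wt: "wt (Xs E) (Ps E) (?c odd) {} = int (length w)" unfolding wt_def by (simp add: X)
      have "floor_log (2 ^ p) \<le> floor_log (card ?V)" using card by (rule floor_log_le_iff)
      then have "2 * int p \<le> int (floor_log (card ?V)) + (wt (Xs E) (Ps E) (?c odd) {} - (int (length w) - int p))"
        unfolding wt by simp
      moreover have "\<forall>c\<in>?V. ?z {} c = (\<forall>i<p. c (p, i) = odd i)" using eq by simp
      ultimately show ?thesis unfolding True fil_def using deg[of p] by blast
    next
      case False
      then show ?thesis using fil_False by simp
    qed
  qed
  then show ?thesis using c0 by blast
qed

text \<open>Levels fall by at most two per change and end at most at \<open>- k\<close>. The count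
  of canonical colourings fixes \<open>k\<close> independently of the chosen unlinking.\<close>

theorem positive_braid_crossing_changes:
  assumes w: "\<forall>l\<in>set w. \<exists>i. l = Gen i \<and> 1 \<le> i \<and> i < p"
    and D: "same_link (closure p w) D" "S \<subseteq> crossings D" "same_link (change_crossings S D) (unlink k)"
  shows "int (length w) - int p + int k \<le> 2 * int (card S)"
    and "card (canon (Cs (evD (closure p w))) (Xs (evD (closure p w))) (Ps (evD (closure p w)))) = 2 ^ k"
proof -
  let ?E = "evD (closure p w)"
  have "is_braid_word p w" using w unfolding is_braid_word_def by fastforce
  then have L: "link_diagram (closure p w)" by (rule link_diagram_closure)
  from same_link_diso[OF D(1) L] have D': "link_diagram D" "dsub 0 (closure p w) D" by (simp_all add: diso_def)
  have L': "link_diagram (change_crossings S D)" using D'(1) by (simp add: link_diagram_def tangle_change_crossings)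
  from same_link_diso[OF D(3) this] have D'': "dsub 0 (change_crossings S D) (unlink k)" by (simp add: diso_def)
  have "dsub (2 * int (card S)) (closure p w) (unlink k)"
    using SUB_trans[OF SUB_trans[OF D'(2)[unfolded dsub_def] dsub_change_crossings[OF D'(1) D(2), unfolded dsub_def]]
        D''[unfolded dsub_def]] by (simp add: dsub_def)
  then have s: "sub (2 * int (card S)) (Cs ?E) (Xs ?E) (Ps ?E) (Cs (evD (unlink k))) (Xs (evD (unlink k))) (Ps (evD (unlink k)))"
    by (simp only: dsub_def SUB_def)
  show "card (canon (Cs ?E) (Xs ?E) (Ps ?E)) = 2 ^ k"
    using sub_card_canon[OF s] by (simp add: Xs_unlink canon_empty card_Cs_unlink)
  obtain c0 where c0: "c0 \<in> canon (Cs ?E) (Xs ?E) (Ps ?E)" "lev (Cs ?E) (Xs ?E) (Ps ?E) c0 (int (length w) - int p)"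
    using lev_positive_braid[OF w valid_evD[OF L]] by blast
  obtain h where h: "bij_betw h (canon (Cs ?E) (Xs ?E) (Ps ?E)) (canon (Cs (evD (unlink k))) (Xs (evD (unlink k))) (Ps (evD (unlink k))))"
    "\<forall>c\<in>canon (Cs ?E) (Xs ?E) (Ps ?E). \<forall>j. lev (Cs ?E) (Xs ?E) (Ps ?E) c j \<longrightarrow>
      lev (Cs (evD (unlink k))) (Xs (evD (unlink k))) (Ps (evD (unlink k))) (h c) (j - 2 * int (card S))"
    using s unfolding sub_def by blast
  have "int (length w) - int p - 2 * int (card S) \<le> - int k"
    by (rule lev_unlink[OF h(2)[THEN bspec, OF c0(1), THEN spec, THEN mp, OF c0(2)] bij_betwE[OF h(1), THEN bspec, OF c0(1)]])
  then show "int (length w) - int p + int k \<le> 2 * int (card S)" by linarith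
qed


section \<open>Moves inside tangles\<close>

text \<open>Equivalence inside every closed diagram, with the end points kept in place. Moves on
  pieces can thus be composed without checking each time that the whole is a link diagram.\<close>

definition tiso :: "nat \<Rightarrow> nat \<Rightarrow> diagram \<Rightarrow> diagram \<Rightarrow> bool" where
  "tiso n m L R \<longleftrightarrow> tangle n L m \<and> tangle n R m \<and>
     (\<forall>A B. tangle 0 A n \<longrightarrow> tangle m B 0 \<longrightarrow> same_link (A @ L @ B) (A @ R @ B))"

lemma tiso_refl: "tangle n L m \<Longrightarrow> tiso n m L L"
  by (simp add: tiso_def same_link_def equivclp_refl)

lemma tiso_sym: "tiso n m L R \<Longrightarrow> tiso n m R L"
  by (simp add: tiso_def same_link_def equivclp_sym)

lemma same_link_trans: "same_link D D' \<Longrightarrow> same_link D' D'' \<Longrightarrow> same_link D D''"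
  unfolding same_link_def by (rule equivclp_trans)

lemma tiso_trans [trans]: "tiso n m L M \<Longrightarrow> tiso n m M R \<Longrightarrow> tiso n m L R"
  unfolding tiso_def
proof (elim conjE, intro conjI allI impI)
  fix A B assume 1: "\<forall>A B. tangle 0 A n \<longrightarrow> tangle m B 0 \<longrightarrow> same_link (A @ L @ B) (A @ M @ B)"
    and 2: "\<forall>A B. tangle 0 A n \<longrightarrow> tangle m B 0 \<longrightarrow> same_link (A @ M @ B) (A @ R @ B)"
    and AB: "tangle 0 A n" "tangle m B 0"
  show "same_link (A @ L @ B) (A @ R @ B)" by (rule same_link_trans[OF 1[rule_format, OF AB] 2[rule_format, OF AB]])
qed

lemma tiso_context:
  assumes "tiso n m L R" "tangle n' A n" "tangle m B m'"
  shows "tiso n' m' (A @ L @ B) (A @ R @ B)"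
  unfolding tiso_def
proof (intro conjI allI impI)
  show "tangle n' (A @ L @ B) m'" "tangle n' (A @ R @ B) m'"
    using assms unfolding tiso_def by (auto intro: tangle_append)
  fix A' B' assume "tangle 0 A' n'" "tangle m' B' 0"
  then have "tangle 0 (A' @ A) n" "tangle m (B @ B') 0" using assms(2,3) by (auto intro: tangle_append)
  then have "same_link ((A' @ A) @ L @ (B @ B')) ((A' @ A) @ R @ (B @ B'))" using assms(1) unfolding tiso_def by blast
  then show "same_link (A' @ (A @ L @ B) @ B') (A' @ (A @ R @ B) @ B')" by simp
qed

lemma tiso_move:
  assumes "local_move L R" "tangle n L m" "tangle n R m"
  shows "tiso n m L R"
  unfolding tiso_def
proof (intro conjI allI impI assms(2,3))
  fix A B assume A: "tangle 0 A n" and B: "tangle m B 0"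
  then have "link_diagram (A @ L @ B)" "link_diagram (A @ R @ B)"
    unfolding link_diagram_def using assms(2,3) by (auto intro: tangle_append)
  then have "diagram_move (A @ L @ B) (A @ R @ B)" unfolding diagram_move_def using assms(1) by blast
  then show "same_link (A @ L @ B) (A @ R @ B)" unfolding same_link_def by blast
qed

lemma tiso_same_link: "tiso 0 0 D D' \<Longrightarrow> same_link D D'"
  unfolding tiso_def by (metis append_Nil append_Nil2 tangle.simps(1))

lemma tiso_Cons: "tiso k m L R \<Longrightarrow> tangle n [ev] k \<Longrightarrow> tiso n m (ev # L) (ev # R)"
  using tiso_context[of k m L R n "[ev]" "[]" m] by simp

lemma tiso_append: "tiso n k L R \<Longrightarrow> tangle k B m \<Longrightarrow> tiso n m (L @ B) (R @ B)"
  using tiso_context[of n k L R n "[]" B m] by simp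

subsection \<open>Circles\<close>

text \<open>A small circle passes a strand: a cancelling pair of crossings with the strand is
  created inside it, cup and cap swing to the other side, and the pair cancels again.\<close>

lemma tiso_circle_step:
  assumes "Suc i \<le> n"
  shows "tiso n n [(Cup, i), (Cap, i)] [(Cup, Suc i), (Cap, Suc i)]"
proof -
  obtain k where n: "n = Suc (i + k)" using assms by (auto simp: le_iff_add)
  let ?s = True
  have "tiso (n + 2) (n + 2) [] [(Crossing ?s, Suc i), (Crossing (\<not> ?s), Suc i)]"
    by (rule tiso_sym[OF tiso_move[OF reidemeister2]]) (simp_all add: n)
  from tiso_context[OF this, of n "[(Cup, i)]" "[(Cap, i)]" n]
  have "tiso n n [(Cup, i), (Cap, i)] [(Cup, i), (Crossing ?s, Suc i), (Crossing (\<not> ?s), Suc i), (Cap, i)]"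
    by (simp add: n)
  also have "tiso n n \<dots> [(Cup, Suc i), (Crossing (\<not> ?s), i), (Crossing (\<not> ?s), Suc i), (Cap, i)]"
  proof -
    have "tiso n (n + 2) [(Cup, Suc i), (Crossing (\<not> ?s), i)] [(Cup, i), (Crossing (\<not> \<not> ?s), Suc i)]"
      by (rule tiso_move[OF swing_cup]) (simp_all add: n)
    from tiso_append[OF tiso_sym[OF this], of "[(Crossing (\<not> ?s), Suc i), (Cap, i)]" n]
    show ?thesis by (simp add: n)
  qed
  also have "tiso n n \<dots> [(Cup, Suc i), (Crossing (\<not> ?s), i), (Crossing ?s, i), (Cap, Suc i)]"
  proof -
    have "tiso (n + 2) n [(Crossing ?s, i), (Cap, Suc i)] [(Crossing (\<not> ?s), Suc i), (Cap, i)]"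
      by (rule tiso_move[OF swing_cap]) (simp_all add: n)
    from tiso_context[OF tiso_sym[OF this], of n "[(Cup, Suc i), (Crossing (\<not> ?s), i)]" "[]" n]
    show ?thesis by (simp add: n)
  qed
  also have "tiso n n \<dots> [(Cup, Suc i), (Cap, Suc i)]"
  proof -
    have "tiso (n + 2) (n + 2) [(Crossing (\<not> ?s), i), (Crossing (\<not> \<not> ?s), i)] []"
      by (rule tiso_move[OF reidemeister2]) (simp_all add: n)
    from tiso_context[OF this, of n "[(Cup, Suc i)]" "[(Cap, Suc i)]" n]
    show ?thesis by (simp add: n)
  qed
  finally show ?thesis .
qed

lemma tiso_circle: "i \<le> n \<Longrightarrow> tiso n n [(Cup, i), (Cap, i)] [(Cup, 0), (Cap, 0)]"
proof (induction i)
  case 0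
  show ?case by (rule tiso_refl) simp
next
  case (Suc i)
  then show ?case using tiso_trans[OF tiso_sym[OF tiso_circle_step[of i n]]] by simp
qed

text \<open>A circle to the left of everything passes each closing arc by two exchanges.\<close>

lemma tiso_circle_past_caps:
  "tiso (2 * p) 0 ([(Cup, 0), (Cap, 0)] @ map (\<lambda>i. (Cap, i)) (rev [0..<p])) (map (\<lambda>i. (Cap, i)) (rev [0..<p]) @ [(Cup, 0), (Cap, 0)])"
proof (induction p)
  case 0
  show ?case by (simp add: tiso_refl)
next
  case (Suc p)
  let ?caps = "map (\<lambda>i. (Cap, i)) (rev [0..<p])"
  have caps: "tangle (2 * p) ?caps 0" by (rule tangle_caps)
  have 1: "tiso (2 * p + 4) (2 * p) [(Cap, 0), (Cap, p)] [(Cap, p + 2), (Cap, 0)]"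
    using tiso_move[OF exchange[of 0 p Cap Cap], of "2 * p + 4" "2 * p"] by simp
  have 2: "tiso (2 * p + 2) (2 * p + 2) [(Cup, 0), (Cap, p + 2)] [(Cap, p), (Cup, 0)]"
    using tiso_move[OF exchange[of 0 p Cup Cap], of "2 * p + 2" "2 * p + 2"] by simp
  have "tiso (2 * p + 2) (2 * p) [(Cup, 0), (Cap, 0), (Cap, p)] [(Cup, 0), (Cap, p + 2), (Cap, 0)]"
    using tiso_Cons[OF 1, of "2 * p + 2" "(Cup, 0)"] by simp
  also have "tiso (2 * p + 2) (2 * p) \<dots> [(Cap, p), (Cup, 0), (Cap, 0)]"
    using tiso_append[OF 2, of "[(Cap, 0)]" "2 * p"] by simp
  finally have "tiso (2 * p + 2) 0 ([(Cup, 0), (Cap, 0), (Cap, p)] @ ?caps) ([(Cap, p), (Cup, 0), (Cap, 0)] @ ?caps)"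
    using tiso_append caps by blast
  also have "tiso (2 * p + 2) 0 \<dots> ((Cap, p) # ?caps @ [(Cup, 0), (Cap, 0)])"
    using tiso_Cons[OF Suc.IH, of "2 * p + 2" "(Cap, p)"] by simp
  finally show ?case by simp
qed

definition close :: "nat \<Rightarrow> diagram \<Rightarrow> diagram" where
  "close p X = map (\<lambda>i. (Cup, i)) [0..<p] @ X @ map (\<lambda>i. (Cap, i)) (rev [0..<p])"

lemma close_Suc: "close (Suc p) X = map (\<lambda>i. (Cup, i)) [0..<p] @ ((Cup, p) # X @ [(Cap, p)]) @ map (\<lambda>i. (Cap, i)) (rev [0..<p])"
  by (simp add: close_def)

lemma tiso_close: "tiso (2 * p) (2 * p) X Y \<Longrightarrow> tiso 0 0 (close p X) (close p Y)"
  unfolding close_def by (rule tiso_context[OF _ tangle_cups tangle_caps])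

text \<open>The innermost circle is taken out to the left and then above the remaining ones.\<close>

lemma close_empty: "tiso 0 0 (close p []) (unlink p)"
proof (induction p)
  case 0
  show ?case by (simp add: close_def unlink_def tiso_refl)
next
  case (Suc p)
  let ?c = "[(Cup, 0), (Cap, 0)]"
  have "tiso 0 0 (close (Suc p) []) (close p ?c)"
    unfolding close_Suc using tiso_context[OF tiso_circle[of p "2 * p"] tangle_cups tangle_caps] by (simp add: close_def)
  also have "tiso 0 0 \<dots> (close p [] @ ?c)"
    using tiso_context[OF tiso_circle_past_caps tangle_cups, where B = "[]" and m' = 0] by (simp add: close_def)
  also have "tiso 0 0 \<dots> (unlink p @ ?c)"
    by (rule tiso_append[OF Suc.IH]) simp
  also have "unlink p @ ?c = unlink (Suc p)"
    by (induction p) (simp_all add: unlink_def)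
  finally show ?case .
qed

subsection \<open>Words in the elementary transpositions\<close>

text \<open>Coxeter presentation of the symmetric group; the generators lie below \<open>n\<close>,
  so they act on the positions up to \<open>n\<close>.\<close>

inductive cox :: "nat \<Rightarrow> nat list \<Rightarrow> nat list \<Rightarrow> bool" for n where
  refl: "cox n w w"
| sym: "cox n w w' \<Longrightarrow> cox n w' w"
| trans: "cox n w w' \<Longrightarrow> cox n w' w'' \<Longrightarrow> cox n w w''"
| cancel: "i < n \<Longrightarrow> cox n (u @ [i, i] @ v) (u @ v)"
| braid: "Suc i < n \<Longrightarrow> cox n (u @ [i, Suc i, i] @ v) (u @ [Suc i, i, Suc i] @ v)"
| far: "i + 2 \<le> j \<Longrightarrow> j < n \<Longrightarrow> cox n (u @ [i, j] @ v) (u @ [j, i] @ v)"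

declare cox.trans [trans]

lemma cox_mono: "cox n w w' \<Longrightarrow> n \<le> m \<Longrightarrow> cox m w w'"
proof (induction rule: cox.induct)
  case (trans w w' w'')
  then show ?case using cox.trans by blast
next
  case (sym w w')
  then show ?case using cox.sym by blast
next
  case (cancel i u v)
  then show ?case by (intro cox.cancel) simp
next
  case (braid i u v)
  then show ?case by (intro cox.braid) simp
next
  case (far i j u v)
  then show ?case by (intro cox.far) simp_all
qed (rule cox.refl)

lemma cox_context: "cox n w w' \<Longrightarrow> cox n (x @ w @ y) (x @ w' @ y)"
proof (induction rule: cox.induct)
  case (trans w w' w'')
  then show ?case using cox.trans by blast
next
  case (cancel i u v)
  then show ?case using cox.cancel[of i n "x @ u" "v @ y"] by simp
next
  case (braid i u v)
  then show ?case using cox.braid[of i n "x @ u" "v @ y"] by simp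
next
  case (far i j u v)
  then show ?case using cox.far[of i j n "x @ u" "v @ y"] by simp
qed (auto intro: cox.refl cox.sym)

lemma cox_append1: "cox n w w' \<Longrightarrow> cox n (x @ w) (x @ w')"
  using cox_context[of n w w' x "[]"] by simp

lemma cox_past:
  assumes "i < n" "\<And>j. j \<in> set v \<Longrightarrow> j < n \<and> (i + 2 \<le> j \<or> j + 2 \<le> i)"
  shows "cox n (v @ [i]) (i # v)"
  using assms(2)
proof (induction v)
  case (Cons j v)
  have "cox n (j # v @ [i]) (j # i # v)"
    using cox_context[OF Cons.IH, of "[j]" "[]"] Cons.prems by simp
  also have "cox n (j # i # v) (i # j # v)"
    using cox.far[of i j n "[]" v] cox.far[of j i n "[]" v] cox.sym Cons.prems[of j] assms(1) by auto
  finally show ?case by simp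
qed (simp add: cox.refl)

text \<open>Coset representatives of a symmetric group in the next one: the top generator
  \<open>n\<close> is needed at most once. When a letter is appended, only its place relative to the
  descending run matters.\<close>

lemma cox_normal_form:
  assumes "set w \<subseteq> {..<Suc n}"
  shows "\<exists>w0 k. set w0 \<subseteq> {..<n} \<and> k \<le> Suc n \<and> cox (Suc n) w (w0 @ rev [k..<Suc n])"
  using assms
proof (induction w rule: rev_induct)
  case Nil
  show ?case by (rule exI[of _ "[]"], rule exI[of _ "Suc n"]) (simp add: cox.refl)
next
  case (snoc i w)
  then obtain w0 k where w0: "set w0 \<subseteq> {..<n}" and k: "k \<le> Suc n"
    and w: "cox (Suc n) w (w0 @ rev [k..<Suc n])" by auto
  have i: "i \<le> n" using snoc.prems by auto
  have wi: "cox (Suc n) (w @ [i]) (w0 @ rev [k..<Suc n] @ [i])"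
    using cox_context[OF w, of "[]" "[i]"] by simp
  consider "Suc i = k" | "Suc i < k" | "i = k" | "k < i" by linarith
  then show ?case
  proof cases
    case 1
    have "rev [i..<Suc n] = rev [k..<Suc n] @ [i]" using 1 i by (simp add: upt_conv_Cons)
    then show ?thesis using w0 wi i by (intro exI[of _ w0] exI[of _ i]) simp
  next
    case 2
    have "cox (Suc n) (rev [k..<Suc n] @ [i]) (i # rev [k..<Suc n])"
      by (rule cox_past) (use 2 i in auto)
    from cox.trans[OF wi cox_append1[OF this, of w0]] 2 k w0
    show ?thesis by (intro exI[of _ "w0 @ [i]"] exI[of _ k]) simp
  next
    case 3
    have "rev [k..<Suc n] = rev [Suc k..<Suc n] @ [k]" using 3 i by (simp add: upt_conv_Cons)
    then have "cox (Suc n) (w @ [i]) ((w0 @ rev [Suc k..<Suc n]) @ [k, k] @ [])" using wi 3 by simp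
    also have "cox (Suc n) \<dots> ((w0 @ rev [Suc k..<Suc n]) @ [])" by (rule cox.cancel) (use 3 i in simp)
    finally show ?thesis using w0 3 i by (intro exI[of _ w0] exI[of _ "Suc k"]) simp
  next
    case 4
    \<comment> \<open>Now \<open>i\<close> belongs to the run but is not its last letter. It moves
      past the lower letters, the braid relation turns it into \<open>l\<close>, and
      \<open>l\<close> moves past the upper ones into the smaller group.\<close>
    then obtain l where l: "i = Suc l" "k \<le> l" by (cases i) auto
    let ?X = "rev [Suc i..<Suc n]" and ?Y = "rev [k..<l]"
    have "[k..<Suc n] = [k..<l] @ [l..<Suc n]" using l i by (metis le_Suc_eq le_trans upt_add_eq_append le_add_diff_inverse Suc_leD)
    moreover have "[l..<Suc n] = l # i # [Suc i..<Suc n]" using l i by (simp add: upt_conv_Cons)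
    ultimately have eq: "rev [k..<Suc n] = ?X @ [i, l] @ ?Y" by simp
    have "cox (Suc n) (?Y @ [i]) (i # ?Y)" by (rule cox_past) (use l i in auto)
    from cox_context[OF this, of "?X @ [i, l]" "[]"]
    have "cox (Suc n) (rev [k..<Suc n] @ [i]) (?X @ [Suc l, l, Suc l] @ ?Y)" by (simp only: eq append_assoc l append_Cons append_Nil append_Nil2)
    also have "cox (Suc n) \<dots> (?X @ [l, Suc l, l] @ ?Y)" by (rule cox.sym[OF cox.braid]) (use l i in simp)
    also have "cox (Suc n) \<dots> (l # ?X @ [i, l] @ ?Y)"
    proof -
      have "cox (Suc n) (?X @ [l]) (l # ?X)" by (rule cox_past) (use l i in auto)
      from cox_context[OF this, of "[]" "[i, l] @ ?Y"] show ?thesis by (simp add: l)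
    qed
    finally have "cox (Suc n) (rev [k..<Suc n] @ [i]) (l # rev [k..<Suc n])" by (simp only: eq)
    from cox.trans[OF wi cox_append1[OF this, of w0]] k w0 l i
    show ?thesis by (intro exI[of _ "w0 @ [l]"] exI[of _ k]) simp
  qed
qed

section \<open>Arrangements produced by words\<close>

definition swp :: "nat \<Rightarrow> (nat \<Rightarrow> 'a) \<Rightarrow> nat \<Rightarrow> 'a" where
  "swp i r = r(i := r (Suc i), Suc i := r i)"

text \<open>Here \<open>r\<close> labels the strands at the bottom, and the result lists these
  labels in their order at the top. In particular \<open>push id w t\<close> is the position at
  which the strand arriving at \<open>t\<close> starts.\<close>

fun push :: "(nat \<Rightarrow> 'a) \<Rightarrow> nat list \<Rightarrow> nat \<Rightarrow> 'a" where
  "push r [] = r"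
| "push r (i # w) = push (swp i r) w"

lemma push_append: "push r (u @ v) = push (push r u) v"
  by (induction u arbitrary: r) simp_all

lemma push_comp: "push (\<lambda>x. f (r x)) w t = f (push r w t)"
proof (induction w arbitrary: r)
  case (Cons i w)
  have "swp i (\<lambda>x. f (r x)) = (\<lambda>x. f (swp i r x))" by (auto simp: swp_def)
  then show ?case using Cons.IH[of "swp i r"] by (simp only: push.simps)
qed simp

lemma push_eq: "push r w t = r (push id w t)"
  using push_comp[of r id w t] by simp

lemma swp_swp [simp]: "swp i (swp i r) = r"
  by (auto simp: swp_def)

lemma cox_push: "cox n w w' \<Longrightarrow> push r w = push r w'"
proof (induction arbitrary: r rule: cox.induct)
  case (braid i u v)
  have "swp i (swp (Suc i) (swp i s)) = swp (Suc i) (swp i (swp (Suc i) s))" for s :: "nat \<Rightarrow> 'a"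
    by (auto simp: swp_def)
  then show ?case by (simp add: push_append)
next
  case (far i j u v)
  then have "swp i (swp j s) = swp j (swp i s)" for s :: "nat \<Rightarrow> 'a"
    by (auto simp: swp_def)
  then show ?case by (simp add: push_append)
qed (simp_all add: push_append)

lemma push_fixes: "set w \<subseteq> {..<n} \<Longrightarrow> n < t \<Longrightarrow> push r w t = r t"
  by (induction w arbitrary: r) (auto simp: swp_def)

lemma push_id_less: "set w \<subseteq> {..<n} \<Longrightarrow> (\<And>t. t \<le> n \<Longrightarrow> r t \<le> n) \<Longrightarrow> t \<le> n \<Longrightarrow> push r w t \<le> (n::nat)"
proof (induction w arbitrary: r)
  case (Cons i w)
  have "swp i r t \<le> n" if "t \<le> n" for t using Cons.prems(1,2) that by (auto simp: swp_def)
  then show ?case using Cons by simp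
qed simp

lemma push_inj: "inj r \<Longrightarrow> inj (push r w)"
proof (induction w arbitrary: r)
  case (Cons i w)
  have "inj (swp i r)" using Cons.prems unfolding inj_def swp_def by auto
  then show ?case using Cons.IH by simp
qed simp

lemma push_desc: "k \<le> n \<Longrightarrow> push r (rev [k..<n]) k = r n"
proof (induction "n - k" arbitrary: k)
  case (Suc m)
  then have "rev [k..<n] = rev [Suc k..<n] @ [k]" by (simp add: upt_conv_Cons)
  then show ?case using Suc.hyps(1)[of "Suc k"] Suc.hyps(2) by (simp add: push_append swp_def)
qed simp

text \<open>The run of the normal form carries the last label to position \<open>k\<close>, so for
  the identity permutation it is empty, and induction applies to the rest.\<close>

lemma cox_identity: "set w \<subseteq> {..<n} \<Longrightarrow> push id w = id \<Longrightarrow> cox n w []"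
proof (induction n arbitrary: w)
  case 0
  then show ?case by (simp add: cox.refl)
next
  case (Suc n)
  obtain w0 k where w0: "set w0 \<subseteq> {..<n}" and k: "k \<le> Suc n"
    and w: "cox (Suc n) w (w0 @ rev [k..<Suc n])" using cox_normal_form[OF Suc.prems(1)] by blast
  have p: "push (push id w0) (rev [k..<Suc n]) = id"
    by (rule HOL.trans[OF HOL.sym[OF cox_push[OF w, of id, unfolded push_append[of id]]] Suc.prems(2)])
  have "id k = push id w0 (Suc n)" using push_desc[OF k, of "push id w0"] unfolding p .
  also have "\<dots> = Suc n" using push_fixes[OF w0, of "Suc n" id] by simp
  finally have "k = Suc n" by simp
  then have "cox (Suc n) w w0" "push id w0 = id" using w p by simp_all
  then show ?case using cox.trans cox_mono[OF Suc.IH[OF w0]] by (metis le_Suc_eq order_refl)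
qed

subsection \<open>Layered braids\<close>

text \<open>The labels travel with the strands, so which of two strands passes over does not depend
  on where they meet.\<close>

fun lay :: "(nat \<Rightarrow> nat) \<Rightarrow> nat list \<Rightarrow> diagram" where
  "lay r [] = []"
| "lay r (i # w) = (Crossing (r i < r (Suc i)), i) # lay (swp i r) w"

lemma lay_append: "lay r (u @ v) = lay r u @ lay (push r u) v"
  by (induction u arbitrary: r) simp_all

lemma tangle_crossing: "Suc i < n \<Longrightarrow> tangle n [(Crossing s, i)] n"
  by auto

lemma tangle_lay: "set w \<subseteq> {..<n} \<Longrightarrow> Suc n \<le> m \<Longrightarrow> tangle m (lay r w) m"
proof (induction w arbitrary: r)
  case (Cons i w)
  have "tangle m ([(Crossing (r i < r (Suc i)), i)] @ lay (swp i r) w) m"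
    by (rule tangle_append[OF tangle_crossing]) (use Cons in auto)
  then show ?case by simp
qed simp

text \<open>Labels choose the signs consistently: a cancelled pair consists of opposite crossings,
  as \<open>r\<close> is injective, and three strands form no cyclic pattern, as labels are linearly
  ordered. So each Coxeter move lifts to a move of diagrams.\<close>

lemma cox_lay:
  assumes "cox n w w'" "Suc n \<le> m"
  shows "(set w \<subseteq> {..<n} \<longleftrightarrow> set w' \<subseteq> {..<n}) \<and>
    (set w \<subseteq> {..<n} \<longrightarrow> inj r \<longrightarrow> tiso m m (lay r w) (lay r w'))"
  using assms(1)
proof (induction rule: cox.induct)
  case (refl w)
  then show ?case using tangle_lay[of w n m r] assms(2) by (simp add: tiso_refl)
next
  case (sym w w')
  then show ?case using tiso_sym by blast
next
  case (trans w w' w'')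
  then show ?case using tiso_trans by blast
next
  case (cancel i u v)
  let ?s = "push r u"
  have "tiso m m (lay r (u @ [i, i] @ v)) (lay r (u @ v))" if "set (u @ v) \<subseteq> {..<n}" "inj r"
  proof -
    have "?s i \<noteq> ?s (Suc i)" using push_inj[OF that(2), of u] by (metis injD n_not_Suc_n)
    then have "lay ?s [i, i] = [(Crossing (?s i < ?s (Suc i)), i), (Crossing (\<not> ?s i < ?s (Suc i)), i)]"
      by (auto simp: swp_def)
    moreover have "tiso m m [(Crossing s, i), (Crossing (\<not> s), i)] []" for s
      by (rule tiso_move[OF reidemeister2]) (use cancel assms(2) in auto)
    ultimately have "tiso m m (lay ?s [i, i]) []" by simp
    from tiso_context[OF this tangle_lay[OF _ assms(2)] tangle_lay[OF _ assms(2)], of u v r ?s] that(1)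
    show ?thesis by (simp add: lay_append)
  qed
  then show ?case using cancel by auto
next
  case (braid i u v)
  let ?s = "push r u"
  have "tiso m m (lay r (u @ [i, Suc i, i] @ v)) (lay r (u @ [Suc i, i, Suc i] @ v))" if "set (u @ v) \<subseteq> {..<n}"
  proof -
    have p: "push ?s [i, Suc i, i] = push ?s [Suc i, i, Suc i]" using cox_push[OF cox.braid[OF braid, of "[]" "[]"]] by simp
    have "Suc (Suc (Suc i)) \<le> m" using braid assms(2) by simp
    then obtain l where m: "m = Suc (Suc (Suc (i + l)))" by (auto simp: le_iff_add)
    have stu: "(a < b) = (a < c) \<or> (a < c) = (b < c)" for a b c :: nat by auto
    have "tiso m m (lay ?s [i, Suc i, i]) (lay ?s [Suc i, i, Suc i])"
      using tiso_move[OF reidemeister3[OF stu[of "?s i" "?s (Suc i)" "?s (Suc (Suc i))"]], of m i m]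
      by (simp add: swp_def m)
    from tiso_context[OF this tangle_lay[OF _ assms(2)] tangle_lay[OF _ assms(2)], of u v r "push ?s [i, Suc i, i]"] that
    show ?thesis unfolding lay_append p[symmetric] by simp
  qed
  then show ?case using braid by auto
next
  case (far i j u v)
  let ?s = "push r u"
  have "tiso m m (lay r (u @ [i, j] @ v)) (lay r (u @ [j, i] @ v))" if "set (u @ v) \<subseteq> {..<n}"
  proof -
    have p: "push ?s [i, j] = push ?s [j, i]" using cox_push[OF cox.far[OF far, of "[]" "[]"]] by simp
    obtain k where k: "j = k + 2" "i \<le> k" using far(1) by (metis add_le_cancel_right le_add_diff_inverse2 add_leD2)
    have "k + 4 \<le> m" using far(2) k(1) assms(2) by simp
    then obtain l where m: "m = k + 4 + l" by (auto simp: le_iff_add)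
    have "tiso m m [(Crossing s, i), (Crossing t, j)] [(Crossing t, j), (Crossing s, i)]" for s t
      using tiso_move[OF exchange[OF k(2), of "Crossing s" "Crossing t"], of m m] k m by simp
    then have "tiso m m (lay ?s [i, j]) (lay ?s [j, i])" using far(1) by (simp add: swp_def)
    from tiso_context[OF this tangle_lay[OF _ assms(2)] tangle_lay[OF _ assms(2)], of u v r "push ?s [i, j]"] that
    show ?thesis unfolding lay_append p[symmetric] by simp
  qed
  then show ?case using far by auto
qed

lemma lay_cong:
  assumes "set w \<subseteq> {..<n}" "\<And>i j. i \<le> n \<Longrightarrow> j \<le> n \<Longrightarrow> i \<noteq> j \<Longrightarrow> (r i < r j) = (s i < s j)"
  shows "lay r w = lay s w"
  using assms
proof (induction w arbitrary: r s)
  case (Cons i w)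
  have "lay (swp i r) w = lay (swp i s) w"
    by (rule Cons.IH) (use Cons.prems in \<open>auto simp: swp_def\<close>)
  then show ?case using Cons.prems by simp
qed simp

subsection \<open>Destabilisation\<close>

lemma tangle_crossings: "\<forall>(e, i)\<in>set A. (\<exists>s. e = Crossing s) \<and> Suc i < n \<Longrightarrow> tangle n A n"
proof (induction A)
  case (Cons a A)
  obtain s i where a: "a = (Crossing s, i)" "Suc i < n" using Cons.prems by (cases a) auto
  have "tangle n ([a] @ A) n" by (rule tangle_append) (use a Cons in auto)
  then show ?case by simp
qed simp

lemma crossings_past_cup_cap:
  assumes "\<forall>(e, i)\<in>set A. (\<exists>s. e = Crossing s) \<and> i + 2 \<le> k" "k \<le> n"
  shows "tiso n (n + 2) ((Cup, k) # A) (A @ [(Cup, k)])"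
    and "tiso (n + 2) n (A @ [(Cap, k)]) ((Cap, k) # A)"
  using assms(1)
proof (induction A)
  case Nil
  { case 1 show ?case using assms(2) by (simp add: tiso_refl) }
  { case 2 show ?case using assms(2) by (simp add: tiso_refl) }
next
  case (Cons a A)
  have A: "\<forall>(e, i)\<in>set (a # A). (\<exists>s. e = Crossing s) \<and> i + 2 \<le> k \<Longrightarrow> tangle m A m" if "k \<le> m" for m
    by (rule tangle_crossings) (use that in auto)
  { case 1
    then obtain s i where a: "a = (Crossing s, i)" "i + 2 \<le> k" by (cases a) auto
    obtain j where j: "k = j + 2" "i \<le> j" using a(2) by (metis add_le_cancel_right le_add_diff_inverse2 add_leD2)
    obtain l where n: "n = j + 2 + l" using assms(2) j(1) by (auto simp: le_iff_add)
    have "tiso n (n + 2) [a, (Cup, k)] [(Cup, k), a]"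
      using tiso_move[OF exchange[OF j(2), of "Crossing s" Cup], of n "n + 2"] a j n by simp
    from tiso_append[OF tiso_sym[OF this] A[OF _ 1]] assms(2)
    have "tiso n (n + 2) ((Cup, k) # a # A) (a # (Cup, k) # A)" by simp
    also have "tiso n (n + 2) \<dots> (a # A @ [(Cup, k)])"
      by (rule tiso_Cons[where k = n]) (use Cons 1 a j n in auto)
    finally show ?case by simp }
  { case 2
    then obtain s i where a: "a = (Crossing s, i)" "i + 2 \<le> k" by (cases a) auto
    obtain j where j: "k = j + 2" "i \<le> j" using a(2) by (metis add_le_cancel_right le_add_diff_inverse2 add_leD2)
    obtain l where n: "n = j + 2 + l" using assms(2) j(1) by (auto simp: le_iff_add)
    have "tiso (n + 2) n [a, (Cap, k)] [(Cap, k), a]"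
      using tiso_move[OF exchange[OF j(2), of "Crossing s" Cap], of "n + 2" n] a j n by simp
    from tiso_append[OF this A[OF assms(2) 2]]
    have *: "tiso (n + 2) n (a # (Cap, k) # A) ((Cap, k) # a # A)" by simp
    have "tiso (n + 2) n (a # A @ [(Cap, k)]) (a # (Cap, k) # A)"
      by (rule tiso_Cons[where k = "n + 2"]) (use Cons 2 a j n in auto)
    also note *
    finally show ?case by simp }
qed

text \<open>The last strand meets the others in a single crossing. Its cup and cap are brought next
  to this crossing; swinging the cup makes the crossing a kink at the cap, and what is left is a
  zigzag.\<close>

lemma destabilise:
  assumes A: "\<forall>(e, i)\<in>set A. (\<exists>s. e = Crossing s) \<and> i < n" and B: "\<forall>(e, i)\<in>set B. (\<exists>s. e = Crossing s) \<and> i < n"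
  shows "tiso 0 0 (close (Suc (Suc n)) (A @ [(Crossing s, n)] @ B)) (close (Suc n) (A @ B))"
proof -
  let ?m = "2 * Suc n"
  have tA: "tangle ?m A ?m" by (rule tangle_crossings) (use A in auto)
  have tB: "tangle ?m B ?m" by (rule tangle_crossings) (use B in auto)
  have tB': "tangle (?m + 2) (B @ [(Cap, Suc n)]) ?m"
    by (rule tangle_append[OF tangle_crossings]) (use B in auto)
  have "tiso ?m (?m + 2) ((Cup, Suc n) # A) (A @ [(Cup, Suc n)])"
    by (rule crossings_past_cup_cap) (use A in auto)
  from tiso_append[OF this, of "[(Crossing s, n)] @ B @ [(Cap, Suc n)]" ?m] tB'
  have "tiso ?m ?m ((Cup, Suc n) # (A @ [(Crossing s, n)] @ B) @ [(Cap, Suc n)]) (A @ [(Cup, Suc n), (Crossing s, n)] @ B @ [(Cap, Suc n)])"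
    by simp
  also have "tiso ?m ?m \<dots> (A @ [(Cup, Suc n), (Crossing s, n), (Cap, Suc n)] @ B)"
  proof -
    have "tiso (?m + 2) ?m (B @ [(Cap, Suc n)]) ((Cap, Suc n) # B)"
      by (rule crossings_past_cup_cap) (use B in auto)
    from tiso_context[OF this tangle_append[OF tA, of "[(Cup, Suc n), (Crossing s, n)]"], of "[]" ?m]
    show ?thesis by simp
  qed
  also have "tiso ?m ?m \<dots> (A @ B)"
  proof -
    have "tiso ?m (?m + 2) [(Cup, Suc n), (Crossing s, n)] [(Cup, n), (Crossing (\<not> s), Suc n)]"
      by (rule tiso_move[OF swing_cup]) auto
    from tiso_append[OF this, of "[(Cap, Suc n)]" ?m]
    have "tiso ?m ?m [(Cup, Suc n), (Crossing s, n), (Cap, Suc n)] [(Cup, n), (Crossing (\<not> s), Suc n), (Cap, Suc n)]"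
      by simp
    also have "tiso ?m ?m \<dots> [(Cup, n), (Cap, Suc n)]"
      by (rule tiso_Cons[OF tiso_move[OF reidemeister1_cap, of "?m + 2"]]) auto
    also have "tiso ?m ?m \<dots> []" by (rule tiso_move[OF zigzag_right]) auto
    finally have "tiso ?m ?m [(Cup, Suc n), (Crossing s, n), (Cap, Suc n)] []" .
    from tiso_context[OF this tA tB] show ?thesis by simp
  qed
  finally have "tiso ?m ?m ((Cup, Suc n) # (A @ [(Crossing s, n)] @ B) @ [(Cap, Suc n)]) (A @ B)" .
  from tiso_context[OF this tangle_cups tangle_caps] show ?thesis unfolding close_Suc[of "Suc n"] by (simp only: close_def)
qed


lemma set_lay: "(e, i) \<in> set (lay r w) \<Longrightarrow> (\<exists>s. e = Crossing s) \<and> i \<in> set w"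
  by (induction w arbitrary: r) auto

text \<open>The strand arriving at \<open>t\<close> starts at \<open>push id w t\<close> and is
  continued by the strand starting at \<open>t\<close>. For \<open>t \<ge> d\<close> the
  continuation has the next larger label, so a component is run through downwards until it returns
  to one of the first \<open>d\<close> positions. Destabilisation keeps these properties, and once
  \<open>d\<close> strands are left the congruence modulo \<open>d\<close> makes the permutation
  trivial.\<close>

lemma layered_closure:
  assumes "d > 0" "inj r" "set w \<subseteq> {..<n}" "d \<le> Suc n"
    "\<And>t. d \<le> t \<Longrightarrow> t \<le> n \<Longrightarrow> r (push id w t) < r t"
    "\<And>t z. d \<le> t \<Longrightarrow> t \<le> n \<Longrightarrow> z \<le> n \<Longrightarrow> r (push id w t) < r z \<Longrightarrow> r t \<le> r z"
    "\<And>t. t \<le> n \<Longrightarrow> push id w t mod d = t mod d"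
  shows "tiso 0 0 (close (Suc n) (lay r w)) (unlink d)"
  using assms(3-7)
proof (induction n arbitrary: w)
  case 0
  then have "w = []" "d = 1" using assms(1) by auto
  then show ?case using close_empty[of 1] by simp
next
  case (Suc n)
  let ?m = "2 * Suc (Suc n)"
  show ?case
  proof (cases "d = Suc (Suc n)")
    case True
    have "push id w t = t" for t
    proof (cases "t \<le> Suc n")
      case t: True
      have "push id w t \<le> Suc n" by (rule push_id_less[OF Suc.prems(1)]) (simp_all add: t)
      then have "push id w t mod d = push id w t" "t mod d = t" using t True by (intro mod_less; simp)+
      then show ?thesis using Suc.prems(5)[OF t] by (simp only:)
    next
      case False
      then show ?thesis using push_fixes[OF Suc.prems(1), of t id] by simp
    qed
    then have "push id w = id" by (simp add: fun_eq_iff)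
    from cox_lay[OF cox_identity[OF Suc.prems(1) this], of ?m r] Suc.prems(1) assms(2)
    have "tiso ?m ?m (lay r w) []" by simp
    then show ?thesis using tiso_trans[OF tiso_close close_empty] True by simp
  next
    case False
    then have d: "d \<le> Suc n" using Suc.prems(2) by simp
    obtain w0 k where w0: "set w0 \<subseteq> {..<n}" and k: "k \<le> Suc n"
      and w: "cox (Suc n) w (w0 @ rev [k..<Suc n])" using cox_normal_form[OF Suc.prems(1)] by blast
    define \<pi> where "\<pi> = push id w"
    note P3 = Suc.prems(3)[folded \<pi>_def] and P4 = Suc.prems(4)[folded \<pi>_def] and P5 = Suc.prems(5)[folded \<pi>_def]
    define \<rho> where "\<rho> = push id w0"
    have \<rho>: "\<rho> (Suc n) = Suc n" using push_fixes[OF w0, of "Suc n" id] by (simp add: \<rho>_def)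
    have \<sigma>: "\<pi> = push \<rho> (rev [k..<Suc n])"
      unfolding \<rho>_def \<pi>_def using cox_push[OF w, of id] by (simp only: push_append)
    \<comment> \<open>If the top generator did not occur, the last strand would be its own
      continuation, against the strict increase of labels.\<close>
    have "k \<noteq> Suc n"
    proof
      assume "k = Suc n"
      then have "\<pi> (Suc n) = Suc n" using \<sigma> \<rho> by simp
      then show False using P3[OF d order_refl] by (simp only: less_irrefl)
    qed
    then have k: "k \<le> n" using k by simp
    define \<beta> where "\<beta> = rev [k..<n]"
    have \<beta>: "set \<beta> \<subseteq> {..<n}" by (auto simp: \<beta>_def)
    have kb: "rev [k..<Suc n] = [n] @ \<beta>" using k by (simp add: \<beta>_def)
    have \<sigma>: "\<pi> t = swp n \<rho> (push id \<beta> t)" for t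
      unfolding \<sigma> kb by (simp add: push_eq[of "swp n \<rho>"])
    define x where "x = \<rho> n"
    have x: "\<pi> (Suc n) = x" unfolding \<sigma> using push_fixes[OF \<beta>, of "Suc n" id] by (simp add: swp_def x_def)
    have inj: "inj \<rho>" unfolding \<rho>_def by (rule push_inj) simp
    have \<rho>n: "\<rho> j \<le> n" if "j \<le> n" for j
      unfolding \<rho>_def by (rule push_id_less[OF w0]) (simp_all add: that)
    have \<sigma>': "\<pi> t = push \<rho> \<beta> t \<or> \<pi> t = Suc n \<and> push \<rho> \<beta> t = x" if "t \<le> n" for t
    proof -
      have "push id \<beta> t \<le> n" by (rule push_id_less[OF \<beta>]) (simp_all add: that)
      then show ?thesis unfolding \<sigma> push_eq[of \<rho>] by (simp add: swp_def x_def \<rho>)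
    qed
    have xn: "r x < r (Suc n)" "\<And>z. z \<le> Suc n \<Longrightarrow> r x < r z \<Longrightarrow> r (Suc n) \<le> r z"
      using P3[OF d] P4[OF d] unfolding x by simp_all
    \<comment> \<open>The strands starting at \<open>x\<close> and at \<open>Suc n\<close> have
      neighbouring labels, so any other strand lies above both or below both. After the
      destabilisation they form one strand, which may keep the label of \<open>x\<close>.\<close>
    have merge: "(r (Suc n) < r z) = (r x < r z)" "(r z < r (Suc n)) = (r z < r x)" if "z \<le> n" "z \<noteq> x" for z
    proof -
      have "r z \<noteq> r x" "r z \<noteq> r (Suc n)" using that assms(2) by (auto simp: inj_eq)
      then show "(r (Suc n) < r z) = (r x < r z)" "(r z < r (Suc n)) = (r z < r x)"
        using xn(1) xn(2)[of z] that(1) by linarith+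
    qed
    have "lay (swp n (push r w0)) \<beta> = lay (push r w0) \<beta>"
    proof (rule lay_cong[OF \<beta>])
      fix i j assume ij: "i \<le> n" "j \<le> n" "i \<noteq> j"
      have e: "push r w0 i = r (\<rho> i)" for i unfolding \<rho>_def by (rule push_eq)
      have "\<rho> l \<le> n \<and> \<rho> l \<noteq> x" if "l \<le> n" "l \<noteq> n" for l
        using \<rho>n[OF that(1)] that(2) inj by (simp add: x_def inj_eq)
      then show "(swp n (push r w0) i < swp n (push r w0) j) = (push r w0 i < push r w0 j)"
        using merge[of "\<rho> i"] merge[of "\<rho> j"] ij by (auto simp: swp_def e \<rho> x_def)
    qed
    then have L: "lay r (w0 @ rev [k..<Suc n]) = lay r w0 @ [(Crossing (push r w0 n < push r w0 (Suc n)), n)] @ lay (push r w0) \<beta>"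
      unfolding kb by (simp add: lay_append)
    have "tiso ?m ?m (lay r w) (lay r (w0 @ rev [k..<Suc n]))"
      using cox_lay[OF w, of ?m r] Suc.prems(1) assms(2) by simp
    then have "tiso 0 0 (close (Suc (Suc n)) (lay r w)) (close (Suc (Suc n)) (lay r (w0 @ rev [k..<Suc n])))"
      by (rule tiso_close)
    also have "tiso 0 0 \<dots> (close (Suc n) (lay r w0 @ lay (push r w0) \<beta>))"
      unfolding L by (rule destabilise) (use set_lay w0 \<beta> in fastforce)+
    also have "lay r w0 @ lay (push r w0) \<beta> = lay r (w0 @ \<beta>)" by (simp add: lay_append)
    also have "tiso 0 0 (close (Suc n) (lay r (w0 @ \<beta>))) (unlink d)"
    proof (rule Suc.IH)
      have \<tau>: "push id (w0 @ \<beta>) = push \<rho> \<beta>" by (simp add: push_append \<rho>_def)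
      show "set (w0 @ \<beta>) \<subseteq> {..<n}" using w0 \<beta> by simp
      show "d \<le> Suc n" by (rule d)
      fix t assume t: "t \<le> n"
      show "push id (w0 @ \<beta>) t mod d = t mod d"
        using \<sigma>'[OF t]
      proof (elim disjE conjE)
        assume a: "\<pi> t = push \<rho> \<beta> t"
        have "\<pi> t mod d = t mod d" by (rule P5) (use t in simp)
        then show ?thesis unfolding \<tau> a .
      next
        assume a: "\<pi> t = Suc n" "push \<rho> \<beta> t = x"
        have "\<pi> t mod d = t mod d" "\<pi> (Suc n) mod d = Suc n mod d"
          by (rule P5, use t in simp)+
        then show ?thesis unfolding \<tau> a x by (simp only:)
      qed
      assume dt: "d \<le> t"
      show 1: "r (push id (w0 @ \<beta>) t) < r t"
        using \<sigma>'[OF t] P3[OF dt] t xn(1) unfolding \<tau> by auto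
      fix z assume z: "z \<le> n" and lt: "r (push id (w0 @ \<beta>) t) < r z"
      show "r t \<le> r z"
        using \<sigma>'[OF t]
      proof
        assume "\<pi> t = push \<rho> \<beta> t"
        then show ?thesis using P4[OF dt, of z] t z lt unfolding \<tau> by simp
      next
        assume a: "\<pi> t = Suc n \<and> push \<rho> \<beta> t = x"
        then have "r x < r z" using lt unfolding \<tau> by simp
        moreover from this have "z \<noteq> x" by auto
        ultimately have "r (Suc n) < r z" using merge(1)[OF z] by simp
        then show ?thesis using P4[OF dt, of z] t z a by simp
      qed
    qed
    finally show ?thesis .
  qed
qed

section \<open>The torus braid\<close>

definition torus_word :: "nat \<Rightarrow> nat \<Rightarrow> nat list" where
  "torus_word p q = concat (replicate q [0..<p - 1])"

lemma torus_word_Suc: "torus_word p (Suc q) = torus_word p q @ [0..<p - 1]"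
  by (induction q) (simp_all add: torus_word_def)

lemma push_round: "push r [0..<m] j = (if j < m then r (Suc j) else if j = m then r 0 else r j)"
  by (induction m arbitrary: j) (auto simp: push_append swp_def less_Suc_eq)

lemma lay_round: "lay r [0..<m] = map (\<lambda>i. (Crossing (r 0 < r (Suc i)), i)) [0..<m]"
  by (induction m) (simp_all add: lay_append push_round)

text \<open>One round moves the first strand to the last place, so \<open>q\<close> rounds rotate
  the arrangement by \<open>q\<close>.\<close>

lemma push_torus_word: "j < p \<Longrightarrow> push r (torus_word p q) j = r ((j + q) mod p)"
proof (induction q arbitrary: j)
  case 0
  then show ?case by (simp add: torus_word_def)
next
  case (Suc q)
  have "push r (torus_word p (Suc q)) j = push (push r (torus_word p q)) [0..<p - 1] j"
    by (simp add: torus_word_Suc push_append)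
  also have "\<dots> = push r (torus_word p q) (Suc j mod p)"
    using Suc.prems by (cases "j < p - 1") (auto simp: push_round mod_Suc)
  also have "\<dots> = r ((Suc j mod p + q) mod p)" by (rule Suc.IH) (use Suc.prems in simp)
  finally show ?case by (simp add: mod_add_left_eq)
qed

text \<open>In round \<open>m\<close> the strand starting at \<open>m mod p\<close> runs from left
  to right across all others.\<close>

lemma negative_lay_torus_word:
  assumes "p > 0"
  shows "length (filter (\<lambda>e. fst e = Crossing False) (lay r (torus_word p q))) =
    (\<Sum>m<q. card {i. i < p - 1 \<and> \<not> r (m mod p) < r ((m + Suc i) mod p)})"
proof (induction q)
  case 0
  then show ?case by (simp add: torus_word_def)
next
  case (Suc q)
  let ?s = "push r (torus_word p q)"
  have "length (filter (\<lambda>e. fst e = Crossing False) (lay ?s [0..<p - 1])) = card {i. i < p - 1 \<and> \<not> ?s 0 < ?s (Suc i)}"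
    unfolding lay_round length_filter_conv_card by (rule arg_cong[of _ _ card]) auto
  also have "{i. i < p - 1 \<and> \<not> ?s 0 < ?s (Suc i)} = {i. i < p - 1 \<and> \<not> r (q mod p) < r ((q + Suc i) mod p)}"
    using assms by (auto simp: push_torus_word add.commute)
  finally show ?case using Suc.IH by (simp add: torus_word_Suc lay_append)
qed

section \<open>Labels of the strands of the torus braid\<close>

lemma bij_shift: "bij_betw (\<lambda>j. (j + i) mod p) {..<p} {..<p::nat}"
proof (cases "p = 0")
  case False
  have "j = j'" if "j < p" "(j + i) mod p = (j' + i) mod p" "j' \<le> j" for j j'
  proof -
    have "p dvd (j + i) - (j' + i)" using that mod_eq_dvd_iff_nat[of "j' + i" "j + i" p] by simp
    then have "p dvd j - j'" by simp
    then have "j - j' = 0" using that(1) by (meson dvd_imp_le less_imp_diff_less not_less neq0_conv)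
    then show ?thesis using that(3) by simp
  qed
  then have "inj_on (\<lambda>j. (j + i) mod p) {..<p}"
    by (intro inj_onI) (metis lessThan_iff nat_le_linear)
  moreover have "(\<lambda>j. (j + i) mod p) ` {..<p} \<subseteq> {..<p}" using False by auto
  ultimately show ?thesis by (simp add: bij_betw_def endo_inj_surj)
qed (simp add: bij_betw_def)

text \<open>The labels permute the numbers below \<open>p\<close>, so exactly
  \<open>r (m mod p)\<close> other strands have a smaller label.\<close>

lemma card_higher:
  assumes r: "bij_betw r {..<p} {..<p}" and p: "p > 0"
  shows "card {i. i < p - 1 \<and> \<not> r (m mod p) < r ((m + Suc i) mod p)} = r (m mod p)"
proof -
  define f where "f i = r ((i + m) mod p)" for i
  have "bij_betw (r \<circ> (\<lambda>i. (i + m) mod p)) {..<p} {..<p}" by (rule bij_betw_trans[OF bij_shift r])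
  moreover have "r \<circ> (\<lambda>i. (i + m) mod p) = f" by (simp add: f_def fun_eq_iff)
  ultimately have f: "inj_on f {..<p}" "f ` {..<p} = {..<p}" unfolding bij_betw_def by simp_all
  have eq: "{i. i < p - 1 \<and> \<not> r (m mod p) < r ((m + Suc i) mod p)} = {i. Suc i < p \<and> f (Suc i) < f 0}" (is "?L = ?R")
  proof (intro set_eqI)
    fix i
    have "f (Suc i) < f 0 \<or> f 0 < f (Suc i)" if "Suc i < p"
      using f(1) that inj_onD[OF f(1), of "Suc i" 0] by (auto simp flip: nat_neq_iff)
    moreover have "r (m mod p) = f 0" "r ((m + Suc i) mod p) = f (Suc i)" by (simp_all add: f_def add.commute)
    moreover have "i < p - 1 \<longleftrightarrow> Suc i < p" using p by auto
    ultimately show "i \<in> ?L \<longleftrightarrow> i \<in> ?R" unfolding mem_Collect_eq by (simp only:) auto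
  qed
  have "Suc ` ?R = {i. i < p \<and> f i < f 0}"
  proof (intro set_eqI iffI)
    fix i assume "i \<in> {i. i < p \<and> f i < f 0}"
    then show "i \<in> Suc ` ?R" by (cases i) auto
  qed auto
  then have "f ` Suc ` ?R = {..<f 0}"
  proof (intro set_eqI)
    fix y
    have f0: "f 0 < p" using f(2) p by blast
    show "y \<in> f ` Suc ` ?R \<longleftrightarrow> y \<in> {..<f 0}" unfolding \<open>Suc ` ?R = _\<close>
    proof (rule iffI)
      assume y: "y \<in> {..<f 0}"
      then have "y \<in> f ` {..<p}" using f(2) f0 by simp
      then show "y \<in> f ` {i. i < p \<and> f i < f 0}" using y by auto
    qed auto
  qed
  moreover have "inj_on f (Suc ` ?R)" by (rule inj_on_subset[OF f(1)]) auto
  then have "card (f ` Suc ` ?R) = card ?R" by (simp add: card_image)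
  ultimately show ?thesis unfolding eq by (simp add: f_def)
qed

text \<open>A strand starting at \<open>z\<close> is continued by the one starting at
  \<open>z - q\<close> modulo \<open>p\<close>, and each of the \<open>d\<close> components has
  \<open>L\<close> strands. Labels are given consecutively along each component and one component
  after another.\<close>

lemma torus_heights:
  assumes "p > 0" "q > 0" and d: "d = gcd p q" and L: "p = d * L"
  obtains r :: "nat \<Rightarrow> nat" where "inj r" "bij_betw r {..<p} {..<p}"
    "\<And>t. d \<le> t \<Longrightarrow> t < p \<Longrightarrow> r t = Suc (r ((t + q) mod p))"
    "\<And>t. t < d \<Longrightarrow> r ((t + q) mod p) + 1 = r t + L"
proof -
  have d0: "d > 0" "L > 0" using \<open>p > 0\<close> unfolding L by simp_all
  \<comment> \<open>The strand with label \<open>n\<close>: \<open>n div L\<close> is the component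
    and also its first strand, and \<open>n mod L\<close> counts the steps by \<open>- q\<close>.
    Integers avoid truncated subtraction.\<close>
  define g where "g n = nat ((int (n div L) - int (n mod L) * int q) mod int p)" for n
  have gi: "int (g n) = (int (n div L) - int (n mod L) * int q) mod int p" for n
    unfolding g_def using \<open>p > 0\<close> by simp
  have g_less: "g n < p" for n
    using gi[of n] pos_mod_bound[of "int p"] \<open>p > 0\<close> by (metis of_nat_0_less_iff of_nat_less_iff)
  obtain q1 where q1: "q = d * q1" using d by (metis dvd_def gcd_dvd2)
  have cop: "coprime L q1"
  proof -
    have "d * gcd L q1 = gcd (d * L) (d * q1)" by (simp add: gcd_mult_distrib_nat)
    also have "\<dots> = d" by (simp only: L[symmetric] q1[symmetric] d[symmetric])
    finally have "gcd L q1 = 1" using d0 by simp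
    then show ?thesis by (simp only: coprime_iff_gcd_eq_1)
  qed
  \<comment> \<open>Modulo \<open>d\<close> the multiples of \<open>q\<close> vanish, which gives
    the component; coprimality of \<open>L\<close> and \<open>q1\<close> then gives the number of
    steps.\<close>
  have inj: "inj_on g {..<p}"
  proof (rule inj_onI)
    fix n n' assume n: "n \<in> {..<p}" "n' \<in> {..<p}" and e: "g n = g n'"
    let ?a = "int (n div L)" and ?b = "int (n mod L)" and ?a' = "int (n' div L)" and ?b' = "int (n' mod L)"
    have "(?a - ?b * int q) mod int p = (?a' - ?b' * int q) mod int p"
      using gi[of n] gi[of n'] by (simp only: e)
    then have dv: "int p dvd (?a - ?b * int q) - (?a' - ?b' * int q)" by (simp only: mod_eq_dvd_iff)
    have eq: "(?a - ?b * int q) - (?a' - ?b' * int q) = (?a - ?a') - (?b - ?b') * int q" by (simp add: algebra_simps)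
    have "int d dvd (?a - ?a') - (?b - ?b') * int q"
      by (rule dvd_trans[OF _ dv[unfolded eq]]) (simp add: L)
    then have "int d dvd ?a - ?a'" using dvd_add[of "int d" "(?a - ?a') - (?b - ?b') * int q" "(?b - ?b') * int q"] q1 by simp
    moreover have "n div L < d" "n' div L < d" using n d0 by (auto simp: L less_mult_imp_div_less)
    then have "\<bar>?a - ?a'\<bar> < int d" by linarith
    ultimately have a: "?a = ?a'" using dvd_imp_le_int[of "?a - ?a'" "int d"] by linarith
    then have "int d * int L dvd int d * ((?b - ?b') * int q1)"
      using dv[unfolded eq] by (simp add: L q1 mult_ac)
    then have "int L dvd (?b - ?b') * int q1" using d0 by simp
    then have "int L dvd ?b - ?b'" using cop by (simp add: coprime_dvd_mult_left_iff)
    moreover have "n mod L < L" "n' mod L < L" using d0 by auto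
    then have "\<bar>?b - ?b'\<bar> < int L" by linarith
    ultimately have "?b = ?b'" using dvd_imp_le_int[of "?b - ?b'" "int L"] by linarith
    then show "n = n'" using a by (metis div_mult_mod_eq of_nat_eq_iff)
  qed
  have bij: "bij_betw g {..<p} {..<p}"
    unfolding bij_betw_def using inj g_less by (intro conjI endo_inj_surj) auto
  define r where "r z = (if z < p then inv_into {..<p} g z else z)" for z
  have rg: "r (g n) = n" if "n < p" for n using that g_less inj by (simp add: r_def inv_into_f_f)
  have gr: "g (r z) = z" "r z < p" if "z < p" for z
  proof -
    have z: "z \<in> g ` {..<p}" using bij that by (simp add: bij_betw_def)
    show "g (r z) = z" using f_inv_into_f[OF z] that by (simp add: r_def)
    show "r z < p" using inv_into_into[OF z] that by (simp add: r_def)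
  qed
  have "bij_betw r {..<p} {..<p}"
    using bij_betw_inv_into[OF bij] by (rule bij_betw_cong[THEN iffD1, rotated]) (simp add: r_def)
  moreover have "inj r"
  proof (rule injI)
    fix x y assume e: "r x = r y"
    show "x = y"
    proof (cases "x < p")
      case True
      then have "y < p" using gr(2)[OF True] e by (cases "y < p") (simp_all add: r_def)
      then show ?thesis using gr(1) True e by metis
    next
      case False
      then have "\<not> y < p" using gr(2)[of y] e by (auto simp: r_def split: if_splits)
      then show ?thesis using e False by (simp add: r_def)
    qed
  qed
  moreover have "r t = Suc (r ((t + q) mod p))" if t: "d \<le> t" "t < p" for t
  proof -
    let ?n = "r t"
    have n: "g ?n = t" "?n < p" using gr t by auto
    have m: "?n mod L \<noteq> 0"
    proof
      assume z: "?n mod L = 0"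
      have "?n div L < d" using n(2) d0 by (auto simp: L less_mult_imp_div_less)
      moreover have "d \<le> p" using L d0 by simp
      ultimately have "int (g ?n) = int (?n div L)" unfolding gi z by simp
      then show False using n(1) t \<open>?n div L < d\<close> by simp
    qed
    then obtain n' where n': "?n = Suc n'" by (cases ?n) auto
    then have dm: "?n div L = n' div L" "?n mod L = Suc (n' mod L)" using m by (auto simp: div_Suc mod_Suc split: if_splits)
    have "int (g n') = (int t + int q) mod int p"
    proof -
      have "int (g n') = (int (?n div L) - int (?n mod L) * int q + int q) mod int p"
        unfolding gi dm by (simp add: algebra_simps)
      also have "\<dots> = (int (g ?n) + int q) mod int p" unfolding gi by (simp add: mod_add_left_eq)
      finally show ?thesis by (simp only: n(1))
    qed
    then have "g n' = (t + q) mod p" by (metis of_nat_add of_nat_eq_iff of_nat_mod)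
    then show ?thesis using rg[of n'] n(2) n' by simp
  qed
  \<comment> \<open>The strand before the first one of a component is its last one, with label
    \<open>t * L + (L - 1)\<close>.\<close>
  moreover have "r ((t + q) mod p) + 1 = r t + L" if t: "t < d" for t
  proof -
    have tp: "t * L + L \<le> p"
    proof -
      have "Suc t * L \<le> d * L" using t by (intro mult_le_mono1) simp
      then show ?thesis by (simp add: L)
    qed
    have dp: "d \<le> p" using L d0 by simp
    have "int (g (t * L)) = int t" unfolding gi using t d0 dp by simp
    then have 1: "r t = t * L" using rg[of "t * L"] tp d0 by simp
    have "(t * L + b) div L = t" "(t * L + b) mod L = b" if "b < L" for b using that by simp_all
    from this[of "L - 1"] have dm: "(t * L + (L - 1)) div L = t" "(t * L + (L - 1)) mod L = L - 1" using d0 by simp_all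
    have "int (g (t * L + (L - 1))) = (int t + int q) mod int p"
    proof -
      have "int t - int (L - 1) * int q = int t + int q - int p * int q1"
        using d0 by (simp add: of_nat_diff L q1 algebra_simps)
      moreover have "(a - int p * int q1) mod int p = a mod int p" for a
        by (subst mod_diff_right_eq[symmetric]) simp
      ultimately show ?thesis unfolding gi dm by (simp only:)
    qed
    then have "g (t * L + (L - 1)) = (t + q) mod p" by (metis of_nat_add of_nat_eq_iff of_nat_mod)
    then have "r ((t + q) mod p) = t * L + (L - 1)" using rg[of "t * L + (L - 1)"] tp d0 by simp
    then show ?thesis using 1 d0 by simp
  qed
  ultimately show thesis using that by blast
qed

text \<open>Shifting the window of \<open>q\<close> consecutive strands by one changes its sum
  \<open>W\<close> by \<open>r ((j + q) mod p) - r j\<close>, which is \<open>L - 1\<close> for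
  \<open>j < d\<close> and \<open>- 1\<close> otherwise. So all \<open>W j\<close> are known up to
  \<open>W 0\<close>, and their total, in which each label is counted \<open>q\<close> times,
  determines it.\<close>

lemma torus_height_sum:
  fixes r :: "nat \<Rightarrow> nat"
  assumes p: "p > 0" and L: "p = d * L" and bij: "bij_betw r {..<p} {..<p}"
    and h1: "\<And>t. d \<le> t \<Longrightarrow> t < p \<Longrightarrow> r t = Suc (r ((t + q) mod p))"
    and h2: "\<And>t. t < d \<Longrightarrow> r ((t + q) mod p) + 1 = r t + L"
  shows "2 * int (\<Sum>m<q. r (m mod p)) = int q * (int p - 1) - int p + int d"
proof -
  define W where "W j = (\<Sum>i<q. int (r ((j + i) mod p)))" for j
  have d: "d \<le> p" "d > 0" using p by (cases "L = 0"; simp add: L)+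
  have step: "W (Suc j) = W j + int (r ((j + q) mod p)) - int (r j)" if "j < p" for j
  proof -
    let ?f = "\<lambda>i. int (r ((j + i) mod p))"
    have "W (Suc j) + ?f 0 = (\<Sum>i<Suc q. ?f i)" unfolding W_def sum.lessThan_Suc_shift by simp
    also have "\<dots> = W j + ?f q" by (simp add: W_def)
    finally show ?thesis using that by simp
  qed
  have W1: "W j = W 0 + int j * (int L - 1)" if "j \<le> d" for j
    using that
  proof (induction j)
    case (Suc j)
    have "int (r ((j + q) mod p)) + 1 = int (r j) + int L" using h2[of j] Suc.prems by linarith
    then show ?case using step[of j] Suc d by (simp add: algebra_simps)
  qed simp
  have W2: "W (d + k) = W 0 + int p - int (d + k)" if "d + k \<le> p" for k
    using that
  proof (induction k)
    case 0
    then show ?case using W1[of d] by (simp add: L algebra_simps)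
  next
    case (Suc k)
    have "int (r (d + k)) = int (r ((d + k + q) mod p)) + 1" using h1[of "d + k"] Suc.prems by simp
    then show ?case using step[of "d + k"] Suc by simp
  qed
  have S1: "2 * (\<Sum>j<m. W j) = 2 * int m * W 0 + (int L - 1) * int m * (int m - 1)" if "m \<le> d" for m
    using that
  proof (induction m)
    case (Suc m)
    then show ?case using W1[of m] by (simp add: algebra_simps)
  qed simp
  have S2: "2 * (\<Sum>j<d + k. W j) = 2 * (\<Sum>j<d. W j) + 2 * int k * W 0 + int k * (2 * int p - 2 * int d - int k + 1)"
    if "d + k \<le> p" for k
    using that
  proof (induction k)
    case (Suc k)
    then show ?case using W2[of k] by (simp add: algebra_simps)
  qed simp
  obtain k where k: "p = d + k" using d by (auto simp: le_iff_add)
  have kd: "int k = int d * (int L - 1)" using L k by (simp add: algebra_simps) (metis of_nat_add of_nat_mult)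
  have "2 * (\<Sum>j<d. W j) = 2 * int d * W 0 + int k * (int d - 1)"
    using S1[of d] unfolding kd by (simp add: algebra_simps)
  then have "2 * (\<Sum>j<p. W j) = 2 * int p * W 0 + int k * (int d - 1) + int k * (int k + 1)"
    using S2[of k] k by (simp add: algebra_simps)
  then have A: "2 * (\<Sum>j<p. W j) = int p * (2 * W 0 + int k)" using k by (simp add: algebra_simps)
  \<comment> \<open>Double counting: for fixed \<open>i\<close> the labels run through all numbers
    below \<open>p\<close>.\<close>
  have "(\<Sum>j<p. W j) = (\<Sum>i<q. \<Sum>j<p. int (r ((j + i) mod p)))" unfolding W_def by (rule sum.swap)
  also have "\<dots> = (\<Sum>i<q. \<Sum>j<p. int j)"
  proof (rule sum.cong)
    fix i
    have "bij_betw (r \<circ> (\<lambda>j. (j + i) mod p)) {..<p} {..<p}" by (rule bij_betw_trans[OF bij_shift bij])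
    from sum.reindex_bij_betw[OF this, of int] show "(\<Sum>j<p. int (r ((j + i) mod p))) = (\<Sum>j<p. int j)" by simp
  qed simp
  also have "\<dots> = int q * (\<Sum>j<p. int j)" by simp
  finally have "2 * (\<Sum>j<p. W j) = int q * (2 * (\<Sum>j<p. int j))" by simp
  also have "2 * (\<Sum>j<p. int j) = int p * (int p - 1)" by (induction p) (simp_all add: algebra_simps)
  finally have "int p * (2 * W 0 + int k) = int p * (int q * (int p - 1))" using A by (simp add: algebra_simps)
  then have "2 * W 0 + int k = int q * (int p - 1)" using p by simp
  moreover have "W 0 = int (\<Sum>m<q. r (m mod p))" by (simp add: W_def)
  ultimately show ?thesis using k by simp
qed

lemma set_torus_word: "set (torus_word p q) \<subseteq> {..<p - 1}"
  by (auto simp: torus_word_def)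

lemma torus_unlinking:
  assumes "p > 0" "q > 0" and d: "d = gcd p q"
  obtains r where "same_link (close p (lay r (torus_word p q))) (unlink d)"
    "2 * int (length (filter (\<lambda>e. fst e = Crossing False) (lay r (torus_word p q)))) = int q * (int p - 1) - int p + int d"
proof -
  obtain L where L: "p = d * L" using d by (metis dvd_def gcd_dvd1)
  obtain r where r: "inj r" "bij_betw r {..<p} {..<p}"
    "\<And>t. d \<le> t \<Longrightarrow> t < p \<Longrightarrow> r t = Suc (r ((t + q) mod p))"
    "\<And>t. t < d \<Longrightarrow> r ((t + q) mod p) + 1 = r t + L"
    using torus_heights[OF assms(1,2) d L] by blast
  have d0: "d > 0" "d \<le> p" using assms by (auto simp: gcd_le1_nat)
  obtain n where n: "p = Suc n" using assms(1) by (cases p) auto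
  have "tiso 0 0 (close (Suc n) (lay r (torus_word p q))) (unlink d)"
  proof (rule layered_closure[OF d0(1) r(1)])
    show "set (torus_word p q) \<subseteq> {..<n}" using set_torus_word[of p q] n by simp
    show "d \<le> Suc n" using d0 n by simp
    fix t assume t: "t \<le> n"
    then have e: "push id (torus_word p q) t = (t + q) mod p" using push_torus_word[of t p id q] n by simp
    have "d dvd p" "d dvd q" using d by auto
    then have "(t + q) mod p mod d = (t + q) mod d" "(t + q) mod d = t mod d"
      by (simp add: mod_mod_cancel, auto simp: dvd_def)
    then show "push id (torus_word p q) t mod d = t mod d" unfolding e by (simp only:)
    assume dt: "d \<le> t"
    have 1: "r t = Suc (r ((t + q) mod p))" using r(3)[OF dt] t n by simp
    show "r (push id (torus_word p q) t) < r t" unfolding e using 1 by simp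
    show "r t \<le> r z" if "r (push id (torus_word p q) t) < r z" for z using that unfolding e using 1 by simp
  qed
  then have "same_link (close p (lay r (torus_word p q))) (unlink d)" using tiso_same_link n by simp
  moreover have "2 * int (length (filter (\<lambda>e. fst e = Crossing False) (lay r (torus_word p q)))) = int q * (int p - 1) - int p + int d"
    unfolding negative_lay_torus_word[OF assms(1)] card_higher[OF r(2) assms(1)]
    by (rule torus_height_sum[OF assms(1) L r(2-4)])
  ultimately show thesis by (rule that)
qed

subsection \<open>Crossing changes in closures\<close>

lemma map_at_append: "map_at S f (xs @ ys) = map_at S f xs @ map_at {k. length xs + k \<in> S} f ys"
  unfolding map_at_def by (rule nth_equalityI) (auto simp: nth_append)

lemma map_at_disjoint: "(\<And>k. k < length xs \<Longrightarrow> k \<notin> S) \<Longrightarrow> map_at S f xs = xs"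
  unfolding map_at_def by (rule nth_equalityI) auto

lemma flip_letter_event: "flip_crossing (letter_event l) = letter_event (inverse_letter l)"
  by (cases l) simp_all

text \<open>In the closure the braid letters stand behind the \<open>p\<close> cups, hence the
  offset \<open>p\<close>.\<close>

lemma change_crossings_closure:
  assumes "S \<subseteq> {..<length w}"
  shows "change_crossings ((+) p ` S) (closure p w) = closure p (change_letters S w)"
proof -
  have 1: "map_at {k. p + k \<in> (+) p ` S} flip_crossing (map letter_event w) = map letter_event (map_at S inverse_letter w)"
    unfolding map_at_def by (rule nth_equalityI) (auto simp: flip_letter_event)
  have 2: "map_at {k. p + (length w + k) \<in> (+) p ` S} flip_crossing xs = xs" for xs
    by (rule map_at_disjoint) (use assms in auto)
  have 3: "map_at ((+) p ` S) flip_crossing (map (\<lambda>i. (Cup, i)) [0..<p]) = map (\<lambda>i. (Cup, i)) [0..<p]"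
    by (rule map_at_disjoint) auto
  show ?thesis unfolding change_crossings_def closure_def change_letters_def map_at_append using 1 2 3 by simp
qed

lemma crossings_closure: "S \<subseteq> {..<length w} \<Longrightarrow> (+) p ` S \<subseteq> crossings (closure p w)"
proof
  fix x assume S: "S \<subseteq> {..<length w}" "x \<in> (+) p ` S"
  then obtain k where k: "x = p + k" "k < length w" by auto
  then have "closure p w ! x = letter_event (w ! k)" by (simp add: closure_def nth_append)
  moreover have "\<exists>s i. letter_event l = (Crossing s, i)" for l by (cases l) auto
  ultimately show "x \<in> crossings (closure p w)" using k by (simp add: crossings_def closure_def)
qed

lemma torus_braid_word: "torus_braid p q = map (\<lambda>i. Gen (Suc i)) (torus_word p q)"
proof -
  have "[1..<p] = map Suc [0..<p - 1]" by (cases p) (simp_all add: map_Suc_upt)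
  then show ?thesis by (simp add: torus_braid_def torus_word_def map_concat comp_def)
qed

lemma lay_nth: "k < length w \<Longrightarrow> \<exists>s. lay r w ! k = (Crossing s, w ! k)"
proof (induction w arbitrary: r k)
  case (Cons i w)
  then show ?case by (cases k) auto
qed simp

lemma length_lay: "length (lay r w) = length w"
  by (induction w arbitrary: r) auto

text \<open>The set \<open>S\<close> collects the letters at which the layering demands the inverse
  generator.\<close>

lemma torus_lay:
  fixes r :: "nat \<Rightarrow> nat" and p q :: nat
  defines "S \<equiv> {k. k < length (torus_word p q) \<and> fst (lay r (torus_word p q) ! k) = Crossing False}"
  shows "closure p (change_letters S (torus_braid p q)) = close p (lay r (torus_word p q))"
    and "card S = length (filter (\<lambda>e. fst e = Crossing False) (lay r (torus_word p q)))"
proof -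
  let ?w = "torus_word p q"
  have "map letter_event (change_letters S (torus_braid p q)) = lay r ?w"
  proof (rule nth_equalityI)
    fix k assume "k < length (map letter_event (change_letters S (torus_braid p q)))"
    then have k: "k < length ?w" by (simp add: change_letters_def map_at_def torus_braid_word)
    obtain s where s: "lay r ?w ! k = (Crossing s, ?w ! k)" using lay_nth[OF k] by blast
    then have "k \<in> S \<longleftrightarrow> \<not> s" using k by (simp add: S_def)
    then show "map letter_event (change_letters S (torus_braid p q)) ! k = lay r ?w ! k"
      using k s by (simp add: change_letters_def map_at_def torus_braid_word)
  qed (simp add: change_letters_def map_at_def torus_braid_word length_lay)
  then show "closure p (change_letters S (torus_braid p q)) = close p (lay r ?w)"
    by (simp add: closure_def close_def)
  show "card S = length (filter (\<lambda>e. fst e = Crossing False) (lay r ?w))"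
    unfolding S_def length_filter_conv_card length_lay ..
qed

lemma length_torus_word: "length (torus_word p q) = q * (p - 1)"
  by (simp add: torus_word_def length_concat sum_list_replicate)


theorem mainTheorem5:
  fixes p q d :: nat
  assumes "p > 0" and "q > 0" and "d = gcd p q"
  shows "\<exists>S. S \<subseteq> {..<length (torus_braid p q)} \<and>
             card S = unknotting_number (torus_link p q) \<and>
             trivial_link (closure p (change_letters S (torus_braid p q)))"
proof -
  obtain r where r: "same_link (close p (lay r (torus_word p q))) (unlink d)"
    "2 * int (length (filter (\<lambda>e. fst e = Crossing False) (lay r (torus_word p q)))) = int q * (int p - 1) - int p + int d"
    using torus_unlinking[OF assms] by blast
  define S where "S = {k. k < length (torus_word p q) \<and> fst (lay r (torus_word p q) ! k) = Crossing False}"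
  have S: "S \<subseteq> {..<length (torus_braid p q)}" by (auto simp: S_def torus_braid_word)
  have unlink: "same_link (closure p (change_letters S (torus_braid p q))) (unlink d)"
    using r(1) unfolding S_def torus_lay(1) .
  have card_S: "2 * int (card S) = int q * (int p - 1) - int p + int d"
    using r(2) unfolding S_def torus_lay(2) .
  let ?S = "(+) p ` S"
  have change: "?S \<subseteq> crossings (torus_link p q)" "same_link (change_crossings ?S (torus_link p q)) (unlink d)"
    using crossings_closure[OF S] change_crossings_closure[OF S] unlink by (simp_all add: torus_link_def)
  have card_image: "card ?S = card S" by (simp add: card_image)
  have refl: "same_link (torus_link p q) (torus_link p q)" by (simp add: same_link_def equivclp_refl)
  have w: "\<forall>l\<in>set (torus_braid p q). \<exists>i. l = Gen i \<and> 1 \<le> i \<and> i < p"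
    by (auto simp: torus_braid_def)
  have len: "int (length (torus_braid p q)) = int q * (int p - 1)"
    using assms(1) by (simp add: torus_braid_word length_torus_word of_nat_diff)
  note bound = positive_braid_crossing_changes[OF w, folded torus_link_def]
  have "unknotting_number (torus_link p q) = card S"
    unfolding unknotting_number_def
  proof (rule Least_equality)
    show "\<exists>D S'. same_link (torus_link p q) D \<and> S' \<subseteq> crossings D \<and> card S' = card S \<and> trivial_link (change_crossings S' D)"
      using refl change card_image unfolding trivial_link_def by blast
    fix n
    assume "\<exists>D S'. same_link (torus_link p q) D \<and> S' \<subseteq> crossings D \<and> card S' = n \<and> trivial_link (change_crossings S' D)"
    then obtain D S' k where D: "same_link (torus_link p q) D" "S' \<subseteq> crossings D" "card S' = n"
      "same_link (change_crossings S' D) (unlink k)" unfolding trivial_link_def by blast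
    \<comment> \<open>Both unlinkings start from the same diagram, and either power counts its
      canonical colourings.\<close>
    have "(2::nat) ^ k = 2 ^ d" using bound(2)[OF D(1,2,4)] bound(2)[OF refl change] by simp
    then have "k = d" by simp
    then show "card S \<le> n" using bound(1)[OF D(1,2,4)] D(3) card_S len by linarith
  qed
  moreover have "trivial_link (closure p (change_letters S (torus_braid p q)))"
    unfolding trivial_link_def using unlink by (rule exI)
  ultimately show ?thesis using S by (intro exI[of _ S] conjI) simp_all
qed

end
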